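(* Let $G$ be a tame $\ell_c$-group, $K\subset G$ any compact open subgroup, and $\rho\in\widehat{K}$. Then the functor of $\rho$-invariants $M\mapsto\operatorname{Hom}_K(\rho,M|_K)$ restricts to an equivalence of categories $$\mathcal{R}_{\rho}(G)\to\mathcal{H}(G,\rho)\text{-}\mathbf{mod}.$$
   Context: An $\ell$-group is a Hausdorff, locally compact, totally disconnected topological group. An $\ell_c$-group is an $\ell$-group which is a filtered union of its compact open subgroups (every element lies in a compact open subgroup, and any two compact open subgroups are contained in a third). A complex representation $(\pi,V)$ of an $\ell$-group $G$ is smooth if every vector of $V$ has open stabilizer in $G$; it is admissible if in addition $V^K$ is finite-dimensional for every compact open subgroup $K \subset G$. An $\ell$-group is tame if all its irreducible smooth representations are admissible. $\mathcal{R}(G)$ is the category of smooth representations of $G$, and $\widehat{K}$ is the set of isomorphism classes of irreducible smooth representations of $K$. $\mathcal{R}_{\rho}(G)$ is the full subcategory of $\mathcal{R}(G)$ of those $M$ which are generated, as $G$-representations, by their $\rho$-isotypic component (the sum of all $K$-subrepresentations of $M$ isomorphic to $\rho$). Fix a Haar measure on $G$. For $(\rho,W)\in\widehat{K}$ (necessarily finite-dimensional, with dual $(\rho^{\vee},W^{\vee})$), $\mathcal{H}(G,\rho)$ is the unital algebra, under convolution $(f_1*f_2)(x)=\int_G f_1(g)f_2(g^{-1}x)\,dg$, of compactly supported locally constant functions $f:G\to\operatorname{End}_{\mathbb{C}}(W^{\vee})$ satisfying $f(k_1gk_2)=\rho^{\vee}(k_1)\circ f(g)\circ\rho^{\vee}(k_2)$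 for $k_1,k_2\in K$, $g\in G$. For a smooth representation $(\pi,M)$ of $G$, the space $\operatorname{Hom}_K(\rho,M|_K)$ is a left $\mathcal{H}(G,\rho)$-module via $(f\cdot\varphi)(w)=\int_G\pi(g)\,\varphi(f(g)^{\vee}w)\,dg$, where $f(g)^{\vee}\in\operatorname{End}_{\mathbb{C}}(W)$ is the transpose of $f(g)$. $\mathcal{H}(G,\rho)$-$\mathbf{mod}$ is the category of (unital) left $\mathcal{H}(G,\rho)$-modules. *)

theory Defs
  imports
    "HOL-Analysis.Analysis"
    "HOL-Algebra.Coset"
    "HOL-Algebra.Module"
    "HOL-Algebra.Algebraic_Closure_Type"
    "HOL-Library.Equipollence"
begin

section \<open>Categories, functors and equivalences\<close>

text \<open>Hom-sets are indexed by objects, and so is composition: below, morphisms are extensional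
  functions, which do not determine their source and target.\<close>

record ('o, 'm) cat =
  Obj :: "'o set"
  Hom :: "'o \<Rightarrow> 'o \<Rightarrow> 'm set"
  Idt :: "'o \<Rightarrow> 'm"
  Cmp :: "'o \<Rightarrow> 'o \<Rightarrow> 'o \<Rightarrow> 'm \<Rightarrow> 'm \<Rightarrow> 'm"  \<comment> \<open>\<open>Cmp C x y z g f\<close> is \<open>g\<close> after \<open>f\<close>, for \<open>f : x \<rightarrow> y\<close> and \<open>g : y \<rightarrow> z\<close>\<close>

definition is_category :: "('o, 'm) cat \<Rightarrow> bool" where
  "is_category C \<longleftrightarrow>
     (\<forall>x\<in>Obj C. Idt C x \<in> Hom C x x) \<and>
     (\<forall>x\<in>Obj C. \<forall>y\<in>Obj C. \<forall>z\<in>Obj C. \<forall>f\<in>Hom C x y. \<forall>g\<in>Hom C y z. Cmp C x y z g f \<in> Hom C x z) \<and>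
     (\<forall>x\<in>Obj C. \<forall>y\<in>Obj C. \<forall>f\<in>Hom C x y. Cmp C x x y f (Idt C x) = f \<and> Cmp C x y y (Idt C y) f = f) \<and>
     (\<forall>x\<in>Obj C. \<forall>y\<in>Obj C. \<forall>z\<in>Obj C. \<forall>u\<in>Obj C. \<forall>f\<in>Hom C x y. \<forall>g\<in>Hom C y z. \<forall>h\<in>Hom C z u.
        Cmp C x z u h (Cmp C x y z g f) = Cmp C x y u (Cmp C y z u h g) f)"

definition full_subcat :: "('o, 'm) cat \<Rightarrow> 'o set \<Rightarrow> ('o, 'm) cat" where
  "full_subcat C S = C\<lparr>Obj := Obj C \<inter> S\<rparr>"

definition is_functor ::
  "('o, 'm) cat \<Rightarrow> ('p, 'n) cat \<Rightarrow> ('o \<Rightarrow> 'p) \<Rightarrow> ('o \<Rightarrow> 'o \<Rightarrow> 'm \<Rightarrow> 'n) \<Rightarrow> bool" where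
  "is_functor C D Fo Fm \<longleftrightarrow>
     is_category C \<and> is_category D \<and>
     (\<forall>x\<in>Obj C. Fo x \<in> Obj D) \<and>
     (\<forall>x\<in>Obj C. \<forall>y\<in>Obj C. \<forall>f\<in>Hom C x y. Fm x y f \<in> Hom D (Fo x) (Fo y)) \<and>
     (\<forall>x\<in>Obj C. Fm x x (Idt C x) = Idt D (Fo x)) \<and>
     (\<forall>x\<in>Obj C. \<forall>y\<in>Obj C. \<forall>z\<in>Obj C. \<forall>f\<in>Hom C x y. \<forall>g\<in>Hom C y z.
        Fm x z (Cmp C x y z g f) = Cmp D (Fo x) (Fo y) (Fo z) (Fm y z g) (Fm x y f))"

definition is_iso :: "('o, 'm) cat \<Rightarrow> 'o \<Rightarrow> 'o \<Rightarrow> 'm \<Rightarrow> bool" where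
  "is_iso C x y f \<longleftrightarrow> f \<in> Hom C x y \<and>
     (\<exists>g\<in>Hom C y x. Cmp C x y x g f = Idt C x \<and> Cmp C y x y f g = Idt C y)"

definition is_nat_iso ::
  "('o, 'm) cat \<Rightarrow> ('p, 'n) cat \<Rightarrow> ('o \<Rightarrow> 'p) \<Rightarrow> ('o \<Rightarrow> 'o \<Rightarrow> 'm \<Rightarrow> 'n) \<Rightarrow>
     ('o \<Rightarrow> 'p) \<Rightarrow> ('o \<Rightarrow> 'o \<Rightarrow> 'm \<Rightarrow> 'n) \<Rightarrow> ('o \<Rightarrow> 'n) \<Rightarrow> bool" where
  "is_nat_iso C D Fo Fm Go Gm \<eta> \<longleftrightarrow>
     (\<forall>x\<in>Obj C. is_iso D (Fo x) (Go x) (\<eta> x)) \<and>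
     (\<forall>x\<in>Obj C. \<forall>y\<in>Obj C. \<forall>f\<in>Hom C x y.
        Cmp D (Fo x) (Fo y) (Go y) (\<eta> y) (Fm x y f) = Cmp D (Fo x) (Go x) (Go y) (Gm x y f) (\<eta> x))"

definition is_equivalence ::
  "('o, 'm) cat \<Rightarrow> ('p, 'n) cat \<Rightarrow> ('o \<Rightarrow> 'p) \<Rightarrow> ('o \<Rightarrow> 'o \<Rightarrow> 'm \<Rightarrow> 'n) \<Rightarrow> bool" where
  "is_equivalence C D Fo Fm \<longleftrightarrow>
     is_functor C D Fo Fm \<and>
     (\<exists>Go Gm. is_functor D C Go Gm \<and>
        (\<exists>\<eta>. is_nat_iso C C (\<lambda>x. x) (\<lambda>x y f. f)
               (\<lambda>x. Go (Fo x)) (\<lambda>x y f. Gm (Fo x) (Fo y) (Fm x y f)) \<eta>) \<and>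
        (\<exists>\<epsilon>. is_nat_iso D D (\<lambda>x. Fo (Go x)) (\<lambda>x y f. Fm (Go x) (Go y) (Gm x y f))
               (\<lambda>x. x) (\<lambda>x y f. f) \<epsilon>))"


section \<open>Totally disconnected groups\<close>

locale topological_group = group G for G :: "'g monoid" (structure) +
  fixes T :: "'g topology"
  assumes topspace_eq: "topspace T = carrier G"
    and continuous_mult: "continuous_map (prod_topology T T) T (\<lambda>(x, y). x \<otimes> y)"
    and continuous_inv: "continuous_map T T (\<lambda>x. inv x)"

locale ell_group = topological_group +
  assumes hausdorff: "Hausdorff_space T"
    and locally_compact: "locally_compact_space T"
    and totally_disconnected: "\<And>S. connectedin T S \<Longrightarrow> \<exists>x. S \<subseteq> {x}"

definition compact_open_subgroup :: "'g monoid \<Rightarrow> 'g topology \<Rightarrow> 'g set \<Rightarrow> bool" where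
  "compact_open_subgroup G T K \<longleftrightarrow> subgroup K G \<and> compactin T K \<and> openin T K"

locale ell_c_group = ell_group +
  assumes covered: "\<And>x. x \<in> carrier G \<Longrightarrow> \<exists>K. compact_open_subgroup G T K \<and> x \<in> K"
    and directed: "\<And>K L. compact_open_subgroup G T K \<Longrightarrow> compact_open_subgroup G T L \<Longrightarrow>
      \<exists>J. compact_open_subgroup G T J \<and> K \<subseteq> J \<and> L \<subseteq> J"

abbreviation subgrp :: "'g monoid \<Rightarrow> 'g set \<Rightarrow> 'g monoid" where
  "subgrp G K \<equiv> G\<lparr>carrier := K\<rparr>"

text \<open>Left Haar measures, as left-invariant Radon measures on the Borel sets.\<close>

definition haar_measure :: "'g monoid \<Rightarrow> 'g topology \<Rightarrow> 'g measure \<Rightarrow> bool" where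
  "haar_measure G T \<mu> \<longleftrightarrow>
     space \<mu> = carrier G \<and>
     sets \<mu> = sigma_sets (carrier G) {U. openin T U} \<and>
     (\<forall>g\<in>carrier G. \<forall>A\<in>sets \<mu>. emeasure \<mu> (g <#\<^bsub>G\<^esub> A) = emeasure \<mu> A) \<and>
     emeasure \<mu> (space \<mu>) \<noteq> 0 \<and>
     (\<forall>C. compactin T C \<longrightarrow> emeasure \<mu> C < \<infinity>) \<and>
     (\<forall>A\<in>sets \<mu>. emeasure \<mu> A = (INF U\<in>{U. openin T U \<and> A \<subseteq> U}. emeasure \<mu> U)) \<and>
     (\<forall>U. openin T U \<longrightarrow> emeasure \<mu> U = (SUP C\<in>{C. compactin T C \<and> C \<subseteq> U}. emeasure \<mu> C))"


section \<open>Complex vector spaces\<close>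

abbreviation complex_ring :: "complex ring" where
  "complex_ring \<equiv> ring_of_type_algebra"

text \<open>Linear maps are kept extensional (undefined outside the carrier), so that equality of maps
  is equality of functions.\<close>

definition lin_maps ::
  "(complex, 'a, 'x) module_scheme \<Rightarrow> (complex, 'b, 'y) module_scheme \<Rightarrow> ('a \<Rightarrow> 'b) set" where
  "lin_maps V V' = {h \<in> carrier V \<rightarrow>\<^sub>E carrier V'.
     (\<forall>x\<in>carrier V. \<forall>y\<in>carrier V. h (x \<oplus>\<^bsub>V\<^esub> y) = h x \<oplus>\<^bsub>V'\<^esub> h y) \<and>
     (\<forall>c. \<forall>x\<in>carrier V. h (c \<odot>\<^bsub>V\<^esub> x) = c \<odot>\<^bsub>V'\<^esub> h x)}"

text \<open>The library's module records extend rings, so they have fields \<open>mult\<close> and \<open>one\<close>, which are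
  irrelevant here and throughout.\<close>

definition hom_space ::
  "(complex, 'a, 'x) module_scheme \<Rightarrow> (complex, 'b, 'y) module_scheme \<Rightarrow> (complex, 'a \<Rightarrow> 'b) module" where
  "hom_space V V' = \<lparr>carrier = lin_maps V V', monoid.mult = undefined, one = undefined,
     zero = (\<lambda>x\<in>carrier V. \<zero>\<^bsub>V'\<^esub>),
     add = (\<lambda>f h. \<lambda>x\<in>carrier V. f x \<oplus>\<^bsub>V'\<^esub> h x),
     smult = (\<lambda>c f. \<lambda>x\<in>carrier V. c \<odot>\<^bsub>V'\<^esub> f x)\<rparr>"

definition scalars :: "(complex, complex) module" where
  "scalars = \<lparr>carrier = UNIV, monoid.mult = (*), one = 1, zero = 0, add = (+), smult = (*)\<rparr>"

definition dual :: "(complex, 'a, 'x) module_scheme \<Rightarrow> (complex, 'a \<Rightarrow> complex) module" where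
  "dual V = hom_space V scalars"

text \<open>For finite-dimensional \<open>W\<close>: the endomorphism of \<open>W\<close> whose transpose is the given
  endomorphism \<open>A\<close> of the dual.\<close>

definition transposed :: "(complex, 'a, 'x) module_scheme \<Rightarrow>
    (('a \<Rightarrow> complex) \<Rightarrow> ('a \<Rightarrow> complex)) \<Rightarrow> 'a \<Rightarrow> 'a" where
  "transposed W A = (THE B. B \<in> lin_maps W W \<and>
     (\<forall>l\<in>carrier (dual W). \<forall>w\<in>carrier W. l (B w) = A l w))"

definition lin_span :: "(complex, 'a, 'x) module_scheme \<Rightarrow> 'a set \<Rightarrow> 'a set" where
  "lin_span V S = \<Inter>{U. submodule U complex_ring V \<and> S \<subseteq> U}"

definition fin_dim_subspace :: "(complex, 'a, 'x) module_scheme \<Rightarrow> 'a set \<Rightarrow> bool" where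
  "fin_dim_subspace V U \<longleftrightarrow> (\<exists>B. finite B \<and> B \<subseteq> carrier V \<and> U = lin_span V B)"

text \<open>The integral of a compactly supported locally constant function with values in a vector
  space without topology: such a function takes finitely many nonzero values, each on a compact
  open set.\<close>

definition lc_integral ::
  "'g measure \<Rightarrow> (complex, 'a, 'x) module_scheme \<Rightarrow> ('g \<Rightarrow> 'a) \<Rightarrow> 'a" where
  "lc_integral \<mu> V F = finsum V
     (\<lambda>v. complex_of_real (measure \<mu> {g \<in> space \<mu>. F g = v}) \<odot>\<^bsub>V\<^esub> v)
     (F ` space \<mu> - {\<zero>\<^bsub>V\<^esub>})"


section \<open>Smooth representations\<close>

record ('g, 'v) rep = "(complex, 'v) module" +
  act :: "'g \<Rightarrow> 'v \<Rightarrow> 'v"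

locale group_rep = G: group G + V: Module.module complex_ring V
  for G :: "'g monoid" and V :: "('g, 'v) rep" +
  assumes act_linear: "\<And>g. g \<in> carrier G \<Longrightarrow> restrict (act V g) (carrier V) \<in> lin_maps V V"
    and act_one: "\<And>v. v \<in> carrier V \<Longrightarrow> act V \<one>\<^bsub>G\<^esub> v = v"
    and act_mult: "\<And>g h v. g \<in> carrier G \<Longrightarrow> h \<in> carrier G \<Longrightarrow> v \<in> carrier V \<Longrightarrow>
      act V (g \<otimes>\<^bsub>G\<^esub> h) v = act V g (act V h v)"

locale smooth_rep = group_rep G V
  for G :: "'g monoid" and T :: "'g topology" and V :: "('g, 'v) rep" +
  assumes smooth: "\<And>v. v \<in> carrier V \<Longrightarrow> openin T {g \<in> carrier G. act V g v = v}"

definition subrep :: "'g monoid \<Rightarrow> ('g, 'v) rep \<Rightarrow> 'v set \<Rightarrow> bool" where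
  "subrep G V U \<longleftrightarrow> submodule U complex_ring V \<and> (\<forall>g\<in>carrier G. \<forall>u\<in>U. act V g u \<in> U)"

definition irreducible_smooth_rep :: "'g monoid \<Rightarrow> 'g topology \<Rightarrow> ('g, 'v) rep \<Rightarrow> bool" where
  "irreducible_smooth_rep G T V \<longleftrightarrow> smooth_rep G T V \<and> carrier V \<noteq> {\<zero>\<^bsub>V\<^esub>} \<and>
     (\<forall>U. subrep G V U \<longrightarrow> U = {\<zero>\<^bsub>V\<^esub>} \<or> U = carrier V)"

definition invariants :: "('g, 'v) rep \<Rightarrow> 'g set \<Rightarrow> 'v set" where
  "invariants V K = {v \<in> carrier V. \<forall>k\<in>K. act V k v = v}"

definition admissible_rep :: "'g monoid \<Rightarrow> 'g topology \<Rightarrow> ('g, 'v) rep \<Rightarrow> bool" where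
  "admissible_rep G T V \<longleftrightarrow> smooth_rep G T V \<and>
     (\<forall>K. compact_open_subgroup G T K \<longrightarrow> fin_dim_subspace V (invariants V K))"

text \<open>It suffices to test tameness on spaces of functions \<open>G \<rightarrow> \<complex>\<close>: if \<open>l\<close> is a nonzero linear
  functional on an irreducible representation \<open>V\<close>, the map sending \<open>v\<close> to the matrix coefficient
  \<open>g \<mapsto> l (g v)\<close> has a subrepresentation other than \<open>V\<close> as its kernel, so it is injective.\<close>

definition tame :: "'g monoid \<Rightarrow> 'g topology \<Rightarrow> bool" where
  "tame G T \<longleftrightarrow>
     (\<forall>V :: ('g, 'g \<Rightarrow> complex) rep. irreducible_smooth_rep G T V \<longrightarrow> admissible_rep G T V)"

definition rep_homs :: "'g monoid \<Rightarrow> ('g, 'a) rep \<Rightarrow> ('g, 'b) rep \<Rightarrow> ('a \<Rightarrow> 'b) set" where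
  "rep_homs G V V' = {h \<in> lin_maps V V'.
     \<forall>g\<in>carrier G. \<forall>v\<in>carrier V. h (act V g v) = act V' g (h v)}"

definition isomorphic_reps :: "'g monoid \<Rightarrow> ('g, 'a) rep \<Rightarrow> ('g, 'b) rep \<Rightarrow> bool" where
  "isomorphic_reps G V V' \<longleftrightarrow> (\<exists>h\<in>rep_homs G V V'. bij_betw h (carrier V) (carrier V'))"

definition smooth_rep_cat :: "'g monoid \<Rightarrow> 'g topology \<Rightarrow> (('g, 'v) rep, 'v \<Rightarrow> 'v) cat" where
  "smooth_rep_cat G T = \<lparr>Obj = {M. smooth_rep G T M}, Hom = rep_homs G,
     Idt = (\<lambda>M. \<lambda>v\<in>carrier M. v), Cmp = (\<lambda>M M' M'' g f. compose (carrier M) g f)\<rparr>"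

definition isotypic_component ::
  "'g monoid \<Rightarrow> 'g set \<Rightarrow> ('g, 'w) rep \<Rightarrow> ('g, 'v) rep \<Rightarrow> 'v set" where
  "isotypic_component G K W M =
     lin_span M (\<Union>{U. subrep (subgrp G K) M U \<and>
                       isomorphic_reps (subgrp G K) W (M\<lparr>carrier := U\<rparr>)})"

definition generated_by :: "'g monoid \<Rightarrow> ('g, 'v) rep \<Rightarrow> 'v set \<Rightarrow> bool" where
  "generated_by G M S \<longleftrightarrow> S \<subseteq> carrier M \<and> (\<forall>U. subrep G M U \<and> S \<subseteq> U \<longrightarrow> U = carrier M)"

definition rho_generated_cat :: "'g monoid \<Rightarrow> 'g topology \<Rightarrow> 'g set \<Rightarrow> ('g, 'w) rep \<Rightarrow>
    (('g, 'v) rep, 'v \<Rightarrow> 'v) cat" where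
  "rho_generated_cat G T K W =
     full_subcat (smooth_rep_cat G T) {M. generated_by G M (isotypic_component G K W M)}"


section \<open>The Hecke algebra and its modules\<close>

text \<open>The contragredient operator of \<open>g\<close>, as an element of the endomorphism space of the dual.\<close>

definition dual_op ::
  "'g monoid \<Rightarrow> ('g, 'w) rep \<Rightarrow> 'g \<Rightarrow> ('w \<Rightarrow> complex) \<Rightarrow> 'w \<Rightarrow> complex" where
  "dual_op G W g = (\<lambda>l\<in>carrier (dual W). \<lambda>w\<in>carrier W. l (act W (inv\<^bsub>G\<^esub> g) w))"

definition dual_end ::
  "('g, 'w) rep \<Rightarrow> (complex, ('w \<Rightarrow> complex) \<Rightarrow> 'w \<Rightarrow> complex) module" where
  "dual_end W = hom_space (dual W) (dual W)"

definition locally_constant :: "'g topology \<Rightarrow> ('g \<Rightarrow> 'a) \<Rightarrow> bool" where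
  "locally_constant T f \<longleftrightarrow>
     (\<forall>x\<in>topspace T. \<exists>U. openin T U \<and> x \<in> U \<and> (\<forall>y\<in>U. f y = f x))"

definition hecke_fun ::
  "'g monoid \<Rightarrow> 'g topology \<Rightarrow> 'g set \<Rightarrow> ('g, 'w) rep \<Rightarrow>
     ('g \<Rightarrow> ('w \<Rightarrow> complex) \<Rightarrow> 'w \<Rightarrow> complex) set" where
  "hecke_fun G T K W = {f \<in> carrier G \<rightarrow>\<^sub>E carrier (dual_end W).
     locally_constant T f \<and>
     compactin T (T closure_of {g \<in> carrier G. f g \<noteq> \<zero>\<^bsub>dual_end W\<^esub>}) \<and>
     (\<forall>k1\<in>K. \<forall>k2\<in>K. \<forall>g\<in>carrier G. f (k1 \<otimes>\<^bsub>G\<^esub> g \<otimes>\<^bsub>G\<^esub> k2) =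
        compose (carrier (dual W)) (dual_op G W k1)
          (compose (carrier (dual W)) (f g) (dual_op G W k2)))}"

text \<open>The unit is the function supported on \<open>K\<close> with value \<open>(vol K)\<^sup>-\<^sup>1 \<rho>\<^sup>\<or>(k)\<close> at \<open>k\<close>.\<close>

definition hecke_algebra ::
  "'g monoid \<Rightarrow> 'g topology \<Rightarrow> 'g measure \<Rightarrow> 'g set \<Rightarrow> ('g, 'w) rep \<Rightarrow>
     ('g \<Rightarrow> ('w \<Rightarrow> complex) \<Rightarrow> 'w \<Rightarrow> complex) ring" where
  "hecke_algebra G T \<mu> K W = \<lparr>carrier = hecke_fun G T K W,
     monoid.mult = (\<lambda>f1 f2. \<lambda>x\<in>carrier G. lc_integral \<mu> (dual_end W)
       (\<lambda>g. compose (carrier (dual W)) (f1 g) (f2 (inv\<^bsub>G\<^esub> g \<otimes>\<^bsub>G\<^esub> x)))),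
     one = (\<lambda>x\<in>carrier G. if x \<in> K
       then complex_of_real (1 / measure \<mu> K) \<odot>\<^bsub>dual_end W\<^esub> dual_op G W x
       else \<zero>\<^bsub>dual_end W\<^esub>),
     zero = (\<lambda>x\<in>carrier G. \<zero>\<^bsub>dual_end W\<^esub>),
     add = (\<lambda>f1 f2. \<lambda>x\<in>carrier G. f1 x \<oplus>\<^bsub>dual_end W\<^esub> f2 x)\<rparr>"

text \<open>The library's modules are over commutative rings only.\<close>

locale left_module = R: ring R + M: abelian_group M
  for R :: "'r ring" and M :: "('r, 'a) module" +
  assumes smult_closed: "\<And>a x. a \<in> carrier R \<Longrightarrow> x \<in> carrier M \<Longrightarrow> a \<odot>\<^bsub>M\<^esub> x \<in> carrier M"
    and smult_l_distr: "\<And>a b x. a \<in> carrier R \<Longrightarrow> b \<in> carrier R \<Longrightarrow> x \<in> carrier M \<Longrightarrow>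
      (a \<oplus>\<^bsub>R\<^esub> b) \<odot>\<^bsub>M\<^esub> x = a \<odot>\<^bsub>M\<^esub> x \<oplus>\<^bsub>M\<^esub> b \<odot>\<^bsub>M\<^esub> x"
    and smult_r_distr: "\<And>a x y. a \<in> carrier R \<Longrightarrow> x \<in> carrier M \<Longrightarrow> y \<in> carrier M \<Longrightarrow>
      a \<odot>\<^bsub>M\<^esub> (x \<oplus>\<^bsub>M\<^esub> y) = a \<odot>\<^bsub>M\<^esub> x \<oplus>\<^bsub>M\<^esub> a \<odot>\<^bsub>M\<^esub> y"
    and smult_assoc: "\<And>a b x. a \<in> carrier R \<Longrightarrow> b \<in> carrier R \<Longrightarrow> x \<in> carrier M \<Longrightarrow>
      (a \<otimes>\<^bsub>R\<^esub> b) \<odot>\<^bsub>M\<^esub> x = a \<odot>\<^bsub>M\<^esub> (b \<odot>\<^bsub>M\<^esub> x)"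
    and smult_one: "\<And>x. x \<in> carrier M \<Longrightarrow> \<one>\<^bsub>R\<^esub> \<odot>\<^bsub>M\<^esub> x = x"

definition left_module_homs ::
  "'r ring \<Rightarrow> ('r, 'a) module \<Rightarrow> ('r, 'b) module \<Rightarrow> ('a \<Rightarrow> 'b) set" where
  "left_module_homs R M N = {h \<in> carrier M \<rightarrow>\<^sub>E carrier N.
     (\<forall>x\<in>carrier M. \<forall>y\<in>carrier M. h (x \<oplus>\<^bsub>M\<^esub> y) = h x \<oplus>\<^bsub>N\<^esub> h y) \<and>
     (\<forall>a\<in>carrier R. \<forall>x\<in>carrier M. h (a \<odot>\<^bsub>M\<^esub> x) = a \<odot>\<^bsub>N\<^esub> h x)}"

definition left_module_cat :: "'r ring \<Rightarrow> (('r, 'a) module, 'a \<Rightarrow> 'a) cat" where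
  "left_module_cat R = \<lparr>Obj = {M. left_module R M}, Hom = left_module_homs R,
     Idt = (\<lambda>M. \<lambda>x\<in>carrier M. x), Cmp = (\<lambda>M M' M'' g f. compose (carrier M) g f)\<rparr>"


section \<open>The functor of \<open>\<rho>\<close>-invariants\<close>

definition rho_inv_obj ::
  "'g monoid \<Rightarrow> 'g measure \<Rightarrow> 'g set \<Rightarrow> ('g, 'w) rep \<Rightarrow> ('g, 'v) rep \<Rightarrow>
     ('g \<Rightarrow> ('w \<Rightarrow> complex) \<Rightarrow> 'w \<Rightarrow> complex, 'w \<Rightarrow> 'v) module" where
  "rho_inv_obj G \<mu> K W M = \<lparr>carrier = rep_homs (subgrp G K) W M,
     monoid.mult = undefined, one = undefined,
     zero = (\<lambda>w\<in>carrier W. \<zero>\<^bsub>M\<^esub>),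
     add = (\<lambda>\<phi> \<psi>. \<lambda>w\<in>carrier W. \<phi> w \<oplus>\<^bsub>M\<^esub> \<psi> w),
     smult = (\<lambda>f \<phi>. \<lambda>w\<in>carrier W.
       lc_integral \<mu> M (\<lambda>g. act M g (\<phi> (transposed W (f g) w))))\<rparr>"

definition rho_inv_mor ::
  "'g monoid \<Rightarrow> 'g set \<Rightarrow> ('g, 'w) rep \<Rightarrow> ('g, 'v) rep \<Rightarrow> ('g, 'v) rep \<Rightarrow>
     ('v \<Rightarrow> 'v) \<Rightarrow> ('w \<Rightarrow> 'v) \<Rightarrow> 'w \<Rightarrow> 'v" where
  "rho_inv_mor G K W M M' h = (\<lambda>\<phi>\<in>rep_homs (subgrp G K) W M. compose (carrier W) h \<phi>)"


section \<open>Universes\<close>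

text \<open>The objects of \<open>smooth_rep_cat\<close> are the smooth representations on subsets of a type \<open>'v\<close>,
  which plays the role of a universe; then \<open>rho_inv_obj\<close> lands in the modules on subsets of
  \<open>'w \<Rightarrow> 'v\<close>. For these two to be categories of objects of the same size, \<open>'v\<close> has to be closed
  under functions from \<open>'w\<close>, and it has to be large enough for \<open>G\<close> to be small.\<close>

definition universe_for :: "'g itself \<Rightarrow> 'w itself \<Rightarrow> 'v itself \<Rightarrow> bool" where
  "universe_for _ _ _ \<longleftrightarrow>
     (UNIV :: 'g set) \<lesssim> (UNIV :: 'v set) \<and> (UNIV :: ('w \<Rightarrow> 'v) set) \<lesssim> (UNIV :: 'v set)"

text \<open>Such universes exist for all \<open>'g\<close> and \<open>'w\<close>, and they can be chosen to contain any type
  \<open>'x\<close> given in advance.\<close>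

lemma universe_for_exists:
  "universe_for TYPE('g) TYPE('w) TYPE(('g \<times> 'w list \<times> 'x) set)"
  "(UNIV :: 'x set) \<lesssim> (UNIV :: ('g \<times> 'w list \<times> 'x) set set)"
proof -
  have 1: "inj (\<lambda>g::'g. {(g, [] :: 'w list, undefined :: 'x)})"
    by (auto intro: injI)
  define c where "c F = {(g, w # ws, x) | g w ws x. (g, ws, x) \<in> F w}"
    for F :: "'w \<Rightarrow> ('g \<times> 'w list \<times> 'x) set"
  have c: "F w = {(g, ws, x). (g, w # ws, x) \<in> c F}" for F w
    by (auto simp: c_def)
  have 2: "inj c"
  proof (rule injI)
    fix F F' assume "c F = c F'"
    then show "F = F'"
      by (intro ext) (simp only: c)
  qed
  show "universe_for TYPE('g) TYPE('w) TYPE(('g \<times> 'w list \<times> 'x) set)"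
    using 1 2 unfolding universe_for_def lepoll_def by blast
  have "inj (\<lambda>x::'x. {(undefined :: 'g, [] :: 'w list, x)})"
    by (auto intro: injI)
  then show "(UNIV :: 'x set) \<lesssim> (UNIV :: ('g \<times> 'w list \<times> 'x) set set)"
    unfolding lepoll_def by blast
qed

end

(* The idempotent of rho gives a functor from M to Hom_K(rho, M) with left adjoint
   N |-> c-Ind(rho) (x)_H N. The unit of the adjunction is always an isomorphism, and the counit on a
   representation generated by its rho-isotypic component is surjective with a kernel without
   rho-isotypic vectors. As G is a union of compact open subgroups J, a representation generated by
   rho-isotypic vectors has no nonzero subrepresentation Z of this kind: for each J containing K,
   averaging over J gives a J-equivariant projection onto Z, which vanishes on rho-isotypic vectors,
   hence on everything these generate under J.

   Vector-valued integrals are handled by testing against linear functionals, which turns every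
   identity into one between integrals of complex functions with finitely many values. *)

theory Submission
  imports Defs
begin

section \<open>Equivalences of categories\<close>

text \<open>Averages do the work of the idempotent. For a functional \<open>l\<close> on
  \<open>W\<close> and a vector \<open>m\<close>, \<open>avg l m\<close> is the integral over
  \<open>K\<close> of the conjugates of the rank one map \<open>w \<mapsto> l(w) m\<close>. Two
  facts carry the argument. On a translate \<open>x \<phi>(v)\<close> this average is
  \<open>hecke_elt l x v\<close> applied to \<open>\<phi>\<close>, with a Hecke function that knows
  neither \<open>M\<close> nor \<open>\<phi>\<close>; so a Hecke-linear map prescribes the averages
  of the image of every generator. And for a basis of \<open>W\<close> with dual functionals
  \<open>E b\<close>, the averages \<open>avg (E b) (\<psi> b)\<close> add up to the volume of
  \<open>K\<close> times \<open>\<psi>\<close>. The tensor product over the noncommutative algebra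
  is avoided: a vector of the induced representation is recorded by its averages, as a function with
  values in the module. An intertwiner is defined by its graph, and the quasi-inverse functor is
  chosen from full faithfulness and essential surjectivity. The function type is too large for the
  universe \<open>'v\<close>; but the vectors are finite sums, so lists of triples code them in
  \<open>'v\<close>.\<close>

lemma is_equivalence_if_fully_faithful_ess_surj:
  assumes F: "is_functor C D Fo Fm"
    and ff: "\<And>x y. x \<in> Obj C \<Longrightarrow> y \<in> Obj C \<Longrightarrow> bij_betw (Fm x y) (Hom C x y) (Hom D (Fo x) (Fo y))"
    and es: "\<And>d. d \<in> Obj D \<Longrightarrow> \<exists>c\<in>Obj C. \<exists>e. is_iso D (Fo c) d e"
  shows "is_equivalence C D Fo Fm"
proof -
  have catC: "is_category C" and catD: "is_category D" using F unfolding is_functor_def by blast+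
  have Fo: "Fo x \<in> Obj D" if "x \<in> Obj C" for x using F that unfolding is_functor_def by blast
  have Fm: "Fm x y f \<in> Hom D (Fo x) (Fo y)" if "x \<in> Obj C" "y \<in> Obj C" "f \<in> Hom C x y" for x y f
    using F that unfolding is_functor_def by blast
  have Fid: "Fm x x (Idt C x) = Idt D (Fo x)" if "x \<in> Obj C" for x
    using F that unfolding is_functor_def by blast
  have Fc: "Fm x z (Cmp C x y z g f) = Cmp D (Fo x) (Fo y) (Fo z) (Fm y z g) (Fm x y f)"
    if "x \<in> Obj C" "y \<in> Obj C" "z \<in> Obj C" "f \<in> Hom C x y" "g \<in> Hom C y z" for x y z f g
    using F that unfolding is_functor_def by blast
  have idC: "Idt C x \<in> Hom C x x" if "x \<in> Obj C" for x using catC that unfolding is_category_def by blast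
  have idD: "Idt D x \<in> Hom D x x" if "x \<in> Obj D" for x using catD that unfolding is_category_def by blast
  have cC: "Cmp C x y z g f \<in> Hom C x z"
    if "x \<in> Obj C" "y \<in> Obj C" "z \<in> Obj C" "f \<in> Hom C x y" "g \<in> Hom C y z" for x y z f g
    using catC that unfolding is_category_def by blast
  have cD: "Cmp D x y z g f \<in> Hom D x z"
    if "x \<in> Obj D" "y \<in> Obj D" "z \<in> Obj D" "f \<in> Hom D x y" "g \<in> Hom D y z" for x y z f g
    using catD that unfolding is_category_def by blast
  have unD: "Cmp D x x y f (Idt D x) = f" "Cmp D x y y (Idt D y) f = f"
    if "x \<in> Obj D" "y \<in> Obj D" "f \<in> Hom D x y" for x y f
    using catD that unfolding is_category_def by blast+
  have asD: "Cmp D x z u h (Cmp D x y z g f) = Cmp D x y u (Cmp D y z u h g) f"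
    if "x \<in> Obj D" "y \<in> Obj D" "z \<in> Obj D" "u \<in> Obj D" "f \<in> Hom D x y" "g \<in> Hom D y z" "h \<in> Hom D z u"
    for x y z u f g h
    using catD that unfolding is_category_def by blast
  obtain go where go0: "\<forall>d\<in>Obj D. go d \<in> Obj C \<and> (\<exists>e. is_iso D (Fo (go d)) d e)"
    using es bchoice[of "Obj D" "\<lambda>d c. c \<in> Obj C \<and> (\<exists>e. is_iso D (Fo c) d e)"] by blast
  have go: "go d \<in> Obj C" if "d \<in> Obj D" for d using go0 that by blast
  define P where "P d = Fo (go d)" for d
  have P: "P d \<in> Obj D" if "d \<in> Obj D" for d using go that Fo by (simp add: P_def)
  obtain e where e0: "\<forall>d\<in>Obj D. is_iso D (P d) d (e d)"
    using go0 bchoice[of "Obj D" "\<lambda>d e. is_iso D (P d) d e"] unfolding P_def by blast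
  then have e: "e d \<in> Hom D (P d) d" if "d \<in> Obj D" for d using that unfolding is_iso_def by blast
  have "\<forall>d\<in>Obj D. \<exists>g. g \<in> Hom D d (P d) \<and> Cmp D (P d) d (P d) g (e d) = Idt D (P d)
      \<and> Cmp D d (P d) d (e d) g = Idt D d"
    using e0 unfolding is_iso_def by blast
  then obtain e' where e'0: "\<forall>d\<in>Obj D. e' d \<in> Hom D d (P d) \<and> Cmp D (P d) d (P d) (e' d) (e d) = Idt D (P d)
      \<and> Cmp D d (P d) d (e d) (e' d) = Idt D d"
    using bchoice[of "Obj D"] by meson
  then have e': "e' d \<in> Hom D d (P d)" and e'e: "Cmp D (P d) d (P d) (e' d) (e d) = Idt D (P d)"
    and ee': "Cmp D d (P d) d (e d) (e' d) = Idt D d" if "d \<in> Obj D" for d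
    using that by blast+
  define J where "J x y = inv_into (Hom C x y) (Fm x y)" for x y
  have J: "J x y f \<in> Hom C x y" "Fm x y (J x y f) = f"
    if "x \<in> Obj C" "y \<in> Obj C" "f \<in> Hom D (Fo x) (Fo y)" for x y f
    using ff[OF that(1,2)] that(3) unfolding J_def
    by (auto simp: bij_betw_def inv_into_into f_inv_into_f)
  have inj: "f = g" if "x \<in> Obj C" "y \<in> Obj C" "f \<in> Hom C x y" "g \<in> Hom C x y" "Fm x y f = Fm x y g" for x y f g
    using ff[OF that(1,2)] that(3-) by (auto simp: bij_betw_def dest: inj_onD)
  \<comment> \<open>The action on morphisms has to be conjugation by the chosen isomorphisms
    \<open>e d\<close>. Each functor law is checked for \<open>H\<close> in \<open>D\<close> and
    then pulled back to \<open>C\<close> by injectivity of \<open>Fm\<close>.\<close>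
  define H where "H d d' f = Cmp D (P d) d (P d') (Cmp D d d' (P d') (e' d') f) (e d)" for d d' f
  have H: "H d d' f \<in> Hom D (P d) (P d')" if "d \<in> Obj D" "d' \<in> Obj D" "f \<in> Hom D d d'" for d d' f
    unfolding H_def using that by (auto intro: cD P e e')
  define Gm where "Gm d d' f = J (go d) (go d') (H d d' f)" for d d' f
  have Gm: "Gm d d' f \<in> Hom C (go d) (go d')" "Fm (go d) (go d') (Gm d d' f) = H d d' f"
    if "d \<in> Obj D" "d' \<in> Obj D" "f \<in> Hom D d d'" for d d' f
    unfolding Gm_def using that J go H P_def by auto
  have eH: "Cmp D (P d) (P d') d' (e d') (H d d' f) = Cmp D (P d) d d' f (e d)"
    if d: "d \<in> Obj D" "d' \<in> Obj D" "f \<in> Hom D d d'" for d d' f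
  proof -
    have 1: "Cmp D d d' (P d') (e' d') f \<in> Hom D d (P d')" using d by (auto intro: cD P e')
    have "Cmp D (P d) (P d') d' (e d') (H d d' f) =
       Cmp D (P d) d d' (Cmp D d (P d') d' (e d') (Cmp D d d' (P d') (e' d') f)) (e d)"
      unfolding H_def using asD[OF P[OF d(1)] d(1) P[OF d(2)] d(2) e[OF d(1)] 1 e[OF d(2)]] .
    also have "Cmp D d (P d') d' (e d') (Cmp D d d' (P d') (e' d') f) = Cmp D d d' d' (Cmp D d' (P d') d' (e d') (e' d')) f"
      using asD[OF d(1,2) P[OF d(2)] d(2) d(3) e'[OF d(2)] e[OF d(2)]] .
    also have "\<dots> = f" using ee' unD d by simp
    finally show ?thesis .
  qed
  have He: "Cmp D d (P d) (P d') (H d d' f) (e' d) = Cmp D d d' (P d') (e' d') f"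
    if d: "d \<in> Obj D" "d' \<in> Obj D" "f \<in> Hom D d d'" for d d' f
  proof -
    have 1: "Cmp D d d' (P d') (e' d') f \<in> Hom D d (P d')" using d by (auto intro: cD P e')
    have "Cmp D d (P d) (P d') (H d d' f) (e' d) =
       Cmp D d d (P d') (Cmp D d d' (P d') (e' d') f) (Cmp D d (P d) d (e d) (e' d))"
      unfolding H_def using asD[OF d(1) P[OF d(1)] d(1) P[OF d(2)] e'[OF d(1)] e[OF d(1)] 1] by simp
    also have "\<dots> = Cmp D d d' (P d') (e' d') f" using 1 ee' unD d P by simp
    finally show ?thesis .
  qed
  have HI: "H d d (Idt D d) = Idt D (P d)" if "d \<in> Obj D" for d
    using that e'e unD e' P by (simp add: H_def)
  have HC: "H x z (Cmp D x y z g f) = Cmp D (P x) (P y) (P z) (H y z g) (H x y f)"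
    if d: "x \<in> Obj D" "y \<in> Obj D" "z \<in> Obj D" "f \<in> Hom D x y" "g \<in> Hom D y z" for x y z f g
  proof -
    have f': "Cmp D x y (P y) (e' y) f \<in> Hom D x (P y)" using d by (auto intro: cD P e')
    have "Cmp D (P x) (P y) (P z) (H y z g) (H x y f) =
      Cmp D (P x) x (P z) (Cmp D x (P y) (P z) (H y z g) (Cmp D x y (P y) (e' y) f)) (e x)"
      using asD[OF P[OF d(1)] d(1) P[OF d(2)] P[OF d(3)] e[OF d(1)] f' H[OF d(2,3,5)]] by (simp add: H_def)
    also have "Cmp D x (P y) (P z) (H y z g) (Cmp D x y (P y) (e' y) f) =
       Cmp D x y (P z) (Cmp D y (P y) (P z) (H y z g) (e' y)) f"
      using asD[OF d(1,2) P[OF d(2)] P[OF d(3)] d(4) e'[OF d(2)] H[OF d(2,3,5)]] .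
    also have "Cmp D y (P y) (P z) (H y z g) (e' y) = Cmp D y z (P z) (e' z) g" using He[OF d(2,3,5)] .
    also have "Cmp D x y (P z) (Cmp D y z (P z) (e' z) g) f = Cmp D x z (P z) (e' z) (Cmp D x y z g f)"
      using asD[OF d(1-3) P[OF d(3)] d(4,5) e'[OF d(3)]] by simp
    finally show ?thesis by (simp add: H_def)
  qed
  have G: "is_functor D C go Gm"
    unfolding is_functor_def
  proof (intro conjI ballI catC catD)
    fix x assume x: "x \<in> Obj D" then show "go x \<in> Obj C" by (rule go)
    show "Gm x x (Idt D x) = Idt C (go x)"
      using x idD by (intro inj[of "go x" "go x"]) (auto simp: go Gm idC HI Fid P_def)
  next
    fix x y f assume "x \<in> Obj D" "y \<in> Obj D" "f \<in> Hom D x y"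
    then show "Gm x y f \<in> Hom C (go x) (go y)" by (rule Gm)
  next
    fix x y z f g assume d: "x \<in> Obj D" "y \<in> Obj D" "z \<in> Obj D" "f \<in> Hom D x y" "g \<in> Hom D y z"
    have gf: "Cmp D x y z g f \<in> Hom D x z" using d by (auto intro: cD)
    have 2: "Cmp C (go x) (go y) (go z) (Gm y z g) (Gm x y f) \<in> Hom C (go x) (go z)"
      using d by (auto intro: cC go Gm(1))
    show "Gm x z (Cmp D x y z g f) = Cmp C (go x) (go y) (go z) (Gm y z g) (Gm x y f)"
      using d gf 2 Gm(1)[OF d(1,2,4)] Gm(1)[OF d(2,3,5)]
      by (intro inj[of "go x" "go z"]) (auto simp: go Gm HC Fc P_def)
  qed
  \<comment> \<open>Fullness lifts \<open>e' (Fo x)\<close>, an isomorphism from \<open>Fo x\<close>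
    to \<open>P (Fo x)\<close>; lifting \<open>e (Fo x)\<close> as well gives the inverse of
    \<open>\<eta> x\<close>.\<close>
  define \<eta> where "\<eta> x = J x (go (Fo x)) (e' (Fo x))" for x
  have \<eta>: "\<eta> x \<in> Hom C x (go (Fo x))" "Fm x (go (Fo x)) (\<eta> x) = e' (Fo x)" if "x \<in> Obj C" for x
    unfolding \<eta>_def using J[of x "go (Fo x)" "e' (Fo x)"] that go Fo e'[of "Fo x"] by (auto simp: P_def)
  have "is_iso C x (go (Fo x)) (\<eta> x)" if x: "x \<in> Obj C" for x
  proof -
    let ?y = "go (Fo x)"
    define k where "k = J ?y x (e (Fo x))"
    have y: "?y \<in> Obj C" using x go Fo by blast
    have k: "k \<in> Hom C ?y x" "Fm ?y x k = e (Fo x)"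
      unfolding k_def using J[of ?y x "e (Fo x)"] x y Fo e[of "Fo x"] by (auto simp: P_def)
    have "Cmp C x ?y x k (\<eta> x) = Idt C x"
      using x y k \<eta>[OF x] cC idC ee'[OF Fo[OF x]] by (intro inj[of x x]) (auto simp: Fc Fid P_def)
    moreover have "Cmp C ?y x ?y (\<eta> x) k = Idt C ?y"
      using x y k \<eta>[OF x] cC idC e'e[OF Fo[OF x]] by (intro inj[of ?y ?y]) (auto simp: Fc Fid P_def)
    ultimately show ?thesis using \<eta>[OF x] k unfolding is_iso_def by blast
  qed
  moreover have "Cmp C x y (go (Fo y)) (\<eta> y) f = Cmp C x (go (Fo x)) (go (Fo y)) (Gm (Fo x) (Fo y) (Fm x y f)) (\<eta> x)"
    if x: "x \<in> Obj C" "y \<in> Obj C" "f \<in> Hom C x y" for x y f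
  proof (rule inj[of x "go (Fo y)"])
    have *: "go (Fo x) \<in> Obj C" "go (Fo y) \<in> Obj C" using x go Fo by blast+
    have **: "Fm x y f \<in> Hom D (Fo x) (Fo y)" using Fm x by blast
    note Gm' = Gm[OF Fo[OF x(1)] Fo[OF x(2)] **]
    show "x \<in> Obj C" "go (Fo y) \<in> Obj C" by fact+
    show "Cmp C x y (go (Fo y)) (\<eta> y) f \<in> Hom C x (go (Fo y))" using x * by (auto intro: cC \<eta>(1))
    show "Cmp C x (go (Fo x)) (go (Fo y)) (Gm (Fo x) (Fo y) (Fm x y f)) (\<eta> x) \<in> Hom C x (go (Fo y))"
      using x * Gm'(1) by (auto intro: cC \<eta>(1))
    show "Fm x (go (Fo y)) (Cmp C x y (go (Fo y)) (\<eta> y) f) =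
      Fm x (go (Fo y)) (Cmp C x (go (Fo x)) (go (Fo y)) (Gm (Fo x) (Fo y) (Fm x y f)) (\<eta> x))"
      using He[OF Fo[OF x(1)] Fo[OF x(2)] **] Gm' * x \<eta>[OF x(1)] \<eta>[OF x(2)]
      by (simp add: Fc P_def)
  qed
  ultimately have "is_nat_iso C C (\<lambda>x. x) (\<lambda>x y f. f)
               (\<lambda>x. go (Fo x)) (\<lambda>x y f. Gm (Fo x) (Fo y) (Fm x y f)) \<eta>"
    unfolding is_nat_iso_def by blast
  moreover have "is_nat_iso D D (\<lambda>x. Fo (go x)) (\<lambda>x y f. Fm (go x) (go y) (Gm x y f))
               (\<lambda>x. x) (\<lambda>x y f. f) e"
    unfolding is_nat_iso_def using e0 eH Gm by (auto simp: P_def)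
  ultimately show ?thesis unfolding is_equivalence_def using F G by blast
qed

section \<open>Complex vector spaces\<close>

lemma complex_ring_simps [simp]:
  "carrier complex_ring = UNIV" "x \<oplus>\<^bsub>complex_ring\<^esub> y = x + y" "x \<otimes>\<^bsub>complex_ring\<^esub> y = x * y"
  "\<zero>\<^bsub>complex_ring\<^esub> = 0" "\<one>\<^bsub>complex_ring\<^esub> = 1"
  by (simp_all add: ring_of_type_algebra_def)

text \<open>Every complex number is a scalar, so the module laws restated here carry no membership
  conditions on coefficients.\<close>

locale complex_space = Module.module complex_ring V
  for V :: "(complex, 'a, 'x) module_scheme" (structure)
begin

lemmas zero_mem [simp, intro] = M.zero_closed
lemmas add_mem [simp, intro] = M.a_closed

lemma smult_mem [simp, intro]: "x \<in> carrier V \<Longrightarrow> c \<odot> x \<in> carrier V"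
  using smult_closed[of c x] by simp

lemma smult_zero_left [simp]: "x \<in> carrier V \<Longrightarrow> 0 \<odot> x = \<zero>"
  using smult_l_null[of x] by simp

lemma smult_zero_right [simp]: "c \<odot> \<zero> = \<zero>"
  using smult_r_null[of c] by simp

lemma smult_one_left [simp]: "x \<in> carrier V \<Longrightarrow> 1 \<odot> x = x"
  using smult_one[of x] by simp

lemma smult_add_left: "x \<in> carrier V \<Longrightarrow> (a + b) \<odot> x = a \<odot> x \<oplus> b \<odot> x"
  using smult_l_distr[of a b x] by simp

lemma smult_add_right: "x \<in> carrier V \<Longrightarrow> y \<in> carrier V \<Longrightarrow> a \<odot> (x \<oplus> y) = a \<odot> x \<oplus> a \<odot> y"
  using smult_r_distr[of a x y] by simp

lemma smult_smult: "x \<in> carrier V \<Longrightarrow> a \<odot> (b \<odot> x) = (a * b) \<odot> x"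
  using smult_assoc1[of a b x] by simp

lemma minus_eq_smult: "x \<in> carrier V \<Longrightarrow> \<ominus> x = (- 1) \<odot> x"
  using smult_add_left[of x "-1" 1] by (simp add: M.minus_equality)

lemma add_eq_zero_iff: "x \<in> carrier V \<Longrightarrow> y \<in> carrier V \<Longrightarrow> x \<oplus> y = \<zero> \<longleftrightarrow> x = (- 1) \<odot> y"
  by (metis minus_eq_smult M.minus_equality M.minus_minus M.a_inv_closed M.l_neg)

lemma eq_iff_diff: "x \<in> carrier V \<Longrightarrow> y \<in> carrier V \<Longrightarrow> x = y \<longleftrightarrow> x \<oplus> (- 1) \<odot> y = \<zero>"
  by (simp add: add_eq_zero_iff smult_smult)

lemma submodule_iff:
  "submodule U complex_ring V \<longleftrightarrow> U \<subseteq> carrier V \<and> \<zero> \<in> U \<and> (\<forall>x\<in>U. \<forall>y\<in>U. x \<oplus> y \<in> U) \<and> (\<forall>c. \<forall>x\<in>U. c \<odot> x \<in> U)"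
    (is "?l \<longleftrightarrow> ?r")
proof
  assume l: ?l
  show ?r using submoduleE[OF l] subgroup.one_closed[OF submodule.axioms(1)[OF l]] by auto
next
  assume r: ?r
  show ?l
  proof (rule submoduleI)
    fix a assume "a \<in> U" then show "\<ominus> a \<in> U" using r minus_eq_smult[of a] by auto
  qed (use r in auto)
qed

lemma lin_span_submodule: "submodule (lin_span V S) complex_ring V" if "S \<subseteq> carrier V"
proof -
  have "submodule (carrier V) complex_ring V" by (rule carrier_is_submodule)
  then show ?thesis using that unfolding lin_span_def submodule_iff by blast
qed

lemma lin_span_superset: "S \<subseteq> lin_span V S"
  unfolding lin_span_def by blast

lemma lin_span_least: "submodule U complex_ring V \<Longrightarrow> S \<subseteq> U \<Longrightarrow> lin_span V S \<subseteq> U"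
  unfolding lin_span_def by blast

text \<open>Zorn's lemma gives a submodule \<open>C\<close> maximal among those meeting
  \<open>Z\<close> only in zero; maximality makes it a complement, and \<open>P\<close> is the
  projection along it. The dimension is arbitrary because the representations to which this is
  applied are infinite-dimensional in general.\<close>

lemma linear_projection_exists:
  assumes Z: "submodule Z complex_ring V"
  obtains P where "P \<in> lin_maps V V" "\<And>v. v \<in> carrier V \<Longrightarrow> P v \<in> Z" "\<And>z. z \<in> Z \<Longrightarrow> P z = z"
proof -
  note Zs = Z[unfolded submodule_iff]
  have Zc: "z \<in> carrier V" if "z \<in> Z" for z using Zs that by blast
  let ?A = "{C. submodule C complex_ring V \<and> C \<inter> Z \<subseteq> {\<zero>}}"
  have "\<exists>M\<in>?A. \<forall>D\<in>?A. M \<subseteq> D \<longrightarrow> D = M"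
  proof (rule subset_Zorn_nonempty)
    have "{\<zero>} \<in> ?A" unfolding submodule_iff by auto
    then show "?A \<noteq> {}" by blast
  next
    fix Ch assume Ch: "Ch \<noteq> {}" "subset.chain ?A Ch"
    then have sub: "\<And>C. C \<in> Ch \<Longrightarrow> submodule C complex_ring V \<and> C \<inter> Z \<subseteq> {\<zero>}"
      and lin: "\<And>C D. C \<in> Ch \<Longrightarrow> D \<in> Ch \<Longrightarrow> C \<subseteq> D \<or> D \<subseteq> C"
      unfolding subset_chain_def by blast+
    have "x \<oplus> y \<in> \<Union> Ch" if "x \<in> \<Union> Ch" "y \<in> \<Union> Ch" for x y
    proof -
      from that obtain C D where CD: "C \<in> Ch" "D \<in> Ch" "x \<in> C" "y \<in> D" by blast
      then obtain E where "E \<in> Ch" "x \<in> E" "y \<in> E" using lin[of C D] by blast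
      then show ?thesis using sub[of E] unfolding submodule_iff by blast
    qed
    moreover have "\<zero> \<in> \<Union> Ch" "\<Union> Ch \<subseteq> carrier V" "\<And>c x. x \<in> \<Union> Ch \<Longrightarrow> c \<odot> x \<in> \<Union> Ch"
      using sub Ch(1) unfolding submodule_iff by blast+
    ultimately have "submodule (\<Union> Ch) complex_ring V" by (simp add: submodule_iff)
    moreover have "\<Union> Ch \<inter> Z \<subseteq> {\<zero>}" using sub by blast
    ultimately show "\<Union> Ch \<in> ?A" by simp
  qed
  then obtain C where C0: "C \<in> ?A" and max0: "\<forall>D\<in>?A. C \<subseteq> D \<longrightarrow> D = C" by (rule bexE)
  have C: "submodule C complex_ring V" "C \<inter> Z \<subseteq> {\<zero>}" using C0 by simp_all
  have max: "D = C" if "submodule D complex_ring V" "D \<inter> Z \<subseteq> {\<zero>}" "C \<subseteq> D" for D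
    using max0 that by simp
  note Cs = C(1)[unfolded submodule_iff]
  have Cc: "z \<in> carrier V" if "z \<in> C" for z using Cs that by blast
  have ex: "\<exists>c\<in>C. \<exists>z\<in>Z. u = c \<oplus> z" if u: "u \<in> carrier V" for u
  proof (rule ccontr)
    assume no: "\<not> ?thesis"
    \<comment> \<open>\<open>C\<close> with the line through \<open>u\<close> adjoined. It is
      strictly larger than \<open>C\<close>, so by maximality it meets \<open>Z\<close> in a nonzero
      vector, and dividing by the coefficient of \<open>u\<close> writes \<open>u\<close> as a sum
      from \<open>C\<close> and \<open>Z\<close>.\<close>
    let ?D = "{c \<oplus> a \<odot> u | c a. c \<in> C}"
    have D: "submodule ?D complex_ring V"
      unfolding submodule_iff
    proof (intro conjI ballI allI)
      show "?D \<subseteq> carrier V" using Cc u by auto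
      show "\<zero> \<in> ?D" using Cs u by (auto intro!: exI[of _ \<zero>] exI[of _ 0])
      fix x assume "x \<in> ?D" then obtain c a where x: "c \<in> C" "x = c \<oplus> a \<odot> u" by blast
      {
        fix y assume "y \<in> ?D" then obtain d b where y: "d \<in> C" "y = d \<oplus> b \<odot> u" by blast
        have "x \<oplus> y = (c \<oplus> d) \<oplus> (a + b) \<odot> u" using x y Cc u by (simp add: M.a_ac smult_add_left)
        then show "x \<oplus> y \<in> ?D" using x y Cs by blast
      next
        fix k have "k \<odot> x = k \<odot> c \<oplus> (k * a) \<odot> u" using x Cc u by (simp add: smult_add_right smult_smult)
        then show "k \<odot> x \<in> ?D" using x Cs by blast
      }
    qed
    have "u \<in> ?D" using Cs u by (auto intro!: exI[of _ \<zero>] exI[of _ 1])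
    moreover have "u \<notin> C"
    proof
      assume "u \<in> C"
      then have "u = u \<oplus> \<zero>" "\<zero> \<in> Z" using Zs u by auto
      then show False using no \<open>u \<in> C\<close> by blast
    qed
    moreover have "C \<subseteq> ?D"
    proof
      fix c assume "c \<in> C" then show "c \<in> ?D" using Cc u by (auto intro!: exI[of _ c] exI[of _ 0])
    qed
    ultimately have "\<not> ?D \<inter> Z \<subseteq> {\<zero>}" using max[OF D] by blast
    then obtain c a where ca: "c \<in> C" "c \<oplus> a \<odot> u \<in> Z" "c \<oplus> a \<odot> u \<noteq> \<zero>" by auto
    show False
    proof (cases "a = 0")
      case True then show False using ca C u Cc by auto
    next
      case False
      let ?z = "c \<oplus> a \<odot> u"
      have "(- (1/a)) \<odot> c \<oplus> (1/a) \<odot> ?z = u"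
      proof -
        have "(- (1/a)) \<odot> c \<oplus> (1/a) \<odot> ?z = ((- (1/a)) \<odot> c \<oplus> (1/a) \<odot> c) \<oplus> u"
          using ca(1) Cc u False by (simp add: smult_add_right smult_smult M.a_assoc)
        also have "(- (1/a)) \<odot> c \<oplus> (1/a) \<odot> c = \<zero>"
          using ca(1) Cc by (simp flip: smult_add_left)
        finally show ?thesis using u by simp
      qed
      moreover have "(- (1/a)) \<odot> c \<in> C" "(1/a) \<odot> ?z \<in> Z" using Cs Zs ca by blast+
      ultimately show False using no by metis
    qed
  qed
  have uniq: "z = z'" if "c \<in> C" "c' \<in> C" "z \<in> Z" "z' \<in> Z" "c \<oplus> z = c' \<oplus> z'" for c c' z z'
  proof -
    have m: "c \<in> carrier V" "c' \<in> carrier V" "z \<in> carrier V" "z' \<in> carrier V" using that Cc Zc by auto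
    have "z \<oplus> (- 1) \<odot> z' = (- 1) \<odot> c \<oplus> (c \<oplus> z) \<oplus> (- 1) \<odot> z'"
      using m by (metis M.a_assoc M.l_neg M.l_zero minus_eq_smult smult_mem)
    also have "\<dots> = (- 1) \<odot> c \<oplus> c'"
      using m unfolding that(5) by (metis M.a_assoc M.r_neg M.r_zero M.a_closed minus_eq_smult smult_mem)
    finally have e: "z \<oplus> (- 1) \<odot> z' = (- 1) \<odot> c \<oplus> c'" .
    have "z \<oplus> (- 1) \<odot> z' \<in> Z" "(- 1) \<odot> c \<oplus> c' \<in> C" using that Cs Zs by blast+
    then have "z \<oplus> (- 1) \<odot> z' = \<zero>" using C(2) e by auto
    then show ?thesis using eq_iff_diff[of z z'] m by simp
  qed
  define P where "P = (\<lambda>v\<in>carrier V. THE z. z \<in> Z \<and> (\<exists>c\<in>C. v = c \<oplus> z))"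
  have Peq: "P (c \<oplus> z) = z" if "c \<in> C" "z \<in> Z" for c z
  proof -
    have "c \<oplus> z \<in> carrier V" using that Cc Zc by auto
    then show ?thesis unfolding P_def using that uniq by (auto intro!: the_equality)
  qed
  show thesis
  proof (rule that)
    show "P v \<in> Z" if "v \<in> carrier V" for v using ex[OF that] Peq by auto
    show "P z = z" if "z \<in> Z" for z
      using Peq[of \<zero> z] that Cs Zc by simp
    show "P \<in> lin_maps V V"
      unfolding lin_maps_def
    proof (intro CollectI conjI ballI allI)
      show "P \<in> carrier V \<rightarrow>\<^sub>E carrier V" using ex Peq Zc by (fastforce simp: P_def)
      fix x assume "x \<in> carrier V" then obtain c z where x: "c \<in> C" "z \<in> Z" "x = c \<oplus> z" using ex by blast
      {
        fix y assume "y \<in> carrier V" then obtain d w where y: "d \<in> C" "w \<in> Z" "y = d \<oplus> w" using ex by blast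
        have "x \<oplus> y = (c \<oplus> d) \<oplus> (z \<oplus> w)" using x y Cc Zc by (simp add: M.a_ac)
        moreover have "c \<oplus> d \<in> C" "z \<oplus> w \<in> Z" using x y Cs Zs by blast+
        ultimately show "P (x \<oplus> y) = P x \<oplus> P y" using Peq x y by simp
      next
        fix k have "k \<odot> x = k \<odot> c \<oplus> k \<odot> z" using x Cc Zc by (simp add: smult_add_right)
        moreover have "k \<odot> c \<in> C" "k \<odot> z \<in> Z" using x Cs Zs by blast+
        ultimately show "P (k \<odot> x) = k \<odot> P x" using Peq x by simp
      }
    qed
  qed
qed

end

section \<open>Extensional linear maps, duals and endomorphism spaces\<close>

lemma scalars_simps [simp]:
  "carrier scalars = UNIV" "x \<oplus>\<^bsub>scalars\<^esub> y = x + y" "c \<odot>\<^bsub>scalars\<^esub> y = c * y" "\<zero>\<^bsub>scalars\<^esub> = 0"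
  by (simp_all add: scalars_def)

text \<open>Additive inverses come from the law for \<open>0 \<odot> x\<close>: it makes
  \<open>(- 1) \<odot> x\<close> the inverse of \<open>x\<close>.\<close>

lemma complex_spaceI:
  fixes V (structure)
  assumes "\<And>x y. x \<in> carrier V \<Longrightarrow> y \<in> carrier V \<Longrightarrow> x \<oplus> y \<in> carrier V"
    and "\<zero> \<in> carrier V"
    and "\<And>x y z. x \<in> carrier V \<Longrightarrow> y \<in> carrier V \<Longrightarrow> z \<in> carrier V \<Longrightarrow> (x \<oplus> y) \<oplus> z = x \<oplus> (y \<oplus> z)"
    and "\<And>x y. x \<in> carrier V \<Longrightarrow> y \<in> carrier V \<Longrightarrow> x \<oplus> y = y \<oplus> x"
    and "\<And>x. x \<in> carrier V \<Longrightarrow> \<zero> \<oplus> x = x"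
    and "\<And>c x. x \<in> carrier V \<Longrightarrow> c \<odot> x \<in> carrier V"
    and "\<And>a b x. x \<in> carrier V \<Longrightarrow> (a + b) \<odot> x = a \<odot> x \<oplus> b \<odot> x"
    and "\<And>a x y. x \<in> carrier V \<Longrightarrow> y \<in> carrier V \<Longrightarrow> a \<odot> (x \<oplus> y) = a \<odot> x \<oplus> a \<odot> y"
    and "\<And>a b x. x \<in> carrier V \<Longrightarrow> (a * b) \<odot> x = a \<odot> (b \<odot> x)"
    and "\<And>x. x \<in> carrier V \<Longrightarrow> 1 \<odot> x = x"
    and "\<And>x. x \<in> carrier V \<Longrightarrow> 0 \<odot> x = \<zero>"
  shows "complex_space V"
proof -
  have inv: "\<exists>y\<in>carrier V. y \<oplus> x = \<zero>" if "x \<in> carrier V" for x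
    using assms(7)[OF that, of "-1" 1] assms(6)[OF that, of "-1"] assms(10,11)[OF that] by auto
  have "abelian_group V" by (rule abelian_groupI) (use assms inv in auto)
  then show ?thesis
    unfolding complex_space_def by (intro moduleI) (use assms in auto)
qed

lemma complex_space_scalars: "complex_space scalars"
  by (rule complex_spaceI) (auto simp: algebra_simps)

lemma lin_mapsD:
  assumes "h \<in> lin_maps V V'"
  shows lin_maps_mem: "x \<in> carrier V \<Longrightarrow> h x \<in> carrier V'"
    and lin_maps_add: "x \<in> carrier V \<Longrightarrow> y \<in> carrier V \<Longrightarrow> h (x \<oplus>\<^bsub>V\<^esub> y) = h x \<oplus>\<^bsub>V'\<^esub> h y"
    and lin_maps_smult: "x \<in> carrier V \<Longrightarrow> h (c \<odot>\<^bsub>V\<^esub> x) = c \<odot>\<^bsub>V'\<^esub> h x"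
  using assms by (auto simp: lin_maps_def PiE_def)

lemma lin_maps_ext: "h \<in> lin_maps V V' \<Longrightarrow> h \<in> extensional (carrier V)"
  by (auto simp: lin_maps_def PiE_def)

lemma lin_maps_undefined: "h \<in> lin_maps V V' \<Longrightarrow> x \<notin> carrier V \<Longrightarrow> h x = undefined"
  using lin_maps_ext by (auto simp: extensional_def)

lemma lin_maps_eqI:
  assumes "f \<in> lin_maps V V'" "h \<in> lin_maps V V''" "\<And>x. x \<in> carrier V \<Longrightarrow> f x = h x"
  shows "f = h"
  using assms lin_maps_undefined by (metis ext)

lemma lin_maps_zero:
  assumes "h \<in> lin_maps V V'" "complex_space V" "complex_space V'"
  shows "h \<zero>\<^bsub>V\<^esub> = \<zero>\<^bsub>V'\<^esub>"
proof -
  interpret V: complex_space V by fact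
  interpret V': complex_space V' by fact
  show ?thesis using lin_maps_smult[OF assms(1), of "\<zero>\<^bsub>V\<^esub>" 0] lin_maps_mem[OF assms(1)] by simp
qed

lemma lin_mapsI:
  assumes "h \<in> extensional (carrier V)" "\<And>x. x \<in> carrier V \<Longrightarrow> h x \<in> carrier V'"
    and "\<And>x y. x \<in> carrier V \<Longrightarrow> y \<in> carrier V \<Longrightarrow> h (x \<oplus>\<^bsub>V\<^esub> y) = h x \<oplus>\<^bsub>V'\<^esub> h y"
    and "\<And>c x. x \<in> carrier V \<Longrightarrow> h (c \<odot>\<^bsub>V\<^esub> x) = c \<odot>\<^bsub>V'\<^esub> h x"
  shows "h \<in> lin_maps V V'"
  using assms by (auto simp: lin_maps_def PiE_def)

lemma lin_maps_compose:
  assumes "complex_space V" "f \<in> lin_maps V V'" "h \<in> lin_maps V' V''"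
  shows "compose (carrier V) h f \<in> lin_maps V V''"
proof -
  interpret complex_space V by fact
  show ?thesis
    by (rule lin_mapsI) (use assms in \<open>auto simp: compose_def lin_mapsD\<close>)
qed

lemma lin_maps_id: "complex_space V \<Longrightarrow> (\<lambda>x\<in>carrier V. x) \<in> lin_maps V V"
proof -
  assume "complex_space V"
  then interpret complex_space V .
  show ?thesis by (rule lin_mapsI) auto
qed

lemma lin_maps_restrict_target:
  "h \<in> lin_maps V (V'\<lparr>carrier := U\<rparr>) \<longleftrightarrow> h \<in> lin_maps V V' \<and> h ` carrier V \<subseteq> U" if "U \<subseteq> carrier V'"
  using that by (auto simp: lin_maps_def PiE_def)

lemma hom_space_simps [simp]:
  "carrier (hom_space V V') = lin_maps V V'"
  "\<zero>\<^bsub>hom_space V V'\<^esub> = (\<lambda>x\<in>carrier V. \<zero>\<^bsub>V'\<^esub>)"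
  "f \<oplus>\<^bsub>hom_space V V'\<^esub> h = (\<lambda>x\<in>carrier V. f x \<oplus>\<^bsub>V'\<^esub> h x)"
  "c \<odot>\<^bsub>hom_space V V'\<^esub> f = (\<lambda>x\<in>carrier V. c \<odot>\<^bsub>V'\<^esub> f x)"
  by (simp_all add: hom_space_def)

lemma complex_space_hom_space:
  assumes "complex_space V" "complex_space V'"
  shows "complex_space (hom_space V V')"
proof -
  interpret V: complex_space V by fact
  interpret V': complex_space V' by fact
  show ?thesis
  proof (rule complex_spaceI)
    fix f h assume "f \<in> carrier (hom_space V V')" "h \<in> carrier (hom_space V V')"
    then show "f \<oplus>\<^bsub>hom_space V V'\<^esub> h \<in> carrier (hom_space V V')"
      by (auto intro!: lin_mapsI simp: lin_mapsD V'.smult_add_right V'.M.a_ac)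
  next
    show "\<zero>\<^bsub>hom_space V V'\<^esub> \<in> carrier (hom_space V V')" by (auto intro!: lin_mapsI)
  next
    fix c f assume "f \<in> carrier (hom_space V V')"
    then show "c \<odot>\<^bsub>hom_space V V'\<^esub> f \<in> carrier (hom_space V V')"
      by (auto intro!: lin_mapsI simp: lin_mapsD V'.smult_add_right V'.smult_smult mult.commute)
  next
    fix f g h assume "f \<in> carrier (hom_space V V')" "g \<in> carrier (hom_space V V')" "h \<in> carrier (hom_space V V')"
    then show "f \<oplus>\<^bsub>hom_space V V'\<^esub> g \<oplus>\<^bsub>hom_space V V'\<^esub> h = f \<oplus>\<^bsub>hom_space V V'\<^esub> (g \<oplus>\<^bsub>hom_space V V'\<^esub> h)"
      by (auto intro!: restrict_ext V'.M.a_assoc simp: lin_maps_mem)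
  next
    fix f h assume "f \<in> carrier (hom_space V V')" "h \<in> carrier (hom_space V V')"
    then show "f \<oplus>\<^bsub>hom_space V V'\<^esub> h = h \<oplus>\<^bsub>hom_space V V'\<^esub> f"
      by (auto intro!: restrict_ext V'.M.a_comm simp: lin_maps_mem)
  next
    fix a f h assume "f \<in> carrier (hom_space V V')" "h \<in> carrier (hom_space V V')"
    then show "a \<odot>\<^bsub>hom_space V V'\<^esub> (f \<oplus>\<^bsub>hom_space V V'\<^esub> h) = a \<odot>\<^bsub>hom_space V V'\<^esub> f \<oplus>\<^bsub>hom_space V V'\<^esub> a \<odot>\<^bsub>hom_space V V'\<^esub> h"
      by (auto intro!: restrict_ext V'.smult_add_right simp: lin_maps_mem)
  next
    fix f assume f: "f \<in> carrier (hom_space V V')"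
    then have ext: "(\<lambda>x\<in>carrier V. f x) = f" by (auto simp: lin_maps_ext extensional_restrict)
    show "\<zero>\<^bsub>hom_space V V'\<^esub> \<oplus>\<^bsub>hom_space V V'\<^esub> f = f" "1 \<odot>\<^bsub>hom_space V V'\<^esub> f = f"
      using f ext by (auto simp: lin_maps_mem cong: restrict_cong)
    fix a b
    show "(a + b) \<odot>\<^bsub>hom_space V V'\<^esub> f = a \<odot>\<^bsub>hom_space V V'\<^esub> f \<oplus>\<^bsub>hom_space V V'\<^esub> b \<odot>\<^bsub>hom_space V V'\<^esub> f"
      using f by (auto intro!: restrict_ext V'.smult_add_left simp: lin_maps_mem)
    show "(a * b) \<odot>\<^bsub>hom_space V V'\<^esub> f = a \<odot>\<^bsub>hom_space V V'\<^esub> (b \<odot>\<^bsub>hom_space V V'\<^esub> f)"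
      using f by (auto intro!: restrict_ext simp: lin_maps_mem V'.smult_smult)
    show "0 \<odot>\<^bsub>hom_space V V'\<^esub> f = \<zero>\<^bsub>hom_space V V'\<^esub>"
      using f by (auto intro!: restrict_ext simp: lin_maps_mem)
  qed
qed

lemma dual_simps [simp]:
  "carrier (dual V) = lin_maps V scalars"
  "\<zero>\<^bsub>dual V\<^esub> = (\<lambda>x\<in>carrier V. 0)"
  "f \<oplus>\<^bsub>dual V\<^esub> h = (\<lambda>x\<in>carrier V. f x + h x)"
  "c \<odot>\<^bsub>dual V\<^esub> f = (\<lambda>x\<in>carrier V. c * f x)"
  by (simp_all add: dual_def)

lemma complex_space_dual: "complex_space V \<Longrightarrow> complex_space (dual V)"
  unfolding dual_def by (intro complex_space_hom_space complex_space_scalars)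

lemma dual_end_simps [simp]:
  "carrier (dual_end W) = lin_maps (dual W) (dual W)"
  "\<zero>\<^bsub>dual_end W\<^esub> = (\<lambda>x\<in>lin_maps W scalars. \<lambda>w\<in>carrier W. 0)"
  "f \<oplus>\<^bsub>dual_end W\<^esub> h = (\<lambda>x\<in>lin_maps W scalars. \<lambda>w\<in>carrier W. f x w + h x w)"
  "c \<odot>\<^bsub>dual_end W\<^esub> f = (\<lambda>x\<in>lin_maps W scalars. \<lambda>w\<in>carrier W. c * f x w)"
  by (simp_all add: dual_end_def)

lemma complex_space_dual_end:
  "complex_space (W :: ('g, 'w) rep) \<Longrightarrow> complex_space (dual_end W)"
  unfolding dual_end_def by (intro complex_space_hom_space complex_space_dual)

section \<open>Functionals and dual frames\<close>

context complex_space begin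

abbreviation functionals where "functionals \<equiv> lin_maps V scalars"

lemma functional_simps:
  assumes "l \<in> functionals"
  shows functional_add: "x \<in> carrier V \<Longrightarrow> y \<in> carrier V \<Longrightarrow> l (x \<oplus> y) = l x + l y"
    and functional_smult: "x \<in> carrier V \<Longrightarrow> l (c \<odot> x) = c * l x"
    and functional_zero: "l \<zero> = 0"
  using lin_mapsD[OF assms] lin_maps_zero[OF assms] complex_space_axioms complex_space_scalars by auto

text \<open>Subtracting a projection onto \<open>Z\<close> kills \<open>Z\<close> and leaves a
  nonzero multiple-free trace \<open>d u\<close> of \<open>u\<close>; projecting further onto the
  line through \<open>d u\<close> gives a well-defined coefficient, and this coefficient is the
  functional.\<close>

lemma functional_separates_submodule:
  assumes Z: "submodule Z complex_ring V" and u: "u \<in> carrier V" "u \<notin> Z"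
  obtains l where "l \<in> functionals" "\<And>z. z \<in> Z \<Longrightarrow> l z = 0" "l u = 1"
proof -
  obtain P where P: "P \<in> lin_maps V V" "\<And>v. v \<in> carrier V \<Longrightarrow> P v \<in> Z" "\<And>z. z \<in> Z \<Longrightarrow> P z = z"
    using linear_projection_exists[OF Z] by blast
  have Zc: "\<And>z. z \<in> Z \<Longrightarrow> z \<in> carrier V" using Z unfolding submodule_iff by blast
  define d where "d v = v \<oplus> (- 1) \<odot> P v" for v
  have d: "d v \<in> carrier V" if "v \<in> carrier V" for v using that P(2) Zc by (simp add: d_def)
  have dz: "d z = \<zero>" if "z \<in> Z" for z using that P(3) Zc eq_iff_diff[of z z] by (simp add: d_def)
  have da: "d (x \<oplus> y) = d x \<oplus> d y" if "x \<in> carrier V" "y \<in> carrier V" for x y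
    using that P(2) Zc lin_maps_add[OF P(1)] by (simp add: d_def smult_add_right M.a_ac)
  have ds: "d (c \<odot> x) = c \<odot> d x" if "x \<in> carrier V" for x c
    using that P(2) Zc lin_maps_smult[OF P(1)] by (simp add: d_def smult_add_right smult_smult)
  have du: "d u \<noteq> \<zero>" using u P(2)[OF u(1)] Zc eq_iff_diff[of u "P u"] by (auto simp: d_def)
  let ?L = "range (\<lambda>c. c \<odot> d u)"
  have L: "submodule ?L complex_ring V"
    unfolding submodule_iff
  proof (intro conjI ballI allI)
    show "?L \<subseteq> carrier V" using d[OF u(1)] by blast
    show "\<zero> \<in> ?L" using smult_zero_left[OF d[OF u(1)]] by (metis rangeI)
    fix x assume "x \<in> ?L" then obtain a where x: "x = a \<odot> d u" by blast
    {
      fix y assume "y \<in> ?L" then obtain b where y: "y = b \<odot> d u" by blast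
      show "x \<oplus> y \<in> ?L" using smult_add_left[OF d[OF u(1)], of a b] unfolding x y by (metis rangeI)
    next
      fix c show "c \<odot> x \<in> ?L" using smult_smult[OF d[OF u(1)], of c a] unfolding x by (metis rangeI)
    }
  qed
  obtain Q where Q: "Q \<in> lin_maps V V" "\<And>v. v \<in> carrier V \<Longrightarrow> Q v \<in> ?L" "\<And>z. z \<in> ?L \<Longrightarrow> Q z = z"
    using linear_projection_exists[OF L] by blast
  have inj: "a = b" if "a \<odot> d u = b \<odot> d u" for a b
  proof (rule ccontr)
    assume "a \<noteq> b"
    have "(a - b) \<odot> d u = a \<odot> d u \<oplus> (- 1) \<odot> (b \<odot> d u)"
      using smult_add_left[of "d u" a "- b"] d[OF u(1)] by (simp add: smult_smult)
    also have "\<dots> = \<zero>" using that eq_iff_diff[of "a \<odot> d u" "b \<odot> d u"] d[OF u(1)] by simp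
    finally have "inverse (a - b) \<odot> ((a - b) \<odot> d u) = \<zero>" by simp
    then show False using \<open>a \<noteq> b\<close> du d[OF u(1)] by (simp add: smult_smult)
  qed
  define l where "l = (\<lambda>v\<in>carrier V. THE c. Q (d v) = c \<odot> d u)"
  have leq: "l v = c" if "v \<in> carrier V" "Q (d v) = c \<odot> d u" for v c
    using that inj by (auto simp: l_def)
  have lc: "Q (d v) = l v \<odot> d u" if v: "v \<in> carrier V" for v
    using Q(2)[OF d[OF v]] leq[OF v] by auto
  have "l \<in> functionals"
  proof (rule lin_mapsI)
    fix x assume x: "x \<in> carrier V"
    {
      fix y assume y: "y \<in> carrier V"
      have "Q (d (x \<oplus> y)) = (l x + l y) \<odot> d u"
        using x y d u by (simp add: da lin_maps_add[OF Q(1)] smult_add_left lc)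
      then show "l (x \<oplus> y) = l x \<oplus>\<^bsub>scalars\<^esub> l y" using leq x y by simp
    next
      fix c
      have "Q (d (c \<odot> x)) = (c * l x) \<odot> d u"
        using x d u by (simp add: ds lin_maps_smult[OF Q(1)] smult_smult lc)
      then show "l (c \<odot> x) = c \<odot>\<^bsub>scalars\<^esub> l x" using leq x by simp
    }
  qed (simp_all add: l_def)
  moreover have "l z = 0" if z: "z \<in> Z" for z
  proof -
    have "Q (d z) = 0 \<odot> d u"
      using dz[OF z] d[OF u(1)] lin_maps_zero[OF Q(1) complex_space_axioms complex_space_axioms] by simp
    then show ?thesis using leq Zc z by blast
  qed
  moreover have "l u = 1"
  proof -
    have "Q (d u) = 1 \<odot> d u" using d[OF u(1)] Q(3)[of "1 \<odot> d u"] rangeI[of "\<lambda>c. c \<odot> d u" 1] by simp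
    then show ?thesis using leq u by blast
  qed
  ultimately show thesis using that by blast
qed

lemma functionals_eqI:
  assumes "x \<in> carrier V" "y \<in> carrier V" "\<And>l. l \<in> functionals \<Longrightarrow> l x = l y"
  shows "x = y"
proof (rule ccontr)
  assume "x \<noteq> y"
  then have "x \<oplus> (- 1) \<odot> y \<notin> {\<zero>}" using eq_iff_diff[of x y] assms by simp
  moreover have "submodule {\<zero>} complex_ring V" by (simp add: submodule_iff)
  ultimately obtain l where l: "l \<in> functionals" "l (x \<oplus> (- 1) \<odot> y) = 1"
    using functional_separates_submodule[of "{\<zero>}" "x \<oplus> (- 1) \<odot> y"] assms by (metis add_mem smult_mem)
  then show False using assms(1,2) assms(3)[OF l(1)] by (simp add: functional_simps)
qed

lemma functional_finsum:
  assumes l: "l \<in> functionals" and "finite A" "\<And>i. i \<in> A \<Longrightarrow> f i \<in> carrier V"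
  shows "l (finsum V f A) = (\<Sum>i\<in>A. l (f i))"
  using assms(2,3)
proof (induction A rule: finite_induct)
  case empty then show ?case using l by (simp add: functional_simps)
next
  case (insert a A)
  then have "f \<in> A \<rightarrow> carrier V" "f a \<in> carrier V" by auto
  then show ?case using insert l by (simp add: functional_simps M.finsum_insert)
qed

lemma finsum_mem_submodule:
  assumes "submodule U complex_ring V" "finite A" "\<And>i. i \<in> A \<Longrightarrow> f i \<in> U"
  shows "finsum V f A \<in> U"
  using assms(2,3)
proof (induction A rule: finite_induct)
  case empty then show ?case using assms(1) by (simp add: submodule_iff)
next
  case (insert a A)
  have U: "U \<subseteq> carrier V" "\<And>x y. x \<in> U \<Longrightarrow> y \<in> U \<Longrightarrow> x \<oplus> y \<in> U" using assms(1) by (auto simp: submodule_iff)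
  have "f \<in> A \<rightarrow> carrier V" "f a \<in> carrier V" using insert U(1) by auto
  then show ?case using insert U by (simp add: M.finsum_insert)
qed

text \<open>A generating set of least size has no member in the span of the others, so each
  \<open>b\<close> has a functional with value 1 there and 0 on the rest. The expansion of
  \<open>w\<close> is stated after applying a functional \<open>l\<close>, the form in which it
  enters integrals.\<close>

lemma dual_frame_exists:
  assumes "fin_dim_subspace V (carrier V)"
  obtains B E where "finite B" "B \<subseteq> carrier V" "\<And>b. b \<in> B \<Longrightarrow> E b \<in> functionals"
    "\<And>l w. l \<in> functionals \<Longrightarrow> w \<in> carrier V \<Longrightarrow> l w = (\<Sum>b\<in>B. E b w * l b)"
proof -
  let ?S = "\<lambda>B. finite B \<and> B \<subseteq> carrier V \<and> carrier V = lin_span V B"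
  obtain B0 where "?S B0" using assms unfolding fin_dim_subspace_def by blast
  then obtain B where B: "?S B" and min: "\<And>B'. ?S B' \<Longrightarrow> card B \<le> card B'"
    using ex_has_least_nat[of ?S B0 card] by blast
  have Bc: "b \<in> carrier V" if "b \<in> B" for b using B that by blast
  have "\<exists>l. l \<in> functionals \<and> (\<forall>z\<in>lin_span V (B - {b}). l z = 0) \<and> l b = 1" if b: "b \<in> B" for b
  proof -
    have sub: "B - {b} \<subseteq> carrier V" using B by blast
    have "b \<notin> lin_span V (B - {b})"
    proof
      assume "b \<in> lin_span V (B - {b})"
      then have "B \<subseteq> lin_span V (B - {b})" using lin_span_superset[of "B - {b}"] by blast
      then have "carrier V \<subseteq> lin_span V (B - {b})"
        using lin_span_least[OF lin_span_submodule[OF sub], of B] B by blast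
      moreover have "lin_span V (B - {b}) \<subseteq> carrier V"
        using lin_span_submodule[OF sub] unfolding submodule_iff by blast
      ultimately have "carrier V = lin_span V (B - {b})" by (rule subset_antisym)
      then have "card B \<le> card (B - {b})" using min[of "B - {b}"] B sub by blast
      then show False using B b by (meson card_Diff1_less leD)
    qed
    then show ?thesis
      by (rule functional_separates_submodule[OF lin_span_submodule[OF sub] Bc[OF b]]) (intro exI conjI ballI)
  qed
  then have "\<exists>E. \<forall>b\<in>B. E b \<in> functionals \<and> (\<forall>z\<in>lin_span V (B - {b}). E b z = 0) \<and> E b b = 1"
    by (intro bchoice ballI)
  then obtain E where E: "\<forall>b\<in>B. E b \<in> functionals \<and> (\<forall>z\<in>lin_span V (B - {b}). E b z = 0) \<and> E b b = 1"
    by (rule exE)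
  have E': "E b \<in> functionals" "E b b = 1" "z \<in> lin_span V (B - {b}) \<Longrightarrow> E b z = 0" if "b \<in> B" for b z
    using bspec[OF E that] by simp_all
  have dual: "E b c = (if b = c then 1 else 0)" if "b \<in> B" "c \<in> B" for b c
  proof (cases "b = c")
    case True then show ?thesis using that E' by simp
  next
    case False
    then have "c \<in> lin_span V (B - {b})" using that lin_span_superset[of "B - {b}"] by auto
    then show ?thesis using that E' False by simp
  qed
  have "l w = (\<Sum>b\<in>B. E b w * l b)" if l: "l \<in> functionals" and w: "w \<in> carrier V" for l w
  proof -
    let ?U = "{w \<in> carrier V. l w = (\<Sum>b\<in>B. E b w * l b)}"
    have "submodule ?U complex_ring V"
      unfolding submodule_iff
    proof (intro conjI ballI allI)
      show "\<zero> \<in> ?U" using l by (simp add: functional_simps E')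
      fix x assume x: "x \<in> ?U"
      {
        fix y assume "y \<in> ?U"
        then show "x \<oplus> y \<in> ?U" using x l
          by (simp add: functional_simps E' algebra_simps flip: sum.distrib cong: sum.cong)
      next
        fix c show "c \<odot> x \<in> ?U" using x l
          by (simp add: functional_simps E' mult.assoc sum_distrib_left cong: sum.cong)
      }
    qed blast
    moreover have "B \<subseteq> ?U"
    proof
      fix c assume c: "c \<in> B"
      have "(\<Sum>b\<in>B. E b c * l b) = (\<Sum>b\<in>B. if b = c then l b else 0)"
        by (rule sum.cong) (auto simp: dual c)
      also have "\<dots> = l c" using B c by (subst sum.delta) auto
      finally show "c \<in> ?U" using Bc[OF c] by simp
    qed
    ultimately have "lin_span V B \<subseteq> ?U" by (rule lin_span_least)
    then show ?thesis using B w by blast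
  qed
  then show thesis using B E'(1) by (intro that) auto
qed

end

section \<open>Integration of compactly supported locally constant functions\<close>

locale haar_group = ell_c_group G T
  for G :: "'g monoid" (structure) and T :: "'g topology" +
  fixes \<mu> :: "'g measure"
  assumes haar: "haar_measure G T \<mu>"
begin

abbreviation "cpt_open \<equiv> compact_open_subgroup G T"

lemma space_haar [simp]: "space \<mu> = carrier G"
  using haar unfolding haar_measure_def by blast

lemma openin_carrier: "openin T U \<Longrightarrow> U \<subseteq> carrier G"
  using openin_subset[of T U] topspace_eq by simp

lemma cpt_openD:
  assumes "cpt_open L"
  shows cpt_open_subgroup: "subgroup L G" and cpt_open_compactin: "compactin T L" and cpt_open_openin: "openin T L"
    and cpt_open_closedin: "closedin T L" and cpt_open_subset: "L \<subseteq> carrier G" and cpt_open_one: "\<one> \<in> L"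
    and cpt_open_mult: "x \<in> L \<Longrightarrow> y \<in> L \<Longrightarrow> x \<otimes> y \<in> L" and cpt_open_inv: "x \<in> L \<Longrightarrow> inv x \<in> L"
  using assms compactin_imp_closedin[OF hausdorff, of L] subgroup.subset subgroup.one_closed
    subgroup.m_closed subgroup.m_inv_closed
  unfolding compact_open_subgroup_def by metis+

lemma cpt_open_carrier: "cpt_open L \<Longrightarrow> x \<in> L \<Longrightarrow> x \<in> carrier G"
  using cpt_open_subset by blast

lemma cpt_open_mult_cancel_left:
  assumes "cpt_open L" "x \<in> L" "y \<in> carrier G" shows "x \<otimes> y \<in> L \<longleftrightarrow> y \<in> L"
proof -
  have "inv x \<otimes> (x \<otimes> y) = y" using assms cpt_open_carrier by (simp add: m_assoc[symmetric])
  then show ?thesis using assms by (metis cpt_open_mult cpt_open_inv)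
qed

lemma cpt_open_mult_cancel_right:
  assumes "cpt_open L" "x \<in> L" "y \<in> carrier G" shows "y \<otimes> x \<in> L \<longleftrightarrow> y \<in> L"
proof -
  have "(y \<otimes> x) \<otimes> inv x = y" using assms cpt_open_carrier by (simp add: m_assoc)
  then show ?thesis using assms by (metis cpt_open_mult cpt_open_inv)
qed

lemma cpt_open_inv_iff: "cpt_open L \<Longrightarrow> x \<in> carrier G \<Longrightarrow> inv x \<in> L \<longleftrightarrow> x \<in> L"
  by (metis cpt_open_inv inv_inv)

lemma continuous_const: "g \<in> carrier G \<Longrightarrow> continuous_map T T (\<lambda>x. g)"
  by (simp add: topspace_eq)

lemma continuous_mult':
  assumes "continuous_map T T p" "continuous_map T T q"
  shows "continuous_map T T (\<lambda>x. p x \<otimes> q x)"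
  using continuous_map_compose[OF continuous_map_pairedI[OF assms] continuous_mult]
  by (simp add: o_def)

lemma continuous_inv': "continuous_map T T p \<Longrightarrow> continuous_map T T (\<lambda>x. inv (p x))"
  using continuous_map_compose[OF _ continuous_inv] by (simp add: o_def)

lemma continuous_closed: "continuous_map T T p \<Longrightarrow> x \<in> carrier G \<Longrightarrow> p x \<in> carrier G"
  using continuous_map_image_subset_topspace[of T T p] topspace_eq by blast

lemma openin_preimage:
  "continuous_map T T p \<Longrightarrow> openin T U \<Longrightarrow> openin T {x \<in> carrier G. p x \<in> U}"
  using openin_continuous_map_preimage[of T T p U] topspace_eq by simp

lemmas continuous_rules = continuous_const continuous_mult' continuous_inv' continuous_map_id[unfolded id_def]

lemma l_coset_iff: "g \<in> carrier G \<Longrightarrow> U \<subseteq> carrier G \<Longrightarrow> x \<in> g <# U \<longleftrightarrow> x \<in> carrier G \<and> inv g \<otimes> x \<in> U"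
proof
  assume g: "g \<in> carrier G" "U \<subseteq> carrier G"
  {
    assume "x \<in> g <# U"
    then obtain u where "u \<in> U" "x = g \<otimes> u" by (auto simp: l_coset_def)
    then show "x \<in> carrier G \<and> inv g \<otimes> x \<in> U" using g by (auto simp: m_assoc[symmetric])
  next
    assume x: "x \<in> carrier G \<and> inv g \<otimes> x \<in> U"
    have "x = g \<otimes> (inv g \<otimes> x)" using x g by (simp add: m_assoc[symmetric])
    then show "x \<in> g <# U" using x by (auto simp: l_coset_def)
  }
qed

lemma l_coset_eq: "g \<in> carrier G \<Longrightarrow> U \<subseteq> carrier G \<Longrightarrow> g <# U = {x \<in> carrier G. inv g \<otimes> x \<in> U}"
  using l_coset_iff by blast

lemma openin_l_coset: "g \<in> carrier G \<Longrightarrow> openin T U \<Longrightarrow> openin T (g <# U)"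
  by (auto simp: l_coset_eq openin_carrier intro!: openin_preimage continuous_rules)

lemma mem_l_coset: "g \<in> carrier G \<Longrightarrow> \<one> \<in> U \<Longrightarrow> g \<in> g <# U"
  by (force simp: l_coset_def)

text \<open>Compactness reduces to finitely many compact open subgroups, and directedness to one.
  Supports can therefore always be bounded by subgroups, so that translating or convolving does not
  lead out of a large enough one.\<close>

lemma cpt_open_covers_compact:
  assumes K: "cpt_open K" and C: "compactin T C"
  obtains L where "cpt_open L" "K \<subseteq> L" "C \<subseteq> L"
proof -
  let ?\<U> = "Collect cpt_open"
  have "C \<subseteq> carrier G" using C compactin_subset_topspace topspace_eq by blast
  then have "C \<subseteq> \<Union> ?\<U>" using covered by blast
  moreover have "\<forall>U\<in>?\<U>. openin T U" using cpt_open_openin by blast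
  ultimately obtain F where F: "finite F" "F \<subseteq> ?\<U>" "C \<subseteq> \<Union> F" using C unfolding compactin_def by meson
  have "\<exists>L. cpt_open L \<and> K \<subseteq> L \<and> \<Union> F \<subseteq> L" using F(1,2)
  proof (induction F rule: finite_induct)
    case empty then show ?case using K by auto
  next
    case (insert U F)
    then obtain L where L: "cpt_open L" "K \<subseteq> L" "\<Union> F \<subseteq> L" "cpt_open U" by auto
    then obtain J where "cpt_open J" "U \<subseteq> J" "L \<subseteq> J" using directed[of U L] by blast
    then show ?case using L by (intro exI[of _ J]) auto
  qed
  then obtain L where "cpt_open L" "K \<subseteq> L" "\<Union> F \<subseteq> L" by auto
  then show thesis using F(3) by (intro that[of L]) auto
qed

lemma cpt_open_covers_mem:
  assumes "cpt_open K" "x \<in> carrier G"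
  obtains L where "cpt_open L" "K \<subseteq> L" "x \<in> L"
  using cpt_open_covers_compact[of K "{x}"] assms topspace_eq by auto

lemma cpt_open_covers_two:
  assumes "cpt_open K" "cpt_open L"
  obtains J where "cpt_open J" "K \<subseteq> J" "L \<subseteq> J"
  using directed[OF assms] by blast

lemma sets_haar: "sets \<mu> = sigma_sets (carrier G) {U. openin T U}"
  using haar unfolding haar_measure_def by blast

lemma openin_sets: "openin T U \<Longrightarrow> U \<in> sets \<mu>"
  unfolding sets_haar by blast

lemma measurable_translation: "g \<in> carrier G \<Longrightarrow> (\<lambda>x. g \<otimes> x) \<in> measurable \<mu> \<mu>"
proof (rule measurable_sigma_sets[OF sets_haar])
  assume g: "g \<in> carrier G"
  show "{U. openin T U} \<subseteq> Pow (carrier G)" using openin_carrier by blast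
  show "(\<lambda>x. g \<otimes> x) \<in> space \<mu> \<rightarrow> carrier G" using g by auto
  fix U assume "U \<in> {U. openin T U}"
  then have "openin T {x \<in> carrier G. g \<otimes> x \<in> U}" using g by (auto intro!: openin_preimage continuous_rules)
  moreover have "(\<lambda>x. g \<otimes> x) -` U \<inter> space \<mu> = {x \<in> carrier G. g \<otimes> x \<in> U}" by auto
  ultimately show "(\<lambda>x. g \<otimes> x) -` U \<inter> space \<mu> \<in> sets \<mu>" using openin_sets by simp
qed

text \<open>Left invariance of the volume of sets, put as invariance of the measure, so that
  integrals of functions may be translated.\<close>

lemma distr_translation: "g \<in> carrier G \<Longrightarrow> distr \<mu> \<mu> (\<lambda>x. g \<otimes> x) = \<mu>"
proof (rule measure_eqI)
  assume g: "g \<in> carrier G"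
  fix A assume "A \<in> sets (distr \<mu> \<mu> (\<lambda>x. g \<otimes> x))"
  then have A: "A \<in> sets \<mu>" by simp
  then have Ac: "A \<subseteq> carrier G" using sets.sets_into_space by fastforce
  have "(\<lambda>x. g \<otimes> x) -` A \<inter> space \<mu> = inv g <# A" using g Ac by (auto simp: l_coset_eq)
  then have "emeasure (distr \<mu> \<mu> (\<lambda>x. g \<otimes> x)) A = emeasure \<mu> (inv g <# A)"
    using emeasure_distr[OF measurable_translation[OF g] A] by simp
  also have "\<dots> = emeasure \<mu> A" using haar g A unfolding haar_measure_def by blast
  finally show "emeasure (distr \<mu> \<mu> (\<lambda>x. g \<otimes> x)) A = emeasure \<mu> A" .
qed simp

lemma emeasure_compact_finite: "compactin T C \<Longrightarrow> emeasure \<mu> C < \<infinity>"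
  using haar unfolding haar_measure_def by blast

lemma measure_l_coset:
  assumes "g \<in> carrier G" "U \<in> sets \<mu>" shows "measure \<mu> (g <# U) = measure \<mu> U"
  using haar assms unfolding haar_measure_def measure_def by metis

text \<open>If \<open>K\<close> had volume zero, so would its cosets, hence every compact set, which
  finitely many of them cover, and by inner regularity the whole group.\<close>

lemma measure_cpt_open_pos:
  assumes K: "cpt_open K" shows "0 < measure \<mu> K"
proof (rule ccontr)
  assume "\<not> ?thesis"
  then have "measure \<mu> K = 0" using measure_nonneg[of \<mu> K] by linarith
  then have K0: "emeasure \<mu> K = 0"
    using emeasure_compact_finite[OF cpt_open_compactin[OF K]] by (simp add: emeasure_eq_ennreal_measure)
  have coset0: "emeasure \<mu> (g <# K) = 0" if "g \<in> carrier G" for g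
    using haar that K0 openin_sets[OF cpt_open_openin[OF K]] unfolding haar_measure_def by metis
  have C0: "emeasure \<mu> C = 0" if C: "compactin T C" for C
  proof -
    have sub: "C \<subseteq> carrier G" using C compactin_subset_topspace topspace_eq by blast
    let ?\<U> = "(\<lambda>g. g <# K) ` carrier G"
    have "C \<subseteq> \<Union> ?\<U>" using sub mem_l_coset[OF _ cpt_open_one[OF K]] by blast
    moreover have op: "\<forall>U\<in>?\<U>. openin T U" using openin_l_coset cpt_open_openin[OF K] by blast
    ultimately obtain F where F: "finite F" "F \<subseteq> ?\<U>" "C \<subseteq> \<Union> F"
      using C unfolding compactin_def by meson
    have "\<Union> F \<in> sets \<mu>" using F op openin_sets by blast
    then have "emeasure \<mu> C \<le> emeasure \<mu> (\<Union> F)" using F(3) by (intro emeasure_mono)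
    also have "\<dots> = emeasure \<mu> (\<Union>U\<in>F. U)" by simp
    also have "\<dots> \<le> (\<Sum>U\<in>F. emeasure \<mu> U)"
      using F(1,2) op openin_sets by (intro emeasure_subadditive_finite) auto
    also have "\<dots> = 0" using F(2) coset0 by (intro sum.neutral) auto
    finally show ?thesis by simp
  qed
  have "openin T (carrier G)" using openin_topspace[of T] topspace_eq by simp
  then have "emeasure \<mu> (carrier G) = (SUP C\<in>{C. compactin T C \<and> C \<subseteq> carrier G}. emeasure \<mu> C)"
    using haar unfolding haar_measure_def by blast
  also have "\<dots> = 0" using C0 by (auto simp: SUP_eq_iff intro!: SUP_eq_const)
  finally have "emeasure \<mu> (space \<mu>) = 0" by simp
  then show False using haar unfolding haar_measure_def by blast
qed

section \<open>Locally constant functions with compact support\<close>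

lemma locally_constantI:
  "(\<And>x. x \<in> carrier G \<Longrightarrow> \<exists>U. openin T U \<and> x \<in> U \<and> (\<forall>y\<in>U. f y = f x)) \<Longrightarrow> locally_constant T f"
  unfolding locally_constant_def topspace_eq by blast

lemma locally_constantD:
  assumes "locally_constant T f" "x \<in> carrier G"
  obtains U where "openin T U" "x \<in> U" "\<forall>y\<in>U. f y = f x"
  using assms unfolding locally_constant_def topspace_eq by blast

lemma locally_constant_const: "locally_constant T (\<lambda>x. c)"
  by (rule locally_constantI) (use openin_topspace[of T] topspace_eq in auto)

lemma locally_constant_comp2:
  assumes "locally_constant T f" "locally_constant T g"
  shows "locally_constant T (\<lambda>x. \<Phi> (f x) (g x))"
proof (rule locally_constantI)
  fix x assume x: "x \<in> carrier G"
  obtain U where U: "openin T U" "x \<in> U" "\<forall>y\<in>U. f y = f x" by (rule locally_constantD[OF assms(1) x])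
  obtain V where V: "openin T V" "x \<in> V" "\<forall>y\<in>V. g y = g x" by (rule locally_constantD[OF assms(2) x])
  show "\<exists>U. openin T U \<and> x \<in> U \<and> (\<forall>y\<in>U. \<Phi> (f y) (g y) = \<Phi> (f x) (g x))"
  proof (intro exI conjI ballI)
    show "openin T (U \<inter> V)" "x \<in> U \<inter> V" using U(1,2) V(1,2) by auto
    fix y assume "y \<in> U \<inter> V"
    then have "f y = f x" "g y = g x" using U(3) V(3) by blast+
    then show "\<Phi> (f y) (g y) = \<Phi> (f x) (g x)" by simp
  qed
qed

lemma locally_constant_comp: "locally_constant T f \<Longrightarrow> locally_constant T (\<lambda>x. \<Phi> (f x))"
  using locally_constant_comp2[of f f "\<lambda>a b. \<Phi> a"] by simp

lemma locally_constant_cong: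
  assumes "locally_constant T f" "\<And>x. x \<in> carrier G \<Longrightarrow> f x = g x"
  shows "locally_constant T g"
proof (rule locally_constantI)
  fix x assume x: "x \<in> carrier G"
  obtain U where U: "openin T U" "x \<in> U" "\<forall>y\<in>U. f y = f x" by (rule locally_constantD[OF assms(1) x])
  then show "\<exists>U. openin T U \<and> x \<in> U \<and> (\<forall>y\<in>U. g y = g x)"
  proof (intro exI conjI ballI)
    show "openin T U" "x \<in> U" by fact+
    fix y assume y: "y \<in> U"
    then have "y \<in> carrier G" using openin_carrier[OF U(1)] by blast
    then show "g y = g x" using U(3)[rule_format, OF y] assms(2)[OF x] assms(2)[of y] by simp
  qed
qed

lemma locally_constant_continuous:
  assumes "locally_constant T f" "continuous_map T T p"
  shows "locally_constant T (\<lambda>x. f (p x))"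
proof (rule locally_constantI)
  fix x assume x: "x \<in> carrier G"
  obtain U where U: "openin T U" "p x \<in> U" "\<forall>y\<in>U. f y = f (p x)"
    by (rule locally_constantD[OF assms(1) continuous_closed[OF assms(2) x]])
  then show "\<exists>U. openin T U \<and> x \<in> U \<and> (\<forall>y\<in>U. f (p y) = f (p x))"
  proof (intro exI conjI ballI)
    show "openin T {x \<in> carrier G. p x \<in> U}" "x \<in> {x \<in> carrier G. p x \<in> U}"
      using openin_preimage[OF assms(2) U(1)] x U(2) by simp_all
    fix y assume "y \<in> {x \<in> carrier G. p x \<in> U}"
    then show "f (p y) = f (p x)" using U(3)[rule_format, of "p y"] by simp
  qed
qed

text \<open>The coset \<open>x J\<close> is the required neighbourhood. With \<open>J\<close> the
  kernel of \<open>\<rho>\<close>, this is how Hecke functions and orbit maps are seen to be locally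
  constant.\<close>

lemma locally_constant_right_invariant:
  assumes J: "openin T J" "\<one> \<in> J" and f: "\<And>x j. x \<in> carrier G \<Longrightarrow> j \<in> J \<Longrightarrow> f (x \<otimes> j) = f x"
  shows "locally_constant T f"
proof (rule locally_constantI)
  fix x assume x: "x \<in> carrier G"
  show "\<exists>U. openin T U \<and> x \<in> U \<and> (\<forall>y\<in>U. f y = f x)"
  proof (intro exI conjI ballI)
    show "openin T (x <# J)" "x \<in> x <# J" using openin_l_coset[OF x J(1)] mem_l_coset[OF x J(2)] by simp_all
    fix y assume "y \<in> x <# J"
    then obtain j where "j \<in> J" "y = x \<otimes> j" by (auto simp: l_coset_def)
    then show "f y = f x" using f[OF x] by simp
  qed
qed

lemma locally_constant_mem_cpt_open: "cpt_open K \<Longrightarrow> locally_constant T (\<lambda>x. x \<in> K)"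
  by (rule locally_constant_right_invariant[of K]) (auto simp: cpt_open_openin cpt_open_one cpt_open_mult_cancel_right)

lemma openin_fiber:
  assumes "locally_constant T f" shows "openin T {x \<in> carrier G. P (f x)}"
  unfolding openin_subopen[of _ "{x \<in> carrier G. P (f x)}"]
proof
  fix x assume x: "x \<in> {x \<in> carrier G. P (f x)}"
  obtain U where U: "openin T U" "x \<in> U" "\<forall>y\<in>U. f y = f x"
    using locally_constantD[OF assms, of x] x by blast
  then show "\<exists>U. openin T U \<and> x \<in> U \<and> U \<subseteq> {x \<in> carrier G. P (f x)}"
  proof (intro exI conjI subsetI)
    show "openin T U" "x \<in> U" by fact+
    fix y assume y: "y \<in> U"
    then have "y \<in> carrier G" using openin_carrier[OF U(1)] by blast
    then show "y \<in> {x \<in> carrier G. P (f x)}" using U(3)[rule_format, OF y] x by simp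
  qed
qed

text \<open>The value \<open>z\<close> outside the support is an argument because the values may be
  numbers, vectors, endomorphisms or functions. The support is bounded by a compact open subgroup,
  which group operations on the variable can respect.\<close>

definition compactly_supported :: "'a \<Rightarrow> ('g \<Rightarrow> 'a) \<Rightarrow> bool" where
  "compactly_supported z f \<longleftrightarrow> locally_constant T f \<and> (\<exists>L. cpt_open L \<and> (\<forall>x\<in>carrier G - L. f x = z))"

lemma compactly_supportedI:
  "locally_constant T f \<Longrightarrow> cpt_open L \<Longrightarrow> (\<And>x. x \<in> carrier G \<Longrightarrow> x \<notin> L \<Longrightarrow> f x = z) \<Longrightarrow> compactly_supported z f"
  unfolding compactly_supported_def by blast

lemma compactly_supported_locally_constant: "compactly_supported z f \<Longrightarrow> locally_constant T f"
  unfolding compactly_supported_def by blast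

lemma compactly_supportedE:
  assumes "compactly_supported z f"
  obtains L where "cpt_open L" "\<forall>x\<in>carrier G - L. f x = z"
  using assms unfolding compactly_supported_def by blast

lemma compactly_supported_comp2:
  assumes "compactly_supported z f" "locally_constant T g" "\<And>x. x \<in> carrier G \<Longrightarrow> \<Phi> z (g x) = z'"
  shows "compactly_supported z' (\<lambda>x. \<Phi> (f x) (g x))"
  using assms(1,3) locally_constant_comp2[OF _ assms(2), of f \<Phi>] unfolding compactly_supported_def by auto

lemma compactly_supported_comp:
  "compactly_supported z f \<Longrightarrow> \<Phi> z = z' \<Longrightarrow> compactly_supported z' (\<lambda>x. \<Phi> (f x))"
  by (rule compactly_supported_comp2[of z f "\<lambda>_. undefined" "\<lambda>a b. \<Phi> a" z'])
    (simp_all add: locally_constant_const)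

lemma compactly_supported_cong:
  assumes "compactly_supported z f" "\<And>x. x \<in> carrier G \<Longrightarrow> f x = g x"
  shows "compactly_supported z g"
  using assms locally_constant_cong[of f g] unfolding compactly_supported_def by fastforce

lemma compactly_supported_translate:
  assumes "compactly_supported z f" "g \<in> carrier G"
  shows "compactly_supported z (\<lambda>x. f (g \<otimes> x))"
proof -
  obtain L where L: "cpt_open L" "\<forall>x\<in>carrier G - L. f x = z" by (rule compactly_supportedE[OF assms(1)])
  obtain J where J: "cpt_open J" "L \<subseteq> J" "g \<in> J" using cpt_open_covers_mem[OF L(1) assms(2)] by blast
  show ?thesis
  proof (rule compactly_supportedI[OF _ J(1)])
    show "locally_constant T (\<lambda>x. f (g \<otimes> x))"
      by (intro locally_constant_continuous[OF compactly_supported_locally_constant[OF assms(1)]]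
        continuous_rules assms(2))
    fix x assume x: "x \<in> carrier G" "x \<notin> J"
    then have "g \<otimes> x \<in> carrier G - L" using J(2) assms(2) cpt_open_mult_cancel_left[OF J(1,3) x(1)] by auto
    then show "f (g \<otimes> x) = z" using L(2) by blast
  qed
qed

text \<open>The fibres of a locally constant function are open, so finitely many of them cover
  \<open>L\<close>; the only possible further value is \<open>z\<close>.\<close>

lemma compactly_supported_finite_image:
  assumes "compactly_supported z f" shows "finite (f ` carrier G)"
proof -
  obtain L where L: "cpt_open L" "\<forall>x\<in>carrier G - L. f x = z" by (rule compactly_supportedE[OF assms])
  note lc = compactly_supported_locally_constant[OF assms]
  let ?\<U> = "(\<lambda>v. {x \<in> carrier G. f x = v}) ` UNIV"
  have op: "openin T {x \<in> carrier G. f x = v}" for v using openin_fiber[OF lc, of "\<lambda>u. u = v"] .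
  have "L \<subseteq> \<Union> ?\<U>" using cpt_open_subset[OF L(1)] by auto
  moreover have "\<forall>U\<in>?\<U>. openin T U" using op by simp
  ultimately obtain F where F: "finite F" "F \<subseteq> ?\<U>" "L \<subseteq> \<Union> F"
    using cpt_open_compactin[OF L(1)] unfolding compactin_def by meson
  obtain A where A: "finite A" "F = (\<lambda>v. {x \<in> carrier G. f x = v}) ` A"
    using finite_subset_image[OF F(1,2)] by blast
  have "f ` carrier G \<subseteq> insert z A" using L(2) F(3) A(2) by blast
  then show ?thesis using A(1) by (meson finite.insertI finite_subset)
qed

text \<open>Stated for any \<open>\<xi>\<close> vanishing at \<open>z\<close>, since it is applied
  to linear functionals, to evaluation at a point and to integration of a function-valued
  \<open>f\<close>.\<close>

lemma has_integral_compactly_supported: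
  fixes \<xi> :: "'a \<Rightarrow> complex"
  assumes f: "compactly_supported z f" and z: "\<xi> z = 0"
  shows "has_bochner_integral \<mu> (\<lambda>x. \<xi> (f x))
    (\<Sum>v\<in>f ` carrier G - {z}. complex_of_real (measure \<mu> {x \<in> carrier G. f x = v}) * \<xi> v)"
proof -
  let ?A = "\<lambda>v. {x \<in> carrier G. f x = v}" and ?I = "f ` carrier G - {z}"
  note fin = compactly_supported_finite_image[OF f]
  have op: "openin T (?A v)" for v
    using openin_fiber[OF compactly_supported_locally_constant[OF f], of "\<lambda>u. u = v"] .
  obtain L where L: "cpt_open L" "\<forall>x\<in>carrier G - L. f x = z" by (rule compactly_supportedE[OF f])
  have "has_bochner_integral \<mu> (\<lambda>x. \<Sum>v\<in>?I. indicator (?A v) x *\<^sub>R \<xi> v) (\<Sum>v\<in>?I. measure \<mu> (?A v) *\<^sub>R \<xi> v)"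
  proof (intro has_bochner_integral_sum has_bochner_integral_indicator)
    fix v assume v: "v \<in> ?I"
    show "?A v \<in> sets \<mu>" using openin_sets[OF op] .
    have "?A v \<subseteq> L" using L(2) v by blast
    then have "emeasure \<mu> (?A v) \<le> emeasure \<mu> L" using openin_sets[OF cpt_open_openin[OF L(1)]] by (rule emeasure_mono)
    then show "emeasure \<mu> (?A v) < \<infinity>"
      using emeasure_compact_finite[OF cpt_open_compactin[OF L(1)]] by (rule le_less_trans)
  qed
  moreover have "(\<Sum>v\<in>?I. indicator (?A v) x *\<^sub>R \<xi> v) = \<xi> (f x)" if x: "x \<in> space \<mu>" for x
  proof -
    have "(\<Sum>v\<in>?I. indicator (?A v) x *\<^sub>R \<xi> v) = (\<Sum>v\<in>?I. if v = f x then \<xi> v else 0)"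
      using x by (intro sum.cong) (auto simp: indicator_def)
    also have "\<dots> = \<xi> (f x)" using fin x z by (cases "f x = z") (auto simp: sum.delta')
    finally show ?thesis .
  qed
  moreover have "(\<Sum>v\<in>?I. measure \<mu> (?A v) *\<^sub>R \<xi> v) = (\<Sum>v\<in>?I. complex_of_real (measure \<mu> (?A v)) * \<xi> v)"
    by (simp add: scaleR_conv_of_real)
  ultimately show ?thesis by (subst has_bochner_integral_cong[symmetric, OF refl _ refl]) auto
qed

lemmas integral_compactly_supported = has_bochner_integral_integral_eq[OF has_integral_compactly_supported]

lemma integrable_compactly_supported:
  fixes f :: "'g \<Rightarrow> complex"
  assumes "compactly_supported 0 f" shows "integrable \<mu> f"
  using has_integral_compactly_supported[OF assms, of "\<lambda>x. x"] by (auto intro: integrable.intros)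

lemma integral_translate:
  fixes f :: "'g \<Rightarrow> complex"
  assumes "compactly_supported 0 f" "g \<in> carrier G"
  shows "(\<integral>x. f (g \<otimes> x) \<partial>\<mu>) = (\<integral>x. f x \<partial>\<mu>)"
  using integral_distr[OF measurable_translation[OF assms(2)], of f]
    borel_measurable_integrable[OF integrable_compactly_supported[OF assms(1)]]
  by (simp add: distr_translation[OF assms(2)])

lemma integral_cong_carrier:
  fixes f g :: "'g \<Rightarrow> complex"
  shows "(\<And>x. x \<in> carrier G \<Longrightarrow> f x = g x) \<Longrightarrow> (\<integral>x. f x \<partial>\<mu>) = (\<integral>x. g x \<partial>\<mu>)"
  by (rule Bochner_Integration.integral_cong) auto

text \<open>The integral is a finite sum of multiples of values of \<open>F\<close>. This is what
  keeps an averaged projection inside the subrepresentation onto which it projects.\<close>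

lemma lc_integral_mem_submodule:
  assumes V: "complex_space V" and U: "submodule U complex_ring V"
    and F: "compactly_supported \<zero>\<^bsub>V\<^esub> F" "\<And>x. x \<in> carrier G \<Longrightarrow> F x \<in> U"
  shows "lc_integral \<mu> V F \<in> U"
proof -
  interpret V: complex_space V by fact
  show ?thesis
    unfolding lc_integral_def
    using F(2) compactly_supported_finite_image[OF F(1)] U[unfolded V.submodule_iff]
    by (intro V.finsum_mem_submodule[OF U]) auto
qed

lemma lc_integral_mem:
  assumes V: "complex_space V"
    and F: "compactly_supported \<zero>\<^bsub>V\<^esub> F" "\<And>x. x \<in> carrier G \<Longrightarrow> F x \<in> carrier V"
  shows "lc_integral \<mu> V F \<in> carrier V"
proof -
  interpret V: complex_space V by fact
  show ?thesis by (rule lc_integral_mem_submodule[OF V V.carrier_is_submodule F])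
qed

text \<open>This determines the integral, as functionals separate points; all identities between
  integrals of vector-valued functions are derived from it.\<close>

lemma functional_lc_integral:
  assumes V: "complex_space V"
    and F: "compactly_supported \<zero>\<^bsub>V\<^esub> F" "\<And>x. x \<in> carrier G \<Longrightarrow> F x \<in> carrier V"
    and \<xi>: "\<xi> \<in> lin_maps V scalars"
  shows "\<xi> (lc_integral \<mu> V F) = (\<integral>x. \<xi> (F x) \<partial>\<mu>)"
proof -
  interpret V: complex_space V by fact
  have mem: "v \<in> carrier V" if "v \<in> F ` carrier G - {\<zero>\<^bsub>V\<^esub>}" for v using that F(2) by blast
  have "\<xi> (lc_integral \<mu> V F) =
      (\<Sum>v\<in>F ` carrier G - {\<zero>\<^bsub>V\<^esub>}. \<xi> (complex_of_real (measure \<mu> {x \<in> carrier G. F x = v}) \<odot>\<^bsub>V\<^esub> v))"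
    unfolding lc_integral_def space_haar
    using compactly_supported_finite_image[OF F(1)] mem by (intro V.functional_finsum[OF \<xi>]) auto
  also have "\<dots> = (\<Sum>v\<in>F ` carrier G - {\<zero>\<^bsub>V\<^esub>}. complex_of_real (measure \<mu> {x \<in> carrier G. F x = v}) * \<xi> v)"
    using mem by (intro sum.cong) (auto simp: V.functional_simps[OF \<xi>])
  also have "\<dots> = (\<integral>x. \<xi> (F x) \<partial>\<mu>)"
    using integral_compactly_supported[OF F(1), of \<xi>] V.functional_zero[OF \<xi>] by simp
  finally show ?thesis .
qed

text \<open>The curried function sending \<open>y\<close> to the slice
  \<open>x \<mapsto> f x y\<close> takes finitely many values; grouping by these values turns both
  iterated integrals into the same finite sum of integrals of slices.\<close>

lemma fubini_compactly_supported:
  fixes f :: "'g \<Rightarrow> 'g \<Rightarrow> complex"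
  assumes curry: "compactly_supported (\<lambda>x\<in>carrier G. 0) (\<lambda>y. \<lambda>x\<in>carrier G. f x y)"
    and sec: "\<And>y. y \<in> carrier G \<Longrightarrow> compactly_supported 0 (\<lambda>x. f x y)"
  shows "(\<integral>x. \<integral>y. f x y \<partial>\<mu> \<partial>\<mu>) = (\<integral>y. \<integral>x. f x y \<partial>\<mu> \<partial>\<mu>)"
proof -
  \<comment> \<open>Restricting to the carrier makes slices that agree on \<open>G\<close> equal as
    functions; otherwise the curried map could fail to be locally constant.\<close>
  let ?F = "\<lambda>y. \<lambda>x\<in>carrier G. f x y" and ?z = "\<lambda>x\<in>carrier G. 0 :: complex"
  let ?I = "?F ` carrier G - {?z}" and ?m = "\<lambda>v. complex_of_real (measure \<mu> {y \<in> carrier G. ?F y = v})"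
  have 1: "(\<integral>y. f x y \<partial>\<mu>) = (\<Sum>v\<in>?I. ?m v * v x)" if x: "x \<in> carrier G" for x
  proof -
    have "(\<integral>y. f x y \<partial>\<mu>) = (\<integral>y. ?F y x \<partial>\<mu>)" using x by simp
    also have "\<dots> = (\<Sum>v\<in>?I. ?m v * v x)"
      using integral_compactly_supported[OF curry, of "\<lambda>v. v x"] x by simp
    finally show ?thesis .
  qed
  have 2: "(\<integral>y. \<integral>x. f x y \<partial>\<mu> \<partial>\<mu>) = (\<Sum>v\<in>?I. ?m v * (\<integral>x. v x \<partial>\<mu>))"
  proof -
    have "(\<integral>y. \<integral>x. f x y \<partial>\<mu> \<partial>\<mu>) = (\<integral>y. (\<lambda>v. \<integral>x. v x \<partial>\<mu>) (?F y) \<partial>\<mu>)"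
      by (intro integral_cong_carrier) (auto intro!: integral_cong_carrier)
    also have "\<dots> = (\<Sum>v\<in>?I. ?m v * (\<integral>x. v x \<partial>\<mu>))"
    proof (rule integral_compactly_supported[OF curry])
      have "(\<integral>x. ?z x \<partial>\<mu>) = (\<integral>x. 0 \<partial>\<mu>)" by (intro integral_cong_carrier) auto
      then show "(\<integral>x. ?z x \<partial>\<mu>) = 0" by simp
    qed
    finally show ?thesis .
  qed
  have int: "integrable \<mu> v" if v: "v \<in> ?I" for v
  proof -
    obtain y where y: "y \<in> carrier G" "v = ?F y" using v by blast
    have "compactly_supported 0 v" unfolding y(2) by (rule compactly_supported_cong[OF sec[OF y(1)]]) auto
    then show ?thesis by (rule integrable_compactly_supported)
  qed
  have "(\<integral>x. \<integral>y. f x y \<partial>\<mu> \<partial>\<mu>) = (\<integral>x. (\<Sum>v\<in>?I. ?m v * v x) \<partial>\<mu>)"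
    by (intro integral_cong_carrier 1)
  also have "\<dots> = (\<Sum>v\<in>?I. ?m v * (\<integral>x. v x \<partial>\<mu>))"
    using int by (subst Bochner_Integration.integral_sum) auto
  finally show ?thesis unfolding 2 .
qed

lemma integral_coset:
  fixes c :: complex
  assumes K: "cpt_open K" and g: "g \<in> carrier G"
  shows "(\<integral>y. (if inv g \<otimes> y \<in> K then c else 0) \<partial>\<mu>) = measure \<mu> K * c"
proof -
  have "(\<integral>y. (if inv g \<otimes> y \<in> K then c else 0) \<partial>\<mu>) = (\<integral>y. indicator (g <# K) y *\<^sub>R c \<partial>\<mu>)"
    by (intro integral_cong_carrier) (auto simp: l_coset_eq[OF g cpt_open_subset[OF K]] indicator_def)
  also have "\<dots> = measure \<mu> (g <# K) *\<^sub>R c"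
  proof (intro has_bochner_integral_integral_eq has_bochner_integral_indicator)
    show "g <# K \<in> sets \<mu>" using openin_l_coset[OF g cpt_open_openin[OF K]] openin_sets by blast
    have "emeasure \<mu> (g <# K) = emeasure \<mu> K"
      using haar g openin_sets[OF cpt_open_openin[OF K]] unfolding haar_measure_def by metis
    then show "emeasure \<mu> (g <# K) < \<infinity>" using emeasure_compact_finite[OF cpt_open_compactin[OF K]] by simp
  qed
  finally show ?thesis
    using measure_l_coset[OF g openin_sets[OF cpt_open_openin[OF K]]] by (simp add: scaleR_conv_of_real)
qed

text \<open>After exchanging the integrals, \<open>y\<close> runs over the coset
  \<open>p(k) K\<close>, whose volume is that of \<open>K\<close>. This is where the factor
  \<open>1 / measure \<mu> K\<close> in \<open>hecke_elt\<close> cancels; there \<open>p\<close> is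
  \<open>k \<mapsto> k x\<close> or \<open>k \<mapsto> x^-1 k^-1 y\<close>.\<close>

lemma integral_integral_coset:
  fixes s :: "'g \<Rightarrow> complex"
  assumes K: "cpt_open K" and s: "compactly_supported 0 s" and p: "continuous_map T T p"
  shows "(\<integral>y. \<integral>k. (if inv (p k) \<otimes> y \<in> K then s k else 0) \<partial>\<mu> \<partial>\<mu>) = measure \<mu> K * (\<integral>k. s k \<partial>\<mu>)"
proof -
  obtain L where L: "cpt_open L" "\<forall>x\<in>carrier G - L. s x = 0" by (rule compactly_supportedE[OF s])
  \<comment> \<open>For \<open>y\<close> outside \<open>J\<close> no \<open>k\<close> in the support
    of \<open>s\<close> has \<open>y\<close> in the coset \<open>p(k) K\<close>, so \<open>J\<close>
    bounds the support of the curried integrand.\<close>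
  have "compactin T (p ` L)" using image_compactin[OF cpt_open_compactin[OF L(1)] p] .
  then obtain J where J: "cpt_open J" "K \<subseteq> J" "p ` L \<subseteq> J" using cpt_open_covers_compact[OF K] by blast
  note pc = continuous_closed[OF p]
  have lc: "locally_constant T (\<lambda>y. \<lambda>k\<in>carrier G. if inv (p k) \<otimes> y \<in> K then s k else 0)"
  proof (rule locally_constant_right_invariant[OF cpt_open_openin[OF K] cpt_open_one[OF K]])
    fix y j assume y: "y \<in> carrier G" and j: "j \<in> K"
    have "inv (p k) \<otimes> (y \<otimes> j) \<in> K \<longleftrightarrow> inv (p k) \<otimes> y \<in> K" if "k \<in> carrier G" for k
      using cpt_open_mult_cancel_right[OF K j, of "inv (p k) \<otimes> y"] y j pc[OF that] cpt_open_carrier[OF K j]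
      by (simp add: m_assoc)
    then show "(\<lambda>k\<in>carrier G. if inv (p k) \<otimes> (y \<otimes> j) \<in> K then s k else 0) =
      (\<lambda>k\<in>carrier G. if inv (p k) \<otimes> y \<in> K then s k else 0)"
      by (intro restrict_ext) simp
  qed
  have "(\<integral>k. \<integral>y. (if inv (p k) \<otimes> y \<in> K then s k else 0) \<partial>\<mu> \<partial>\<mu>) =
    (\<integral>y. \<integral>k. (if inv (p k) \<otimes> y \<in> K then s k else 0) \<partial>\<mu> \<partial>\<mu>)"
  proof (rule fubini_compactly_supported)
    show "compactly_supported (\<lambda>x\<in>carrier G. 0) (\<lambda>y. \<lambda>x\<in>carrier G. if inv (p x) \<otimes> y \<in> K then s x else 0)"
    proof (rule compactly_supportedI[OF lc J(1)])
      fix y assume y: "y \<in> carrier G" "y \<notin> J"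
      have "s k = 0" if k: "k \<in> carrier G" "inv (p k) \<otimes> y \<in> K" for k
      proof (rule ccontr)
        assume "s k \<noteq> 0" then have "p k \<in> J" using L(2) k J by blast
        then show False using cpt_open_mult_cancel_left[OF J(1) cpt_open_inv[OF J(1)], of "p k" y] y k J(2) by blast
      qed
      then show "(\<lambda>x\<in>carrier G. if inv (p x) \<otimes> y \<in> K then s x else 0) = (\<lambda>x\<in>carrier G. 0)"
        by (intro restrict_ext) simp
    qed
    fix y assume y: "y \<in> carrier G"
    have "locally_constant T (\<lambda>x. inv (p x) \<otimes> y \<in> K)"
      using y by (intro locally_constant_continuous[OF locally_constant_mem_cpt_open[OF K]] continuous_rules p)
    then show "compactly_supported 0 (\<lambda>x. if inv (p x) \<otimes> y \<in> K then s x else 0)"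
      using compactly_supported_comp2[OF s, of "\<lambda>x. inv (p x) \<otimes> y \<in> K" "\<lambda>a b. if b then a else 0" 0] by simp
  qed
  moreover have "(\<integral>k. \<integral>y. (if inv (p k) \<otimes> y \<in> K then s k else 0) \<partial>\<mu> \<partial>\<mu>) = (\<integral>k. measure \<mu> K * s k \<partial>\<mu>)"
    by (intro integral_cong_carrier integral_coset[OF K] pc)
  ultimately show ?thesis by simp
qed

end

section \<open>The Hecke algebra\<close>

text \<open>Finite dimensionality of \<open>W\<close> makes transposes exist and the kernel of
  \<open>\<rho>\<close> open; irreducibility is called upon later, when isotypic components are
  compared with images of \<open>K\<close>-homomorphisms.\<close>

locale hecke_setup = haar_group G T \<mu> + W: smooth_rep "subgrp G K" "subtopology T K" W
  for G :: "'g monoid" (structure) and T :: "'g topology" and \<mu> :: "'g measure"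
    and K :: "'g set" and W :: "('g, 'w) rep" +
  assumes K: "compact_open_subgroup G T K"
    and W_fin_dim: "fin_dim_subspace W (carrier W)"
begin

abbreviation "\<H> \<equiv> hecke_algebra G T \<mu> K W"
abbreviation "W_dual \<equiv> lin_maps W scalars"

sublocale W: complex_space W
  by unfold_locales

lemma W_dual_space: "complex_space (dual W)"
  by (rule complex_space_dual[OF W.complex_space_axioms])

lemma W_end_space: "complex_space (dual_end W)"
  by (rule complex_space_dual_end[OF W.complex_space_axioms])

lemmas K_carrier = cpt_open_carrier[OF K]
  and K_mult = cpt_open_mult[OF K] and K_inv = cpt_open_inv[OF K] and K_one = cpt_open_one[OF K]
  and K_subset = cpt_open_subset[OF K]

lemma act_W:
  assumes "k \<in> K"
  shows act_W_mem: "w \<in> carrier W \<Longrightarrow> act W k w \<in> carrier W"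
    and act_W_add: "w \<in> carrier W \<Longrightarrow> w' \<in> carrier W \<Longrightarrow> act W k (w \<oplus>\<^bsub>W\<^esub> w') = act W k w \<oplus>\<^bsub>W\<^esub> act W k w'"
    and act_W_smult: "w \<in> carrier W \<Longrightarrow> act W k (c \<odot>\<^bsub>W\<^esub> w) = c \<odot>\<^bsub>W\<^esub> act W k w"
  using lin_mapsD[OF W.act_linear[of k]] assms by auto

lemma act_W_one: "w \<in> carrier W \<Longrightarrow> act W \<one> w = w"
  using W.act_one by simp

lemma act_W_mult: "k \<in> K \<Longrightarrow> k' \<in> K \<Longrightarrow> w \<in> carrier W \<Longrightarrow> act W (k \<otimes> k') w = act W k (act W k' w)"
  using W.act_mult by simp

lemma act_W_cancel:
  assumes "k \<in> K" "w \<in> carrier W"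
  shows "act W (inv k) (act W k w) = w" "act W k (act W (inv k) w) = w"
  using assms K_inv K_carrier by (simp_all add: act_W_mult[symmetric] act_W_one)

text \<open>The kernel of \<open>\<rho>\<close>. One open subgroup fixing all of \<open>W\<close>
  lets local constancy be checked for all vectors at once.\<close>

definition fixer :: "'g set" where
  "fixer = {k \<in> K. \<forall>w\<in>carrier W. act W k w = w}"

lemma fixer_K: "j \<in> fixer \<Longrightarrow> j \<in> K"
  by (simp add: fixer_def)

lemma fixer_act: "j \<in> fixer \<Longrightarrow> w \<in> carrier W \<Longrightarrow> act W j w = w"
  by (simp add: fixer_def)

lemma fixer_inv: "j \<in> fixer \<Longrightarrow> inv j \<in> fixer"
proof -
  assume j: "j \<in> fixer"
  have "act W (inv j) w = w" if w: "w \<in> carrier W" for w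
    using act_W_cancel(1)[OF fixer_K[OF j] w] unfolding fixer_act[OF j w] .
  then show "inv j \<in> fixer" using K_inv[OF fixer_K[OF j]] by (simp add: fixer_def)
qed

lemma fixer_one: "\<one> \<in> fixer"
  by (simp add: fixer_def K_one act_W_one)

text \<open>By finite dimensionality it is a finite intersection of stabilisers of generators. The
  intersection with \<open>topspace T\<close> gives the right meaning to an empty family of
  generators.\<close>

lemma openin_fixer: "openin T fixer"
proof -
  obtain B where B: "finite B" "B \<subseteq> carrier W" "carrier W = lin_span W B"
    using W_fin_dim unfolding fin_dim_subspace_def by blast
  have op: "openin T {k \<in> K. act W k b = b}" if "b \<in> B" for b
  proof -
    have "openin (subtopology T K) {k \<in> K. act W k b = b}" using W.smooth[of b] that B(2) by auto
    then show ?thesis using openin_trans_full[OF _ cpt_open_openin[OF K]] by blast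
  qed
  have "fixer = K \<inter> ((\<Inter>b\<in>B. {k \<in> K. act W k b = b}) \<inter> topspace T)"
  proof (intro equalityI subsetI)
    fix k assume "k \<in> fixer"
    then show "k \<in> K \<inter> ((\<Inter>b\<in>B. {k \<in> K. act W k b = b}) \<inter> topspace T)"
      using B(2) K_carrier topspace_eq unfolding fixer_def by blast
  next
    fix k assume k: "k \<in> K \<inter> ((\<Inter>b\<in>B. {k \<in> K. act W k b = b}) \<inter> topspace T)"
    then have kK: "k \<in> K" and kB: "\<And>b. b \<in> B \<Longrightarrow> act W k b = b" by auto
    have "submodule {w \<in> carrier W. act W k w = w} complex_ring W"
      unfolding W.submodule_iff using act_W_add[OF kK] act_W_smult[OF kK]
      act_W_smult[OF kK W.zero_mem, of 0] act_W_mem[OF kK W.zero_mem] by auto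
    then have "lin_span W B \<subseteq> {w \<in> carrier W. act W k w = w}"
      using kB B(2) by (intro W.lin_span_least) auto
    then show "k \<in> fixer" using kK B(3) unfolding fixer_def by blast
  qed
  moreover have "openin T (K \<inter> ((\<Inter>b\<in>B. {k \<in> K. act W k b = b}) \<inter> topspace T))"
    by (rule openin_Int[OF cpt_open_openin[OF K] openin_INT[OF B(1) op]])
  ultimately show ?thesis by simp
qed

lemma dual_frame:
  obtains B E where "finite B" "B \<subseteq> carrier W" "\<forall>b\<in>B. E b \<in> W_dual"
    "\<forall>l\<in>W_dual. \<forall>w\<in>carrier W. l w = (\<Sum>b\<in>B. E b w * l b)"
proof -
  have "\<exists>B E. finite B \<and> B \<subseteq> carrier W \<and> (\<forall>b\<in>B. E b \<in> W_dual) \<and>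
    (\<forall>l\<in>W_dual. \<forall>w\<in>carrier W. l w = (\<Sum>b\<in>B. E b w * l b))"
    by (rule W.dual_frame_exists[OF W_fin_dim]) (intro exI conjI ballI)
  then show thesis by (elim exE conjE) (rule that)
qed

section \<open>Endomorphisms of the dual space and their transposes\<close>

lemma dual_op_apply:
  "k \<in> K \<Longrightarrow> l \<in> W_dual \<Longrightarrow> w \<in> carrier W \<Longrightarrow> dual_op G W k l w = l (act W (inv k) w)"
  by (simp add: dual_op_def)

lemma dual_op_mem: "k \<in> K \<Longrightarrow> l \<in> W_dual \<Longrightarrow> dual_op G W k l \<in> W_dual"
  by (rule lin_mapsI)
    (auto simp: dual_op_def act_W_mem act_W_add act_W_smult K_inv W.functional_simps)

lemma W_dual_eqI: "l \<in> W_dual \<Longrightarrow> l' \<in> W_dual \<Longrightarrow> (\<And>w. w \<in> carrier W \<Longrightarrow> l w = l' w) \<Longrightarrow> l = l'"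
  by (rule lin_maps_eqI)

lemma dual_op_end: "k \<in> K \<Longrightarrow> dual_op G W k \<in> lin_maps (dual W) (dual W)"
proof (rule lin_mapsI)
  assume k: "k \<in> K"
  show "dual_op G W k \<in> extensional (carrier (dual W))" by (simp add: dual_op_def)
  fix x assume x: "x \<in> carrier (dual W)"
  then show "dual_op G W k x \<in> carrier (dual W)" using k by (simp add: dual_op_mem)
  {
    fix y assume y: "y \<in> carrier (dual W)"
    have xy: "x \<oplus>\<^bsub>dual W\<^esub> y \<in> carrier (dual W)"
      using x y complex_space.add_mem[OF W_dual_space] by blast
    show "dual_op G W k (x \<oplus>\<^bsub>dual W\<^esub> y) = dual_op G W k x \<oplus>\<^bsub>dual W\<^esub> dual_op G W k y"
      using x y xy k by (auto simp: dual_op_def act_W_mem K_inv)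
  next
    fix c
    have "c \<odot>\<^bsub>dual W\<^esub> x \<in> carrier (dual W)"
      using x complex_space.smult_mem[OF W_dual_space] by blast
    then show "dual_op G W k (c \<odot>\<^bsub>dual W\<^esub> x) = c \<odot>\<^bsub>dual W\<^esub> dual_op G W k x"
      using x k by (auto simp: dual_op_def act_W_mem K_inv)
  }
qed

lemma end_mem: "A \<in> lin_maps (dual W) (dual W) \<Longrightarrow> l \<in> W_dual \<Longrightarrow> A l \<in> W_dual"
  using lin_maps_mem[of A "dual W" "dual W" l] by simp

lemma end_eqI:
  assumes "A \<in> lin_maps (dual W) (dual W)" "A' \<in> lin_maps (dual W) (dual W)"
    and "\<And>l w. l \<in> W_dual \<Longrightarrow> w \<in> carrier W \<Longrightarrow> A l w = A' l w"
  shows "A = A'"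
  using assms by (intro lin_maps_eqI[OF assms(1,2)] W_dual_eqI) (auto intro: end_mem)

lemma dual_eval_functional:
  assumes A: "A \<in> lin_maps (dual W) (dual W)" and w: "w \<in> carrier W"
  shows "(\<lambda>l\<in>carrier (dual W). A l w) \<in> lin_maps (dual W) scalars"
proof (rule lin_mapsI)
  fix x assume x: "x \<in> carrier (dual W)"
  {
    fix y assume y: "y \<in> carrier (dual W)"
    have "x \<oplus>\<^bsub>dual W\<^esub> y \<in> carrier (dual W)" using x y complex_space.add_mem[OF W_dual_space] by blast
    then show "(\<lambda>A'\<in>carrier (dual W). A A' w) (x \<oplus>\<^bsub>dual W\<^esub> y) =
       (\<lambda>A'\<in>carrier (dual W). A A' w) x \<oplus>\<^bsub>scalars\<^esub> (\<lambda>A'\<in>carrier (dual W). A A' w) y"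
      using x y lin_maps_add[OF A x y] w by (simp del: dual_simps(3)) simp
  next
    fix c
    have "c \<odot>\<^bsub>dual W\<^esub> x \<in> carrier (dual W)" using x complex_space.smult_mem[OF W_dual_space] by blast
    then show "(\<lambda>A'\<in>carrier (dual W). A A' w) (c \<odot>\<^bsub>dual W\<^esub> x) =
       c \<odot>\<^bsub>scalars\<^esub> (\<lambda>A'\<in>carrier (dual W). A A' w) x"
      using x lin_maps_smult[OF A x] w by (simp del: dual_simps(4)) simp
  }
qed auto

text \<open>A functional \<open>l\<close> is the combination of the functionals \<open>E b\<close>
  with coefficients \<open>l b\<close>, so \<open>A\<close> is determined by its values on the
  \<open>E b\<close>.\<close>

lemma end_expand:
  assumes A: "A \<in> lin_maps (dual W) (dual W)" and l: "l \<in> W_dual" and w: "w \<in> carrier W"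
    and B: "finite B" "B \<subseteq> carrier W" "\<forall>b\<in>B. E b \<in> W_dual"
    "\<forall>l\<in>W_dual. \<forall>w\<in>carrier W. l w = (\<Sum>b\<in>B. E b w * l b)"
  shows "A l w = (\<Sum>b\<in>B. A (E b) w * l b)"
proof -
  interpret D: complex_space "dual W" by (rule W_dual_space)
  let ?f = "\<lambda>b. l b \<odot>\<^bsub>dual W\<^esub> E b"
  have f: "?f b \<in> carrier (dual W)" if "b \<in> B" for b using B(3)[rule_format, OF that] D.smult_mem[of "E b"] by simp
  have ev: "(\<lambda>l\<in>carrier (dual W). l w) \<in> lin_maps (dual W) scalars" if "w \<in> carrier W" for w
    using dual_eval_functional[OF lin_maps_id[OF W_dual_space] that] by (simp cong: restrict_cong)
  have sum: "finsum (dual W) ?f B \<in> carrier (dual W)" using f by (intro D.M.finsum_closed) auto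
  have "l = finsum (dual W) ?f B"
  proof (rule W_dual_eqI[OF l])
    show "finsum (dual W) ?f B \<in> W_dual" using sum by simp
    fix w assume w: "w \<in> carrier W"
    have "finsum (dual W) ?f B w = (\<lambda>l\<in>carrier (dual W). l w) (finsum (dual W) ?f B)" using sum by simp
    also have "\<dots> = (\<Sum>b\<in>B. (\<lambda>l\<in>carrier (dual W). l w) (?f b))"
      by (rule D.functional_finsum[OF ev[OF w] B(1) f])
    also have "\<dots> = (\<Sum>b\<in>B. E b w * l b)" using f w B(3) by (intro sum.cong) auto
    also have "\<dots> = l w" using B(4)[rule_format, OF l w] by simp
    finally show "l w = finsum (dual W) ?f B w" by simp
  qed
  then have "A l w = (\<lambda>l\<in>carrier (dual W). A l w) (finsum (dual W) ?f B)" using sum by simp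
  also have "\<dots> = (\<Sum>b\<in>B. (\<lambda>l\<in>carrier (dual W). A l w) (?f b))"
    by (rule D.functional_finsum[OF dual_eval_functional[OF A w] B(1) f])
  also have "\<dots> = (\<Sum>b\<in>B. A (E b) w * l b)"
  proof (rule sum.cong)
    fix b assume b: "b \<in> B"
    have "(\<lambda>l\<in>carrier (dual W). A l w) (?f b) = l b * (\<lambda>l\<in>carrier (dual W). A l w) (E b)"
      using lin_maps_smult[OF dual_eval_functional[OF A w], of "E b" "l b"] B(3)[rule_format, OF b] by simp
    then show "(\<lambda>l\<in>carrier (dual W). A l w) (?f b) = A (E b) w * l b" using B(3)[rule_format, OF b] by simp
  qed simp
  finally show ?thesis .
qed

text \<open>The description in \<open>transposed\<close> has a unique solution because
  \<open>W\<close> is reflexive: in terms of a frame the solution sends \<open>w\<close> to the sum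
  of the vectors \<open>b\<close> with coefficients \<open>A (E b) w\<close>, and it is unique as
  functionals separate vectors.\<close>

lemma transposed:
  assumes A: "A \<in> lin_maps (dual W) (dual W)"
  shows transposed_lin: "transposed W A \<in> lin_maps W W"
    and functional_transposed: "l \<in> W_dual \<Longrightarrow> w \<in> carrier W \<Longrightarrow> l (transposed W A w) = A l w"
proof -
  obtain B E where B: "finite B" "B \<subseteq> carrier W" "\<forall>b\<in>B. E b \<in> W_dual"
    "\<forall>l\<in>W_dual. \<forall>w\<in>carrier W. l w = (\<Sum>b\<in>B. E b w * l b)"
    by (rule dual_frame)
  define C where "C = (\<lambda>w\<in>carrier W. finsum W (\<lambda>b. A (E b) w \<odot>\<^bsub>W\<^esub> b) B)"
  have Cm: "C w \<in> carrier W" if "w \<in> carrier W" for w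
    using that B(2)
    by (simp add: C_def) (intro W.finsum_mem_submodule[OF W.V.carrier_is_submodule B(1)] W.smult_mem, auto)
  have Cl: "l (C w) = A l w" if l: "l \<in> W_dual" and w: "w \<in> carrier W" for l w
  proof -
    have "l (C w) = (\<Sum>b\<in>B. l (A (E b) w \<odot>\<^bsub>W\<^esub> b))"
      unfolding C_def using w B(2) by (simp, intro W.functional_finsum[OF l B(1)]) auto
    also have "\<dots> = (\<Sum>b\<in>B. A (E b) w * l b)"
      using B(2) by (intro sum.cong refl W.functional_smult[OF l]) auto
    finally show ?thesis using end_expand[OF A l w B] by simp
  qed
  have El: "A l \<in> W_dual" if "l \<in> W_dual" for l using end_mem[OF A that] .
  have C: "C \<in> lin_maps W W"
  proof (rule lin_mapsI)
    show "C \<in> extensional (carrier W)" by (simp add: C_def)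
    fix x assume x: "x \<in> carrier W"
    then show "C x \<in> carrier W" by (rule Cm)
    {
      fix y assume y: "y \<in> carrier W"
      show "C (x \<oplus>\<^bsub>W\<^esub> y) = C x \<oplus>\<^bsub>W\<^esub> C y"
        using x y Cm by (intro W.functionals_eqI) (auto simp: W.functional_add Cl El)
    next
      fix c
      show "C (c \<odot>\<^bsub>W\<^esub> x) = c \<odot>\<^bsub>W\<^esub> C x"
        using x Cm by (intro W.functionals_eqI) (auto simp: W.functional_smult Cl El)
    }
  qed
  have "transposed W A = C"
    unfolding transposed_def
  proof (rule the_equality)
    show "C \<in> lin_maps W W \<and> (\<forall>l\<in>carrier (dual W). \<forall>w\<in>carrier W. l (C w) = A l w)" using C Cl by simp
    fix D assume D: "D \<in> lin_maps W W \<and> (\<forall>l\<in>carrier (dual W). \<forall>w\<in>carrier W. l (D w) = A l w)"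
    then have D1: "D \<in> lin_maps W W" by blast
    show "D = C"
    proof (rule lin_maps_eqI[OF D1 C])
      fix w assume w: "w \<in> carrier W"
      show "D w = C w"
        using D Cl w by (intro W.functionals_eqI[OF lin_maps_mem[OF D1 w] Cm[OF w]]) simp
    qed
  qed
  then show "transposed W A \<in> lin_maps W W" "l \<in> W_dual \<Longrightarrow> w \<in> carrier W \<Longrightarrow> l (transposed W A w) = A l w"
    using C Cl by simp_all
qed

lemma transposed_mem:
  "A \<in> lin_maps (dual W) (dual W) \<Longrightarrow> w \<in> carrier W \<Longrightarrow> transposed W A w \<in> carrier W"
  using lin_maps_mem[OF transposed_lin] by blast

lemma transposed_eqI:
  assumes "A \<in> lin_maps (dual W) (dual W)" "w \<in> carrier W" "v \<in> carrier W"
    and "\<And>l. l \<in> W_dual \<Longrightarrow> A l w = l v"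
  shows "transposed W A w = v"
  using assms by (intro W.functionals_eqI transposed_mem) (auto simp: functional_transposed)

section \<open>Functions with two-sided equivariance under K\<close>

lemma hecke_fun_PiE: "f \<in> hecke_fun G T K W \<Longrightarrow> f \<in> carrier G \<rightarrow>\<^sub>E carrier (dual_end W)"
  unfolding hecke_fun_def by blast

lemma hecke_fun_end: "f \<in> hecke_fun G T K W \<Longrightarrow> g \<in> carrier G \<Longrightarrow> f g \<in> lin_maps (dual W) (dual W)"
  using PiE_mem[OF hecke_fun_PiE] by simp

lemma hecke_fun_dual: "f \<in> hecke_fun G T K W \<Longrightarrow> g \<in> carrier G \<Longrightarrow> l \<in> W_dual \<Longrightarrow> f g l \<in> W_dual"
  using hecke_fun_end end_mem by blast

lemma hecke_fun_ext: "f \<in> hecke_fun G T K W \<Longrightarrow> f \<in> extensional (carrier G)"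
  using hecke_fun_PiE by (simp add: PiE_iff)

lemma hecke_fun_eqI:
  assumes "f \<in> hecke_fun G T K W" "f' \<in> hecke_fun G T K W"
    and "\<And>g l w. g \<in> carrier G \<Longrightarrow> l \<in> W_dual \<Longrightarrow> w \<in> carrier W \<Longrightarrow> f g l w = f' g l w"
  shows "f = f'"
  using hecke_fun_ext[OF assms(1)] hecke_fun_ext[OF assms(2)]
proof (rule extensionalityI)
  fix g assume g: "g \<in> carrier G"
  show "f g = f' g" by (rule end_eqI) (use assms g hecke_fun_end in auto)
qed

lemma hecke_fun_locally_constant: "f \<in> hecke_fun G T K W \<Longrightarrow> locally_constant T f"
  unfolding hecke_fun_def by blast

lemma hecke_fun_support:
  assumes f: "f \<in> hecke_fun G T K W"
  obtains L where "cpt_open L" "K \<subseteq> L" "\<forall>x\<in>carrier G - L. f x = \<zero>\<^bsub>dual_end W\<^esub>"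
proof -
  let ?S = "{g \<in> carrier G. f g \<noteq> \<zero>\<^bsub>dual_end W\<^esub>}"
  have "compactin T (T closure_of ?S)" using f unfolding hecke_fun_def by blast
  then obtain L where L: "cpt_open L" "K \<subseteq> L" "T closure_of ?S \<subseteq> L" using cpt_open_covers_compact[OF K] by blast
  have "?S \<subseteq> T closure_of ?S" by (intro closure_of_subset) (auto simp: topspace_eq)
  then show thesis using L by (intro that[of L]) auto
qed

lemma hecke_fun_compactly_supported:
  assumes "f \<in> hecke_fun G T K W" shows "compactly_supported \<zero>\<^bsub>dual_end W\<^esub> f"
proof -
  obtain L where "cpt_open L" "\<forall>x\<in>carrier G - L. f x = \<zero>\<^bsub>dual_end W\<^esub>" by (rule hecke_fun_support[OF assms])
  then show ?thesis using hecke_fun_locally_constant[OF assms] unfolding compactly_supported_def by blast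
qed

lemma hecke_fun_equivariant:
  assumes f: "f \<in> hecke_fun G T K W" and k: "k1 \<in> K" "k2 \<in> K" and g: "g \<in> carrier G"
    and l: "l \<in> W_dual" and w: "w \<in> carrier W"
  shows "f (k1 \<otimes> g \<otimes> k2) l w = f g (dual_op G W k2 l) (act W (inv k1) w)"
proof -
  have "f (k1 \<otimes> g \<otimes> k2) = compose (carrier (dual W)) (dual_op G W k1)
      (compose (carrier (dual W)) (f g) (dual_op G W k2))"
    using f k g unfolding hecke_fun_def by blast
  then show ?thesis
    using k l w g hecke_fun_dual[OF f g] by (simp add: compose_def dual_op_mem dual_op_apply)
qed

lemma dual_op_one: "l \<in> W_dual \<Longrightarrow> dual_op G W \<one> l = l"
  by (rule W_dual_eqI) (auto simp: dual_op_apply dual_op_mem K_one act_W_one)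

lemma hecke_fun_left:
  "f \<in> hecke_fun G T K W \<Longrightarrow> k \<in> K \<Longrightarrow> g \<in> carrier G \<Longrightarrow> l \<in> W_dual \<Longrightarrow> w \<in> carrier W \<Longrightarrow>
    f (k \<otimes> g) l w = f g l (act W (inv k) w)"
  using hecke_fun_equivariant[of f k \<one> g l w] by (simp add: K_one K_carrier dual_op_one)

lemma hecke_fun_right:
  "f \<in> hecke_fun G T K W \<Longrightarrow> k \<in> K \<Longrightarrow> g \<in> carrier G \<Longrightarrow> l \<in> W_dual \<Longrightarrow> w \<in> carrier W \<Longrightarrow>
    f (g \<otimes> k) l w = f g (dual_op G W k l) w"
  using hecke_fun_equivariant[of f \<one> k g l w] by (simp add: K_one act_W_one)

text \<open>Right equivariance makes \<open>f\<close> invariant under the open subgroup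
  \<open>fixer\<close>, hence locally constant. A bound \<open>L\<close> on the support is enough
  because a compact open subgroup is closed and so contains the closure of the support.\<close>

lemma hecke_funI:
  assumes ext: "f \<in> extensional (carrier G)"
    and mem: "\<And>g. g \<in> carrier G \<Longrightarrow> f g \<in> lin_maps (dual W) (dual W)"
    and supp: "cpt_open L" "\<And>g l w. g \<in> carrier G \<Longrightarrow> g \<notin> L \<Longrightarrow> l \<in> W_dual \<Longrightarrow> w \<in> carrier W \<Longrightarrow> f g l w = 0"
    and left: "\<And>k g l w. k \<in> K \<Longrightarrow> g \<in> carrier G \<Longrightarrow> l \<in> W_dual \<Longrightarrow> w \<in> carrier W \<Longrightarrow>
      f (k \<otimes> g) l w = f g l (act W (inv k) w)"
    and right: "\<And>k g l w. k \<in> K \<Longrightarrow> g \<in> carrier G \<Longrightarrow> l \<in> W_dual \<Longrightarrow> w \<in> carrier W \<Longrightarrow>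
      f (g \<otimes> k) l w = f g (dual_op G W k l) w"
  shows "f \<in> hecke_fun G T K W"
  unfolding hecke_fun_def
proof (intro CollectI conjI ballI)
  show "f \<in> carrier G \<rightarrow>\<^sub>E carrier (dual_end W)" using ext mem by (simp add: PiE_iff)
  show "locally_constant T f"
  proof (rule locally_constant_right_invariant[OF openin_fixer fixer_one])
    fix x j assume x: "x \<in> carrier G" and j: "j \<in> fixer"
    note jK = fixer_K[OF j]
    show "f (x \<otimes> j) = f x"
    proof (rule end_eqI)
      fix l w assume l: "l \<in> W_dual" and w: "w \<in> carrier W"
      have "dual_op G W j l = l"
        by (rule W_dual_eqI) (auto simp: dual_op_apply dual_op_mem jK l fixer_act fixer_inv j)
      then show "f (x \<otimes> j) l w = f x l w" using right[OF jK x l w] by simp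
    qed (use mem x jK K_carrier in auto)
  qed
  have "f x = \<zero>\<^bsub>dual_end W\<^esub>" if "x \<in> carrier G" "x \<notin> L" for x
  proof (rule end_eqI[OF mem[OF that(1)]])
    show "\<zero>\<^bsub>dual_end W\<^esub> \<in> lin_maps (dual W) (dual W)"
      using complex_space.zero_mem[OF W_end_space] by simp
  qed (use supp(2) that in auto)
  then have "{g \<in> carrier G. f g \<noteq> \<zero>\<^bsub>dual_end W\<^esub>} \<subseteq> L" by blast
  then have "T closure_of {g \<in> carrier G. f g \<noteq> \<zero>\<^bsub>dual_end W\<^esub>} \<subseteq> L"
    using cpt_open_closedin[OF supp(1)] closure_of_minimal by blast
  then show "compactin T (T closure_of {g \<in> carrier G. f g \<noteq> \<zero>\<^bsub>dual_end W\<^esub>})"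
    using closed_compactin[OF cpt_open_compactin[OF supp(1)]] closedin_closure_of by blast
  fix k1 k2 g assume k: "k1 \<in> K" "k2 \<in> K" and g: "g \<in> carrier G"
  let ?R = "compose (carrier (dual W)) (dual_op G W k1) (compose (carrier (dual W)) (f g) (dual_op G W k2))"
  have "?R \<in> lin_maps (dual W) (dual W)"
    by (intro lin_maps_compose[OF W_dual_space, where V'="dual W"] dual_op_end mem k g)
  then show "f (k1 \<otimes> g \<otimes> k2) = ?R"
  proof (rule end_eqI[rotated])
    show "f (k1 \<otimes> g \<otimes> k2) \<in> lin_maps (dual W) (dual W)" using mem k g K_carrier by simp
    fix l w assume l: "l \<in> W_dual" and w: "w \<in> carrier W"
    have "f (k1 \<otimes> g \<otimes> k2) l w = f g (dual_op G W k2 l) (act W (inv k1) w)"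
      using k g l w K_carrier by (simp add: right left K_inv act_W_mem dual_op_mem)
    moreover have "f g (dual_op G W k2 l) \<in> W_dual" using end_mem[OF mem[OF g]] dual_op_mem[OF k(2) l] .
    ultimately show "f (k1 \<otimes> g \<otimes> k2) l w = ?R l w"
      using k l w by (simp add: compose_def dual_op_mem dual_op_apply)
  qed
qed

lemma hecke_algebra_simps:
  "carrier \<H> = hecke_fun G T K W"
  "\<zero>\<^bsub>\<H>\<^esub> = (\<lambda>x\<in>carrier G. \<zero>\<^bsub>dual_end W\<^esub>)"
  "f \<oplus>\<^bsub>\<H>\<^esub> f' = (\<lambda>x\<in>carrier G. f x \<oplus>\<^bsub>dual_end W\<^esub> f' x)"
  "f \<otimes>\<^bsub>\<H>\<^esub> f' = (\<lambda>x\<in>carrier G. lc_integral \<mu> (dual_end W)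
       (\<lambda>g. compose (carrier (dual W)) (f g) (f' (inv g \<otimes> x))))"
  "\<one>\<^bsub>\<H>\<^esub> = (\<lambda>x\<in>carrier G. if x \<in> K
       then complex_of_real (1 / measure \<mu> K) \<odot>\<^bsub>dual_end W\<^esub> dual_op G W x
       else \<zero>\<^bsub>dual_end W\<^esub>)"
  by (simp_all add: hecke_algebra_def)

text \<open>The vector space underlying the algebra: \<open>\<H>\<close> is only a ring, while
  \<open>lc_integral\<close> and functionals need complex scalars.\<close>

definition hecke_space :: "(complex, 'g \<Rightarrow> ('w \<Rightarrow> complex) \<Rightarrow> 'w \<Rightarrow> complex) module" where
  "hecke_space = \<lparr>carrier = hecke_fun G T K W, monoid.mult = undefined, one = undefined,
     zero = \<zero>\<^bsub>\<H>\<^esub>, add = add \<H>,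
     smult = (\<lambda>c f. \<lambda>x\<in>carrier G. c \<odot>\<^bsub>dual_end W\<^esub> f x)\<rparr>"

lemma hecke_space_simps:
  "carrier hecke_space = hecke_fun G T K W" "\<zero>\<^bsub>hecke_space\<^esub> = \<zero>\<^bsub>\<H>\<^esub>"
  "f \<oplus>\<^bsub>hecke_space\<^esub> f' = f \<oplus>\<^bsub>\<H>\<^esub> f'"
  "c \<odot>\<^bsub>hecke_space\<^esub> f = (\<lambda>x\<in>carrier G. c \<odot>\<^bsub>dual_end W\<^esub> f x)"
  by (simp_all add: hecke_space_def)

lemma end_zero_apply: "l \<in> W_dual \<Longrightarrow> w \<in> carrier W \<Longrightarrow> \<zero>\<^bsub>dual_end W\<^esub> l w = 0"
  by simp

lemma end_zero_mem: "\<zero>\<^bsub>dual_end W\<^esub> \<in> lin_maps (dual W) (dual W)"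
  using complex_space.zero_mem[OF W_end_space] by simp

lemma end_apply_zero:
  "A \<in> lin_maps (dual W) (dual W) \<Longrightarrow> w \<in> carrier W \<Longrightarrow> A (\<lambda>x\<in>carrier W. 0) w = 0"
  using lin_maps_zero[OF _ W_dual_space W_dual_space, of A] by simp

lemma end_comp_zero_apply:
  "A \<in> lin_maps (dual W) (dual W) \<Longrightarrow> l \<in> W_dual \<Longrightarrow> w \<in> carrier W \<Longrightarrow> A (\<zero>\<^bsub>dual_end W\<^esub> l) w = 0"
  using end_apply_zero by simp

lemma end_smult_apply:
  "A \<in> lin_maps (dual W) (dual W) \<Longrightarrow> l \<in> W_dual \<Longrightarrow> w \<in> carrier W \<Longrightarrow>
    A (c \<odot>\<^bsub>dual W\<^esub> l) w = c * A l w"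
  using lin_maps_smult[of A "dual W" "dual W" l c] by simp

lemma hecke_zero_apply: "x \<in> carrier G \<Longrightarrow> l \<in> W_dual \<Longrightarrow> w \<in> carrier W \<Longrightarrow> \<zero>\<^bsub>\<H>\<^esub> x l w = 0"
  by (simp add: hecke_algebra_simps)

lemma hecke_add_apply:
  "x \<in> carrier G \<Longrightarrow> l \<in> W_dual \<Longrightarrow> w \<in> carrier W \<Longrightarrow> (f \<oplus>\<^bsub>\<H>\<^esub> f') x l w = f x l w + f' x l w"
  by (simp add: hecke_algebra_simps)

lemma hecke_smult_apply:
  "x \<in> carrier G \<Longrightarrow> l \<in> W_dual \<Longrightarrow> w \<in> carrier W \<Longrightarrow> (c \<odot>\<^bsub>hecke_space\<^esub> f) x l w = c * f x l w"
  by (simp add: hecke_space_simps)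

lemma hecke_one_apply:
  "x \<in> carrier G \<Longrightarrow> l \<in> W_dual \<Longrightarrow> w \<in> carrier W \<Longrightarrow>
    \<one>\<^bsub>\<H>\<^esub> x l w = (if x \<in> K then complex_of_real (1 / measure \<mu> K) * l (act W (inv x) w) else 0)"
  by (simp add: hecke_algebra_simps dual_op_apply)

lemma hecke_zero_mem: "\<zero>\<^bsub>\<H>\<^esub> \<in> hecke_fun G T K W"
  by (rule hecke_funI[OF _ _ K])
    (simp_all add: hecke_zero_apply K_carrier dual_op_mem act_W_mem K_inv,
     simp_all add: hecke_algebra_simps end_zero_mem del: dual_end_simps(2))

lemma hecke_support_two:
  assumes "f \<in> hecke_fun G T K W" "f' \<in> hecke_fun G T K W"
  obtains L where "cpt_open L" "K \<subseteq> L" "\<forall>x\<in>carrier G - L. f x = \<zero>\<^bsub>dual_end W\<^esub>"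
    "\<forall>x\<in>carrier G - L. f' x = \<zero>\<^bsub>dual_end W\<^esub>"
proof -
  obtain L where L: "cpt_open L" "K \<subseteq> L" "\<forall>x\<in>carrier G - L. f x = \<zero>\<^bsub>dual_end W\<^esub>"
    by (rule hecke_fun_support[OF assms(1)])
  obtain L' where L': "cpt_open L'" "K \<subseteq> L'" "\<forall>x\<in>carrier G - L'. f' x = \<zero>\<^bsub>dual_end W\<^esub>"
    by (rule hecke_fun_support[OF assms(2)])
  obtain J where J: "cpt_open J" "L \<subseteq> J" "L' \<subseteq> J" by (rule cpt_open_covers_two[OF L(1) L'(1)])
  show thesis by (rule that[OF J(1)]) (use L L' J in blast)+
qed

lemma hecke_add_mem:
  assumes f: "f \<in> hecke_fun G T K W" "f' \<in> hecke_fun G T K W"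
  shows "f \<oplus>\<^bsub>\<H>\<^esub> f' \<in> hecke_fun G T K W"
proof -
  obtain L where L: "cpt_open L" "K \<subseteq> L" "\<forall>x\<in>carrier G - L. f x = \<zero>\<^bsub>dual_end W\<^esub>"
    "\<forall>x\<in>carrier G - L. f' x = \<zero>\<^bsub>dual_end W\<^esub>" by (rule hecke_support_two[OF f])
  show ?thesis
  proof (rule hecke_funI[OF _ _ L(1)])
    show "f \<oplus>\<^bsub>\<H>\<^esub> f' \<in> extensional (carrier G)" by (simp add: hecke_algebra_simps)
    fix g assume g: "g \<in> carrier G"
    show "(f \<oplus>\<^bsub>\<H>\<^esub> f') g \<in> lin_maps (dual W) (dual W)"
      using complex_space.add_mem[OF W_end_space, of "f g" "f' g"] hecke_fun_end[OF f(1) g] hecke_fun_end[OF f(2) g] g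
      by (simp add: hecke_algebra_simps del: dual_end_simps(3))
    fix l w assume lw: "l \<in> W_dual" "w \<in> carrier W"
    show "(f \<oplus>\<^bsub>\<H>\<^esub> f') g l w = 0" if "g \<notin> L"
      using L(3,4) g that lw by (simp add: hecke_add_apply)
    fix k assume k: "k \<in> K"
    show "(f \<oplus>\<^bsub>\<H>\<^esub> f') (k \<otimes> g) l w = (f \<oplus>\<^bsub>\<H>\<^esub> f') g l (act W (inv k) w)"
      using k g lw f by (simp add: hecke_add_apply K_carrier act_W_mem K_inv hecke_fun_left)
    show "(f \<oplus>\<^bsub>\<H>\<^esub> f') (g \<otimes> k) l w = (f \<oplus>\<^bsub>\<H>\<^esub> f') g (dual_op G W k l) w"
      using k g lw f by (simp add: hecke_add_apply K_carrier dual_op_mem hecke_fun_right)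
  qed
qed

lemma hecke_smult_mem:
  assumes f: "f \<in> hecke_fun G T K W"
  shows "c \<odot>\<^bsub>hecke_space\<^esub> f \<in> hecke_fun G T K W"
proof -
  obtain L where L: "cpt_open L" "K \<subseteq> L" "\<forall>x\<in>carrier G - L. f x = \<zero>\<^bsub>dual_end W\<^esub>"
    by (rule hecke_fun_support[OF f])
  show ?thesis
  proof (rule hecke_funI[OF _ _ L(1)])
    show "c \<odot>\<^bsub>hecke_space\<^esub> f \<in> extensional (carrier G)" by (simp add: hecke_space_simps)
    fix g assume g: "g \<in> carrier G"
    show "(c \<odot>\<^bsub>hecke_space\<^esub> f) g \<in> lin_maps (dual W) (dual W)"
      using complex_space.smult_mem[OF W_end_space, of "f g" c] hecke_fun_end[OF f(1) g] g
      by (simp add: hecke_space_simps del: dual_end_simps(4))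
    fix l w assume lw: "l \<in> W_dual" "w \<in> carrier W"
    show "(c \<odot>\<^bsub>hecke_space\<^esub> f) g l w = 0" if "g \<notin> L"
      using L(3) g that lw by (simp add: hecke_smult_apply)
    fix k assume k: "k \<in> K"
    show "(c \<odot>\<^bsub>hecke_space\<^esub> f) (k \<otimes> g) l w = (c \<odot>\<^bsub>hecke_space\<^esub> f) g l (act W (inv k) w)"
      using k g lw f by (simp add: hecke_smult_apply K_carrier act_W_mem K_inv hecke_fun_left)
    show "(c \<odot>\<^bsub>hecke_space\<^esub> f) (g \<otimes> k) l w = (c \<odot>\<^bsub>hecke_space\<^esub> f) g (dual_op G W k l) w"
      using k g lw f by (simp add: hecke_smult_apply K_carrier dual_op_mem hecke_fun_right)
  qed
qed

lemma complex_space_hecke: "complex_space hecke_space"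
proof (rule complex_spaceI)
  fix a b and f f' f'' assume f: "f \<in> carrier hecke_space"
  then have m: "f \<in> hecke_fun G T K W" by (simp add: hecke_space_simps)
  note mem = hecke_add_mem hecke_smult_mem hecke_zero_mem m
  note ap = hecke_add_apply hecke_smult_apply hecke_zero_apply
  show "c \<odot>\<^bsub>hecke_space\<^esub> f \<in> carrier hecke_space" for c
    using m hecke_smult_mem by (simp add: hecke_space_simps(1))
  show "\<zero>\<^bsub>hecke_space\<^esub> \<oplus>\<^bsub>hecke_space\<^esub> f = f" "1 \<odot>\<^bsub>hecke_space\<^esub> f = f"
    "0 \<odot>\<^bsub>hecke_space\<^esub> f = \<zero>\<^bsub>hecke_space\<^esub>"
    "(a + b) \<odot>\<^bsub>hecke_space\<^esub> f = a \<odot>\<^bsub>hecke_space\<^esub> f \<oplus>\<^bsub>hecke_space\<^esub> b \<odot>\<^bsub>hecke_space\<^esub> f"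
    "(a * b) \<odot>\<^bsub>hecke_space\<^esub> f = a \<odot>\<^bsub>hecke_space\<^esub> (b \<odot>\<^bsub>hecke_space\<^esub> f)"
    unfolding hecke_space_simps(2,3)
    by (rule hecke_fun_eqI; (intro mem | simp add: ap algebra_simps))+
  assume f': "f' \<in> carrier hecke_space"
  then have m': "f' \<in> hecke_fun G T K W" by (simp add: hecke_space_simps)
  show "f \<oplus>\<^bsub>hecke_space\<^esub> f' \<in> carrier hecke_space"
    using mem m' by (simp add: hecke_space_simps(1,3))
  show "f \<oplus>\<^bsub>hecke_space\<^esub> f' = f' \<oplus>\<^bsub>hecke_space\<^esub> f"
    "a \<odot>\<^bsub>hecke_space\<^esub> (f \<oplus>\<^bsub>hecke_space\<^esub> f') = a \<odot>\<^bsub>hecke_space\<^esub> f \<oplus>\<^bsub>hecke_space\<^esub> a \<odot>\<^bsub>hecke_space\<^esub> f'"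
    unfolding hecke_space_simps(2,3)
    by (rule hecke_fun_eqI; (intro mem m' | simp add: ap algebra_simps))+
  assume "f'' \<in> carrier hecke_space"
  then have m'': "f'' \<in> hecke_fun G T K W" by (simp add: hecke_space_simps)
  show "f \<oplus>\<^bsub>hecke_space\<^esub> f' \<oplus>\<^bsub>hecke_space\<^esub> f'' = f \<oplus>\<^bsub>hecke_space\<^esub> (f' \<oplus>\<^bsub>hecke_space\<^esub> f'')"
    unfolding hecke_space_simps(2,3)
    by (rule hecke_fun_eqI; (intro mem m' m'' | simp add: ap algebra_simps))
next
  show "\<zero>\<^bsub>hecke_space\<^esub> \<in> carrier hecke_space" by (simp add: hecke_space_simps(1,2) hecke_zero_mem)
qed

lemma dual_op_fixer: "j \<in> fixer \<Longrightarrow> l \<in> W_dual \<Longrightarrow> dual_op G W j l = l"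
  by (rule W_dual_eqI) (auto simp: dual_op_apply dual_op_mem fixer_K fixer_act fixer_inv)

lemma hecke_fixer_right:
  assumes f: "f \<in> hecke_fun G T K W" and x: "x \<in> carrier G" and j: "j \<in> fixer"
  shows "f (x \<otimes> j) = f x"
proof (rule end_eqI)
  show "f (x \<otimes> j) \<in> lin_maps (dual W) (dual W)" "f x \<in> lin_maps (dual W) (dual W)"
    using hecke_fun_end[OF f] x K_carrier[OF fixer_K[OF j]] by simp_all
qed (use f x j in \<open>simp add: hecke_fun_right fixer_K dual_op_fixer\<close>)

lemma hecke_fixer_left:
  assumes f: "f \<in> hecke_fun G T K W" and x: "x \<in> carrier G" and j: "j \<in> fixer"
  shows "f (j \<otimes> x) = f x"
proof (rule end_eqI)
  show "f (j \<otimes> x) \<in> lin_maps (dual W) (dual W)" "f x \<in> lin_maps (dual W) (dual W)"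
    using hecke_fun_end[OF f] x K_carrier[OF fixer_K[OF j]] by simp_all
qed (use f x j in \<open>simp add: hecke_fun_left fixer_K fixer_act fixer_inv\<close>)

lemma inv_mult_fixer:
  assumes "x \<in> carrier G" "y \<in> carrier G" "j \<in> fixer" "f \<in> hecke_fun G T K W"
  shows "f (inv (x \<otimes> j) \<otimes> y) = f (inv x \<otimes> y)"
proof -
  have j: "j \<in> carrier G" using assms fixer_K K_carrier by blast
  have "inv (x \<otimes> j) \<otimes> y = inv j \<otimes> (inv x \<otimes> y)" using assms j by (simp add: inv_mult_group m_assoc)
  then show ?thesis using hecke_fixer_left[OF assms(4) _ fixer_inv[OF assms(3)]] assms(1,2) by simp
qed

section \<open>Convolution and the algebra axioms\<close>

lemma locally_constant_hecke:
  "f \<in> hecke_fun G T K W \<Longrightarrow> continuous_map T T p \<Longrightarrow> locally_constant T (\<lambda>g. f (p g))"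
  using locally_constant_continuous[OF hecke_fun_locally_constant] .

lemma convolution_integrand:
  assumes f: "f \<in> hecke_fun G T K W" "f' \<in> hecke_fun G T K W" and x: "x \<in> carrier G"
  shows "compactly_supported \<zero>\<^bsub>dual_end W\<^esub> (\<lambda>g. compose (carrier (dual W)) (f g) (f' (inv g \<otimes> x)))"
    and "g \<in> carrier G \<Longrightarrow> compose (carrier (dual W)) (f g) (f' (inv g \<otimes> x)) \<in> carrier (dual_end W)"
proof -
  show m: "compose (carrier (dual W)) (f g) (f' (inv g \<otimes> x)) \<in> carrier (dual_end W)"
    if "g \<in> carrier G" for g
    using lin_maps_compose[OF W_dual_space hecke_fun_end[OF f(2)] hecke_fun_end[OF f(1)]] that x by simp
  show "compactly_supported \<zero>\<^bsub>dual_end W\<^esub> (\<lambda>g. compose (carrier (dual W)) (f g) (f' (inv g \<otimes> x)))"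
  proof (rule compactly_supported_cong[of _ "\<lambda>g. compose (carrier (dual W)) (f g) (if inv g \<otimes> x \<in> carrier G then f' (inv g \<otimes> x) else \<zero>\<^bsub>dual_end W\<^esub>)"])
    have lc: "locally_constant T (\<lambda>g. if inv g \<otimes> x \<in> carrier G then f' (inv g \<otimes> x) else \<zero>\<^bsub>dual_end W\<^esub>)"
      by (rule locally_constant_cong[OF locally_constant_hecke[OF f(2), of "\<lambda>g. inv g \<otimes> x"]])
        (intro continuous_rules x, simp add: x)
    show "compactly_supported \<zero>\<^bsub>dual_end W\<^esub> (\<lambda>g. compose (carrier (dual W)) (f g)
        (if inv g \<otimes> x \<in> carrier G then f' (inv g \<otimes> x) else \<zero>\<^bsub>dual_end W\<^esub>))"
    proof (rule compactly_supported_comp2[OF hecke_fun_compactly_supported[OF f(1)] lc])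
      fix g assume g: "g \<in> carrier G"
      have "compose (carrier (dual W)) \<zero>\<^bsub>dual_end W\<^esub> (f' (inv g \<otimes> x)) = \<zero>\<^bsub>dual_end W\<^esub>"
        using hecke_fun_dual[OF f(2), of "inv g \<otimes> x"] g x by (auto simp: compose_def intro!: restrict_ext)
      then show "compose (carrier (dual W)) \<zero>\<^bsub>dual_end W\<^esub>
          (if inv g \<otimes> x \<in> carrier G then f' (inv g \<otimes> x) else \<zero>\<^bsub>dual_end W\<^esub>) = \<zero>\<^bsub>dual_end W\<^esub>"
        using g x by (simp del: dual_end_simps)
    qed
  qed (simp add: x)
qed

lemma end_eval_functional:
  assumes A: "A \<in> lin_maps (dual W) (dual W)" and l: "l \<in> W_dual" and w: "w \<in> carrier W"
  shows "(\<lambda>B\<in>carrier (dual_end W). A (B l) w) \<in> lin_maps (dual_end W) scalars"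
proof (rule lin_mapsI)
  fix B assume B: "B \<in> carrier (dual_end W)"
  have Bl: "B l \<in> carrier (dual W)" using B l end_mem by simp
  {
    fix C assume C: "C \<in> carrier (dual_end W)"
    have Cl: "C l \<in> carrier (dual W)" using C l end_mem by simp
    have BC: "B \<oplus>\<^bsub>dual_end W\<^esub> C \<in> carrier (dual_end W)"
      using B C complex_space.add_mem[OF W_end_space] by blast
    have "(B \<oplus>\<^bsub>dual_end W\<^esub> C) l = B l \<oplus>\<^bsub>dual W\<^esub> C l" using l by simp
    then have "A ((B \<oplus>\<^bsub>dual_end W\<^esub> C) l) w = A (B l) w + A (C l) w"
      using lin_maps_add[OF A Bl Cl] w by simp
    then show "(\<lambda>B\<in>carrier (dual_end W). A (B l) w) (B \<oplus>\<^bsub>dual_end W\<^esub> C) =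
       (\<lambda>B\<in>carrier (dual_end W). A (B l) w) B \<oplus>\<^bsub>scalars\<^esub> (\<lambda>B\<in>carrier (dual_end W). A (B l) w) C"
      using B C BC by (simp del: dual_end_simps)
  next
    fix c
    have cB: "c \<odot>\<^bsub>dual_end W\<^esub> B \<in> carrier (dual_end W)"
      using B complex_space.smult_mem[OF W_end_space] by blast
    have "(c \<odot>\<^bsub>dual_end W\<^esub> B) l = c \<odot>\<^bsub>dual W\<^esub> B l" using l by simp
    then have "A ((c \<odot>\<^bsub>dual_end W\<^esub> B) l) w = c * A (B l) w"
      using lin_maps_smult[OF A Bl] w by simp
    then show "(\<lambda>B\<in>carrier (dual_end W). A (B l) w) (c \<odot>\<^bsub>dual_end W\<^esub> B) =
       c \<odot>\<^bsub>scalars\<^esub> (\<lambda>B\<in>carrier (dual_end W). A (B l) w) B"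
      using B cB by (simp del: dual_end_simps)
  }
qed auto

lemma hecke_mult_end:
  assumes f: "f \<in> hecke_fun G T K W" "f' \<in> hecke_fun G T K W" and x: "x \<in> carrier G"
  shows "(f \<otimes>\<^bsub>\<H>\<^esub> f') x \<in> lin_maps (dual W) (dual W)"
  using lc_integral_mem[OF W_end_space convolution_integrand[OF f x]] x by (simp add: hecke_algebra_simps)

text \<open>Evaluating an endomorphism \<open>B\<close> to \<open>A (B l) w\<close> is a functional,
  so it passes under the integral. The outer \<open>A\<close> is there for associativity, where it
  is a value of the first factor.\<close>

lemma end_hecke_mult_apply:
  assumes f: "f \<in> hecke_fun G T K W" "f' \<in> hecke_fun G T K W" and x: "x \<in> carrier G"
    and A: "A \<in> lin_maps (dual W) (dual W)" and l: "l \<in> W_dual" and w: "w \<in> carrier W"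
  shows "A ((f \<otimes>\<^bsub>\<H>\<^esub> f') x l) w = (\<integral>g. A (f g (f' (inv g \<otimes> x) l)) w \<partial>\<mu>)"
proof -
  let ?F = "\<lambda>g. compose (carrier (dual W)) (f g) (f' (inv g \<otimes> x))"
  have "A ((f \<otimes>\<^bsub>\<H>\<^esub> f') x l) w = (\<lambda>B\<in>carrier (dual_end W). A (B l) w) (lc_integral \<mu> (dual_end W) ?F)"
    using lc_integral_mem[OF W_end_space convolution_integrand[OF f x]] x
    by (simp add: hecke_algebra_simps del: dual_end_simps)
  also have "\<dots> = (\<integral>g. (\<lambda>B\<in>carrier (dual_end W). A (B l) w) (?F g) \<partial>\<mu>)"
    by (rule functional_lc_integral[OF W_end_space convolution_integrand[OF f x] end_eval_functional[OF A l w]])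
  also have "\<dots> = (\<integral>g. A (f g (f' (inv g \<otimes> x) l)) w \<partial>\<mu>)"
  proof (rule integral_cong_carrier)
    fix g assume "g \<in> carrier G"
    then show "(\<lambda>B\<in>carrier (dual_end W). A (B l) w) (?F g) = A (f g (f' (inv g \<otimes> x) l)) w"
      using convolution_integrand(2)[OF f x] l by (simp add: compose_def)
  qed
  finally show ?thesis .
qed

lemma hecke_mult_apply:
  assumes f: "f \<in> hecke_fun G T K W" "f' \<in> hecke_fun G T K W" and x: "x \<in> carrier G"
    and l: "l \<in> W_dual" and w: "w \<in> carrier W"
  shows "(f \<otimes>\<^bsub>\<H>\<^esub> f') x l w = (\<integral>g. f g (f' (inv g \<otimes> x) l) w \<partial>\<mu>)"
proof -
  have id: "(\<lambda>l\<in>carrier (dual W). l) \<in> lin_maps (dual W) (dual W)" by (rule lin_maps_id[OF W_dual_space])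
  have 1: "(f \<otimes>\<^bsub>\<H>\<^esub> f') x l \<in> W_dual" using end_mem[OF hecke_mult_end[OF f x] l] .
  have 2: "f g (f' (inv g \<otimes> x) l) \<in> W_dual" if "g \<in> carrier G" for g
    using hecke_fun_dual f that x l by simp
  have "(f \<otimes>\<^bsub>\<H>\<^esub> f') x l w = (\<lambda>l\<in>carrier (dual W). l) ((f \<otimes>\<^bsub>\<H>\<^esub> f') x l) w" using 1 by simp
  also have "\<dots> = (\<integral>g. (\<lambda>l\<in>carrier (dual W). l) (f g (f' (inv g \<otimes> x) l)) w \<partial>\<mu>)"
    by (rule end_hecke_mult_apply[OF f x id l w])
  also have "\<dots> = (\<integral>g. f g (f' (inv g \<otimes> x) l) w \<partial>\<mu>)"
    using 2 by (intro integral_cong_carrier) simp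
  finally show ?thesis .
qed

lemma convolution_apply_compactly_supported:
  assumes f: "f \<in> hecke_fun G T K W" "f' \<in> hecke_fun G T K W" and x: "x \<in> carrier G"
    and l: "l \<in> W_dual" and w: "w \<in> carrier W"
  shows "compactly_supported 0 (\<lambda>g. f g (f' (inv g \<otimes> x) l) w)"
  by (rule compactly_supported_cong[OF compactly_supported_comp[OF convolution_integrand(1)[OF f x],
        of "\<lambda>A. A l w"]]) (simp_all add: l w compose_def)

text \<open>The common bound \<open>L\<close> on the supports is a subgroup, so it also bounds the
  support of the convolution. Left equivariance comes from translating the integration variable and
  using that of \<open>f\<close>, right equivariance directly from that of
  \<open>f'\<close>.\<close>

lemma hecke_mult_mem:
  assumes f: "f \<in> hecke_fun G T K W" "f' \<in> hecke_fun G T K W"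
  shows "f \<otimes>\<^bsub>\<H>\<^esub> f' \<in> hecke_fun G T K W"
proof -
  obtain L where L: "cpt_open L" "K \<subseteq> L" "\<forall>x\<in>carrier G - L. f x = \<zero>\<^bsub>dual_end W\<^esub>"
    "\<forall>x\<in>carrier G - L. f' x = \<zero>\<^bsub>dual_end W\<^esub>" by (rule hecke_support_two[OF f])
  show ?thesis
  proof (rule hecke_funI[OF _ hecke_mult_end[OF f] L(1)])
    show "f \<otimes>\<^bsub>\<H>\<^esub> f' \<in> extensional (carrier G)" by (simp add: hecke_algebra_simps)
    fix x l w assume x: "x \<in> carrier G" and l: "l \<in> W_dual" and w: "w \<in> carrier W"
    note fd = hecke_fun_dual[OF f(1)] hecke_fun_dual[OF f(2)]
    show "(f \<otimes>\<^bsub>\<H>\<^esub> f') x l w = 0" if xL: "x \<notin> L"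
    proof -
      have "f g (f' (inv g \<otimes> x) l) w = 0" if g: "g \<in> carrier G" for g
      proof (cases "g \<in> L")
        case True
        then have "inv g \<otimes> x \<in> carrier G - L"
          using x g xL cpt_open_mult_cancel_left[OF L(1) cpt_open_inv[OF L(1) True] x] by simp
        then have "f' (inv g \<otimes> x) = \<zero>\<^bsub>dual_end W\<^esub>" using L(4) by blast
        then show ?thesis using end_comp_zero_apply[OF hecke_fun_end[OF f(1) g] l w] by (simp del: dual_end_simps)
      next
        case False
        then have "f g = \<zero>\<^bsub>dual_end W\<^esub>" using L(3) g by blast
        then show ?thesis using fd(2)[of "inv g \<otimes> x" l] x g l w by simp
      qed
      then have "(\<integral>g. f g (f' (inv g \<otimes> x) l) w \<partial>\<mu>) = (\<integral>g. 0 \<partial>\<mu>)" by (rule integral_cong_carrier)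
      then show ?thesis using hecke_mult_apply[OF f x l w] by simp
    qed
    fix k assume k: "k \<in> K"
    note kc = K_carrier[OF k]
    show "(f \<otimes>\<^bsub>\<H>\<^esub> f') (k \<otimes> x) l w = (f \<otimes>\<^bsub>\<H>\<^esub> f') x l (act W (inv k) w)"
    proof -
      have kx: "k \<otimes> x \<in> carrier G" using kc x by simp
      have "(f \<otimes>\<^bsub>\<H>\<^esub> f') (k \<otimes> x) l w = (\<integral>g. f g (f' (inv g \<otimes> (k \<otimes> x)) l) w \<partial>\<mu>)"
        by (rule hecke_mult_apply[OF f kx l w])
      also have "\<dots> = (\<integral>g. f (k \<otimes> g) (f' (inv (k \<otimes> g) \<otimes> (k \<otimes> x)) l) w \<partial>\<mu>)"
        by (rule integral_translate[OF convolution_apply_compactly_supported[OF f kx l w] kc, symmetric])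
      also have "\<dots> = (\<integral>g. f g (f' (inv g \<otimes> x) l) (act W (inv k) w) \<partial>\<mu>)"
      proof (rule integral_cong_carrier)
        fix g assume g: "g \<in> carrier G"
        have "inv (k \<otimes> g) \<otimes> (k \<otimes> x) = inv g \<otimes> x"
          using g x kc by (simp add: inv_mult_group m_assoc) (simp add: m_assoc[symmetric])
        then show "f (k \<otimes> g) (f' (inv (k \<otimes> g) \<otimes> (k \<otimes> x)) l) w = f g (f' (inv g \<otimes> x) l) (act W (inv k) w)"
          using hecke_fun_left[OF f(1) k g fd(2) w] g x l by simp
      qed
      also have "\<dots> = (f \<otimes>\<^bsub>\<H>\<^esub> f') x l (act W (inv k) w)"
        by (rule hecke_mult_apply[OF f x l act_W_mem[OF K_inv[OF k] w], symmetric])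
      finally show ?thesis .
    qed
    show "(f \<otimes>\<^bsub>\<H>\<^esub> f') (x \<otimes> k) l w = (f \<otimes>\<^bsub>\<H>\<^esub> f') x (dual_op G W k l) w"
    proof -
      have xk: "x \<otimes> k \<in> carrier G" using kc x by simp
      have "(f \<otimes>\<^bsub>\<H>\<^esub> f') (x \<otimes> k) l w = (\<integral>g. f g (f' (inv g \<otimes> (x \<otimes> k)) l) w \<partial>\<mu>)"
        by (rule hecke_mult_apply[OF f xk l w])
      also have "\<dots> = (\<integral>g. f g (f' (inv g \<otimes> x) (dual_op G W k l)) w \<partial>\<mu>)"
      proof (rule integral_cong_carrier)
        fix g assume g: "g \<in> carrier G"
        have "f' ((inv g \<otimes> x) \<otimes> k) l = f' (inv g \<otimes> x) (dual_op G W k l)"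
        proof (rule W_dual_eqI)
          show "f' (inv g \<otimes> x \<otimes> k) l \<in> W_dual" "f' (inv g \<otimes> x) (dual_op G W k l) \<in> W_dual"
            using fd g x kc l k by (simp_all add: dual_op_mem)
        qed (use hecke_fun_right[OF f(2) k] g x l in simp)
        then show "f g (f' (inv g \<otimes> (x \<otimes> k)) l) w = f g (f' (inv g \<otimes> x) (dual_op G W k l)) w"
          using g x kc by (simp add: m_assoc)
      qed
      also have "\<dots> = (f \<otimes>\<^bsub>\<H>\<^esub> f') x (dual_op G W k l) w"
        by (rule hecke_mult_apply[OF f x dual_op_mem[OF k l] w, symmetric])
      finally show ?thesis .
    qed
  qed
qed

text \<open>When the invariance group \<open>J\<close> and the bound \<open>L\<close> for the second
  variable do not depend on the first, the curried function inherits both.\<close>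

lemma fubini_right_invariant:
  fixes F :: "'g \<Rightarrow> 'g \<Rightarrow> complex"
  assumes J: "openin T J" "\<one> \<in> J" and L: "cpt_open L"
    and inv: "\<And>x y j. x \<in> carrier G \<Longrightarrow> y \<in> carrier G \<Longrightarrow> j \<in> J \<Longrightarrow> F x (y \<otimes> j) = F x y"
    and supp: "\<And>x y. x \<in> carrier G \<Longrightarrow> y \<in> carrier G \<Longrightarrow> y \<notin> L \<Longrightarrow> F x y = 0"
    and sec: "\<And>y. y \<in> carrier G \<Longrightarrow> compactly_supported 0 (\<lambda>x. F x y)"
  shows "(\<integral>x. \<integral>y. F x y \<partial>\<mu> \<partial>\<mu>) = (\<integral>y. \<integral>x. F x y \<partial>\<mu> \<partial>\<mu>)"
proof (rule fubini_compactly_supported[OF compactly_supportedI[OF _ L] sec])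
  show "locally_constant T (\<lambda>y. \<lambda>x\<in>carrier G. F x y)"
    by (rule locally_constant_right_invariant[OF J]) (auto intro!: restrict_ext inv)
  show "(\<lambda>x\<in>carrier G. F x y) = (\<lambda>x\<in>carrier G. 0)" if "y \<in> carrier G" "y \<notin> L" for y
    using that by (intro restrict_ext supp)
qed

lemma double_convolution_section:
  assumes f: "f1 \<in> hecke_fun G T K W" "f2 \<in> hecke_fun G T K W" "f3 \<in> hecke_fun G T K W"
    and x: "x \<in> carrier G" and l: "l \<in> W_dual" and w: "w \<in> carrier W" and d: "d \<in> carrier G"
  shows "compactly_supported 0 (\<lambda>c. f1 d (f2 (inv d \<otimes> c) (f3 (inv c \<otimes> x) l)) w)"
proof -
  have cs: "compactly_supported \<zero>\<^bsub>dual_end W\<^esub> (\<lambda>c. f2 (inv d \<otimes> c))"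
    by (rule compactly_supported_translate[OF hecke_fun_compactly_supported[OF f(2)] inv_closed[OF d]])
  have lc: "locally_constant T (\<lambda>c. f3 (inv c \<otimes> x))"
    by (rule locally_constant_hecke[OF f(3)]) (intro continuous_rules x)
  have "compactly_supported 0 (\<lambda>c. if inv c \<otimes> x \<in> carrier G then f1 d (f2 (inv d \<otimes> c) (f3 (inv c \<otimes> x) l)) w else 0)"
  proof (rule compactly_supported_cong[OF compactly_supported_comp2[OF cs lc]])
    fix c assume c: "c \<in> carrier G"
    have "f3 (inv c \<otimes> x) l \<in> W_dual" using hecke_fun_dual[OF f(3) _ l] c x by simp
    then show "f1 d (\<zero>\<^bsub>dual_end W\<^esub> (f3 (inv c \<otimes> x) l)) w = 0"
      by (intro end_comp_zero_apply hecke_fun_end[OF f(1) d] w)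
    show "f1 d (f2 (inv d \<otimes> c) (f3 (inv c \<otimes> x) l)) w =
      (if inv c \<otimes> x \<in> carrier G then f1 d (f2 (inv d \<otimes> c) (f3 (inv c \<otimes> x) l)) w else 0)"
      using c x by simp
  qed
  then show ?thesis by (rule compactly_supported_cong) (simp add: x)
qed

text \<open>Exchange the two integrals and replace \<open>c\<close> by \<open>d c\<close> in the
  inner one.\<close>

lemma hecke_mult_assoc:
  assumes f: "f1 \<in> hecke_fun G T K W" "f2 \<in> hecke_fun G T K W" "f3 \<in> hecke_fun G T K W"
  shows "f1 \<otimes>\<^bsub>\<H>\<^esub> f2 \<otimes>\<^bsub>\<H>\<^esub> f3 = f1 \<otimes>\<^bsub>\<H>\<^esub> (f2 \<otimes>\<^bsub>\<H>\<^esub> f3)"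
proof (rule hecke_fun_eqI)
  fix x l w assume x: "x \<in> carrier G" and l: "l \<in> W_dual" and w: "w \<in> carrier W"
  note f12 = hecke_mult_mem[OF f(1,2)] and f23 = hecke_mult_mem[OF f(2,3)]
  note e1 = hecke_fun_end[OF f(1)] and d2 = hecke_fun_dual[OF f(2)] and d3 = hecke_fun_dual[OF f(3)]
  let ?F = "\<lambda>c d. f1 d (f2 (inv d \<otimes> c) (f3 (inv c \<otimes> x) l)) w"
  obtain L where L: "cpt_open L" "K \<subseteq> L" "\<forall>x\<in>carrier G - L. f1 x = \<zero>\<^bsub>dual_end W\<^esub>"
    by (rule hecke_fun_support[OF f(1)])
  have "(f1 \<otimes>\<^bsub>\<H>\<^esub> f2 \<otimes>\<^bsub>\<H>\<^esub> f3) x l w = (\<integral>c. (f1 \<otimes>\<^bsub>\<H>\<^esub> f2) c (f3 (inv c \<otimes> x) l) w \<partial>\<mu>)"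
    by (rule hecke_mult_apply[OF f12 f(3) x l w])
  also have "\<dots> = (\<integral>c. \<integral>d. ?F c d \<partial>\<mu> \<partial>\<mu>)"
  proof (rule integral_cong_carrier)
    fix c assume c: "c \<in> carrier G"
    show "(f1 \<otimes>\<^bsub>\<H>\<^esub> f2) c (f3 (inv c \<otimes> x) l) w = (\<integral>d. ?F c d \<partial>\<mu>)"
      by (rule hecke_mult_apply[OF f(1,2) c _ w]) (use d3 c x l in simp)
  qed
  also have "\<dots> = (\<integral>d. \<integral>c. ?F c d \<partial>\<mu> \<partial>\<mu>)"
  proof (rule fubini_right_invariant[OF openin_fixer fixer_one L(1)])
    fix c d assume c: "c \<in> carrier G" and d: "d \<in> carrier G"
    show "?F c (d \<otimes> j) = ?F c d" if "j \<in> fixer" for j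
      using that c d by (simp add: hecke_fixer_right[OF f(1)] inv_mult_fixer[OF d c that f(2)])
    show "?F c d = 0" if "d \<notin> L"
    proof -
      have "f1 d = \<zero>\<^bsub>dual_end W\<^esub>" using L(3) d that by blast
      then show ?thesis using d2[of "inv d \<otimes> c" "f3 (inv c \<otimes> x) l"] d3[of "inv c \<otimes> x" l] x c d l w by simp
    qed
  next
    fix d assume "d \<in> carrier G"
    then show "compactly_supported 0 (\<lambda>c. ?F c d)" by (rule double_convolution_section[OF f x l w])
  qed
  also have "\<dots> = (\<integral>d. f1 d ((f2 \<otimes>\<^bsub>\<H>\<^esub> f3) (inv d \<otimes> x) l) w \<partial>\<mu>)"
  proof (rule integral_cong_carrier)
    fix d assume d: "d \<in> carrier G"
    have "(\<integral>c. ?F c d \<partial>\<mu>) = (\<integral>c. ?F (d \<otimes> c) d \<partial>\<mu>)"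
      by (rule integral_translate[OF double_convolution_section[OF f x l w d] d, symmetric])
    also have "\<dots> = (\<integral>c. f1 d (f2 c (f3 (inv c \<otimes> (inv d \<otimes> x)) l)) w \<partial>\<mu>)"
    proof (rule integral_cong_carrier)
      fix c assume c: "c \<in> carrier G"
      have "inv d \<otimes> (d \<otimes> c) = c" using c d by (simp add: m_assoc[symmetric])
      then show "?F (d \<otimes> c) d = f1 d (f2 c (f3 (inv c \<otimes> (inv d \<otimes> x)) l)) w"
        using c d x by (simp add: inv_mult_group m_assoc)
    qed
    also have "\<dots> = f1 d ((f2 \<otimes>\<^bsub>\<H>\<^esub> f3) (inv d \<otimes> x) l) w"
      by (rule end_hecke_mult_apply[OF f(2,3) _ e1[OF d] l w, symmetric]) (simp add: d x)
    finally show "(\<integral>c. ?F c d \<partial>\<mu>) = f1 d ((f2 \<otimes>\<^bsub>\<H>\<^esub> f3) (inv d \<otimes> x) l) w" .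
  qed
  also have "\<dots> = (f1 \<otimes>\<^bsub>\<H>\<^esub> (f2 \<otimes>\<^bsub>\<H>\<^esub> f3)) x l w"
    by (rule hecke_mult_apply[OF f(1) f23 x l w, symmetric])
  finally show "(f1 \<otimes>\<^bsub>\<H>\<^esub> f2 \<otimes>\<^bsub>\<H>\<^esub> f3) x l w = (f1 \<otimes>\<^bsub>\<H>\<^esub> (f2 \<otimes>\<^bsub>\<H>\<^esub> f3)) x l w" .
qed (intro hecke_mult_mem f)+

lemma measure_K_nonzero: "complex_of_real (measure \<mu> K) \<noteq> 0"
  using measure_cpt_open_pos[OF K] by simp

lemma hecke_one_end: "x \<in> carrier G \<Longrightarrow> \<one>\<^bsub>\<H>\<^esub> x \<in> lin_maps (dual W) (dual W)"
  using complex_space.smult_mem[OF W_end_space, of "dual_op G W x"] dual_op_end[of x] end_zero_mem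
  by (simp add: hecke_algebra_simps del: dual_end_simps(2-))

lemma hecke_one_mem: "\<one>\<^bsub>\<H>\<^esub> \<in> hecke_fun G T K W"
proof (rule hecke_funI[OF _ hecke_one_end K])
  show "\<one>\<^bsub>\<H>\<^esub> \<in> extensional (carrier G)" by (simp add: hecke_algebra_simps)
  fix g l w assume g: "g \<in> carrier G" and l: "l \<in> W_dual" and w: "w \<in> carrier W"
  show "\<one>\<^bsub>\<H>\<^esub> g l w = 0" if "g \<notin> K" using that g l w by (simp add: hecke_one_apply)
  fix k assume k: "k \<in> K"
  show "\<one>\<^bsub>\<H>\<^esub> (k \<otimes> g) l w = \<one>\<^bsub>\<H>\<^esub> g l (act W (inv k) w)"
    using k g l w cpt_open_mult_cancel_left[OF K k g]
    by (auto simp: hecke_one_apply K_carrier act_W_mem K_inv inv_mult_group act_W_mult)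
  show "\<one>\<^bsub>\<H>\<^esub> (g \<otimes> k) l w = \<one>\<^bsub>\<H>\<^esub> g (dual_op G W k l) w"
    using k g l w cpt_open_mult_cancel_right[OF K k g]
    by (auto simp: hecke_one_apply K_carrier act_W_mem K_inv inv_mult_group act_W_mult dual_op_mem dual_op_apply)
qed

lemma integral_K: "(\<integral>y. (if y \<in> K then c else 0) \<partial>\<mu>) = measure \<mu> K * (c :: complex)"
proof -
  have "(\<integral>y. (if y \<in> K then c else 0) \<partial>\<mu>) = (\<integral>y. (if inv \<one> \<otimes> y \<in> K then c else 0) \<partial>\<mu>)"
    by (rule integral_cong_carrier) simp
  also have "\<dots> = measure \<mu> K * c" by (rule integral_coset[OF K one_closed])
  finally show ?thesis .
qed

lemma hecke_l_one:
  assumes f: "f \<in> hecke_fun G T K W" shows "\<one>\<^bsub>\<H>\<^esub> \<otimes>\<^bsub>\<H>\<^esub> f = f"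
proof (rule hecke_fun_eqI)
  fix x l w assume x: "x \<in> carrier G" and l: "l \<in> W_dual" and w: "w \<in> carrier W"
  have "(\<one>\<^bsub>\<H>\<^esub> \<otimes>\<^bsub>\<H>\<^esub> f) x l w = (\<integral>g. \<one>\<^bsub>\<H>\<^esub> g (f (inv g \<otimes> x) l) w \<partial>\<mu>)"
    by (rule hecke_mult_apply[OF hecke_one_mem f x l w])
  also have "\<dots> = (\<integral>g. (if g \<in> K then complex_of_real (1 / measure \<mu> K) * f x l w else 0) \<partial>\<mu>)"
  proof (rule integral_cong_carrier)
    fix g assume g: "g \<in> carrier G"
    have "f (inv g \<otimes> x) l (act W (inv g) w) = f x l w" if gK: "g \<in> K"
      using hecke_fun_left[OF f K_inv[OF gK] x l act_W_mem[OF K_inv[OF gK] w]] act_W_cancel(2)[OF gK w] g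
      by simp
    then show "\<one>\<^bsub>\<H>\<^esub> g (f (inv g \<otimes> x) l) w = (if g \<in> K then complex_of_real (1 / measure \<mu> K) * f x l w else 0)"
      using g x l w hecke_fun_dual[OF f _ l, of "inv g \<otimes> x"] by (simp add: hecke_one_apply)
  qed
  also have "\<dots> = f x l w" unfolding integral_K using measure_K_nonzero by simp
  finally show "(\<one>\<^bsub>\<H>\<^esub> \<otimes>\<^bsub>\<H>\<^esub> f) x l w = f x l w" .
qed (intro hecke_mult_mem f hecke_one_mem)+

lemma hecke_one_eq_smult:
  assumes "k \<in> K" "l \<in> W_dual"
  shows "\<one>\<^bsub>\<H>\<^esub> k l = complex_of_real (1 / measure \<mu> K) \<odot>\<^bsub>dual W\<^esub> dual_op G W k l"
proof (rule W_dual_eqI)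
  have k: "k \<in> carrier G" using assms K_carrier by simp
  show "\<one>\<^bsub>\<H>\<^esub> k l \<in> W_dual" using end_mem[OF hecke_one_end[OF k] assms(2)] .
  show "complex_of_real (1 / measure \<mu> K) \<odot>\<^bsub>dual W\<^esub> dual_op G W k l \<in> W_dual"
  proof -
    have "dual_op G W k l \<in> carrier (dual W)" using dual_op_mem[OF assms] by simp
    then have "complex_of_real (1 / measure \<mu> K) \<odot>\<^bsub>dual W\<^esub> dual_op G W k l \<in> carrier (dual W)"
      by (rule complex_space.smult_mem[OF W_dual_space])
    then show ?thesis by (simp only: dual_simps(1))
  qed
  show "\<one>\<^bsub>\<H>\<^esub> k l w = (complex_of_real (1 / measure \<mu> K) \<odot>\<^bsub>dual W\<^esub> dual_op G W k l) w"
    if "w \<in> carrier W" for w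
    using that assms k by (simp add: hecke_one_apply dual_op_apply)
qed

text \<open>By right equivariance the integrand is constant on the coset \<open>x K\<close>, and it
  vanishes outside; the volume of the coset cancels the normalisation of the unit.\<close>

lemma hecke_r_one:
  assumes f: "f \<in> hecke_fun G T K W" shows "f \<otimes>\<^bsub>\<H>\<^esub> \<one>\<^bsub>\<H>\<^esub> = f"
proof (rule hecke_fun_eqI)
  fix x l w assume x: "x \<in> carrier G" and l: "l \<in> W_dual" and w: "w \<in> carrier W"
  have "(f \<otimes>\<^bsub>\<H>\<^esub> \<one>\<^bsub>\<H>\<^esub>) x l w = (\<integral>g. f g (\<one>\<^bsub>\<H>\<^esub> (inv g \<otimes> x) l) w \<partial>\<mu>)"
    by (rule hecke_mult_apply[OF f hecke_one_mem x l w])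
  also have "\<dots> = (\<integral>g. (if inv x \<otimes> g \<in> K then complex_of_real (1 / measure \<mu> K) * f x l w else 0) \<partial>\<mu>)"
  proof (rule integral_cong_carrier)
    fix g assume g: "g \<in> carrier G"
    have iff: "inv x \<otimes> g \<in> K \<longleftrightarrow> inv g \<otimes> x \<in> K"
      using cpt_open_inv_iff[OF K, of "inv g \<otimes> x"] g x by (simp add: inv_mult_group)
    show "f g (\<one>\<^bsub>\<H>\<^esub> (inv g \<otimes> x) l) w = (if inv x \<otimes> g \<in> K then complex_of_real (1 / measure \<mu> K) * f x l w else 0)"
    proof (cases "inv g \<otimes> x \<in> K")
      case True
      have "f g (dual_op G W (inv g \<otimes> x) l) w = f (g \<otimes> (inv g \<otimes> x)) l w"
        using hecke_fun_right[OF f True g l w] by simp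
      also have "g \<otimes> (inv g \<otimes> x) = x" using g x by (simp add: m_assoc[symmetric])
      finally have "f g (dual_op G W (inv g \<otimes> x) l) w = f x l w" .
      then show ?thesis
        using True iff end_smult_apply[OF hecke_fun_end[OF f g] dual_op_mem[OF True l] w]
        by (simp add: hecke_one_eq_smult[OF True l] del: dual_simps)
    next
      case False
      have "\<one>\<^bsub>\<H>\<^esub> (inv g \<otimes> x) = \<zero>\<^bsub>dual_end W\<^esub>" using False g x by (simp add: hecke_algebra_simps)
      then show ?thesis using False iff end_comp_zero_apply[OF hecke_fun_end[OF f g] l w]
        by (simp del: dual_end_simps)
    qed
  qed
  also have "\<dots> = f x l w" unfolding integral_coset[OF K x] using measure_K_nonzero by simp
  finally show "(f \<otimes>\<^bsub>\<H>\<^esub> \<one>\<^bsub>\<H>\<^esub>) x l w = f x l w" .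
qed (intro hecke_mult_mem f hecke_one_mem)+

lemma hecke_l_distr:
  assumes f: "f1 \<in> hecke_fun G T K W" "f2 \<in> hecke_fun G T K W" "f3 \<in> hecke_fun G T K W"
  shows "(f1 \<oplus>\<^bsub>\<H>\<^esub> f2) \<otimes>\<^bsub>\<H>\<^esub> f3 = f1 \<otimes>\<^bsub>\<H>\<^esub> f3 \<oplus>\<^bsub>\<H>\<^esub> f2 \<otimes>\<^bsub>\<H>\<^esub> f3"
proof (rule hecke_fun_eqI)
  fix x l w assume x: "x \<in> carrier G" and l: "l \<in> W_dual" and w: "w \<in> carrier W"
  have "((f1 \<oplus>\<^bsub>\<H>\<^esub> f2) \<otimes>\<^bsub>\<H>\<^esub> f3) x l w = (\<integral>g. (f1 \<oplus>\<^bsub>\<H>\<^esub> f2) g (f3 (inv g \<otimes> x) l) w \<partial>\<mu>)"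
    by (rule hecke_mult_apply[OF hecke_add_mem[OF f(1,2)] f(3) x l w])
  also have "\<dots> = (\<integral>g. f1 g (f3 (inv g \<otimes> x) l) w + f2 g (f3 (inv g \<otimes> x) l) w \<partial>\<mu>)"
    using hecke_fun_dual[OF f(3) _ l] x w by (intro integral_cong_carrier) (simp add: hecke_add_apply)
  also have "\<dots> = (\<integral>g. f1 g (f3 (inv g \<otimes> x) l) w \<partial>\<mu>) + (\<integral>g. f2 g (f3 (inv g \<otimes> x) l) w \<partial>\<mu>)"
    by (intro Bochner_Integration.integral_add integrable_compactly_supported
        convolution_apply_compactly_supported f x l w)
  also have "\<dots> = (f1 \<otimes>\<^bsub>\<H>\<^esub> f3 \<oplus>\<^bsub>\<H>\<^esub> f2 \<otimes>\<^bsub>\<H>\<^esub> f3) x l w"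
    using hecke_mult_apply[OF f(1,3) x l w] hecke_mult_apply[OF f(2,3) x l w] x l w
    by (simp add: hecke_add_apply)
  finally show "((f1 \<oplus>\<^bsub>\<H>\<^esub> f2) \<otimes>\<^bsub>\<H>\<^esub> f3) x l w = (f1 \<otimes>\<^bsub>\<H>\<^esub> f3 \<oplus>\<^bsub>\<H>\<^esub> f2 \<otimes>\<^bsub>\<H>\<^esub> f3) x l w" .
qed (intro hecke_mult_mem hecke_add_mem f)+

lemma hecke_r_distr:
  assumes f: "f1 \<in> hecke_fun G T K W" "f2 \<in> hecke_fun G T K W" "f3 \<in> hecke_fun G T K W"
  shows "f3 \<otimes>\<^bsub>\<H>\<^esub> (f1 \<oplus>\<^bsub>\<H>\<^esub> f2) = f3 \<otimes>\<^bsub>\<H>\<^esub> f1 \<oplus>\<^bsub>\<H>\<^esub> f3 \<otimes>\<^bsub>\<H>\<^esub> f2"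
proof (rule hecke_fun_eqI)
  fix x l w assume x: "x \<in> carrier G" and l: "l \<in> W_dual" and w: "w \<in> carrier W"
  have "(f3 \<otimes>\<^bsub>\<H>\<^esub> (f1 \<oplus>\<^bsub>\<H>\<^esub> f2)) x l w = (\<integral>g. f3 g ((f1 \<oplus>\<^bsub>\<H>\<^esub> f2) (inv g \<otimes> x) l) w \<partial>\<mu>)"
    by (rule hecke_mult_apply[OF f(3) hecke_add_mem[OF f(1,2)] x l w])
  also have "\<dots> = (\<integral>g. f3 g (f1 (inv g \<otimes> x) l) w + f3 g (f2 (inv g \<otimes> x) l) w \<partial>\<mu>)"
  proof (rule integral_cong_carrier)
    fix g assume g: "g \<in> carrier G"
    have m: "f1 (inv g \<otimes> x) l \<in> carrier (dual W)" "f2 (inv g \<otimes> x) l \<in> carrier (dual W)"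
      using hecke_fun_dual[OF f(1) _ l] hecke_fun_dual[OF f(2) _ l] g x by simp_all
    have "(f1 \<oplus>\<^bsub>\<H>\<^esub> f2) (inv g \<otimes> x) l = f1 (inv g \<otimes> x) l \<oplus>\<^bsub>dual W\<^esub> f2 (inv g \<otimes> x) l"
      using g x l by (simp add: hecke_algebra_simps)
    then show "f3 g ((f1 \<oplus>\<^bsub>\<H>\<^esub> f2) (inv g \<otimes> x) l) w = f3 g (f1 (inv g \<otimes> x) l) w + f3 g (f2 (inv g \<otimes> x) l) w"
      using lin_maps_add[OF hecke_fun_end[OF f(3) g] m] w by simp
  qed
  also have "\<dots> = (\<integral>g. f3 g (f1 (inv g \<otimes> x) l) w \<partial>\<mu>) + (\<integral>g. f3 g (f2 (inv g \<otimes> x) l) w \<partial>\<mu>)"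
    by (intro Bochner_Integration.integral_add integrable_compactly_supported
        convolution_apply_compactly_supported f x l w)
  also have "\<dots> = (f3 \<otimes>\<^bsub>\<H>\<^esub> f1 \<oplus>\<^bsub>\<H>\<^esub> f3 \<otimes>\<^bsub>\<H>\<^esub> f2) x l w"
    using hecke_mult_apply[OF f(3,1) x l w] hecke_mult_apply[OF f(3,2) x l w] x l w
    by (simp add: hecke_add_apply)
  finally show "(f3 \<otimes>\<^bsub>\<H>\<^esub> (f1 \<oplus>\<^bsub>\<H>\<^esub> f2)) x l w = (f3 \<otimes>\<^bsub>\<H>\<^esub> f1 \<oplus>\<^bsub>\<H>\<^esub> f3 \<otimes>\<^bsub>\<H>\<^esub> f2) x l w" .
qed (intro hecke_mult_mem hecke_add_mem f)+

text \<open>Addition is shared with \<open>hecke_space\<close>, so the group laws are taken over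
  from the vector space.\<close>

lemma ring_hecke_algebra: "ring \<H>"
proof (rule ringI)
  have ag: "abelian_group hecke_space"
    using complex_space_hecke unfolding complex_space_def Module.module_def by blast
  note E = abelian_groupE[OF ag, unfolded hecke_space_simps(1,2,3)]
  show "abelian_group \<H>"
    by (rule abelian_groupI; unfold hecke_algebra_simps(1)) (fact E | rule E; assumption)+
  show "Group.monoid \<H>"
    by (rule monoidI)
      (simp_all add: hecke_algebra_simps(1) hecke_mult_mem hecke_one_mem hecke_mult_assoc hecke_l_one hecke_r_one)
qed (simp_all add: hecke_algebra_simps(1) hecke_l_distr hecke_r_distr)

end

section \<open>Spaces of equivariant maps as Hecke modules\<close>

locale hecke_rep = hecke_setup G T \<mu> K W + M: smooth_rep G T M
  for G :: "'g monoid" (structure) and T :: "'g topology" and \<mu> :: "'g measure"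
    and K :: "'g set" and W :: "('g, 'w) rep" and M :: "('g, 'm) rep"
begin

sublocale M: complex_space M
  by unfold_locales

abbreviation "K_homs \<equiv> rep_homs (subgrp G K) W M"
abbreviation "F_M \<equiv> rho_inv_obj G \<mu> K W M"
abbreviation "M_dual \<equiv> lin_maps M scalars"

lemma act_M:
  assumes "g \<in> carrier G"
  shows act_M_mem: "v \<in> carrier M \<Longrightarrow> act M g v \<in> carrier M"
    and act_M_add: "v \<in> carrier M \<Longrightarrow> v' \<in> carrier M \<Longrightarrow> act M g (v \<oplus>\<^bsub>M\<^esub> v') = act M g v \<oplus>\<^bsub>M\<^esub> act M g v'"
    and act_M_smult: "v \<in> carrier M \<Longrightarrow> act M g (c \<odot>\<^bsub>M\<^esub> v) = c \<odot>\<^bsub>M\<^esub> act M g v"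
  using lin_mapsD[OF M.act_linear[of g]] assms by auto

lemma act_M_zero: "g \<in> carrier G \<Longrightarrow> act M g \<zero>\<^bsub>M\<^esub> = \<zero>\<^bsub>M\<^esub>"
  using act_M_smult[of g "\<zero>\<^bsub>M\<^esub>" 0] act_M_mem[of g "\<zero>\<^bsub>M\<^esub>"] by simp

lemma functional_act:
  assumes "\<xi> \<in> M_dual" "g \<in> carrier G"
  shows "(\<lambda>v\<in>carrier M. \<xi> (act M g v)) \<in> M_dual"
  by (rule lin_mapsI) (auto simp: assms act_M_mem act_M_add act_M_smult M.functional_simps[OF assms(1)])

lemma locally_constant_orbit:
  assumes "v \<in> carrier M" shows "locally_constant T (\<lambda>g. act M g v)"
proof (rule locally_constant_right_invariant[OF M.smooth[OF assms]])
  show "\<one> \<in> {g \<in> carrier G. act M g v = v}" using M.act_one assms by simp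
  fix x j assume "x \<in> carrier G" and j: "j \<in> {g \<in> carrier G. act M g v = v}"
  then show "act M (x \<otimes> j) v = act M x v" using M.act_mult[OF _ _ assms, of x j] by auto
qed

lemma locally_constant_act:
  assumes y: "locally_constant T y" "\<And>g. g \<in> carrier G \<Longrightarrow> y g \<in> carrier M"
  shows "locally_constant T (\<lambda>g. act M g (y g))"
proof (rule locally_constantI)
  fix x assume x: "x \<in> carrier G"
  obtain U where U: "openin T U" "x \<in> U" "\<forall>g\<in>U. y g = y x" by (rule locally_constantD[OF y(1) x])
  obtain V where V: "openin T V" "x \<in> V" "\<forall>g\<in>V. act M g (y x) = act M x (y x)"
    by (rule locally_constantD[OF locally_constant_orbit[OF y(2)[OF x]] x])
  show "\<exists>U. openin T U \<and> x \<in> U \<and> (\<forall>g\<in>U. act M g (y g) = act M x (y x))"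
  proof (intro exI conjI ballI)
    show "openin T (U \<inter> V)" "x \<in> U \<inter> V" using U(1,2) V(1,2) by auto
    fix g assume "g \<in> U \<inter> V"
    then have "y g = y x" "act M g (y x) = act M x (y x)" using U(3) V(3) by blast+
    then show "act M g (y g) = act M x (y x)" by (simp only:)
  qed
qed

lemma K_homsD:
  assumes "\<phi> \<in> K_homs"
  shows K_homs_lin: "\<phi> \<in> lin_maps W M"
    and K_homs_equivariant: "k \<in> K \<Longrightarrow> w \<in> carrier W \<Longrightarrow> \<phi> (act W k w) = act M k (\<phi> w)"
    and K_homs_mem: "w \<in> carrier W \<Longrightarrow> \<phi> w \<in> carrier M"
  using assms lin_maps_mem[of \<phi> W M w] unfolding rep_homs_def by auto

lemma K_homsI:
  assumes "\<phi> \<in> lin_maps W M" "\<And>k w. k \<in> K \<Longrightarrow> w \<in> carrier W \<Longrightarrow> \<phi> (act W k w) = act M k (\<phi> w)"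
  shows "\<phi> \<in> K_homs"
  using assms unfolding rep_homs_def by simp

lemma K_homs_zero: "\<phi> \<in> K_homs \<Longrightarrow> \<phi> \<zero>\<^bsub>W\<^esub> = \<zero>\<^bsub>M\<^esub>"
  by (rule lin_maps_zero[OF K_homs_lin W.complex_space_axioms M.complex_space_axioms])

lemma F_M_simps:
  "carrier F_M = K_homs" "\<zero>\<^bsub>F_M\<^esub> = (\<lambda>w\<in>carrier W. \<zero>\<^bsub>M\<^esub>)"
  "\<phi> \<oplus>\<^bsub>F_M\<^esub> \<psi> = (\<lambda>w\<in>carrier W. \<phi> w \<oplus>\<^bsub>M\<^esub> \<psi> w)"
  "f \<odot>\<^bsub>F_M\<^esub> \<phi> = (\<lambda>w\<in>carrier W. lc_integral \<mu> M (\<lambda>g. act M g (\<phi> (transposed W (f g) w))))"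
  by (simp_all add: rho_inv_obj_def)

text \<open>Places the invariants inside \<open>hom_space W M\<close>, from which \<open>F_M\<close>
  inherits its additive group.\<close>

lemma K_homs_submodule: "submodule K_homs complex_ring (hom_space W M)"
proof -
  interpret H: complex_space "hom_space W M"
    by (rule complex_space_hom_space[OF W.complex_space_axioms M.complex_space_axioms])
  show ?thesis
    unfolding H.submodule_iff
  proof (intro conjI ballI allI)
    show "K_homs \<subseteq> carrier (hom_space W M)" by (auto simp: K_homs_lin)
    show "\<zero>\<^bsub>hom_space W M\<^esub> \<in> K_homs"
      using H.zero_mem by (intro K_homsI) (simp_all add: act_W_mem act_M_zero K_carrier)
    fix \<phi> assume \<phi>: "\<phi> \<in> K_homs"
    {
      fix \<psi> assume \<psi>: "\<psi> \<in> K_homs"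
      show "\<phi> \<oplus>\<^bsub>hom_space W M\<^esub> \<psi> \<in> K_homs"
      proof (rule K_homsI)
        show "\<phi> \<oplus>\<^bsub>hom_space W M\<^esub> \<psi> \<in> lin_maps W M"
          using H.add_mem[of \<phi> \<psi>] K_homs_lin \<phi> \<psi> by (simp del: hom_space_simps(2-))
      qed (use \<phi> \<psi> in \<open>simp add: act_W_mem K_homs_equivariant K_homs_mem act_M_add K_carrier\<close>)
    next
      fix c
      show "c \<odot>\<^bsub>hom_space W M\<^esub> \<phi> \<in> K_homs"
      proof (rule K_homsI)
        show "c \<odot>\<^bsub>hom_space W M\<^esub> \<phi> \<in> lin_maps W M"
          using H.smult_mem[of \<phi> c] K_homs_lin \<phi> by (simp del: hom_space_simps(2-))
      qed (use \<phi> in \<open>simp add: act_W_mem K_homs_equivariant K_homs_mem act_M_smult K_carrier\<close>)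
    }
  qed
qed

lemma abelian_group_F_M: "abelian_group F_M"
proof -
  have H: "complex_space (hom_space W M)"
    by (rule complex_space_hom_space[OF W.complex_space_axioms M.complex_space_axioms])
  have ag: "abelian_group ((hom_space W M)\<lparr>carrier := K_homs\<rparr>)"
    using submodule.submodule_is_module[OF K_homs_submodule H[unfolded complex_space_def]]
    unfolding Module.module_def by blast
  have eqs: "x \<oplus>\<^bsub>(hom_space W M)\<lparr>carrier := K_homs\<rparr>\<^esub> y = x \<oplus>\<^bsub>F_M\<^esub> y"
    "\<zero>\<^bsub>(hom_space W M)\<lparr>carrier := K_homs\<rparr>\<^esub> = \<zero>\<^bsub>F_M\<^esub>"
    "carrier ((hom_space W M)\<lparr>carrier := K_homs\<rparr>) = K_homs" for x y
    by (simp_all add: F_M_simps)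
  note E = abelian_groupE[OF ag, unfolded eqs]
  show ?thesis
    by (rule abelian_groupI; unfold F_M_simps(1)) (fact E)+
qed

lemma transposed_zero: "w \<in> carrier W \<Longrightarrow> transposed W \<zero>\<^bsub>dual_end W\<^esub> w = \<zero>\<^bsub>W\<^esub>"
  using end_zero_mem by (intro transposed_eqI) (auto simp: W.functional_zero simp del: dual_end_simps(2) simp: end_zero_apply)

lemma hecke_transposed_mem:
  "f \<in> hecke_fun G T K W \<Longrightarrow> g \<in> carrier G \<Longrightarrow> w \<in> carrier W \<Longrightarrow> transposed W (f g) w \<in> carrier W"
  using transposed_mem hecke_fun_end by blast

text \<open>The translation by \<open>d\<close> prepares associativity, where the second factor is
  evaluated at \<open>inv g \<otimes> x\<close>.\<close>

lemma action_integrand: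
  assumes f: "f \<in> hecke_fun G T K W" and \<phi>: "\<phi> \<in> K_homs" and w: "w \<in> carrier W" and d: "d \<in> carrier G"
  shows "compactly_supported \<zero>\<^bsub>M\<^esub> (\<lambda>g. act M g (\<phi> (transposed W (f (d \<otimes> g)) w)))"
proof -
  let ?y = "\<lambda>g. if g \<in> carrier G then \<phi> (transposed W (f (d \<otimes> g)) w) else \<zero>\<^bsub>M\<^esub>"
  have "compactly_supported \<zero>\<^bsub>M\<^esub> (\<lambda>g. \<phi> (transposed W (f (d \<otimes> g)) w))"
    by (rule compactly_supported_comp[OF
          compactly_supported_translate[OF hecke_fun_compactly_supported[OF f] d], of "\<lambda>A. \<phi> (transposed W A w)"])
      (use w \<phi> in \<open>simp add: transposed_zero K_homs_zero del: dual_end_simps\<close>)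
  then obtain L where L: "cpt_open L" "\<forall>g\<in>carrier G - L. \<phi> (transposed W (f (d \<otimes> g)) w) = \<zero>\<^bsub>M\<^esub>"
    and lc: "locally_constant T (\<lambda>g. \<phi> (transposed W (f (d \<otimes> g)) w))"
    unfolding compactly_supported_def by blast
  show ?thesis
  proof (rule compactly_supportedI[OF _ L(1)])
    show "locally_constant T (\<lambda>g. act M g (\<phi> (transposed W (f (d \<otimes> g)) w)))"
      by (rule locally_constant_act[OF lc]) (use f w d \<phi> in \<open>simp add: K_homs_mem hecke_transposed_mem\<close>)
    fix g assume g: "g \<in> carrier G" "g \<notin> L"
    then have "\<phi> (transposed W (f (d \<otimes> g)) w) = \<zero>\<^bsub>M\<^esub>" using L(2) by blast
    then show "act M g (\<phi> (transposed W (f (d \<otimes> g)) w)) = \<zero>\<^bsub>M\<^esub>" using act_M_zero g by simp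
  qed
qed

lemma action_integrand_one:
  assumes f: "f \<in> hecke_fun G T K W" and \<phi>: "\<phi> \<in> K_homs" and w: "w \<in> carrier W"
  shows "compactly_supported \<zero>\<^bsub>M\<^esub> (\<lambda>g. act M g (\<phi> (transposed W (f g) w)))"
    and "g \<in> carrier G \<Longrightarrow> act M g (\<phi> (transposed W (f g) w)) \<in> carrier M"
proof -
  show "compactly_supported \<zero>\<^bsub>M\<^esub> (\<lambda>g. act M g (\<phi> (transposed W (f g) w)))"
    by (rule compactly_supported_cong[OF action_integrand[OF f \<phi> w one_closed]]) simp
qed (use assms in \<open>simp add: act_M_mem K_homs_mem hecke_transposed_mem\<close>)

lemma action_mem:
  assumes f: "f \<in> hecke_fun G T K W" and \<phi>: "\<phi> \<in> K_homs" and w: "w \<in> carrier W"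
  shows "(f \<odot>\<^bsub>F_M\<^esub> \<phi>) w \<in> carrier M"
  using lc_integral_mem[OF M.complex_space_axioms action_integrand_one[OF f \<phi> w]] w
  by (simp add: F_M_simps)

lemma functional_action:
  assumes f: "f \<in> hecke_fun G T K W" and \<phi>: "\<phi> \<in> K_homs" and w: "w \<in> carrier W" and \<xi>: "\<xi> \<in> M_dual"
  shows "\<xi> ((f \<odot>\<^bsub>F_M\<^esub> \<phi>) w) = (\<integral>g. \<xi> (act M g (\<phi> (transposed W (f g) w))) \<partial>\<mu>)"
  using functional_lc_integral[OF M.complex_space_axioms action_integrand_one[OF f \<phi> w] \<xi>] w
  by (simp add: F_M_simps)

lemma functional_action_integrable:
  assumes f: "f \<in> hecke_fun G T K W" and \<phi>: "\<phi> \<in> K_homs" and w: "w \<in> carrier W" and \<xi>: "\<xi> \<in> M_dual"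
  shows "compactly_supported 0 (\<lambda>g. \<xi> (act M g (\<phi> (transposed W (f g) w))))"
  by (rule compactly_supported_comp[OF action_integrand_one(1)[OF f \<phi> w]]) (rule M.functional_zero[OF \<xi>])

lemma transposed_add:
  assumes f: "f \<in> hecke_fun G T K W" and g: "g \<in> carrier G" and w: "w \<in> carrier W" "w' \<in> carrier W"
  shows "transposed W (f g) (w \<oplus>\<^bsub>W\<^esub> w') = transposed W (f g) w \<oplus>\<^bsub>W\<^esub> transposed W (f g) w'"
  using lin_maps_add[OF transposed_lin[OF hecke_fun_end[OF f g]] w] .

lemma transposed_smult:
  assumes f: "f \<in> hecke_fun G T K W" and g: "g \<in> carrier G" and w: "w \<in> carrier W"
  shows "transposed W (f g) (c \<odot>\<^bsub>W\<^esub> w) = c \<odot>\<^bsub>W\<^esub> transposed W (f g) w"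
  using lin_maps_smult[OF transposed_lin[OF hecke_fun_end[OF f g]] w] .

text \<open>Transposition reverses the order of composition: \<open>\<rho>\<^sup>\<or>(k)\<close> on
  the left of \<open>f g\<close> becomes \<open>\<rho> (inv k)\<close> on the right of the
  transpose.\<close>

lemma transposed_left:
  assumes f: "f \<in> hecke_fun G T K W" and g: "g \<in> carrier G" and k: "k \<in> K" and w: "w \<in> carrier W"
  shows "transposed W (f (k \<otimes> g)) (act W k w) = transposed W (f g) w"
proof (rule transposed_eqI)
  show "f (k \<otimes> g) \<in> lin_maps (dual W) (dual W)" using hecke_fun_end[OF f] g k K_carrier by simp
  show "act W k w \<in> carrier W" "transposed W (f g) w \<in> carrier W"
    using act_W_mem[OF k w] hecke_transposed_mem[OF f g w] .
  fix l assume l: "l \<in> W_dual"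
  show "f (k \<otimes> g) l (act W k w) = l (transposed W (f g) w)"
    using hecke_fun_left[OF f k g l act_W_mem[OF k w]] act_W_cancel(1)[OF k w]
      functional_transposed[OF hecke_fun_end[OF f g] l w] by simp
qed

lemma K_homs_add:
  "\<phi> \<in> K_homs \<Longrightarrow> w \<in> carrier W \<Longrightarrow> w' \<in> carrier W \<Longrightarrow> \<phi> (w \<oplus>\<^bsub>W\<^esub> w') = \<phi> w \<oplus>\<^bsub>M\<^esub> \<phi> w'"
  using lin_maps_add[OF K_homs_lin] .

lemma K_homs_smult: "\<phi> \<in> K_homs \<Longrightarrow> w \<in> carrier W \<Longrightarrow> \<phi> (c \<odot>\<^bsub>W\<^esub> w) = c \<odot>\<^bsub>M\<^esub> \<phi> w"
  using lin_maps_smult[OF K_homs_lin] .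

lemma K_homs_eqI:
  assumes "\<phi> \<in> K_homs" "\<psi> \<in> K_homs" "\<And>w. w \<in> carrier W \<Longrightarrow> \<phi> w = \<psi> w"
  shows "\<phi> = \<psi>"
  using lin_maps_eqI[OF K_homs_lin[OF assms(1)] K_homs_lin[OF assms(2)] assms(3)] .

lemma K_homs_functional_eqI:
  assumes "\<phi> \<in> K_homs" "\<psi> \<in> K_homs" "\<And>\<xi> w. \<xi> \<in> M_dual \<Longrightarrow> w \<in> carrier W \<Longrightarrow> \<xi> (\<phi> w) = \<xi> (\<psi> w)"
  shows "\<phi> = \<psi>"
  by (intro K_homs_eqI[OF assms(1,2)] M.functionals_eqI K_homs_mem assms)

text \<open>Equivariance under \<open>k\<close> is the substitution of \<open>k g\<close> for
  \<open>g\<close> in the integral; linearity is inherited from the integrand.\<close>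

lemma action_K_homs:
  assumes f: "f \<in> hecke_fun G T K W" and \<phi>: "\<phi> \<in> K_homs"
  shows "f \<odot>\<^bsub>F_M\<^esub> \<phi> \<in> K_homs"
proof (rule K_homsI)
  note mem = action_mem[OF f \<phi>] and fnl = functional_action[OF f \<phi>]
    and int = integrable_compactly_supported[OF functional_action_integrable[OF f \<phi>]]
  note t = hecke_transposed_mem[OF f]
  show "f \<odot>\<^bsub>F_M\<^esub> \<phi> \<in> lin_maps W M"
  proof (rule lin_mapsI)
    show "f \<odot>\<^bsub>F_M\<^esub> \<phi> \<in> extensional (carrier W)" by (simp add: F_M_simps)
    fix w assume w: "w \<in> carrier W"
    show "(f \<odot>\<^bsub>F_M\<^esub> \<phi>) w \<in> carrier M" by (rule mem[OF w])
    {
      fix w' assume w': "w' \<in> carrier W"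
      show "(f \<odot>\<^bsub>F_M\<^esub> \<phi>) (w \<oplus>\<^bsub>W\<^esub> w') = (f \<odot>\<^bsub>F_M\<^esub> \<phi>) w \<oplus>\<^bsub>M\<^esub> (f \<odot>\<^bsub>F_M\<^esub> \<phi>) w'"
      proof (rule M.functionals_eqI)
        fix \<xi> assume \<xi>: "\<xi> \<in> M_dual"
        have "\<xi> ((f \<odot>\<^bsub>F_M\<^esub> \<phi>) (w \<oplus>\<^bsub>W\<^esub> w')) =
          (\<integral>g. \<xi> (act M g (\<phi> (transposed W (f g) w))) + \<xi> (act M g (\<phi> (transposed W (f g) w'))) \<partial>\<mu>)"
          unfolding fnl[OF W.add_mem[OF w w'] \<xi>] using w w' \<xi> \<phi> f
          by (intro integral_cong_carrier)
            (simp add: transposed_add K_homs_add act_M_add M.functional_add t K_homs_mem act_M_mem)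
        also have "\<dots> = \<xi> ((f \<odot>\<^bsub>F_M\<^esub> \<phi>) w) + \<xi> ((f \<odot>\<^bsub>F_M\<^esub> \<phi>) w')"
          unfolding fnl[OF w \<xi>] fnl[OF w' \<xi>]
          by (rule Bochner_Integration.integral_add[OF int[OF w \<xi>] int[OF w' \<xi>]])
        finally show "\<xi> ((f \<odot>\<^bsub>F_M\<^esub> \<phi>) (w \<oplus>\<^bsub>W\<^esub> w')) = \<xi> ((f \<odot>\<^bsub>F_M\<^esub> \<phi>) w \<oplus>\<^bsub>M\<^esub> (f \<odot>\<^bsub>F_M\<^esub> \<phi>) w')"
          using M.functional_add[OF \<xi> mem[OF w] mem[OF w']] by simp
      qed (intro mem M.add_mem W.add_mem w w')+
    next
      fix c
      show "(f \<odot>\<^bsub>F_M\<^esub> \<phi>) (c \<odot>\<^bsub>W\<^esub> w) = c \<odot>\<^bsub>M\<^esub> (f \<odot>\<^bsub>F_M\<^esub> \<phi>) w"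
      proof (rule M.functionals_eqI)
        fix \<xi> assume \<xi>: "\<xi> \<in> M_dual"
        have "\<xi> ((f \<odot>\<^bsub>F_M\<^esub> \<phi>) (c \<odot>\<^bsub>W\<^esub> w)) = (\<integral>g. c * \<xi> (act M g (\<phi> (transposed W (f g) w))) \<partial>\<mu>)"
          unfolding fnl[OF W.smult_mem[OF w] \<xi>] using w \<xi> \<phi> f
          by (intro integral_cong_carrier)
            (simp add: transposed_smult K_homs_smult act_M_smult M.functional_smult t K_homs_mem act_M_mem)
        then show "\<xi> ((f \<odot>\<^bsub>F_M\<^esub> \<phi>) (c \<odot>\<^bsub>W\<^esub> w)) = \<xi> (c \<odot>\<^bsub>M\<^esub> (f \<odot>\<^bsub>F_M\<^esub> \<phi>) w)"
          using M.functional_smult[OF \<xi> mem[OF w]] fnl[OF w \<xi>] by simp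
      qed (intro mem M.smult_mem W.smult_mem w)+
    }
  qed
  fix k w assume k: "k \<in> K" and w: "w \<in> carrier W"
  note kc = K_carrier[OF k] and kw = act_W_mem[OF k w]
  show "(f \<odot>\<^bsub>F_M\<^esub> \<phi>) (act W k w) = act M k ((f \<odot>\<^bsub>F_M\<^esub> \<phi>) w)"
  proof (rule M.functionals_eqI)
    fix \<xi> assume \<xi>: "\<xi> \<in> M_dual"
    let ?\<xi> = "\<lambda>v\<in>carrier M. \<xi> (act M k v)"
    have "\<xi> ((f \<odot>\<^bsub>F_M\<^esub> \<phi>) (act W k w)) = (\<integral>g. \<xi> (act M g (\<phi> (transposed W (f g) (act W k w)))) \<partial>\<mu>)"
      by (rule fnl[OF kw \<xi>])
    also have "\<dots> = (\<integral>g. \<xi> (act M (k \<otimes> g) (\<phi> (transposed W (f (k \<otimes> g)) (act W k w)))) \<partial>\<mu>)"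
      by (rule integral_translate[OF functional_action_integrable[OF f \<phi> kw \<xi>] kc, symmetric])
    also have "\<dots> = (\<integral>g. ?\<xi> (act M g (\<phi> (transposed W (f g) w))) \<partial>\<mu>)"
      by (intro integral_cong_carrier)
        (simp add: transposed_left[OF f _ k w] M.act_mult kc K_homs_mem[OF \<phi>] t w act_M_mem)
    also have "\<dots> = ?\<xi> ((f \<odot>\<^bsub>F_M\<^esub> \<phi>) w)" by (rule fnl[OF w functional_act[OF \<xi> kc], symmetric])
    also have "\<dots> = \<xi> (act M k ((f \<odot>\<^bsub>F_M\<^esub> \<phi>) w))" using mem[OF w] by simp
    finally show "\<xi> ((f \<odot>\<^bsub>F_M\<^esub> \<phi>) (act W k w)) = \<xi> (act M k ((f \<odot>\<^bsub>F_M\<^esub> \<phi>) w))" .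
  qed (intro mem act_M_mem kc kw w)+
qed

end

section \<open>Module laws for the action of the Hecke algebra\<close>

context hecke_rep begin

lemma action_l_distr:
  assumes f: "f \<in> hecke_fun G T K W" "f' \<in> hecke_fun G T K W" and \<phi>: "\<phi> \<in> K_homs"
  shows "(f \<oplus>\<^bsub>\<H>\<^esub> f') \<odot>\<^bsub>F_M\<^esub> \<phi> = f \<odot>\<^bsub>F_M\<^esub> \<phi> \<oplus>\<^bsub>F_M\<^esub> f' \<odot>\<^bsub>F_M\<^esub> \<phi>"
proof (rule K_homs_functional_eqI)
  note ff = hecke_add_mem[OF f]
  show "(f \<oplus>\<^bsub>\<H>\<^esub> f') \<odot>\<^bsub>F_M\<^esub> \<phi> \<in> K_homs" by (rule action_K_homs[OF ff \<phi>])
  show "f \<odot>\<^bsub>F_M\<^esub> \<phi> \<oplus>\<^bsub>F_M\<^esub> f' \<odot>\<^bsub>F_M\<^esub> \<phi> \<in> K_homs"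
    using abelian_groupE(1)[OF abelian_group_F_M] action_K_homs[OF f(1) \<phi>] action_K_homs[OF f(2) \<phi>]
    by (simp add: F_M_simps(1))
  fix \<xi> w assume \<xi>: "\<xi> \<in> M_dual" and w: "w \<in> carrier W"
  have t: "transposed W ((f \<oplus>\<^bsub>\<H>\<^esub> f') g) w = transposed W (f g) w \<oplus>\<^bsub>W\<^esub> transposed W (f' g) w" if g: "g \<in> carrier G" for g
  proof (rule transposed_eqI[OF hecke_fun_end[OF ff g] w])
    note m = hecke_transposed_mem[OF f(1) g w] hecke_transposed_mem[OF f(2) g w]
    show "transposed W (f g) w \<oplus>\<^bsub>W\<^esub> transposed W (f' g) w \<in> carrier W" using m by simp
    show "(f \<oplus>\<^bsub>\<H>\<^esub> f') g l w = l (transposed W (f g) w \<oplus>\<^bsub>W\<^esub> transposed W (f' g) w)" if l: "l \<in> W_dual" for l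
      using m l g w functional_transposed[OF hecke_fun_end[OF f(1) g] l w] functional_transposed[OF hecke_fun_end[OF f(2) g] l w]
      by (simp add: W.functional_add hecke_add_apply)
  qed
  have "\<xi> (((f \<oplus>\<^bsub>\<H>\<^esub> f') \<odot>\<^bsub>F_M\<^esub> \<phi>) w) =
    (\<integral>g. \<xi> (act M g (\<phi> (transposed W (f g) w))) + \<xi> (act M g (\<phi> (transposed W (f' g) w))) \<partial>\<mu>)"
    unfolding functional_action[OF ff \<phi> w \<xi>] using w \<xi> \<phi> f
    by (intro integral_cong_carrier)
      (simp add: t hecke_transposed_mem K_homs_add act_M_add M.functional_add K_homs_mem act_M_mem)
  also have "\<dots> = \<xi> ((f \<odot>\<^bsub>F_M\<^esub> \<phi>) w) + \<xi> ((f' \<odot>\<^bsub>F_M\<^esub> \<phi>) w)"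
    unfolding functional_action[OF f(1) \<phi> w \<xi>] functional_action[OF f(2) \<phi> w \<xi>]
    by (intro Bochner_Integration.integral_add integrable_compactly_supported functional_action_integrable f \<phi> w \<xi>)
  also have "\<dots> = \<xi> ((f \<odot>\<^bsub>F_M\<^esub> \<phi> \<oplus>\<^bsub>F_M\<^esub> f' \<odot>\<^bsub>F_M\<^esub> \<phi>) w)"
    using w M.functional_add[OF \<xi> action_mem[OF f(1) \<phi> w] action_mem[OF f(2) \<phi> w]] by (simp add: F_M_simps(3))
  finally show "\<xi> (((f \<oplus>\<^bsub>\<H>\<^esub> f') \<odot>\<^bsub>F_M\<^esub> \<phi>) w) = \<xi> ((f \<odot>\<^bsub>F_M\<^esub> \<phi> \<oplus>\<^bsub>F_M\<^esub> f' \<odot>\<^bsub>F_M\<^esub> \<phi>) w)" .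
qed

lemma action_r_distr:
  assumes f: "f \<in> hecke_fun G T K W" and \<phi>: "\<phi> \<in> K_homs" "\<psi> \<in> K_homs"
  shows "f \<odot>\<^bsub>F_M\<^esub> (\<phi> \<oplus>\<^bsub>F_M\<^esub> \<psi>) = f \<odot>\<^bsub>F_M\<^esub> \<phi> \<oplus>\<^bsub>F_M\<^esub> f \<odot>\<^bsub>F_M\<^esub> \<psi>"
proof (rule K_homs_functional_eqI)
  have add: "\<phi> \<oplus>\<^bsub>F_M\<^esub> \<psi> \<in> K_homs" if "\<phi> \<in> K_homs" "\<psi> \<in> K_homs" for \<phi> \<psi>
    using abelian_groupE(1)[OF abelian_group_F_M] that by (simp add: F_M_simps(1))
  show "f \<odot>\<^bsub>F_M\<^esub> (\<phi> \<oplus>\<^bsub>F_M\<^esub> \<psi>) \<in> K_homs" by (intro action_K_homs add f \<phi>)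
  show "f \<odot>\<^bsub>F_M\<^esub> \<phi> \<oplus>\<^bsub>F_M\<^esub> f \<odot>\<^bsub>F_M\<^esub> \<psi> \<in> K_homs" by (intro action_K_homs add f \<phi>)
  fix \<xi> w assume \<xi>: "\<xi> \<in> M_dual" and w: "w \<in> carrier W"
  have "\<xi> ((f \<odot>\<^bsub>F_M\<^esub> (\<phi> \<oplus>\<^bsub>F_M\<^esub> \<psi>)) w) =
    (\<integral>g. \<xi> (act M g (\<phi> (transposed W (f g) w))) + \<xi> (act M g (\<psi> (transposed W (f g) w))) \<partial>\<mu>)"
    unfolding functional_action[OF f add[OF \<phi>] w \<xi>] using w \<xi> \<phi> f
    by (intro integral_cong_carrier)
      (simp add: F_M_simps(3) hecke_transposed_mem act_M_add M.functional_add K_homs_mem act_M_mem)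
  also have "\<dots> = \<xi> ((f \<odot>\<^bsub>F_M\<^esub> \<phi>) w) + \<xi> ((f \<odot>\<^bsub>F_M\<^esub> \<psi>) w)"
    unfolding functional_action[OF f \<phi>(1) w \<xi>] functional_action[OF f \<phi>(2) w \<xi>]
    by (intro Bochner_Integration.integral_add integrable_compactly_supported functional_action_integrable f \<phi> w \<xi>)
  also have "\<dots> = \<xi> ((f \<odot>\<^bsub>F_M\<^esub> \<phi> \<oplus>\<^bsub>F_M\<^esub> f \<odot>\<^bsub>F_M\<^esub> \<psi>) w)"
    using w M.functional_add[OF \<xi> action_mem[OF f \<phi>(1) w] action_mem[OF f \<phi>(2) w]] by (simp add: F_M_simps(3))
  finally show "\<xi> ((f \<odot>\<^bsub>F_M\<^esub> (\<phi> \<oplus>\<^bsub>F_M\<^esub> \<psi>)) w) = \<xi> ((f \<odot>\<^bsub>F_M\<^esub> \<phi> \<oplus>\<^bsub>F_M\<^esub> f \<odot>\<^bsub>F_M\<^esub> \<psi>) w)" .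
qed

lemma action_one:
  assumes \<phi>: "\<phi> \<in> K_homs" shows "\<one>\<^bsub>\<H>\<^esub> \<odot>\<^bsub>F_M\<^esub> \<phi> = \<phi>"
proof (rule K_homs_functional_eqI[OF action_K_homs[OF hecke_one_mem \<phi>] \<phi>])
  fix \<xi> w assume \<xi>: "\<xi> \<in> M_dual" and w: "w \<in> carrier W"
  have "\<xi> ((\<one>\<^bsub>\<H>\<^esub> \<odot>\<^bsub>F_M\<^esub> \<phi>) w) = (\<integral>g. (if g \<in> K then complex_of_real (1 / measure \<mu> K) * \<xi> (\<phi> w) else 0) \<partial>\<mu>)"
    unfolding functional_action[OF hecke_one_mem \<phi> w \<xi>]
  proof (rule integral_cong_carrier)
    fix g assume g: "g \<in> carrier G"
    show "\<xi> (act M g (\<phi> (transposed W (\<one>\<^bsub>\<H>\<^esub> g) w))) =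
      (if g \<in> K then complex_of_real (1 / measure \<mu> K) * \<xi> (\<phi> w) else 0)"
    proof (cases "g \<in> K")
      case True
      let ?c = "complex_of_real (1 / measure \<mu> K)"
      note m = act_W_mem[OF K_inv[OF True] w]
      have t: "transposed W (\<one>\<^bsub>\<H>\<^esub> g) w = ?c \<odot>\<^bsub>W\<^esub> act W (inv g) w"
      proof (rule transposed_eqI[OF hecke_one_end[OF g] w W.smult_mem[OF m]])
        show "\<one>\<^bsub>\<H>\<^esub> g l w = l (?c \<odot>\<^bsub>W\<^esub> act W (inv g) w)" if l: "l \<in> W_dual" for l
          using hecke_one_apply[OF g l w] W.functional_smult[OF l m, of ?c] True by simp
      qed
      have "act M g (\<phi> (?c \<odot>\<^bsub>W\<^esub> act W (inv g) w)) = ?c \<odot>\<^bsub>M\<^esub> \<phi> w"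
        using K_homs_smult[OF \<phi> m, of ?c] K_homs_mem[OF \<phi> m] act_M_smult[OF g]
          K_homs_equivariant[OF \<phi> True m] act_W_cancel(2)[OF True w] by simp
      then show ?thesis using t True M.functional_smult[OF \<xi> K_homs_mem[OF \<phi> w], of ?c] by simp
    next
      case False
      have "\<one>\<^bsub>\<H>\<^esub> g = \<zero>\<^bsub>dual_end W\<^esub>" using False g by (simp add: hecke_algebra_simps)
      then show ?thesis using False g w by (simp add: transposed_zero K_homs_zero[OF \<phi>] act_M_zero M.functional_zero[OF \<xi>] del: dual_end_simps)
    qed
  qed
  then show "\<xi> ((\<one>\<^bsub>\<H>\<^esub> \<odot>\<^bsub>F_M\<^esub> \<phi>) w) = \<xi> (\<phi> w)"
    unfolding integral_K using measure_K_nonzero by simp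
qed

text \<open>With \<open>\<xi>\<close> pulled back to a functional on \<open>W\<close>, a term in
  which \<open>\<phi>\<close> is applied to a transposed endomorphism can be read as a value of the
  endomorphism itself, which removes the transpose.\<close>

lemma functional_K_hom:
  assumes "\<phi> \<in> K_homs" "\<xi> \<in> M_dual" "x \<in> carrier G"
  shows "(\<lambda>w\<in>carrier W. \<xi> (act M x (\<phi> w))) \<in> W_dual"
  by (rule lin_mapsI)
    (auto simp: K_homs_add K_homs_smult act_M_add act_M_smult act_M_mem K_homs_mem assms M.functional_simps[OF assms(2)])

text \<open>Since transposition reverses composition, the product under the integral acts as the
  transpose of \<open>f1\<close> followed by that of \<open>f2\<close>. Exchanging the integrals and
  translating by \<open>g\<close> then separates the two actions.\<close>

lemma action_assoc:
  assumes f: "f1 \<in> hecke_fun G T K W" "f2 \<in> hecke_fun G T K W" and \<phi>: "\<phi> \<in> K_homs"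
  shows "(f1 \<otimes>\<^bsub>\<H>\<^esub> f2) \<odot>\<^bsub>F_M\<^esub> \<phi> = f1 \<odot>\<^bsub>F_M\<^esub> (f2 \<odot>\<^bsub>F_M\<^esub> \<phi>)"
proof (rule K_homs_functional_eqI)
  note f12 = hecke_mult_mem[OF f] and f2\<phi> = action_K_homs[OF f(2) \<phi>]
  note t1 = hecke_transposed_mem[OF f(1)] and t2 = hecke_transposed_mem[OF f(2)]
  show "(f1 \<otimes>\<^bsub>\<H>\<^esub> f2) \<odot>\<^bsub>F_M\<^esub> \<phi> \<in> K_homs" "f1 \<odot>\<^bsub>F_M\<^esub> (f2 \<odot>\<^bsub>F_M\<^esub> \<phi>) \<in> K_homs"
    by (intro action_K_homs f12 f f2\<phi> \<phi>)+
  fix \<xi> w assume \<xi>: "\<xi> \<in> M_dual" and w: "w \<in> carrier W"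
  let ?F = "\<lambda>x g. \<xi> (act M x (\<phi> (transposed W (f2 (inv g \<otimes> x)) (transposed W (f1 g) w))))"
  obtain L where L: "cpt_open L" "K \<subseteq> L" "\<forall>x\<in>carrier G - L. f1 x = \<zero>\<^bsub>dual_end W\<^esub>"
    by (rule hecke_fun_support[OF f(1)])
  have "\<xi> (((f1 \<otimes>\<^bsub>\<H>\<^esub> f2) \<odot>\<^bsub>F_M\<^esub> \<phi>) w) = (\<integral>x. \<integral>g. ?F x g \<partial>\<mu> \<partial>\<mu>)"
    unfolding functional_action[OF f12 \<phi> w \<xi>]
  proof (rule integral_cong_carrier)
    fix x assume x: "x \<in> carrier G"
    let ?\<eta> = "\<lambda>w\<in>carrier W. \<xi> (act M x (\<phi> w))"
    note \<eta> = functional_K_hom[OF \<phi> \<xi> x]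
    have "\<xi> (act M x (\<phi> (transposed W ((f1 \<otimes>\<^bsub>\<H>\<^esub> f2) x) w))) = ?\<eta> (transposed W ((f1 \<otimes>\<^bsub>\<H>\<^esub> f2) x) w)"
      using hecke_transposed_mem[OF f12 x w] by simp
    also have "\<dots> = (f1 \<otimes>\<^bsub>\<H>\<^esub> f2) x ?\<eta> w"
      by (rule functional_transposed[OF hecke_fun_end[OF f12 x] \<eta> w])
    also have "\<dots> = (\<integral>g. f1 g (f2 (inv g \<otimes> x) ?\<eta>) w \<partial>\<mu>)" by (rule hecke_mult_apply[OF f x \<eta> w])
    also have "\<dots> = (\<integral>g. ?F x g \<partial>\<mu>)"
    proof (rule integral_cong_carrier)
      fix g assume g: "g \<in> carrier G"
      then have gx: "inv g \<otimes> x \<in> carrier G" using x by simp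
      have "f1 g (f2 (inv g \<otimes> x) ?\<eta>) w = f2 (inv g \<otimes> x) ?\<eta> (transposed W (f1 g) w)"
        by (rule functional_transposed[OF hecke_fun_end[OF f(1) g] hecke_fun_dual[OF f(2) gx \<eta>] w, symmetric])
      also have "\<dots> = ?\<eta> (transposed W (f2 (inv g \<otimes> x)) (transposed W (f1 g) w))"
        by (rule functional_transposed[OF hecke_fun_end[OF f(2) gx] \<eta> t1[OF g w], symmetric])
      also have "\<dots> = ?F x g" using t2[OF gx t1[OF g w]] by simp
      finally show "f1 g (f2 (inv g \<otimes> x) ?\<eta>) w = ?F x g" .
    qed
    finally show "\<xi> (act M x (\<phi> (transposed W ((f1 \<otimes>\<^bsub>\<H>\<^esub> f2) x) w))) = (\<integral>g. ?F x g \<partial>\<mu>)" .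
  qed
  also have "\<dots> = (\<integral>g. \<integral>x. ?F x g \<partial>\<mu> \<partial>\<mu>)"
  proof (rule fubini_right_invariant[OF openin_fixer fixer_one L(1)])
    fix x g assume x: "x \<in> carrier G" and g: "g \<in> carrier G"
    show "?F x (g \<otimes> j) = ?F x g" if "j \<in> fixer" for j
      using that x g by (simp add: hecke_fixer_right[OF f(1)] inv_mult_fixer[OF g x that f(2)])
    show "?F x g = 0" if "g \<notin> L"
    proof -
      have "f1 g = \<zero>\<^bsub>dual_end W\<^esub>" using L(3) g that by blast
      then have "transposed W (f1 g) w = \<zero>\<^bsub>W\<^esub>" using transposed_zero[OF w] by simp
      moreover have "transposed W (f2 (inv g \<otimes> x)) \<zero>\<^bsub>W\<^esub> = \<zero>\<^bsub>W\<^esub>"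
        using x g by (intro lin_maps_zero[OF transposed_lin[OF hecke_fun_end[OF f(2)]]] W.complex_space_axioms) simp
      ultimately show ?thesis using x by (simp add: K_homs_zero[OF \<phi>] act_M_zero M.functional_zero[OF \<xi>])
    qed
  next
    fix g assume g: "g \<in> carrier G"
    show "compactly_supported 0 (\<lambda>x. ?F x g)"
      by (rule compactly_supported_comp[OF action_integrand[OF f(2) \<phi> t1[OF g w] inv_closed[OF g]]])
        (rule M.functional_zero[OF \<xi>])
  qed
  also have "\<dots> = (\<integral>g. \<xi> (act M g ((f2 \<odot>\<^bsub>F_M\<^esub> \<phi>) (transposed W (f1 g) w))) \<partial>\<mu>)"
  proof (rule integral_cong_carrier)
    fix g assume g: "g \<in> carrier G"
    let ?\<xi> = "\<lambda>v\<in>carrier M. \<xi> (act M g v)"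
    note \<xi>' = functional_act[OF \<xi> g] and u = t1[OF g w]
    have cs: "compactly_supported 0 (\<lambda>x. ?F x g)"
      by (rule compactly_supported_comp[OF action_integrand[OF f(2) \<phi> t1[OF g w] inv_closed[OF g]]])
        (rule M.functional_zero[OF \<xi>])
    have "(\<integral>x. ?F x g \<partial>\<mu>) = (\<integral>x. ?F (g \<otimes> x) g \<partial>\<mu>)" by (rule integral_translate[OF cs g, symmetric])
    also have "\<dots> = (\<integral>x. ?\<xi> (act M x (\<phi> (transposed W (f2 x) (transposed W (f1 g) w)))) \<partial>\<mu>)"
    proof (rule integral_cong_carrier)
      fix x assume x: "x \<in> carrier G"
      have "inv g \<otimes> (g \<otimes> x) = x" using g x by (simp add: m_assoc[symmetric])
      then show "?F (g \<otimes> x) g = ?\<xi> (act M x (\<phi> (transposed W (f2 x) (transposed W (f1 g) w))))"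
        using K_homs_mem[OF \<phi> t2[OF x u]] act_M_mem[OF x] M.act_mult[OF g x] by simp
    qed
    also have "\<dots> = ?\<xi> ((f2 \<odot>\<^bsub>F_M\<^esub> \<phi>) (transposed W (f1 g) w))"
      by (rule functional_action[OF f(2) \<phi> u \<xi>', symmetric])
    also have "\<dots> = \<xi> (act M g ((f2 \<odot>\<^bsub>F_M\<^esub> \<phi>) (transposed W (f1 g) w)))"
      using action_mem[OF f(2) \<phi> u] by simp
    finally show "(\<integral>x. ?F x g \<partial>\<mu>) = \<xi> (act M g ((f2 \<odot>\<^bsub>F_M\<^esub> \<phi>) (transposed W (f1 g) w)))" .
  qed
  also have "\<dots> = \<xi> ((f1 \<odot>\<^bsub>F_M\<^esub> (f2 \<odot>\<^bsub>F_M\<^esub> \<phi>)) w)"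
    by (rule functional_action[OF f(1) f2\<phi> w \<xi>, symmetric])
  finally show "\<xi> (((f1 \<otimes>\<^bsub>\<H>\<^esub> f2) \<odot>\<^bsub>F_M\<^esub> \<phi>) w) = \<xi> ((f1 \<odot>\<^bsub>F_M\<^esub> (f2 \<odot>\<^bsub>F_M\<^esub> \<phi>)) w)" .
qed

lemma left_module_F_M: "left_module \<H> F_M"
proof (intro left_module.intro ring_hecke_algebra abelian_group_F_M left_module_axioms.intro)
qed (simp_all only: hecke_algebra_simps(1) F_M_simps(1) action_K_homs action_l_distr action_r_distr
    action_assoc action_one)

text \<open>Complex scalars act through multiples of the unit, so Hecke-linear maps and Hecke-stable
  sets respect them. In particular one may divide by the volume of \<open>K\<close> inside such a
  set.\<close>

lemma action_scalar:
  assumes f: "f \<in> hecke_fun G T K W" and \<phi>: "\<phi> \<in> K_homs"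
  shows "(c \<odot>\<^bsub>hecke_space\<^esub> f) \<odot>\<^bsub>F_M\<^esub> \<phi> = (\<lambda>w\<in>carrier W. c \<odot>\<^bsub>M\<^esub> (f \<odot>\<^bsub>F_M\<^esub> \<phi>) w)"
proof (rule lin_maps_eqI)
  note cf = hecke_smult_mem[OF f, of c] and f\<phi> = action_K_homs[OF f \<phi>]
  show "(c \<odot>\<^bsub>hecke_space\<^esub> f) \<odot>\<^bsub>F_M\<^esub> \<phi> \<in> lin_maps W M" by (rule K_homs_lin[OF action_K_homs[OF cf \<phi>]])
  show "(\<lambda>w\<in>carrier W. c \<odot>\<^bsub>M\<^esub> (f \<odot>\<^bsub>F_M\<^esub> \<phi>) w) \<in> lin_maps W M"
    using K_homs_submodule complex_space.submodule_iff[OF complex_space_hom_space[OF W.complex_space_axioms M.complex_space_axioms]]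
      f\<phi> by (auto simp: K_homs_lin)
  fix w assume w: "w \<in> carrier W"
  have t: "transposed W ((c \<odot>\<^bsub>hecke_space\<^esub> f) g) w = c \<odot>\<^bsub>W\<^esub> transposed W (f g) w" if g: "g \<in> carrier G" for g
  proof (rule transposed_eqI[OF hecke_fun_end[OF cf g] w])
    note m = hecke_transposed_mem[OF f g w]
    show "c \<odot>\<^bsub>W\<^esub> transposed W (f g) w \<in> carrier W" using m by simp
    show "(c \<odot>\<^bsub>hecke_space\<^esub> f) g l w = l (c \<odot>\<^bsub>W\<^esub> transposed W (f g) w)" if l: "l \<in> W_dual" for l
      using m l g w functional_transposed[OF hecke_fun_end[OF f g] l w]
      by (simp add: W.functional_smult hecke_smult_apply)
  qed
  have "((c \<odot>\<^bsub>hecke_space\<^esub> f) \<odot>\<^bsub>F_M\<^esub> \<phi>) w = c \<odot>\<^bsub>M\<^esub> (f \<odot>\<^bsub>F_M\<^esub> \<phi>) w"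
  proof (rule M.functionals_eqI[OF action_mem[OF cf \<phi> w] M.smult_mem[OF action_mem[OF f \<phi> w]]])
    fix \<xi> assume \<xi>: "\<xi> \<in> M_dual"
    have "\<xi> (((c \<odot>\<^bsub>hecke_space\<^esub> f) \<odot>\<^bsub>F_M\<^esub> \<phi>) w) = (\<integral>g. c * \<xi> (act M g (\<phi> (transposed W (f g) w))) \<partial>\<mu>)"
      unfolding functional_action[OF cf \<phi> w \<xi>] using w \<xi> \<phi> f
      by (intro integral_cong_carrier)
        (simp add: t hecke_transposed_mem K_homs_smult act_M_smult M.functional_smult K_homs_mem act_M_mem)
    then show "\<xi> (((c \<odot>\<^bsub>hecke_space\<^esub> f) \<odot>\<^bsub>F_M\<^esub> \<phi>) w) = \<xi> (c \<odot>\<^bsub>M\<^esub> (f \<odot>\<^bsub>F_M\<^esub> \<phi>) w)"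
      using M.functional_smult[OF \<xi> action_mem[OF f \<phi> w]] functional_action[OF f \<phi> w \<xi>] by simp
  qed
  then show "((c \<odot>\<^bsub>hecke_space\<^esub> f) \<odot>\<^bsub>F_M\<^esub> \<phi>) w = (\<lambda>w\<in>carrier W. c \<odot>\<^bsub>M\<^esub> (f \<odot>\<^bsub>F_M\<^esub> \<phi>) w) w"
    using w by simp
qed

end

section \<open>The functor of rho-invariants on smooth representations\<close>

lemma rep_homs_lin: "h \<in> rep_homs G M M' \<Longrightarrow> h \<in> lin_maps M M'"
  by (simp add: rep_homs_def)

lemma rep_homs_act: "h \<in> rep_homs G M M' \<Longrightarrow> g \<in> carrier G \<Longrightarrow> v \<in> carrier M \<Longrightarrow> h (act M g v) = act M' g (h v)"
  by (simp add: rep_homs_def)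

lemma smooth_rep_complex_space: "smooth_rep G T M \<Longrightarrow> complex_space M"
  unfolding smooth_rep_def group_rep_def complex_space_def by blast

lemma is_category_smooth_rep_cat: "is_category (smooth_rep_cat G T :: (('g, 'v) rep, 'v \<Rightarrow> 'v) cat)"
proof -
  have mem: "act M g v \<in> carrier M" if "smooth_rep G T M" "g \<in> carrier G" "v \<in> carrier M" for M :: "('g, 'v) rep" and g v
  proof -
    interpret smooth_rep G T M by fact
    show ?thesis using lin_maps_mem[OF act_linear[OF that(2)] that(3)] that by simp
  qed
  have comp: "compose (carrier M) h f \<in> rep_homs G M M''"
    if "smooth_rep G T M" "f \<in> rep_homs G M M'" "h \<in> rep_homs G M' M''" for M M' M'' :: "('g, 'v) rep" and f h
    using lin_maps_compose[OF smooth_rep_complex_space[OF that(1)] rep_homs_lin[OF that(2)] rep_homs_lin[OF that(3)]]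
      mem[OF that(1)] that(2,3) lin_maps_mem[OF rep_homs_lin[OF that(2)]]
    by (simp add: rep_homs_def compose_def)
  have id: "(\<lambda>v\<in>carrier M. v) \<in> rep_homs G M M" if "smooth_rep G T M" for M :: "('g, 'v) rep"
    using lin_maps_id[OF smooth_rep_complex_space[OF that]] mem[OF that] by (simp add: rep_homs_def)
  have ext: "f \<in> carrier M \<rightarrow>\<^sub>E carrier M'" if "f \<in> rep_homs G M M'" for M M' :: "('g, 'v) rep" and f
    using rep_homs_lin[OF that] by (simp add: lin_maps_def)
  show ?thesis
    unfolding is_category_def smooth_rep_cat_def
    using comp id
    by (auto simp: compose_def fun_eq_iff restrict_def dest!: ext)
qed

lemma is_category_left_module_cat: "is_category (left_module_cat R :: (('r, 'a) module, 'a \<Rightarrow> 'a) cat)"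
proof -
  have comp: "compose (carrier M) h f \<in> left_module_homs R M M''"
    if "left_module R M" "f \<in> left_module_homs R M M'" "h \<in> left_module_homs R M' M''" for M M' M'' :: "('r, 'a) module" and f h
  proof -
    interpret left_module R M by fact
    have "x \<oplus>\<^bsub>M\<^esub> y \<in> carrier M" "a \<odot>\<^bsub>M\<^esub> x \<in> carrier M" "f x \<in> carrier M'"
      if "x \<in> carrier M" "y \<in> carrier M" "a \<in> carrier R" for x y a
      using that smult_closed \<open>f \<in> left_module_homs R M M'\<close> by (auto simp: left_module_homs_def)
    then show ?thesis using that(2,3) by (auto simp: left_module_homs_def compose_def PiE_iff)
  qed
  have id: "(\<lambda>v\<in>carrier M. v) \<in> left_module_homs R M M" if "left_module R M" for M :: "('r, 'a) module"
  proof -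
    interpret left_module R M by fact
    show ?thesis using smult_closed by (auto simp: left_module_homs_def)
  qed
  have ext: "f \<in> carrier M \<rightarrow>\<^sub>E carrier M'" if "f \<in> left_module_homs R M M'" for M M' :: "('r, 'a) module" and f
    using that by (simp add: left_module_homs_def)
  show ?thesis
    unfolding is_category_def left_module_cat_def
    using comp id
    by (auto simp: compose_def fun_eq_iff restrict_def dest!: ext)
qed

context hecke_setup begin

lemma hecke_rep: "smooth_rep G T M \<Longrightarrow> hecke_rep G T \<mu> K W M"
  by (intro hecke_rep.intro hecke_setup_axioms)

lemma compose_K_hom:
  assumes M: "smooth_rep G T M" "smooth_rep G T M'" and h: "h \<in> rep_homs G M M'"
    and \<phi>: "\<phi> \<in> rep_homs (subgrp G K) W M"
  shows "compose (carrier W) h \<phi> \<in> rep_homs (subgrp G K) W M'"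
proof -
  interpret M: hecke_rep G T \<mu> K W M by (rule hecke_rep[OF M(1)])
  interpret M': hecke_rep G T \<mu> K W M' by (rule hecke_rep[OF M(2)])
  show ?thesis
    using lin_maps_compose[OF W.complex_space_axioms M.K_homs_lin[OF \<phi>] rep_homs_lin[OF h]] \<phi> h
    by (intro M'.K_homsI) (auto simp: compose_def act_W_mem M.K_homs_equivariant rep_homs_act K_carrier M.K_homs_mem)
qed

text \<open>An intertwiner commutes with the integral because \<open>\<xi>\<close> composed with
  \<open>h\<close> is again a functional, now on \<open>M\<close>.\<close>

lemma compose_action:
  assumes M: "smooth_rep G T M" "smooth_rep G T M'" and h: "h \<in> rep_homs G M M'"
    and \<phi>: "\<phi> \<in> rep_homs (subgrp G K) W M" and f: "f \<in> hecke_fun G T K W"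
  shows "compose (carrier W) h (f \<odot>\<^bsub>rho_inv_obj G \<mu> K W M\<^esub> \<phi>) =
    f \<odot>\<^bsub>rho_inv_obj G \<mu> K W M'\<^esub> (compose (carrier W) h \<phi>)"
proof -
  interpret M: hecke_rep G T \<mu> K W M by (rule hecke_rep[OF M(1)])
  interpret M': hecke_rep G T \<mu> K W M' by (rule hecke_rep[OF M(2)])
  note h\<phi> = compose_K_hom[OF M h \<phi>] and f\<phi> = M.action_K_homs[OF f \<phi>]
  show ?thesis
  proof (rule M'.K_homs_functional_eqI[OF compose_K_hom[OF M h f\<phi>] M'.action_K_homs[OF f h\<phi>]])
    fix \<xi> w assume \<xi>: "\<xi> \<in> lin_maps M' scalars" and w: "w \<in> carrier W"
    let ?\<xi> = "compose (carrier M) \<xi> h"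
    have \<xi>h: "?\<xi> \<in> lin_maps M scalars"
      by (rule lin_maps_compose[OF M.M.complex_space_axioms rep_homs_lin[OF h] \<xi>])
    have "\<xi> (compose (carrier W) h (f \<odot>\<^bsub>rho_inv_obj G \<mu> K W M\<^esub> \<phi>) w) = ?\<xi> ((f \<odot>\<^bsub>rho_inv_obj G \<mu> K W M\<^esub> \<phi>) w)"
      using w M.K_homs_mem[OF f\<phi> w] by (simp add: compose_def)
    also have "\<dots> = (\<integral>g. ?\<xi> (act M g (\<phi> (transposed W (f g) w))) \<partial>\<mu>)"
      by (rule M.functional_action[OF f \<phi> w \<xi>h])
    also have "\<dots> = (\<integral>g. \<xi> (act M' g (compose (carrier W) h \<phi> (transposed W (f g) w))) \<partial>\<mu>)"
    proof (rule integral_cong_carrier)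
      fix g assume g: "g \<in> carrier G"
      note t = M.hecke_transposed_mem[OF f g w]
      show "?\<xi> (act M g (\<phi> (transposed W (f g) w))) = \<xi> (act M' g (compose (carrier W) h \<phi> (transposed W (f g) w)))"
        using t g M.K_homs_mem[OF \<phi> t] by (simp add: compose_def M.act_M_mem rep_homs_act[OF h])
    qed
    also have "\<dots> = \<xi> ((f \<odot>\<^bsub>rho_inv_obj G \<mu> K W M'\<^esub> (compose (carrier W) h \<phi>)) w)"
      by (rule M'.functional_action[OF f h\<phi> w \<xi>, symmetric])
    finally show "\<xi> (compose (carrier W) h (f \<odot>\<^bsub>rho_inv_obj G \<mu> K W M\<^esub> \<phi>) w) =
      \<xi> ((f \<odot>\<^bsub>rho_inv_obj G \<mu> K W M'\<^esub> (compose (carrier W) h \<phi>)) w)" .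
  qed
qed

lemma rho_inv_mor_hom:
  fixes M :: "('g, 'v) rep" and M' :: "('g, 'v) rep"
  assumes M: "smooth_rep G T M" "smooth_rep G T M'" and h: "h \<in> rep_homs G M M'"
  shows "rho_inv_mor G K W M M' h \<in> left_module_homs \<H> (rho_inv_obj G \<mu> K W M) (rho_inv_obj G \<mu> K W M')"
proof -
  interpret M: hecke_rep G T \<mu> K W M by (rule hecke_rep[OF M(1)])
  interpret M': hecke_rep G T \<mu> K W M' by (rule hecke_rep[OF M(2)])
  have add: "\<phi> \<oplus>\<^bsub>M.F_M\<^esub> \<psi> \<in> M.K_homs" if "\<phi> \<in> M.K_homs" "\<psi> \<in> M.K_homs" for \<phi> \<psi>
    using abelian_groupE(1)[OF M.abelian_group_F_M] that by (simp add: M.F_M_simps(1))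
  show ?thesis
    unfolding left_module_homs_def
  proof (intro CollectI conjI ballI)
    show "rho_inv_mor G K W M M' h \<in> carrier M.F_M \<rightarrow>\<^sub>E carrier M'.F_M"
      using compose_K_hom[OF M h] by (simp add: rho_inv_mor_def M.F_M_simps(1) M'.F_M_simps(1))
    fix \<phi> assume "\<phi> \<in> carrier M.F_M"
    then have \<phi>: "\<phi> \<in> M.K_homs" by (simp add: M.F_M_simps(1))
    {
      fix \<psi> assume "\<psi> \<in> carrier M.F_M"
      then have \<psi>: "\<psi> \<in> M.K_homs" by (simp add: M.F_M_simps(1))
      have "compose (carrier W) h (\<phi> \<oplus>\<^bsub>M.F_M\<^esub> \<psi>) = compose (carrier W) h \<phi> \<oplus>\<^bsub>M'.F_M\<^esub> compose (carrier W) h \<psi>"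
        using lin_maps_add[OF rep_homs_lin[OF h]] M.K_homs_mem[OF \<phi>] M.K_homs_mem[OF \<psi>]
        by (auto simp: M.F_M_simps(3) M'.F_M_simps(3) compose_def intro!: restrict_ext)
      then show "rho_inv_mor G K W M M' h (\<phi> \<oplus>\<^bsub>M.F_M\<^esub> \<psi>) =
        rho_inv_mor G K W M M' h \<phi> \<oplus>\<^bsub>M'.F_M\<^esub> rho_inv_mor G K W M M' h \<psi>"
        using \<phi> \<psi> add[OF \<phi> \<psi>] by (simp add: rho_inv_mor_def)
    next
      fix f assume "f \<in> carrier \<H>"
      then have f: "f \<in> hecke_fun G T K W" by (simp add: hecke_algebra_simps(1))
      show "rho_inv_mor G K W M M' h (f \<odot>\<^bsub>M.F_M\<^esub> \<phi>) = f \<odot>\<^bsub>M'.F_M\<^esub> rho_inv_mor G K W M M' h \<phi>"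
        using compose_action[OF M h \<phi> f] M.action_K_homs[OF f \<phi>] \<phi> by (simp add: rho_inv_mor_def)
    }
  qed
qed

lemma is_functor_rho_inv:
  "is_functor (smooth_rep_cat G T :: (('g, 'v) rep, 'v \<Rightarrow> 'v) cat) (left_module_cat \<H>)
    (rho_inv_obj G \<mu> K W) (rho_inv_mor G K W)"
  unfolding is_functor_def
proof (intro conjI ballI is_category_smooth_rep_cat is_category_left_module_cat)
  fix M :: "('g, 'v) rep" assume "M \<in> Obj (smooth_rep_cat G T)"
  then have M: "smooth_rep G T M" by (simp add: smooth_rep_cat_def)
  interpret M: hecke_rep G T \<mu> K W M by (rule hecke_rep[OF M])
  show "rho_inv_obj G \<mu> K W M \<in> Obj (left_module_cat \<H>)"
    using M.left_module_F_M by (simp add: left_module_cat_def)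
  have "compose (carrier W) (\<lambda>v\<in>carrier M. v) \<phi> = \<phi>" if \<phi>: "\<phi> \<in> M.K_homs" for \<phi>
    by (rule lin_maps_eqI[OF lin_maps_compose[OF W.complex_space_axioms M.K_homs_lin[OF \<phi>]
          lin_maps_id[OF M.M.complex_space_axioms]] M.K_homs_lin[OF \<phi>]])
      (simp add: compose_def M.K_homs_mem[OF \<phi>])
  then show "rho_inv_mor G K W M M (Idt (smooth_rep_cat G T) M) = Idt (left_module_cat \<H>) (rho_inv_obj G \<mu> K W M)"
    by (auto simp: smooth_rep_cat_def left_module_cat_def rho_inv_mor_def M.F_M_simps(1) intro!: restrict_ext)
  fix M' :: "('g, 'v) rep" assume "M' \<in> Obj (smooth_rep_cat G T)"
  then have M': "smooth_rep G T M'" by (simp add: smooth_rep_cat_def)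
  {
    fix h assume "h \<in> Hom (smooth_rep_cat G T) M M'"
    then show "rho_inv_mor G K W M M' h \<in> Hom (left_module_cat \<H>) (rho_inv_obj G \<mu> K W M) (rho_inv_obj G \<mu> K W M')"
      using rho_inv_mor_hom[OF M M'] by (simp add: smooth_rep_cat_def left_module_cat_def)
  next
    fix M'' :: "('g, 'v) rep" and h h'
    assume "M'' \<in> Obj (smooth_rep_cat G T)" "h \<in> Hom (smooth_rep_cat G T) M M'" "h' \<in> Hom (smooth_rep_cat G T) M' M''"
    then have h: "h \<in> rep_homs G M M'" "h' \<in> rep_homs G M' M''" by (simp_all add: smooth_rep_cat_def)
    have "compose (carrier W) (compose (carrier M) h' h) \<phi> = compose (carrier W) h' (compose (carrier W) h \<phi>)"
      if \<phi>: "\<phi> \<in> M.K_homs" for \<phi>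
      using M.K_homs_mem[OF \<phi>] by (auto simp: compose_def intro!: restrict_ext)
    then show "rho_inv_mor G K W M M'' (Cmp (smooth_rep_cat G T) M M' M'' h' h) =
      Cmp (left_module_cat \<H>) (rho_inv_obj G \<mu> K W M) (rho_inv_obj G \<mu> K W M') (rho_inv_obj G \<mu> K W M'')
        (rho_inv_mor G K W M' M'' h') (rho_inv_mor G K W M M' h)"
      using compose_K_hom[OF M M' h(1)]
      by (auto simp: smooth_rep_cat_def left_module_cat_def rho_inv_mor_def M.F_M_simps(1)
          compose_def[of "M.K_homs"] intro!: restrict_ext)
  }
qed

end

section \<open>Averages of matrix coefficients\<close>

context hecke_setup begin

text \<open>Extension by zero turns integrals over \<open>K\<close> into integrals over
  \<open>G\<close>. Here \<open>coeff_inv\<close> is the weight in averages, while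
  \<open>coeff\<close> also detects whether a group element falls into \<open>K\<close>.\<close>

definition coeff_inv :: "('w \<Rightarrow> complex) \<Rightarrow> 'w \<Rightarrow> 'g \<Rightarrow> complex" where
  "coeff_inv l w k = (if k \<in> K then l (act W (inv k) w) else 0)"

definition coeff :: "('w \<Rightarrow> complex) \<Rightarrow> 'w \<Rightarrow> 'g \<Rightarrow> complex" where
  "coeff l w k = (if k \<in> K then l (act W k w) else 0)"

lemma coeff_inv_compactly_supported:
  assumes l: "l \<in> W_dual" and w: "w \<in> carrier W"
  shows "compactly_supported 0 (coeff_inv l w)"
proof (rule compactly_supportedI[OF _ K])
  show "locally_constant T (coeff_inv l w)"
  proof (rule locally_constant_right_invariant[OF openin_fixer fixer_one])
    fix x j assume x: "x \<in> carrier G" and j: "j \<in> fixer"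
    note jK = fixer_K[OF j]
    have iff: "x \<otimes> j \<in> K \<longleftrightarrow> x \<in> K" by (rule cpt_open_mult_cancel_right[OF K jK x])
    have "act W (inv (x \<otimes> j)) w = act W (inv x) w" if xK: "x \<in> K"
      using x K_carrier[OF jK] act_W_mult[OF K_inv[OF jK] K_inv[OF xK] w]
        fixer_act[OF fixer_inv[OF j] act_W_mem[OF K_inv[OF xK] w]] by (simp add: inv_mult_group)
    then show "coeff_inv l w (x \<otimes> j) = coeff_inv l w x" using iff by (simp add: coeff_inv_def)
  qed
qed (simp add: coeff_inv_def)

lemma coeff_locally_constant:
  assumes l: "l \<in> W_dual" and w: "w \<in> carrier W"
  shows "locally_constant T (coeff l w)"
proof (rule locally_constant_right_invariant[OF openin_fixer fixer_one])
  fix x j assume x: "x \<in> carrier G" and j: "j \<in> fixer"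
  note jK = fixer_K[OF j]
  have iff: "x \<otimes> j \<in> K \<longleftrightarrow> x \<in> K" by (rule cpt_open_mult_cancel_right[OF K jK x])
  have "act W (x \<otimes> j) w = act W x w" if xK: "x \<in> K"
    using act_W_mult[OF xK jK w] fixer_act[OF j w] by simp
  then show "coeff l w (x \<otimes> j) = coeff l w x" using iff by (simp add: coeff_def)
qed

lemma coeff_inv_add_right:
  "l \<in> W_dual \<Longrightarrow> w \<in> carrier W \<Longrightarrow> w' \<in> carrier W \<Longrightarrow>
    coeff_inv l (w \<oplus>\<^bsub>W\<^esub> w') k = coeff_inv l w k + coeff_inv l w' k"
  by (simp add: coeff_inv_def act_W_add K_inv W.functional_add act_W_mem)

lemma coeff_inv_smult_right:
  "l \<in> W_dual \<Longrightarrow> w \<in> carrier W \<Longrightarrow> coeff_inv l (c \<odot>\<^bsub>W\<^esub> w) k = c * coeff_inv l w k"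
  by (simp add: coeff_inv_def act_W_smult K_inv W.functional_smult act_W_mem)

lemma coeff_add_right:
  "l \<in> W_dual \<Longrightarrow> w \<in> carrier W \<Longrightarrow> w' \<in> carrier W \<Longrightarrow>
    coeff l (w \<oplus>\<^bsub>W\<^esub> w') k = coeff l w k + coeff l w' k"
  by (simp add: coeff_def act_W_add W.functional_add act_W_mem)

lemma coeff_smult_right:
  "l \<in> W_dual \<Longrightarrow> w \<in> carrier W \<Longrightarrow> coeff l (c \<odot>\<^bsub>W\<^esub> w) k = c * coeff l w k"
  by (simp add: coeff_def act_W_smult W.functional_smult act_W_mem)

lemma coeff_add_left:
  "w \<in> carrier W \<Longrightarrow> coeff (l \<oplus>\<^bsub>dual W\<^esub> l') w k = coeff l w k + coeff l' w k"
  by (simp add: coeff_def act_W_mem)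

lemma coeff_smult_left: "w \<in> carrier W \<Longrightarrow> coeff (c \<odot>\<^bsub>dual W\<^esub> l) w k = c * coeff l w k"
  by (simp add: coeff_def act_W_mem)

lemma coeff_inv_act:
  assumes "k0 \<in> K" "k \<in> carrier G" "w \<in> carrier W"
  shows "coeff_inv l (act W k0 w) (k0 \<otimes> k) = coeff_inv l w k"
proof -
  have "act W (inv (k0 \<otimes> k)) (act W k0 w) = act W (inv k) w" if "k \<in> K"
  proof -
    have "inv (k0 \<otimes> k) \<otimes> k0 = inv k" using assms K_carrier by (simp add: inv_mult_group m_assoc)
    then show ?thesis using act_W_mult[OF K_inv[OF K_mult[OF assms(1) that]] assms(1,3)] by simp
  qed
  then show ?thesis using cpt_open_mult_cancel_left[OF K assms(1,2)] by (simp add: coeff_inv_def)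
qed

lemma coeff_left:
  assumes "k \<in> K" "g \<in> carrier G" "w \<in> carrier W" "l \<in> W_dual"
  shows "coeff l w (inv k \<otimes> g) = coeff (dual_op G W k l) w g"
  using cpt_open_mult_cancel_left[OF K K_inv[OF assms(1)] assms(2)] assms
  by (auto simp: coeff_def dual_op_apply act_W_mem act_W_mult K_inv)

lemma coeff_right:
  assumes "k \<in> K" "g \<in> carrier G" "w \<in> carrier W"
  shows "coeff l (act W k w) g = coeff l w (g \<otimes> k)"
  using cpt_open_mult_cancel_right[OF K assms(1,2)] assms by (auto simp: coeff_def act_W_mult)

lemma inv_in_K_commute: "x \<in> carrier G \<Longrightarrow> y \<in> carrier G \<Longrightarrow> inv x \<otimes> y \<in> K \<longleftrightarrow> inv y \<otimes> x \<in> K"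
  using cpt_open_inv_iff[OF K, of "inv x \<otimes> y"] by (simp add: inv_mult_group)

text \<open>For every representation, the element below sends \<open>\<phi>\<close> to the \<open>K\<close>-equivariant map
  \<open>w \<mapsto> \<integral>\<^sub>K l(k\<^sup>-\<^sup>1 w) k x \<phi>(v) dk\<close>.\<close>

definition hecke_elt :: "('w \<Rightarrow> complex) \<Rightarrow> 'g \<Rightarrow> 'w \<Rightarrow> 'g \<Rightarrow> ('w \<Rightarrow> complex) \<Rightarrow> 'w \<Rightarrow> complex" where
  "hecke_elt l x v = (\<lambda>y\<in>carrier G. \<lambda>l'\<in>carrier (dual W). \<lambda>w\<in>carrier W.
     complex_of_real (1 / measure \<mu> K) * (\<integral>k. coeff_inv l w k * coeff l' v (inv y \<otimes> k \<otimes> x) \<partial>\<mu>))"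

lemma hecke_elt_apply:
  "y \<in> carrier G \<Longrightarrow> l' \<in> W_dual \<Longrightarrow> w \<in> carrier W \<Longrightarrow> hecke_elt l x v y l' w =
    complex_of_real (1 / measure \<mu> K) * (\<integral>k. coeff_inv l w k * coeff l' v (inv y \<otimes> k \<otimes> x) \<partial>\<mu>)"
  by (simp add: hecke_elt_def)

lemma coeff_product_compactly_supported:
  assumes l: "l \<in> W_dual" and w: "w \<in> carrier W" and f: "locally_constant T f"
  shows "compactly_supported 0 (\<lambda>k. coeff_inv l w k * f k)"
  by (rule compactly_supported_comp2[OF coeff_inv_compactly_supported[OF l w] f]) simp

lemma hecke_elt_integrand:
  assumes "l \<in> W_dual" "x \<in> carrier G" "v \<in> carrier W" "y \<in> carrier G" "l' \<in> W_dual" "w \<in> carrier W"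
  shows "compactly_supported 0 (\<lambda>k. coeff_inv l w k * coeff l' v (inv y \<otimes> k \<otimes> x))"
  by (intro coeff_product_compactly_supported locally_constant_continuous[OF coeff_locally_constant]
      continuous_rules inv_closed assms)

text \<open>Translating \<open>k\<close> by an element of \<open>K\<close> gives left equivariance,
  and moving such an element into the functional \<open>l'\<close> gives right equivariance. The
  support lies in any compact open subgroup containing \<open>K\<close> and
  \<open>x\<close>.\<close>

lemma hecke_elt_mem:
  assumes l: "l \<in> W_dual" and x: "x \<in> carrier G" and v: "v \<in> carrier W"
  shows "hecke_elt l x v \<in> hecke_fun G T K W"
proof -
  let ?h = "hecke_elt l x v"
  note int = integrable_compactly_supported[OF hecke_elt_integrand[OF l x v]]
  note ap = hecke_elt_apply[where l = l and x = x and v = v]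
  obtain L where L: "cpt_open L" "K \<subseteq> L" "x \<in> L" by (rule cpt_open_covers_mem[OF K x])
  have dual: "?h y l' \<in> W_dual" if y: "y \<in> carrier G" and l': "l' \<in> W_dual" for y l'
  proof (rule lin_mapsI)
    show "?h y l' \<in> extensional (carrier W)" using y l' by (simp add: hecke_elt_def)
    fix w assume w: "w \<in> carrier W"
    {
      fix w' assume w': "w' \<in> carrier W"
      have "(\<integral>k. coeff_inv l (w \<oplus>\<^bsub>W\<^esub> w') k * coeff l' v (inv y \<otimes> k \<otimes> x) \<partial>\<mu>) =
        (\<integral>k. coeff_inv l w k * coeff l' v (inv y \<otimes> k \<otimes> x) \<partial>\<mu>) + (\<integral>k. coeff_inv l w' k * coeff l' v (inv y \<otimes> k \<otimes> x) \<partial>\<mu>)"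
        using Bochner_Integration.integral_add[OF int[OF y l' w] int[OF y l' w']]
        by (simp add: coeff_inv_add_right[OF l w w'] distrib_right)
      then show "?h y l' (w \<oplus>\<^bsub>W\<^esub> w') = ?h y l' w \<oplus>\<^bsub>scalars\<^esub> ?h y l' w'"
        by (simp add: ap y l' w w' distrib_left)
    next
      fix c
      have "(\<integral>k. coeff_inv l (c \<odot>\<^bsub>W\<^esub> w) k * coeff l' v (inv y \<otimes> k \<otimes> x) \<partial>\<mu>) =
        c * (\<integral>k. coeff_inv l w k * coeff l' v (inv y \<otimes> k \<otimes> x) \<partial>\<mu>)"
        by (simp add: coeff_inv_smult_right[OF l w] mult.assoc)
      then show "?h y l' (c \<odot>\<^bsub>W\<^esub> w) = c \<odot>\<^bsub>scalars\<^esub> ?h y l' w"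
        by (simp add: ap y l' w)
    }
  qed simp
  have endm: "?h y \<in> lin_maps (dual W) (dual W)" if y: "y \<in> carrier G" for y
  proof (rule lin_mapsI)
    show "?h y \<in> extensional (carrier (dual W))" using y by (simp add: hecke_elt_def)
    fix l' assume l': "l' \<in> carrier (dual W)"
    then have l'W: "l' \<in> W_dual" by simp
    show "?h y l' \<in> carrier (dual W)" using dual[OF y l'W] by simp
    {
      fix l'' assume l'': "l'' \<in> carrier (dual W)"
      then have l''W: "l'' \<in> W_dual" by simp
      have s: "l' \<oplus>\<^bsub>dual W\<^esub> l'' \<in> W_dual"
        using complex_space.add_mem[OF W_dual_space l' l''] by (simp only: dual_simps(1))
      show "?h y (l' \<oplus>\<^bsub>dual W\<^esub> l'') = ?h y l' \<oplus>\<^bsub>dual W\<^esub> ?h y l''"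
      proof (rule W_dual_eqI[OF dual[OF y s]])
        show "?h y l' \<oplus>\<^bsub>dual W\<^esub> ?h y l'' \<in> W_dual"
          using complex_space.add_mem[OF W_dual_space, of "?h y l'" "?h y l''"] dual[OF y l'W] dual[OF y l''W]
          by (simp only: dual_simps(1))
        fix w assume w: "w \<in> carrier W"
        have "(\<integral>k. coeff_inv l w k * coeff (l' \<oplus>\<^bsub>dual W\<^esub> l'') v (inv y \<otimes> k \<otimes> x) \<partial>\<mu>) =
          (\<integral>k. coeff_inv l w k * coeff l' v (inv y \<otimes> k \<otimes> x) \<partial>\<mu>) + (\<integral>k. coeff_inv l w k * coeff l'' v (inv y \<otimes> k \<otimes> x) \<partial>\<mu>)"
          using Bochner_Integration.integral_add[OF int[OF y l'W w] int[OF y l''W w]]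
          by (simp add: coeff_add_left[OF v] distrib_left del: dual_simps)
        then show "?h y (l' \<oplus>\<^bsub>dual W\<^esub> l'') w = (?h y l' \<oplus>\<^bsub>dual W\<^esub> ?h y l'') w"
          using ap[OF y s w] ap[OF y l'W w] ap[OF y l''W w] w by (simp add: distrib_left)
      qed
    next
      fix c
      have s: "c \<odot>\<^bsub>dual W\<^esub> l' \<in> W_dual"
        using complex_space.smult_mem[OF W_dual_space l'] by (simp only: dual_simps(1))
      show "?h y (c \<odot>\<^bsub>dual W\<^esub> l') = c \<odot>\<^bsub>dual W\<^esub> ?h y l'"
      proof (rule W_dual_eqI[OF dual[OF y s]])
        show "c \<odot>\<^bsub>dual W\<^esub> ?h y l' \<in> W_dual"
          using complex_space.smult_mem[OF W_dual_space, of "?h y l'"] dual[OF y l'W]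
          by (simp only: dual_simps(1))
        fix w assume w: "w \<in> carrier W"
        have "(\<integral>k. coeff_inv l w k * coeff (c \<odot>\<^bsub>dual W\<^esub> l') v (inv y \<otimes> k \<otimes> x) \<partial>\<mu>) =
          c * (\<integral>k. coeff_inv l w k * coeff l' v (inv y \<otimes> k \<otimes> x) \<partial>\<mu>)"
          by (simp add: coeff_smult_left[OF v] mult.left_commute del: dual_simps)
        then show "?h y (c \<odot>\<^bsub>dual W\<^esub> l') w = (c \<odot>\<^bsub>dual W\<^esub> ?h y l') w"
          using ap[OF y s w] ap[OF y l'W w] w by simp
      qed
    }
  qed
  show ?thesis
  proof (rule hecke_funI[OF _ endm L(1)])
    show "?h \<in> extensional (carrier G)" by (simp add: hecke_elt_def)
    fix y l' w assume y: "y \<in> carrier G" and l': "l' \<in> W_dual" and w: "w \<in> carrier W"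
    show "?h y l' w = 0" if yL: "y \<notin> L"
    proof -
      have "coeff_inv l w k * coeff l' v (inv y \<otimes> k \<otimes> x) = 0" if k: "k \<in> carrier G" for k
      proof (cases "k \<in> K")
        case True
        then have kx: "k \<otimes> x \<in> L" using L cpt_open_mult[OF L(1)] by blast
        have "inv y \<otimes> k \<otimes> x \<notin> L"
          using cpt_open_mult_cancel_right[OF L(1) kx, of "inv y"] y yL k x cpt_open_inv_iff[OF L(1) y] by (simp add: m_assoc)
        then have "inv y \<otimes> k \<otimes> x \<notin> K" using L(2) by blast
        then show ?thesis by (simp add: coeff_def)
      qed (simp add: coeff_inv_def)
      then have "(\<integral>k. coeff_inv l w k * coeff l' v (inv y \<otimes> k \<otimes> x) \<partial>\<mu>) = (\<integral>k. 0 \<partial>\<mu>)"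
        by (rule integral_cong_carrier)
      then show ?thesis using ap[OF y l' w] by simp
    qed
    fix k0 assume k0: "k0 \<in> K"
    note k0c = K_carrier[OF k0] and w' = act_W_mem[OF K_inv[OF k0] w]
    have k0y: "k0 \<otimes> y \<in> carrier G" "y \<otimes> k0 \<in> carrier G" using k0c y by auto
    show "?h (k0 \<otimes> y) l' w = ?h y l' (act W (inv k0) w)"
    proof -
      have "(\<integral>k. coeff_inv l w k * coeff l' v (inv (k0 \<otimes> y) \<otimes> k \<otimes> x) \<partial>\<mu>) =
        (\<integral>k. coeff_inv l w (k0 \<otimes> k) * coeff l' v (inv (k0 \<otimes> y) \<otimes> (k0 \<otimes> k) \<otimes> x) \<partial>\<mu>)"
        by (rule integral_translate[OF hecke_elt_integrand[OF l x v k0y(1) l' w] k0c, symmetric])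
      also have "\<dots> = (\<integral>k. coeff_inv l (act W (inv k0) w) k * coeff l' v (inv y \<otimes> k \<otimes> x) \<partial>\<mu>)"
      proof (rule integral_cong_carrier)
        fix k assume k: "k \<in> carrier G"
        have "inv (k0 \<otimes> y) \<otimes> (k0 \<otimes> k) = inv y \<otimes> k"
          using k0c y k by (simp add: inv_mult_group m_assoc) (simp add: m_assoc[symmetric])
        then show "coeff_inv l w (k0 \<otimes> k) * coeff l' v (inv (k0 \<otimes> y) \<otimes> (k0 \<otimes> k) \<otimes> x) =
          coeff_inv l (act W (inv k0) w) k * coeff l' v (inv y \<otimes> k \<otimes> x)"
          using coeff_inv_act[OF k0 k w', of l] act_W_cancel(2)[OF k0 w] by simp
      qed
      finally show ?thesis using ap[OF k0y(1) l' w] ap[OF y l' w'] by simp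
    qed
    show "?h (y \<otimes> k0) l' w = ?h y (dual_op G W k0 l') w"
    proof -
      have "(\<integral>k. coeff_inv l w k * coeff l' v (inv (y \<otimes> k0) \<otimes> k \<otimes> x) \<partial>\<mu>) =
        (\<integral>k. coeff_inv l w k * coeff (dual_op G W k0 l') v (inv y \<otimes> k \<otimes> x) \<partial>\<mu>)"
      proof (rule integral_cong_carrier)
        fix k assume k: "k \<in> carrier G"
        have "inv (y \<otimes> k0) \<otimes> k \<otimes> x = inv k0 \<otimes> (inv y \<otimes> k \<otimes> x)"
          using k0c y k x by (simp add: inv_mult_group m_assoc)
        then show "coeff_inv l w k * coeff l' v (inv (y \<otimes> k0) \<otimes> k \<otimes> x) =
          coeff_inv l w k * coeff (dual_op G W k0 l') v (inv y \<otimes> k \<otimes> x)"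
          using coeff_left[OF k0 _ v l', of "inv y \<otimes> k \<otimes> x"] y k x by simp
      qed
      then show ?thesis using ap[OF k0y(2) l' w] ap[OF y dual_op_mem[OF k0 l'] w] by simp
    qed
  qed
qed

text \<open>The balancing relation of compact induction, which identifies \<open>(x, k v)\<close>
  with \<open>(x k, v)\<close>. It makes \<open>unit_hom\<close> equivariant and, for
  \<open>k\<close> in \<open>fixer\<close>, gives local constancy in \<open>x\<close>.\<close>

lemma hecke_elt_act:
  assumes "x \<in> carrier G" "k \<in> K" "v \<in> carrier W"
  shows "hecke_elt l x (act W k v) = hecke_elt l (x \<otimes> k) v"
  unfolding hecke_elt_def
proof (intro restrict_ext arg_cong2[where f = "(*)"] refl integral_cong_carrier)
  fix y l' w k' assume y: "y \<in> carrier G" and k': "k' \<in> carrier G"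
  show "coeff l' (act W k v) (inv y \<otimes> k' \<otimes> x) = coeff l' v (inv y \<otimes> k' \<otimes> (x \<otimes> k))"
    using coeff_right[OF assms(2) _ assms(3), of "inv y \<otimes> k' \<otimes> x" l'] y k' assms K_carrier
    by (simp add: m_assoc)
qed

lemma hecke_elt_add:
  assumes l: "l \<in> W_dual" and x: "x \<in> carrier G" and v: "v \<in> carrier W" "v' \<in> carrier W"
  shows "hecke_elt l x (v \<oplus>\<^bsub>W\<^esub> v') = hecke_elt l x v \<oplus>\<^bsub>\<H>\<^esub> hecke_elt l x v'"
proof (rule hecke_fun_eqI)
  fix y l' w assume y: "y \<in> carrier G" and l': "l' \<in> W_dual" and w: "w \<in> carrier W"
  have "(\<integral>k. coeff_inv l w k * coeff l' (v \<oplus>\<^bsub>W\<^esub> v') (inv y \<otimes> k \<otimes> x) \<partial>\<mu>) =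
    (\<integral>k. coeff_inv l w k * coeff l' v (inv y \<otimes> k \<otimes> x) \<partial>\<mu>) + (\<integral>k. coeff_inv l w k * coeff l' v' (inv y \<otimes> k \<otimes> x) \<partial>\<mu>)"
    using Bochner_Integration.integral_add[OF
        integrable_compactly_supported[OF hecke_elt_integrand[OF l x v(1) y l' w]]
        integrable_compactly_supported[OF hecke_elt_integrand[OF l x v(2) y l' w]]]
    by (simp add: coeff_add_right[OF l' v] distrib_left)
  then show "hecke_elt l x (v \<oplus>\<^bsub>W\<^esub> v') y l' w = (hecke_elt l x v \<oplus>\<^bsub>\<H>\<^esub> hecke_elt l x v') y l' w"
    using y l' w by (simp add: hecke_add_apply hecke_elt_apply distrib_left)
qed (intro hecke_elt_mem hecke_add_mem l x v W.add_mem)+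

lemma hecke_elt_smult:
  assumes l: "l \<in> W_dual" and x: "x \<in> carrier G" and v: "v \<in> carrier W"
  shows "hecke_elt l x (c \<odot>\<^bsub>W\<^esub> v) = c \<odot>\<^bsub>hecke_space\<^esub> hecke_elt l x v"
proof (rule hecke_fun_eqI)
  fix y l' w assume y: "y \<in> carrier G" and l': "l' \<in> W_dual" and w: "w \<in> carrier W"
  have "(\<integral>k. coeff_inv l w k * coeff l' (c \<odot>\<^bsub>W\<^esub> v) (inv y \<otimes> k \<otimes> x) \<partial>\<mu>) =
    c * (\<integral>k. coeff_inv l w k * coeff l' v (inv y \<otimes> k \<otimes> x) \<partial>\<mu>)"
    by (simp add: coeff_smult_right[OF l' v] mult.left_commute)
  then show "hecke_elt l x (c \<odot>\<^bsub>W\<^esub> v) y l' w = (c \<odot>\<^bsub>hecke_space\<^esub> hecke_elt l x v) y l' w"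
    using y l' w by (simp add: hecke_smult_apply hecke_elt_apply)
qed (intro hecke_elt_mem hecke_smult_mem l x v W.smult_mem)+

text \<open>For fixed \<open>k\<close> only the \<open>g\<close> in the coset \<open>k x K\<close>
  contribute, and by equivariance the contribution is the same throughout the coset. In
  \<open>integral_hecke_elt\<close> the same integral over \<open>k\<close> is reached from another
  expression.\<close>

lemma hecke_elt_mult_apply:
  assumes l: "l \<in> W_dual" and x: "x \<in> carrier G" and v: "v \<in> carrier W" and f: "f \<in> hecke_fun G T K W"
    and y: "y \<in> carrier G" and l': "l' \<in> W_dual" and w: "w \<in> carrier W"
  shows "(hecke_elt l x v \<otimes>\<^bsub>\<H>\<^esub> f) y l' w = (\<integral>k. coeff_inv l w k * f (inv x \<otimes> inv k \<otimes> y) l' v \<partial>\<mu>)"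
proof -
  let ?c = "complex_of_real (1 / measure \<mu> K)"
  let ?s = "\<lambda>k. coeff_inv l w k * f (inv x \<otimes> inv k \<otimes> y) l' v"
  have cs: "compactly_supported 0 ?s"
    by (intro coeff_product_compactly_supported[OF l w] locally_constant_comp[OF locally_constant_hecke[OF f]]
        continuous_rules inv_closed x y)
  have p: "continuous_map T T (\<lambda>k. k \<otimes> x)" by (intro continuous_rules x)
  have "(hecke_elt l x v \<otimes>\<^bsub>\<H>\<^esub> f) y l' w = (\<integral>g. hecke_elt l x v g (f (inv g \<otimes> y) l') w \<partial>\<mu>)"
    by (rule hecke_mult_apply[OF hecke_elt_mem[OF l x v] f y l' w])
  also have "\<dots> = (\<integral>g. ?c * (\<integral>k. (if inv (k \<otimes> x) \<otimes> g \<in> K then ?s k else 0) \<partial>\<mu>) \<partial>\<mu>)"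
  proof (rule integral_cong_carrier)
    fix g assume g: "g \<in> carrier G"
    then have gy: "inv g \<otimes> y \<in> carrier G" using y by simp
    note m = hecke_fun_dual[OF f gy l']
    have "(\<integral>k. coeff_inv l w k * coeff (f (inv g \<otimes> y) l') v (inv g \<otimes> k \<otimes> x) \<partial>\<mu>) =
      (\<integral>k. (if inv (k \<otimes> x) \<otimes> g \<in> K then ?s k else 0) \<partial>\<mu>)"
    proof (rule integral_cong_carrier)
      fix k assume k: "k \<in> carrier G"
      let ?u = "inv g \<otimes> k \<otimes> x"
      have u: "?u \<in> carrier G" using g k x by simp
      have iff: "inv (k \<otimes> x) \<otimes> g \<in> K \<longleftrightarrow> ?u \<in> K"
        using inv_in_K_commute[of "k \<otimes> x" g] g k x by (simp add: m_assoc)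
      have "f (inv g \<otimes> y) l' (act W ?u v) = f (inv x \<otimes> inv k \<otimes> y) l' v" if uK: "?u \<in> K"
      proof -
        have "inv ?u \<otimes> (inv g \<otimes> y) = inv x \<otimes> inv k \<otimes> y"
          using g k x y by (simp add: inv_mult_group m_assoc) (simp add: m_assoc[symmetric])
        then show ?thesis using hecke_fun_left[OF f K_inv[OF uK] gy l' v] u by simp
      qed
      then show "coeff_inv l w k * coeff (f (inv g \<otimes> y) l') v (inv g \<otimes> k \<otimes> x) =
        (if inv (k \<otimes> x) \<otimes> g \<in> K then ?s k else 0)"
        using iff by (simp add: coeff_def)
    qed
    then show "hecke_elt l x v g (f (inv g \<otimes> y) l') w =
      ?c * (\<integral>k. (if inv (k \<otimes> x) \<otimes> g \<in> K then ?s k else 0) \<partial>\<mu>)"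
      using hecke_elt_apply[OF g m w] by simp
  qed
  also have "\<dots> = ?c * (\<integral>g. \<integral>k. (if inv (k \<otimes> x) \<otimes> g \<in> K then ?s k else 0) \<partial>\<mu> \<partial>\<mu>)"
    by (rule integral_mult_right_zero)
  also have "\<dots> = (\<integral>k. ?s k \<partial>\<mu>)"
    unfolding integral_integral_coset[OF K cs p] using measure_K_nonzero by simp
  finally show ?thesis .
qed

lemma transposed_hecke_right:
  assumes f: "f \<in> hecke_fun G T K W" and g: "g \<in> carrier G" and u: "u \<in> K" and w: "w \<in> carrier W" and l: "l \<in> W_dual"
  shows "l (act W u (transposed W (f g) w)) = f (g \<otimes> inv u) l w"
proof -
  have t: "transposed W (f g) w \<in> carrier W" using transposed_mem[OF hecke_fun_end[OF f g] w] .
  have "f (g \<otimes> inv u) l w = f g (dual_op G W (inv u) l) w" by (rule hecke_fun_right[OF f K_inv[OF u] g l w])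
  also have "\<dots> = dual_op G W (inv u) l (transposed W (f g) w)"
    by (rule functional_transposed[OF hecke_fun_end[OF f g] dual_op_mem[OF K_inv[OF u] l] w, symmetric])
  also have "\<dots> = l (act W u (transposed W (f g) w))"
    using dual_op_apply[OF K_inv[OF u] l t] K_carrier[OF u] by simp
  finally show ?thesis by simp
qed

text \<open>Here the \<open>g\<close> that contribute for fixed \<open>k\<close> form the coset
  \<open>x^-1 k^-1 y K\<close>, on which the transpose of \<open>f g\<close> and the coefficient
  combine to a constant. Comparison with \<open>hecke_elt_mult_apply\<close> shows that multiplying
  by \<open>f\<close> on the right is the same as integrating translates against
  \<open>f\<close>.\<close>

lemma integral_hecke_elt:
  assumes l: "l \<in> W_dual" and x: "x \<in> carrier G" and v: "v \<in> carrier W" and f: "f \<in> hecke_fun G T K W"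
    and y: "y \<in> carrier G" and l': "l' \<in> W_dual" and w: "w \<in> carrier W"
  shows "(\<integral>g. hecke_elt l (x \<otimes> g) (transposed W (f g) v) y l' w \<partial>\<mu>) =
    (\<integral>k. coeff_inv l w k * f (inv x \<otimes> inv k \<otimes> y) l' v \<partial>\<mu>)"
proof -
  let ?c = "complex_of_real (1 / measure \<mu> K)"
  let ?s = "\<lambda>k. coeff_inv l w k * f (inv x \<otimes> inv k \<otimes> y) l' v"
  let ?p = "\<lambda>k. inv x \<otimes> inv k \<otimes> y"
  have cs: "compactly_supported 0 ?s"
    by (intro coeff_product_compactly_supported[OF l w] locally_constant_comp[OF locally_constant_hecke[OF f]]
        continuous_rules inv_closed x y)
  have p: "continuous_map T T ?p" by (intro continuous_rules inv_closed x y)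
  have "(\<integral>g. hecke_elt l (x \<otimes> g) (transposed W (f g) v) y l' w \<partial>\<mu>) =
    (\<integral>g. ?c * (\<integral>k. (if inv (?p k) \<otimes> g \<in> K then ?s k else 0) \<partial>\<mu>) \<partial>\<mu>)"
  proof (rule integral_cong_carrier)
    fix g assume g: "g \<in> carrier G"
    have "(\<integral>k. coeff_inv l w k * coeff l' (transposed W (f g) v) (inv y \<otimes> k \<otimes> (x \<otimes> g)) \<partial>\<mu>) =
      (\<integral>k. (if inv (?p k) \<otimes> g \<in> K then ?s k else 0) \<partial>\<mu>)"
    proof (rule integral_cong_carrier)
      fix k assume k: "k \<in> carrier G"
      let ?u = "inv y \<otimes> k \<otimes> (x \<otimes> g)"
      have u: "inv (?p k) \<otimes> g = ?u" using g k x y by (simp add: inv_mult_group m_assoc)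
      have "l' (act W ?u (transposed W (f g) v)) = f (?p k) l' v" if uK: "?u \<in> K"
      proof -
        have "g \<otimes> inv ?u = ?p k"
          using g k x y by (simp add: inv_mult_group m_assoc) (simp add: m_assoc[symmetric])
        then show ?thesis using transposed_hecke_right[OF f g uK v l'] by simp
      qed
      then show "coeff_inv l w k * coeff l' (transposed W (f g) v) ?u = (if inv (?p k) \<otimes> g \<in> K then ?s k else 0)"
        unfolding u by (simp add: coeff_def)
    qed
    then show "hecke_elt l (x \<otimes> g) (transposed W (f g) v) y l' w =
      ?c * (\<integral>k. (if inv (?p k) \<otimes> g \<in> K then ?s k else 0) \<partial>\<mu>)"
      using hecke_elt_apply[OF y l' w] by simp
  qed
  also have "\<dots> = ?c * (\<integral>g. \<integral>k. (if inv (?p k) \<otimes> g \<in> K then ?s k else 0) \<partial>\<mu> \<partial>\<mu>)"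
    by (rule integral_mult_right_zero)
  also have "\<dots> = (\<integral>k. ?s k \<partial>\<mu>)"
    unfolding integral_integral_coset[OF K cs p] using measure_K_nonzero by simp
  finally show ?thesis .
qed

text \<open>Contracting the frame inside the integral leaves \<open>l'\<close> at
  \<open>inv y\<close> acting on \<open>w\<close>, independent of \<open>k\<close>, so integrating
  over \<open>K\<close> just cancels the factor \<open>1 / measure \<mu> K\<close>; the volume on
  the right undoes the normalisation of the unit. This is the counterpart of
  \<open>sum_avg_frame\<close> in the algebra and yields injectivity of
  \<open>unit_hom\<close>.\<close>

lemma sum_hecke_elt_frame:
  assumes B: "finite B" "B \<subseteq> carrier W" "\<forall>b\<in>B. E b \<in> W_dual"
    "\<forall>l\<in>W_dual. \<forall>w\<in>carrier W. l w = (\<Sum>b\<in>B. E b w * l b)"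
    and y: "y \<in> carrier G" and l': "l' \<in> W_dual" and w: "w \<in> carrier W"
  shows "(\<Sum>b\<in>B. hecke_elt (E b) \<one> b y l' w) = measure \<mu> K * \<one>\<^bsub>\<H>\<^esub> y l' w"
proof -
  let ?c = "complex_of_real (1 / measure \<mu> K)"
  have Bm: "b \<in> carrier W" "E b \<in> W_dual" if "b \<in> B" for b using that B by auto
  have "(\<Sum>b\<in>B. hecke_elt (E b) \<one> b y l' w) =
    ?c * (\<Sum>b\<in>B. (\<integral>k. coeff_inv (E b) w k * coeff l' b (inv y \<otimes> k \<otimes> \<one>) \<partial>\<mu>))"
    unfolding sum_distrib_left by (intro sum.cong refl hecke_elt_apply y l' w)
  also have "(\<Sum>b\<in>B. (\<integral>k. coeff_inv (E b) w k * coeff l' b (inv y \<otimes> k \<otimes> \<one>) \<partial>\<mu>)) =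
    (\<integral>k. (\<Sum>b\<in>B. coeff_inv (E b) w k * coeff l' b (inv y \<otimes> k \<otimes> \<one>)) \<partial>\<mu>)"
    using Bm by (intro Bochner_Integration.integral_sum[symmetric] integrable_compactly_supported hecke_elt_integrand y l' w) auto
  also have "\<dots> = (\<integral>k. (if k \<in> K then (if y \<in> K then l' (act W (inv y) w) else 0) else 0) \<partial>\<mu>)"
  proof (rule integral_cong_carrier)
    fix k assume k: "k \<in> carrier G"
    show "(\<Sum>b\<in>B. coeff_inv (E b) w k * coeff l' b (inv y \<otimes> k \<otimes> \<one>)) =
      (if k \<in> K then (if y \<in> K then l' (act W (inv y) w) else 0) else 0)"
    proof (cases "k \<in> K")
      case kK: True
      have iff: "inv y \<otimes> k \<in> K \<longleftrightarrow> y \<in> K"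
        using cpt_open_mult_cancel_right[OF K kK, of "inv y"] cpt_open_inv_iff[OF K y] y by simp
      show ?thesis
      proof (cases "y \<in> K")
        case yK: True
        then have uK: "inv y \<otimes> k \<in> K" using iff by simp
        let ?l = "dual_op G W (inv (inv y \<otimes> k)) l'"
        have l: "?l \<in> W_dual" by (rule dual_op_mem[OF K_inv[OF uK] l'])
        have l_ap: "?l u = l' (act W (inv y \<otimes> k) u)" if "u \<in> carrier W" for u
          using dual_op_apply[OF K_inv[OF uK] l' that] y k by simp
        have kw: "act W (inv k) w \<in> carrier W" by (rule act_W_mem[OF K_inv[OF kK] w])
        have "(\<Sum>b\<in>B. coeff_inv (E b) w k * coeff l' b (inv y \<otimes> k \<otimes> \<one>)) =
          (\<Sum>b\<in>B. E b (act W (inv k) w) * ?l b)"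
          using Bm kK uK y k by (intro sum.cong) (auto simp: coeff_inv_def coeff_def l_ap)
        also have "\<dots> = ?l (act W (inv k) w)" using B(4) l kw by simp
        also have "\<dots> = l' (act W (inv y) w)"
        proof -
          have "inv y \<otimes> k \<otimes> inv k = inv y" using y k by (simp add: m_assoc)
          then show ?thesis using act_W_mult[OF uK K_inv[OF kK] w] l_ap[OF kw] by simp
        qed
        finally show ?thesis using kK yK by simp
      next
        case False
        then show ?thesis using iff y k kK by (simp add: coeff_def)
      qed
    qed (simp add: coeff_inv_def)
  qed
  also have "?c * \<dots> = measure \<mu> K * \<one>\<^bsub>\<H>\<^esub> y l' w"
    unfolding integral_K using measure_K_nonzero y l' w by (simp add: hecke_one_apply)
  finally show ?thesis .
qed

end

section \<open>Averaging operators on a representation\<close>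

context hecke_rep begin

text \<open>The rank one map \<open>w \<mapsto> l(w) m\<close>, conjugated by \<open>k\<close> and
  integrated over \<open>K\<close>: the usual way to make a linear map equivariant.\<close>

definition avg :: "('w \<Rightarrow> complex) \<Rightarrow> 'm \<Rightarrow> 'w \<Rightarrow> 'm" where
  "avg l m = (\<lambda>w\<in>carrier W. lc_integral \<mu> M (\<lambda>k. coeff_inv l w k \<odot>\<^bsub>M\<^esub> (if k \<in> carrier G then act M k m else \<zero>\<^bsub>M\<^esub>)))"

lemma avg_integrand:
  assumes l: "l \<in> W_dual" and m: "m \<in> carrier M" and w: "w \<in> carrier W"
  shows "compactly_supported \<zero>\<^bsub>M\<^esub> (\<lambda>k. coeff_inv l w k \<odot>\<^bsub>M\<^esub> (if k \<in> carrier G then act M k m else \<zero>\<^bsub>M\<^esub>))"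
    and "k \<in> carrier G \<Longrightarrow> coeff_inv l w k \<odot>\<^bsub>M\<^esub> (if k \<in> carrier G then act M k m else \<zero>\<^bsub>M\<^esub>) \<in> carrier M"
proof -
  have lc: "locally_constant T (\<lambda>k. if k \<in> carrier G then act M k m else \<zero>\<^bsub>M\<^esub>)"
    by (rule locally_constant_cong[OF locally_constant_orbit[OF m]]) simp
  show "compactly_supported \<zero>\<^bsub>M\<^esub> (\<lambda>k. coeff_inv l w k \<odot>\<^bsub>M\<^esub> (if k \<in> carrier G then act M k m else \<zero>\<^bsub>M\<^esub>))"
    by (rule compactly_supported_comp2[OF coeff_inv_compactly_supported[OF l w] lc]) (simp add: act_M_mem m)
qed (simp add: act_M_mem m)

lemma avg_mem: "l \<in> W_dual \<Longrightarrow> m \<in> carrier M \<Longrightarrow> w \<in> carrier W \<Longrightarrow> avg l m w \<in> carrier M"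
  using lc_integral_mem[OF M.complex_space_axioms avg_integrand] by (simp add: avg_def)

lemma functional_avg:
  assumes l: "l \<in> W_dual" and m: "m \<in> carrier M" and w: "w \<in> carrier W" and \<xi>: "\<xi> \<in> M_dual"
  shows "\<xi> (avg l m w) = (\<integral>k. coeff_inv l w k * \<xi> (act M k m) \<partial>\<mu>)"
proof -
  have "\<xi> (avg l m w) = (\<integral>k. \<xi> (coeff_inv l w k \<odot>\<^bsub>M\<^esub> (if k \<in> carrier G then act M k m else \<zero>\<^bsub>M\<^esub>)) \<partial>\<mu>)"
    using functional_lc_integral[OF M.complex_space_axioms avg_integrand[OF l m w] \<xi>] w by (simp add: avg_def)
  also have "\<dots> = (\<integral>k. coeff_inv l w k * \<xi> (act M k m) \<partial>\<mu>)"
    by (rule integral_cong_carrier) (simp add: M.functional_smult[OF \<xi>] act_M_mem m)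
  finally show ?thesis .
qed

lemma avg_cs:
  assumes l: "l \<in> W_dual" and m: "m \<in> carrier M" and w: "w \<in> carrier W" and \<xi>: "\<xi> \<in> M_dual"
  shows "compactly_supported 0 (\<lambda>k. coeff_inv l w k * \<xi> (act M k m))"
  by (intro coeff_product_compactly_supported l w locally_constant_comp[OF locally_constant_orbit[OF m]])

lemma avg_K_homs:
  assumes l: "l \<in> W_dual" and m: "m \<in> carrier M"
  shows "avg l m \<in> K_homs"
proof (rule K_homsI)
  note mem = avg_mem[OF l m] and fnl = functional_avg[OF l m]
    and int = integrable_compactly_supported[OF avg_cs[OF l m]]
  show "avg l m \<in> lin_maps W M"
  proof (rule lin_mapsI)
    show "avg l m \<in> extensional (carrier W)" by (simp add: avg_def)
    fix w assume w: "w \<in> carrier W"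
    show "avg l m w \<in> carrier M" by (rule mem[OF w])
    {
      fix w' assume w': "w' \<in> carrier W"
      show "avg l m (w \<oplus>\<^bsub>W\<^esub> w') = avg l m w \<oplus>\<^bsub>M\<^esub> avg l m w'"
      proof (rule M.functionals_eqI)
        fix \<xi> assume \<xi>: "\<xi> \<in> M_dual"
        show "\<xi> (avg l m (w \<oplus>\<^bsub>W\<^esub> w')) = \<xi> (avg l m w \<oplus>\<^bsub>M\<^esub> avg l m w')"
          using fnl[OF W.add_mem[OF w w'] \<xi>] fnl[OF w \<xi>] fnl[OF w' \<xi>] M.functional_add[OF \<xi> mem[OF w] mem[OF w']]
            Bochner_Integration.integral_add[OF int[OF w \<xi>] int[OF w' \<xi>]]
          by (simp add: coeff_inv_add_right[OF l w w'] distrib_right)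
      qed (intro mem M.add_mem W.add_mem w w')+
    next
      fix c
      show "avg l m (c \<odot>\<^bsub>W\<^esub> w) = c \<odot>\<^bsub>M\<^esub> avg l m w"
      proof (rule M.functionals_eqI)
        fix \<xi> assume \<xi>: "\<xi> \<in> M_dual"
        show "\<xi> (avg l m (c \<odot>\<^bsub>W\<^esub> w)) = \<xi> (c \<odot>\<^bsub>M\<^esub> avg l m w)"
          using fnl[OF W.smult_mem[OF w] \<xi>] fnl[OF w \<xi>] M.functional_smult[OF \<xi> mem[OF w]]
          by (simp add: coeff_inv_smult_right[OF l w] mult.assoc)
      qed (intro mem M.smult_mem W.smult_mem w)+
    }
  qed
  fix k w assume k: "k \<in> K" and w: "w \<in> carrier W"
  note kc = K_carrier[OF k] and kw = act_W_mem[OF k w]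
  show "avg l m (act W k w) = act M k (avg l m w)"
  proof (rule M.functionals_eqI)
    fix \<xi> assume \<xi>: "\<xi> \<in> M_dual"
    let ?\<xi> = "\<lambda>v\<in>carrier M. \<xi> (act M k v)"
    have "\<xi> (avg l m (act W k w)) = (\<integral>g. coeff_inv l (act W k w) (k \<otimes> g) * \<xi> (act M (k \<otimes> g) m) \<partial>\<mu>)"
      unfolding fnl[OF kw \<xi>] by (rule integral_translate[OF avg_cs[OF l m kw \<xi>] kc, symmetric])
    also have "\<dots> = (\<integral>g. coeff_inv l w g * ?\<xi> (act M g m) \<partial>\<mu>)"
      by (rule integral_cong_carrier) (simp add: coeff_inv_act[OF k _ w] M.act_mult kc m act_M_mem)
    also have "\<dots> = \<xi> (act M k (avg l m w))"
      using fnl[OF w functional_act[OF \<xi> kc]] mem[OF w] by simp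
    finally show "\<xi> (avg l m (act W k w)) = \<xi> (act M k (avg l m w))" .
  qed (intro mem act_M_mem kc kw w)+
qed

lemma avg_add:
  assumes l: "l \<in> W_dual" and m: "m \<in> carrier M" "m' \<in> carrier M"
  shows "avg l (m \<oplus>\<^bsub>M\<^esub> m') = avg l m \<oplus>\<^bsub>F_M\<^esub> avg l m'"
proof (rule K_homs_functional_eqI[OF avg_K_homs[OF l M.add_mem[OF m]]])
  show "avg l m \<oplus>\<^bsub>F_M\<^esub> avg l m' \<in> K_homs"
    using abelian_groupE(1)[OF abelian_group_F_M] avg_K_homs[OF l] m by (simp add: F_M_simps(1))
  fix \<xi> w assume \<xi>: "\<xi> \<in> M_dual" and w: "w \<in> carrier W"
  have "(\<integral>k. coeff_inv l w k * \<xi> (act M k (m \<oplus>\<^bsub>M\<^esub> m')) \<partial>\<mu>) =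
    (\<integral>k. coeff_inv l w k * \<xi> (act M k m) + coeff_inv l w k * \<xi> (act M k m') \<partial>\<mu>)"
    by (rule integral_cong_carrier) (simp add: act_M_add m M.functional_add[OF \<xi>] act_M_mem distrib_left)
  also have "\<dots> = (\<integral>k. coeff_inv l w k * \<xi> (act M k m) \<partial>\<mu>) + (\<integral>k. coeff_inv l w k * \<xi> (act M k m') \<partial>\<mu>)"
    by (intro Bochner_Integration.integral_add integrable_compactly_supported avg_cs l m w \<xi>)
  finally show "\<xi> (avg l (m \<oplus>\<^bsub>M\<^esub> m') w) = \<xi> ((avg l m \<oplus>\<^bsub>F_M\<^esub> avg l m') w)"
    using functional_avg[OF l _ w \<xi>] m M.functional_add[OF \<xi> avg_mem[OF l m(1) w] avg_mem[OF l m(2) w]] w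
    by (simp add: F_M_simps(3))
qed

lemma avg_smult:
  assumes l: "l \<in> W_dual" and m: "m \<in> carrier M"
  shows "avg l (c \<odot>\<^bsub>M\<^esub> m) = (c \<odot>\<^bsub>hecke_space\<^esub> \<one>\<^bsub>\<H>\<^esub>) \<odot>\<^bsub>F_M\<^esub> avg l m"
proof (rule K_homs_functional_eqI[OF avg_K_homs[OF l M.smult_mem[OF m]]])
  note am = avg_K_homs[OF l m]
  show "(c \<odot>\<^bsub>hecke_space\<^esub> \<one>\<^bsub>\<H>\<^esub>) \<odot>\<^bsub>F_M\<^esub> avg l m \<in> K_homs"
    by (intro action_K_homs hecke_smult_mem hecke_one_mem am)
  fix \<xi> w assume \<xi>: "\<xi> \<in> M_dual" and w: "w \<in> carrier W"
  have "(\<integral>k. coeff_inv l w k * \<xi> (act M k (c \<odot>\<^bsub>M\<^esub> m)) \<partial>\<mu>) = (\<integral>k. c * (coeff_inv l w k * \<xi> (act M k m)) \<partial>\<mu>)"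
    by (rule integral_cong_carrier) (simp add: act_M_smult m M.functional_smult[OF \<xi>] act_M_mem)
  then have "\<xi> (avg l (c \<odot>\<^bsub>M\<^esub> m) w) = c * \<xi> (avg l m w)"
    using functional_avg[OF l M.smult_mem[OF m] w \<xi>] functional_avg[OF l m w \<xi>] by simp
  then show "\<xi> (avg l (c \<odot>\<^bsub>M\<^esub> m) w) = \<xi> (((c \<odot>\<^bsub>hecke_space\<^esub> \<one>\<^bsub>\<H>\<^esub>) \<odot>\<^bsub>F_M\<^esub> avg l m) w)"
    unfolding action_scalar[OF hecke_one_mem am] action_one[OF am]
    using w M.functional_smult[OF \<xi> avg_mem[OF l m w]] by simp
qed

text \<open>In the action of \<open>hecke_elt l x v\<close> only \<open>y\<close> in the coset
  \<open>k x K\<close> contribute for given \<open>k\<close>, each with the vector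
  \<open>k x \<phi>(v)\<close>; integrating over the coset gives the volume of \<open>K\<close>,
  which the factor in \<open>hecke_elt\<close> cancels. As the Hecke element depends on neither
  \<open>M\<close> nor \<open>\<phi>\<close>, the same one serves every representation.\<close>

lemma avg_translate:
  assumes l: "l \<in> W_dual" and x: "x \<in> carrier G" and \<phi>: "\<phi> \<in> K_homs" and v: "v \<in> carrier W"
  shows "avg l (act M x (\<phi> v)) = hecke_elt l x v \<odot>\<^bsub>F_M\<^esub> \<phi>"
proof (rule K_homs_functional_eqI)
  note h = hecke_elt_mem[OF l x v] and \<phi>v = K_homs_mem[OF \<phi> v]
  have m: "act M x (\<phi> v) \<in> carrier M" by (rule act_M_mem[OF x \<phi>v])
  show "avg l (act M x (\<phi> v)) \<in> K_homs" by (rule avg_K_homs[OF l m])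
  show "hecke_elt l x v \<odot>\<^bsub>F_M\<^esub> \<phi> \<in> K_homs" by (rule action_K_homs[OF h \<phi>])
  fix \<xi> w assume \<xi>: "\<xi> \<in> M_dual" and w: "w \<in> carrier W"
  let ?c = "complex_of_real (1 / measure \<mu> K)"
  let ?s = "\<lambda>k. coeff_inv l w k * \<xi> (act M k (act M x (\<phi> v)))"
  have cs: "compactly_supported 0 ?s" by (rule avg_cs[OF l m w \<xi>])
  have p: "continuous_map T T (\<lambda>k. k \<otimes> x)" by (intro continuous_rules x)
  have "\<xi> ((hecke_elt l x v \<odot>\<^bsub>F_M\<^esub> \<phi>) w) = (\<integral>y. \<xi> (act M y (\<phi> (transposed W (hecke_elt l x v y) w))) \<partial>\<mu>)"
    by (rule functional_action[OF h \<phi> w \<xi>])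
  also have "\<dots> = (\<integral>y. ?c * (\<integral>k. (if inv (k \<otimes> x) \<otimes> y \<in> K then ?s k else 0) \<partial>\<mu>) \<partial>\<mu>)"
  proof (rule integral_cong_carrier)
    fix y assume y: "y \<in> carrier G"
    let ?\<eta> = "\<lambda>w\<in>carrier W. \<xi> (act M y (\<phi> w))"
    note \<eta> = functional_K_hom[OF \<phi> \<xi> y]
    have "\<xi> (act M y (\<phi> (transposed W (hecke_elt l x v y) w))) = ?\<eta> (transposed W (hecke_elt l x v y) w)"
      using hecke_transposed_mem[OF h y w] by simp
    also have "\<dots> = hecke_elt l x v y ?\<eta> w" by (rule functional_transposed[OF hecke_fun_end[OF h y] \<eta> w])
    also have "\<dots> = ?c * (\<integral>k. coeff_inv l w k * coeff ?\<eta> v (inv y \<otimes> k \<otimes> x) \<partial>\<mu>)"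
      by (rule hecke_elt_apply[OF y \<eta> w])
    also have "(\<integral>k. coeff_inv l w k * coeff ?\<eta> v (inv y \<otimes> k \<otimes> x) \<partial>\<mu>) =
      (\<integral>k. (if inv (k \<otimes> x) \<otimes> y \<in> K then ?s k else 0) \<partial>\<mu>)"
    proof (rule integral_cong_carrier)
      fix k assume k: "k \<in> carrier G"
      let ?u = "inv y \<otimes> k \<otimes> x"
      have iff: "inv (k \<otimes> x) \<otimes> y \<in> K \<longleftrightarrow> ?u \<in> K"
        using inv_in_K_commute[of "k \<otimes> x" y] y k x by (simp add: m_assoc)
      have "?\<eta> (act W ?u v) = \<xi> (act M k (act M x (\<phi> v)))" if uK: "?u \<in> K"
      proof -
        have yu: "y \<otimes> ?u = k \<otimes> x" using y k x by (simp add: m_assoc) (simp add: m_assoc[symmetric])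
        have "?\<eta> (act W ?u v) = \<xi> (act M y (act M ?u (\<phi> v)))"
          using act_W_mem[OF uK v] K_homs_equivariant[OF \<phi> uK v] by simp
        also have "act M y (act M ?u (\<phi> v)) = act M (y \<otimes> ?u) (\<phi> v)"
          using M.act_mult[OF y _ \<phi>v, of ?u] y k x by simp
        also have "\<dots> = act M k (act M x (\<phi> v))" unfolding yu by (rule M.act_mult[OF k x \<phi>v])
        finally show ?thesis .
      qed
      then show "coeff_inv l w k * coeff ?\<eta> v ?u = (if inv (k \<otimes> x) \<otimes> y \<in> K then ?s k else 0)"
        using iff by (simp add: coeff_def)
    qed
    finally show "\<xi> (act M y (\<phi> (transposed W (hecke_elt l x v y) w))) =
      ?c * (\<integral>k. (if inv (k \<otimes> x) \<otimes> y \<in> K then ?s k else 0) \<partial>\<mu>)" .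
  qed
  also have "\<dots> = ?c * (\<integral>y. \<integral>k. (if inv (k \<otimes> x) \<otimes> y \<in> K then ?s k else 0) \<partial>\<mu> \<partial>\<mu>)"
    by (rule integral_mult_right_zero)
  also have "\<dots> = (\<integral>k. ?s k \<partial>\<mu>)"
    unfolding integral_integral_coset[OF K cs p] using measure_K_nonzero by simp
  also have "\<dots> = \<xi> (avg l (act M x (\<phi> v)) w)" by (rule functional_avg[OF l m w \<xi>, symmetric])
  finally show "\<xi> (avg l (act M x (\<phi> v)) w) = \<xi> ((hecke_elt l x v \<odot>\<^bsub>F_M\<^esub> \<phi>) w)" by simp
qed

text \<open>Contracting the frame turns the integrand into \<open>k \<psi>(k^-1 w)\<close>, which is
  \<open>\<psi> w\<close> by equivariance, and the volume of \<open>K\<close> remains. So every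
  \<open>K\<close>-homomorphism is recovered from averages of its values.\<close>

lemma sum_avg_frame:
  assumes B: "finite B" "B \<subseteq> carrier W" "\<forall>b\<in>B. E b \<in> W_dual"
    "\<forall>l\<in>W_dual. \<forall>w\<in>carrier W. l w = (\<Sum>b\<in>B. E b w * l b)"
    and \<psi>: "\<psi> \<in> K_homs" and \<xi>: "\<xi> \<in> M_dual" and w: "w \<in> carrier W"
  shows "(\<Sum>b\<in>B. \<xi> (avg (E b) (\<psi> b) w)) = complex_of_real (measure \<mu> K) * \<xi> (\<psi> w)"
proof -
  have Bm: "b \<in> carrier W" "E b \<in> W_dual" "\<psi> b \<in> carrier M" if "b \<in> B" for b
    using that B K_homs_mem[OF \<psi>] by auto
  have "(\<Sum>b\<in>B. \<xi> (avg (E b) (\<psi> b) w)) = (\<Sum>b\<in>B. (\<integral>k. coeff_inv (E b) w k * \<xi> (act M k (\<psi> b)) \<partial>\<mu>))"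
    using Bm by (intro sum.cong refl functional_avg w \<xi>) auto
  also have "\<dots> = (\<integral>k. (\<Sum>b\<in>B. coeff_inv (E b) w k * \<xi> (act M k (\<psi> b))) \<partial>\<mu>)"
    using Bm by (intro Bochner_Integration.integral_sum[symmetric] integrable_compactly_supported avg_cs w \<xi>) auto
  also have "\<dots> = (\<integral>k. (if k \<in> K then \<xi> (\<psi> w) else 0) \<partial>\<mu>)"
  proof (rule integral_cong_carrier)
    fix k assume k: "k \<in> carrier G"
    show "(\<Sum>b\<in>B. coeff_inv (E b) w k * \<xi> (act M k (\<psi> b))) = (if k \<in> K then \<xi> (\<psi> w) else 0)"
    proof (cases "k \<in> K")
      case True
      let ?\<eta> = "\<lambda>w\<in>carrier W. \<xi> (act M k (\<psi> w))"
      note \<eta> = functional_K_hom[OF \<psi> \<xi> k] and kw = act_W_mem[OF K_inv[OF True] w]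
      have "(\<Sum>b\<in>B. coeff_inv (E b) w k * \<xi> (act M k (\<psi> b))) = (\<Sum>b\<in>B. E b (act W (inv k) w) * ?\<eta> b)"
        using Bm True by (intro sum.cong) (auto simp: coeff_inv_def)
      also have "\<dots> = ?\<eta> (act W (inv k) w)" by (rule B(4)[rule_format, OF \<eta> kw, symmetric])
      also have "\<dots> = \<xi> (\<psi> w)"
        using kw K_homs_equivariant[OF \<psi> True kw] act_W_cancel(2)[OF True w] by simp
      finally show ?thesis using True by simp
    qed (simp add: coeff_inv_def)
  qed
  also have "\<dots> = complex_of_real (measure \<mu> K) * \<xi> (\<psi> w)" by (rule integral_K)
  finally show ?thesis .
qed

text \<open>The frame identity writes a multiple of \<open>\<psi>\<close> as a sum of averages of
  its values. Hence the vectors with vanishing averages contain no copy of \<open>W\<close>.\<close>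

lemma K_hom_eq_zero_if_avg:
  assumes \<psi>: "\<psi> \<in> K_homs" and z: "\<And>l w. l \<in> W_dual \<Longrightarrow> w \<in> carrier W \<Longrightarrow> avg l (\<psi> w) = \<zero>\<^bsub>F_M\<^esub>"
    and w: "w \<in> carrier W"
  shows "\<psi> w = \<zero>\<^bsub>M\<^esub>"
proof (rule M.functionals_eqI[OF K_homs_mem[OF \<psi> w] M.zero_mem])
  fix \<xi> assume \<xi>: "\<xi> \<in> M_dual"
  obtain B E where B: "finite B" "B \<subseteq> carrier W" "\<forall>b\<in>B. E b \<in> W_dual"
    "\<forall>l\<in>W_dual. \<forall>w\<in>carrier W. l w = (\<Sum>b\<in>B. E b w * l b)"
    by (rule dual_frame)
  have "(\<Sum>b\<in>B. \<xi> (avg (E b) (\<psi> b) w)) = (\<Sum>b\<in>B. 0)"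
  proof (rule sum.cong)
    fix b assume "b \<in> B"
    then have "avg (E b) (\<psi> b) = \<zero>\<^bsub>F_M\<^esub>" using B by (intro z) auto
    then show "\<xi> (avg (E b) (\<psi> b) w) = 0" using w M.functional_zero[OF \<xi>] by (simp add: F_M_simps(2))
  qed simp
  then have "complex_of_real (measure \<mu> K) * \<xi> (\<psi> w) = 0" using sum_avg_frame[OF B \<psi> \<xi> w] by simp
  then show "\<xi> (\<psi> w) = \<xi> \<zero>\<^bsub>M\<^esub>" using measure_K_nonzero M.functional_zero[OF \<xi>] by simp
qed

text \<open>Used with \<open>S\<close> consisting of the zero map, where it gives the common kernel
  of all averages, and with \<open>S\<close> a Hecke-stable family whose images generate
  \<open>M\<close>. Testing all translates of \<open>m\<close> makes the set stable under
  \<open>G\<close>; scalars are covered since they act through the unit.\<close>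

lemma avg_closed_subrep:
  assumes S: "S \<subseteq> K_homs" "\<zero>\<^bsub>F_M\<^esub> \<in> S" "\<And>\<phi> \<psi>. \<phi> \<in> S \<Longrightarrow> \<psi> \<in> S \<Longrightarrow> \<phi> \<oplus>\<^bsub>F_M\<^esub> \<psi> \<in> S"
    "\<And>f \<phi>. f \<in> hecke_fun G T K W \<Longrightarrow> \<phi> \<in> S \<Longrightarrow> f \<odot>\<^bsub>F_M\<^esub> \<phi> \<in> S"
  shows "subrep G M {m \<in> carrier M. \<forall>l\<in>W_dual. \<forall>x\<in>carrier G. avg l (act M x m) \<in> S}"
    (is "subrep G M ?U")
proof -
  have "submodule ?U complex_ring M"
    unfolding M.submodule_iff
  proof (intro conjI ballI allI)
    have "avg l (0 \<odot>\<^bsub>M\<^esub> \<zero>\<^bsub>M\<^esub>) = \<zero>\<^bsub>F_M\<^esub>" if l: "l \<in> W_dual" for l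
    proof (rule K_homs_functional_eqI[OF avg_K_homs[OF l]])
      show "\<zero>\<^bsub>F_M\<^esub> \<in> K_homs" using S by blast
      show "\<xi> (avg l (0 \<odot>\<^bsub>M\<^esub> \<zero>\<^bsub>M\<^esub>) w) = \<xi> (\<zero>\<^bsub>F_M\<^esub> w)" if "\<xi> \<in> M_dual" "w \<in> carrier W" for \<xi> w
      proof -
        have "(\<integral>k. coeff_inv l w k * \<xi> (act M k \<zero>\<^bsub>M\<^esub>) \<partial>\<mu>) = (\<integral>k. 0 \<partial>\<mu>)"
          by (rule integral_cong_carrier) (simp add: act_M_zero M.functional_zero[OF that(1)])
        then show ?thesis using functional_avg[OF l M.zero_mem that(2,1)] that(2) M.functional_zero[OF that(1)]
          by (simp add: F_M_simps(2))
      qed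
    qed simp
    then show "\<zero>\<^bsub>M\<^esub> \<in> ?U" using S(2) by (simp add: act_M_zero)
    fix m assume m: "m \<in> ?U"
    {
      fix m' assume "m' \<in> ?U"
      then show "m \<oplus>\<^bsub>M\<^esub> m' \<in> ?U" using m S(3) by (simp add: act_M_add avg_add act_M_mem)
    next
      fix c show "c \<odot>\<^bsub>M\<^esub> m \<in> ?U"
        using m S(4)[OF hecke_smult_mem[OF hecke_one_mem]] by (simp add: act_M_smult avg_smult act_M_mem)
    }
  qed blast
  moreover have "act M g m \<in> ?U" if "g \<in> carrier G" "m \<in> ?U" for g m
    using that by (auto simp: act_M_mem M.act_mult[symmetric])
  ultimately show ?thesis unfolding subrep_def by blast
qed

text \<open>The vectors whose translates average into \<open>S\<close> form a subrepresentation,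
  which by \<open>avg_translate\<close> contains the generators and so is all of \<open>M\<close>.
  The frame identity then writes any \<open>\<psi>\<close> as a combination of averages of its
  values, all of them in \<open>S\<close>.\<close>

lemma K_homs_subset_if_generated:
  assumes S: "S \<subseteq> K_homs" "\<zero>\<^bsub>F_M\<^esub> \<in> S" "\<And>\<phi> \<psi>. \<phi> \<in> S \<Longrightarrow> \<psi> \<in> S \<Longrightarrow> \<phi> \<oplus>\<^bsub>F_M\<^esub> \<psi> \<in> S"
    "\<And>f \<phi>. f \<in> hecke_fun G T K W \<Longrightarrow> \<phi> \<in> S \<Longrightarrow> f \<odot>\<^bsub>F_M\<^esub> \<phi> \<in> S"
    and gen: "generated_by G M (\<Union>\<phi>\<in>S. \<phi> ` carrier W)"
  shows "K_homs \<subseteq> S"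
proof
  let ?U = "{m \<in> carrier M. \<forall>l\<in>W_dual. \<forall>x\<in>carrier G. avg l (act M x m) \<in> S}"
  have "\<phi> w \<in> ?U" if "\<phi> \<in> S" "w \<in> carrier W" for \<phi> w
  proof -
    have "\<phi> \<in> K_homs" using that S(1) by blast
    then show ?thesis using that S(4)[OF hecke_elt_mem] by (simp add: K_homs_mem avg_translate)
  qed
  then have "(\<Union>\<phi>\<in>S. \<phi> ` carrier W) \<subseteq> ?U" by blast
  then have U: "?U = carrier M" using gen avg_closed_subrep[OF S] unfolding generated_by_def by blast
  have avgS: "avg l m \<in> S" if "l \<in> W_dual" "m \<in> carrier M" for l m
  proof -
    have "m \<in> ?U" using U that by blast
    then have "avg l (act M \<one> m) \<in> S" using that by blast
    then show ?thesis using M.act_one[OF that(2)] by simp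
  qed
  fix \<psi> assume \<psi>: "\<psi> \<in> K_homs"
  obtain B E where B: "finite B" "B \<subseteq> carrier W" "\<forall>b\<in>B. E b \<in> W_dual"
    "\<forall>l\<in>W_dual. \<forall>w\<in>carrier W. l w = (\<Sum>b\<in>B. E b w * l b)"
    by (rule dual_frame)
  have Bm: "b \<in> carrier W" "E b \<in> W_dual" "\<psi> b \<in> carrier M" if "b \<in> B" for b
    using that B K_homs_mem[OF \<psi>] by auto
  \<comment> \<open>\<open>S\<close> is closed under binary sums, so the frame sum is assembled by
    induction; testing it against functionals keeps the sum one of complex numbers.\<close>
  have "\<exists>\<phi>\<in>S. \<forall>\<xi>\<in>M_dual. \<forall>w\<in>carrier W. \<xi> (\<phi> w) = (\<Sum>b\<in>A. \<xi> (avg (E b) (\<psi> b) w))"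
    if "finite A" "A \<subseteq> B" for A
    using that
  proof (induction A rule: finite_induct)
    case empty
    then show ?case by (intro bexI[OF _ S(2)]) (simp add: F_M_simps(2) M.functional_zero)
  next
    case (insert b A)
    then obtain \<phi> where \<phi>: "\<phi> \<in> S" "\<forall>\<xi>\<in>M_dual. \<forall>w\<in>carrier W. \<xi> (\<phi> w) = (\<Sum>b\<in>A. \<xi> (avg (E b) (\<psi> b) w))"
      by blast
    have b: "b \<in> B" using insert by blast
    have \<phi>K: "\<phi> \<in> K_homs" using \<phi> S(1) by blast
    show ?case
    proof (intro bexI[OF _ S(3)[OF avgS[OF Bm(2,3)[OF b]] \<phi>(1)]] ballI)
      fix \<xi> w assume "\<xi> \<in> M_dual" "w \<in> carrier W"
      then show "\<xi> ((avg (E b) (\<psi> b) \<oplus>\<^bsub>F_M\<^esub> \<phi>) w) = (\<Sum>b\<in>insert b A. \<xi> (avg (E b) (\<psi> b) w))"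
        using \<phi>(2) insert(1,2) avg_mem[OF Bm(2,3)[OF b]] K_homs_mem[OF \<phi>K]
        by (simp add: F_M_simps(3) M.functional_add)
    qed
  qed
  then obtain \<phi> where \<phi>: "\<phi> \<in> S" "\<forall>\<xi>\<in>M_dual. \<forall>w\<in>carrier W. \<xi> (\<phi> w) = (\<Sum>b\<in>B. \<xi> (avg (E b) (\<psi> b) w))"
    using B(1) by blast
  have \<phi>K: "\<phi> \<in> K_homs" using \<phi> S(1) by blast
  \<comment> \<open>Division by the volume is performed by an element of the algebra, under which
    \<open>S\<close> is closed.\<close>
  let ?f = "complex_of_real (1 / measure \<mu> K) \<odot>\<^bsub>hecke_space\<^esub> \<one>\<^bsub>\<H>\<^esub>"
  have f: "?f \<in> hecke_fun G T K W" by (intro hecke_smult_mem hecke_one_mem)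
  have "?f \<odot>\<^bsub>F_M\<^esub> \<phi> = \<psi>"
  proof (rule K_homs_functional_eqI[OF action_K_homs[OF f \<phi>K] \<psi>])
    fix \<xi> w assume \<xi>: "\<xi> \<in> M_dual" and w: "w \<in> carrier W"
    have "\<xi> (\<phi> w) = complex_of_real (measure \<mu> K) * \<xi> (\<psi> w)" using \<phi>(2) \<xi> w sum_avg_frame[OF B \<psi> \<xi> w] by simp
    then show "\<xi> ((?f \<odot>\<^bsub>F_M\<^esub> \<phi>) w) = \<xi> (\<psi> w)"
      unfolding action_scalar[OF hecke_one_mem \<phi>K] action_one[OF \<phi>K]
      using w M.functional_smult[OF \<xi> K_homs_mem[OF \<phi>K w]] measure_K_nonzero by simp
  qed
  then show "\<psi> \<in> S" using S(4)[OF f \<phi>(1)] by simp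
qed

end

section \<open>Fullness and faithfulness\<close>

context hecke_rep begin

text \<open>The averaging in the proof of Maschke's theorem, without division by the volume of
  \<open>J\<close>.\<close>

definition avg_proj :: "('m \<Rightarrow> 'm) \<Rightarrow> 'g set \<Rightarrow> 'm \<Rightarrow> 'm" where
  "avg_proj P J u = lc_integral \<mu> M (\<lambda>j. if j \<in> J then act M j (P (act M (inv j) u)) else \<zero>\<^bsub>M\<^esub>)"

lemma avg_proj_integrand:
  assumes J: "cpt_open J" and P: "P \<in> lin_maps M M" and u: "u \<in> carrier M"
  shows "compactly_supported \<zero>\<^bsub>M\<^esub> (\<lambda>j. if j \<in> J then act M j (P (act M (inv j) u)) else \<zero>\<^bsub>M\<^esub>)"
    and "j \<in> carrier G \<Longrightarrow> (if j \<in> J then act M j (P (act M (inv j) u)) else \<zero>\<^bsub>M\<^esub>) \<in> carrier M"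
proof -
  have m: "P (act M (inv j) u) \<in> carrier M" if "j \<in> carrier G" for j
    using lin_maps_mem[OF P] act_M_mem u that by simp
  then show "(if j \<in> J then act M j (P (act M (inv j) u)) else \<zero>\<^bsub>M\<^esub>) \<in> carrier M" if "j \<in> carrier G"
    using act_M_mem that by simp
  have "locally_constant T (\<lambda>j. act M (inv j) u)"
    by (rule locally_constant_continuous[OF locally_constant_orbit[OF u]]) (intro continuous_rules)
  then have "locally_constant T (\<lambda>j. P (act M (inv j) u))" by (rule locally_constant_comp)
  then have "locally_constant T (\<lambda>j. act M j (P (act M (inv j) u)))" by (rule locally_constant_act) (rule m)
  then have "locally_constant T (\<lambda>j. if j \<in> J then act M j (P (act M (inv j) u)) else \<zero>\<^bsub>M\<^esub>)"
    by (rule locally_constant_comp2[OF locally_constant_mem_cpt_open[OF J], of _ "\<lambda>a b. if a then b else \<zero>\<^bsub>M\<^esub>"])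
  then show "compactly_supported \<zero>\<^bsub>M\<^esub> (\<lambda>j. if j \<in> J then act M j (P (act M (inv j) u)) else \<zero>\<^bsub>M\<^esub>)"
    by (rule compactly_supportedI[OF _ J]) simp
qed

lemma avg_proj_mem:
  "cpt_open J \<Longrightarrow> P \<in> lin_maps M M \<Longrightarrow> u \<in> carrier M \<Longrightarrow> avg_proj P J u \<in> carrier M"
  unfolding avg_proj_def by (rule lc_integral_mem[OF M.complex_space_axioms avg_proj_integrand])

lemma functional_avg_proj:
  assumes J: "cpt_open J" and P: "P \<in> lin_maps M M" and u: "u \<in> carrier M" and \<xi>: "\<xi> \<in> M_dual"
  shows "\<xi> (avg_proj P J u) = (\<integral>j. (if j \<in> J then \<xi> (act M j (P (act M (inv j) u))) else 0) \<partial>\<mu>)"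
proof -
  have "\<xi> (avg_proj P J u) = (\<integral>j. \<xi> (if j \<in> J then act M j (P (act M (inv j) u)) else \<zero>\<^bsub>M\<^esub>) \<partial>\<mu>)"
    unfolding avg_proj_def
    by (rule functional_lc_integral[OF M.complex_space_axioms avg_proj_integrand[OF J P u] \<xi>])
  also have "\<dots> = (\<integral>j. (if j \<in> J then \<xi> (act M j (P (act M (inv j) u))) else 0) \<partial>\<mu>)"
    by (rule integral_cong_carrier) (simp add: M.functional_zero[OF \<xi>])
  finally show ?thesis .
qed

lemma avg_proj_cs:
  assumes J: "cpt_open J" and P: "P \<in> lin_maps M M" and u: "u \<in> carrier M" and \<xi>: "\<xi> \<in> M_dual"
  shows "compactly_supported 0 (\<lambda>j. if j \<in> J then \<xi> (act M j (P (act M (inv j) u))) else 0)"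
  by (rule compactly_supported_cong[OF compactly_supported_comp[OF avg_proj_integrand(1)[OF J P u], of \<xi>]])
    (simp_all add: M.functional_zero[OF \<xi>])

lemma avg_proj_add:
  assumes J: "cpt_open J" and P: "P \<in> lin_maps M M" and u: "u \<in> carrier M" "v \<in> carrier M"
  shows "avg_proj P J (u \<oplus>\<^bsub>M\<^esub> v) = avg_proj P J u \<oplus>\<^bsub>M\<^esub> avg_proj P J v"
proof (rule M.functionals_eqI)
  note mem = avg_proj_mem[OF J P]
  fix \<xi> assume \<xi>: "\<xi> \<in> M_dual"
  have "\<xi> (avg_proj P J (u \<oplus>\<^bsub>M\<^esub> v)) = (\<integral>j. (if j \<in> J then \<xi> (act M j (P (act M (inv j) u))) else 0)
      + (if j \<in> J then \<xi> (act M j (P (act M (inv j) v))) else 0) \<partial>\<mu>)"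
    unfolding functional_avg_proj[OF J P M.add_mem[OF u] \<xi>]
    by (rule integral_cong_carrier)
      (simp add: act_M_add act_M_mem u lin_maps_add[OF P] lin_maps_mem[OF P] M.functional_add[OF \<xi>])
  also have "\<dots> = \<xi> (avg_proj P J u) + \<xi> (avg_proj P J v)"
    unfolding functional_avg_proj[OF J P u(1) \<xi>] functional_avg_proj[OF J P u(2) \<xi>]
    by (intro Bochner_Integration.integral_add integrable_compactly_supported avg_proj_cs J P u \<xi>)
  finally show "\<xi> (avg_proj P J (u \<oplus>\<^bsub>M\<^esub> v)) = \<xi> (avg_proj P J u \<oplus>\<^bsub>M\<^esub> avg_proj P J v)"
    using M.functional_add[OF \<xi> mem[OF u(1)] mem[OF u(2)]] by simp
qed (intro avg_proj_mem J P u M.add_mem)+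

lemma avg_proj_smult:
  assumes J: "cpt_open J" and P: "P \<in> lin_maps M M" and u: "u \<in> carrier M"
  shows "avg_proj P J (c \<odot>\<^bsub>M\<^esub> u) = c \<odot>\<^bsub>M\<^esub> avg_proj P J u"
proof (rule M.functionals_eqI)
  fix \<xi> assume \<xi>: "\<xi> \<in> M_dual"
  have "\<xi> (avg_proj P J (c \<odot>\<^bsub>M\<^esub> u)) = (\<integral>j. c * (if j \<in> J then \<xi> (act M j (P (act M (inv j) u))) else 0) \<partial>\<mu>)"
    unfolding functional_avg_proj[OF J P M.smult_mem[OF u] \<xi>]
    by (rule integral_cong_carrier)
      (simp add: act_M_smult act_M_mem u lin_maps_smult[OF P] lin_maps_mem[OF P] M.functional_smult[OF \<xi>])
  then show "\<xi> (avg_proj P J (c \<odot>\<^bsub>M\<^esub> u)) = \<xi> (c \<odot>\<^bsub>M\<^esub> avg_proj P J u)"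
    using functional_avg_proj[OF J P u \<xi>] M.functional_smult[OF \<xi> avg_proj_mem[OF J P u]] by simp
qed (intro avg_proj_mem J P u M.smult_mem)+

lemma avg_proj_act:
  assumes J: "cpt_open J" and P: "P \<in> lin_maps M M" and u: "u \<in> carrier M" and g: "g \<in> J"
  shows "avg_proj P J (act M g u) = act M g (avg_proj P J u)"
proof (rule M.functionals_eqI)
  note gc = cpt_open_carrier[OF J g]
  have gu: "act M g u \<in> carrier M" by (rule act_M_mem[OF gc u])
  show "avg_proj P J (act M g u) \<in> carrier M" "act M g (avg_proj P J u) \<in> carrier M"
    by (intro avg_proj_mem act_M_mem J P u gc)+
  fix \<xi> assume \<xi>: "\<xi> \<in> M_dual"
  let ?\<xi> = "\<lambda>v\<in>carrier M. \<xi> (act M g v)"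
  let ?F = "\<lambda>j. if j \<in> J then \<xi> (act M j (P (act M (inv j) (act M g u)))) else 0"
  have "\<xi> (avg_proj P J (act M g u)) = (\<integral>j. ?F j \<partial>\<mu>)" by (rule functional_avg_proj[OF J P gu \<xi>])
  also have "\<dots> = (\<integral>j. ?F (g \<otimes> j) \<partial>\<mu>)" by (rule integral_translate[OF avg_proj_cs[OF J P gu \<xi>] gc, symmetric])
  also have "\<dots> = (\<integral>j. (if j \<in> J then ?\<xi> (act M j (P (act M (inv j) u))) else 0) \<partial>\<mu>)"
  proof (rule integral_cong_carrier)
    fix j assume j: "j \<in> carrier G"
    have e: "act M (inv (g \<otimes> j)) (act M g u) = act M (inv j) u"
    proof -
      have "inv (g \<otimes> j) \<otimes> g = inv j" using gc j by (simp add: inv_mult_group m_assoc)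
      then show ?thesis using M.act_mult[of "inv (g \<otimes> j)" g u] gc j u by simp
    qed
    have m: "P (act M (inv j) u) \<in> carrier M" using lin_maps_mem[OF P] act_M_mem u j by simp
    show "?F (g \<otimes> j) = (if j \<in> J then ?\<xi> (act M j (P (act M (inv j) u))) else 0)"
      unfolding e using cpt_open_mult_cancel_left[OF J g j] M.act_mult[OF gc j m] act_M_mem[OF j m] by simp
  qed
  also have "\<dots> = ?\<xi> (avg_proj P J u)" by (rule functional_avg_proj[OF J P u functional_act[OF \<xi> gc], symmetric])
  also have "\<dots> = \<xi> (act M g (avg_proj P J u))" using avg_proj_mem[OF J P u] by simp
  finally show "\<xi> (avg_proj P J (act M g u)) = \<xi> (act M g (avg_proj P J u))" .
qed

abbreviation "K_image \<equiv> (\<Union>\<phi>\<in>K_homs. \<phi> ` carrier W)"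

text \<open>The vectors all of whose \<open>\<rho>\<close>-averages vanish form a subrepresentation \<open>Z\<close> without \<open>\<rho>\<close>-isotypic
  vectors. Averaging a linear projection onto \<open>Z\<close> over a compact open \<open>J \<supseteq> K\<close> gives a
  \<open>J\<close>-equivariant map into \<open>Z\<close>, which has to vanish on the \<open>\<rho>\<close>-isotypic vectors and hence on the
  \<open>J\<close>-representation they generate; as \<open>G\<close> is the union of such \<open>J\<close>, every vector of \<open>Z\<close> is killed
  by one of these maps, which multiplies it by the volume of \<open>J\<close>.\<close>

lemma eq_zero_if_avg_zero:
  assumes gen: "generated_by G M K_image" and m: "m \<in> carrier M"
    and z: "\<And>l x. l \<in> W_dual \<Longrightarrow> x \<in> carrier G \<Longrightarrow> avg l (act M x m) = \<zero>\<^bsub>F_M\<^esub>"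
  shows "m = \<zero>\<^bsub>M\<^esub>"
proof -
  let ?Z = "{m \<in> carrier M. \<forall>l\<in>W_dual. \<forall>x\<in>carrier G. avg l (act M x m) \<in> {\<zero>\<^bsub>F_M\<^esub>}}"
  interpret F: left_module \<H> F_M by (rule left_module_F_M)
  have zero: "\<zero>\<^bsub>F_M\<^esub> \<in> K_homs" using F.M.zero_closed by (simp only: F_M_simps(1))
  have szero: "f \<odot>\<^bsub>F_M\<^esub> \<zero>\<^bsub>F_M\<^esub> = \<zero>\<^bsub>F_M\<^esub>" if f: "f \<in> hecke_fun G T K W" for f
    using F.smult_r_distr[of f "\<zero>\<^bsub>F_M\<^esub>" "\<zero>\<^bsub>F_M\<^esub>"] F.smult_closed[of f "\<zero>\<^bsub>F_M\<^esub>"] f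
    by (simp add: hecke_algebra_simps(1) del: F_M_simps)
  have Zrep: "subrep G M ?Z"
    by (rule avg_closed_subrep) (use zero szero F.M.l_zero[OF F.M.zero_closed] in auto)
  then have Z: "submodule ?Z complex_ring M" unfolding subrep_def by blast
  obtain P where P: "P \<in> lin_maps M M" "\<And>v. v \<in> carrier M \<Longrightarrow> P v \<in> ?Z" "\<And>z. z \<in> ?Z \<Longrightarrow> P z = z"
    using M.linear_projection_exists[OF Z] by blast
  have actZ: "act M g v \<in> ?Z" if "g \<in> carrier G" "v \<in> ?Z" for g v
    using Zrep that unfolding subrep_def by blast
  have projZ: "avg_proj P J u \<in> ?Z" if J: "cpt_open J" and u: "u \<in> carrier M" for J u
    unfolding avg_proj_def
  proof (rule lc_integral_mem_submodule[OF M.complex_space_axioms Z avg_proj_integrand(1)[OF J P(1) u]])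
    fix j assume j: "j \<in> carrier G"
    have "act M j (P (act M (inv j) u)) \<in> ?Z" by (intro actZ P(2) act_M_mem inv_closed j u)
    moreover have "\<zero>\<^bsub>M\<^esub> \<in> ?Z" using Z unfolding M.submodule_iff by blast
    ultimately show "(if j \<in> J then act M j (P (act M (inv j) u)) else \<zero>\<^bsub>M\<^esub>) \<in> ?Z" by (cases "j \<in> J") (simp_all only: if_True if_False)
  qed
  have proj\<phi>: "avg_proj P J (\<phi> w) = \<zero>\<^bsub>M\<^esub>" if J: "cpt_open J" "K \<subseteq> J" and \<phi>: "\<phi> \<in> K_homs" and w: "w \<in> carrier W" for J \<phi> w
  proof -
    let ?\<psi> = "\<lambda>w\<in>carrier W. avg_proj P J (\<phi> w)"
    have \<psi>: "?\<psi> \<in> K_homs"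
    proof (rule K_homsI)
      show "?\<psi> \<in> lin_maps W M"
        by (rule lin_mapsI) (auto simp: avg_proj_mem avg_proj_add avg_proj_smult J P(1) K_homs_mem[OF \<phi>] K_homs_add[OF \<phi>] K_homs_smult[OF \<phi>])
      show "?\<psi> (act W k w) = act M k (?\<psi> w)" if k: "k \<in> K" and w: "w \<in> carrier W" for k w
        using k w J(2) by (auto simp: act_W_mem K_homs_equivariant[OF \<phi>] intro!: avg_proj_act[OF J(1) P(1)] K_homs_mem[OF \<phi>])
    qed
    have "?\<psi> w = \<zero>\<^bsub>M\<^esub>"
    proof (rule K_hom_eq_zero_if_avg[OF \<psi> _ w])
      fix l w assume l: "l \<in> W_dual" and w: "w \<in> carrier W"
      have "avg_proj P J (\<phi> w) \<in> ?Z" by (rule projZ[OF J(1) K_homs_mem[OF \<phi> w]])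
      then have "avg l (act M \<one> (avg_proj P J (\<phi> w))) = \<zero>\<^bsub>F_M\<^esub>" using l by blast
      then show "avg l (?\<psi> w) = \<zero>\<^bsub>F_M\<^esub>"
        using w M.act_one[OF avg_proj_mem[OF J(1) P(1) K_homs_mem[OF \<phi> w]]] by simp
    qed
    then show ?thesis using w by simp
  qed
  \<comment> \<open>Vanishing is asked for all compact open \<open>L\<close> above some
    \<open>J\<close>, so that \<open>J\<close> may grow: to a common bound for a sum, and to a
    subgroup containing \<open>g\<close> for a translate by \<open>g\<close>.\<close>
  let ?U = "{u \<in> carrier M. \<exists>J. cpt_open J \<and> K \<subseteq> J \<and> (\<forall>L. cpt_open L \<longrightarrow> J \<subseteq> L \<longrightarrow> avg_proj P L u = \<zero>\<^bsub>M\<^esub>)}"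
  have "subrep G M ?U"
    unfolding subrep_def M.submodule_iff
  proof (intro conjI ballI allI)
    have "avg_proj P L \<zero>\<^bsub>M\<^esub> = \<zero>\<^bsub>M\<^esub>" if L: "cpt_open L" for L
      using avg_proj_smult[OF L P(1) M.zero_mem, of 0] avg_proj_mem[OF L P(1) M.zero_mem] by simp
    then show "\<zero>\<^bsub>M\<^esub> \<in> ?U" using K by (intro CollectI conjI exI[of _ K]) auto
    fix u assume "u \<in> ?U"
    then obtain J where u: "u \<in> carrier M" and J: "cpt_open J" "K \<subseteq> J"
      "\<forall>L. cpt_open L \<longrightarrow> J \<subseteq> L \<longrightarrow> avg_proj P L u = \<zero>\<^bsub>M\<^esub>" by blast
    {
      fix v assume "v \<in> ?U"
      then obtain J' where v: "v \<in> carrier M" and J': "cpt_open J'" "K \<subseteq> J'"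
        "\<forall>L. cpt_open L \<longrightarrow> J' \<subseteq> L \<longrightarrow> avg_proj P L v = \<zero>\<^bsub>M\<^esub>" by blast
      obtain J'' where J'': "cpt_open J''" "J \<subseteq> J''" "J' \<subseteq> J''" by (rule cpt_open_covers_two[OF J(1) J'(1)])
      have "avg_proj P L (u \<oplus>\<^bsub>M\<^esub> v) = \<zero>\<^bsub>M\<^esub>" if L: "cpt_open L" "J'' \<subseteq> L" for L
      proof -
        have "avg_proj P L u = \<zero>\<^bsub>M\<^esub>" "avg_proj P L v = \<zero>\<^bsub>M\<^esub>" using J(3) J'(3) J'' L by blast+
        then show ?thesis using avg_proj_add[OF L(1) P(1) u v] by simp
      qed
      then show "u \<oplus>\<^bsub>M\<^esub> v \<in> ?U" using u v J'' J(2) by (intro CollectI conjI exI[of _ J'']) auto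
    next
      fix c
      have "avg_proj P L (c \<odot>\<^bsub>M\<^esub> u) = \<zero>\<^bsub>M\<^esub>" if "cpt_open L" "J \<subseteq> L" for L
        using J(3) that avg_proj_smult[OF that(1) P(1) u, of c] by simp
      then show "c \<odot>\<^bsub>M\<^esub> u \<in> ?U" using u J by (intro CollectI conjI exI[of _ J]) auto
    }
    fix u g assume g: "g \<in> carrier G" and "u \<in> ?U"
    then obtain J where u: "u \<in> carrier M" and J: "cpt_open J" "K \<subseteq> J"
      "\<forall>L. cpt_open L \<longrightarrow> J \<subseteq> L \<longrightarrow> avg_proj P L u = \<zero>\<^bsub>M\<^esub>" by blast
    obtain J' where J': "cpt_open J'" "J \<subseteq> J'" "g \<in> J'" by (rule cpt_open_covers_mem[OF J(1) g])
    have "avg_proj P L (act M g u) = \<zero>\<^bsub>M\<^esub>" if L: "cpt_open L" "J' \<subseteq> L" for L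
    proof -
      have "avg_proj P L u = \<zero>\<^bsub>M\<^esub>" "g \<in> L" using J(3) J' L by blast+
      then show ?thesis using avg_proj_act[OF L(1) P(1) u] act_M_zero[OF g] by simp
    qed
    then show "act M g u \<in> ?U" using act_M_mem[OF g u] J J' by (intro CollectI conjI exI[of _ J']) auto
  qed blast
  moreover have "K_image \<subseteq> ?U"
  proof
    fix u assume "u \<in> K_image"
    then obtain \<phi> w where "\<phi> \<in> K_homs" "w \<in> carrier W" "u = \<phi> w" by blast
    then show "u \<in> ?U" using proj\<phi> K K_homs_mem by (intro CollectI conjI exI[of _ K]) auto
  qed
  ultimately have U: "?U = carrier M" using gen unfolding generated_by_def by blast
  have mZ: "m \<in> ?Z" using m z by simp
  have "m \<in> ?U" using U m by blast
  then obtain J where J: "cpt_open J" and "\<forall>L. cpt_open L \<longrightarrow> J \<subseteq> L \<longrightarrow> avg_proj P L m = \<zero>\<^bsub>M\<^esub>" by blast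
  then have J0: "avg_proj P J m = \<zero>\<^bsub>M\<^esub>" by blast
  show ?thesis
  proof (rule M.functionals_eqI[OF m M.zero_mem])
    fix \<xi> assume \<xi>: "\<xi> \<in> M_dual"
    have "\<xi> (avg_proj P J m) = (\<integral>j. (if inv \<one> \<otimes> j \<in> J then \<xi> m else 0) \<partial>\<mu>)"
      unfolding functional_avg_proj[OF J P(1) m \<xi>]
    proof (rule integral_cong_carrier)
      fix j assume j: "j \<in> carrier G"
      have "P (act M (inv j) m) = act M (inv j) m" by (rule P(3)[OF actZ[OF inv_closed[OF j] mZ]])
      then have "act M j (P (act M (inv j) m)) = m"
        using M.act_mult[OF j inv_closed[OF j] m] M.act_one[OF m] j by simp
      then show "(if j \<in> J then \<xi> (act M j (P (act M (inv j) m))) else 0) = (if inv \<one> \<otimes> j \<in> J then \<xi> m else 0)"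
        using j by simp
    qed
    also have "\<dots> = measure \<mu> J * \<xi> m" by (rule integral_coset[OF J one_closed])
    finally have "complex_of_real (measure \<mu> J) * \<xi> m = 0" using J0 M.functional_zero[OF \<xi>] by simp
    then show "\<xi> m = \<xi> \<zero>\<^bsub>M\<^esub>" using measure_cpt_open_pos[OF J] M.functional_zero[OF \<xi>] by simp
  qed
qed

text \<open>A copy of \<open>W\<close> inside \<open>M\<close> is the image of a
  \<open>K\<close>-homomorphism, so a subrepresentation containing all such images contains the
  isotypic component.\<close>

lemma generated_by_K_image:
  assumes gen: "generated_by G M (isotypic_component G K W M)"
  shows "generated_by G M K_image"
  unfolding generated_by_def
proof (intro conjI allI impI)
  show "K_image \<subseteq> carrier M" using K_homs_mem by blast
  fix U assume U: "subrep G M U \<and> K_image \<subseteq> U"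
  have "isotypic_component G K W M \<subseteq> U"
    unfolding isotypic_component_def
  proof (rule M.lin_span_least)
    show "submodule U complex_ring M" using U unfolding subrep_def by blast
    show "\<Union> {U. subrep (subgrp G K) M U \<and> isomorphic_reps (subgrp G K) W (M\<lparr>carrier := U\<rparr>)} \<subseteq> U"
    proof
      fix u assume "u \<in> \<Union> {U. subrep (subgrp G K) M U \<and> isomorphic_reps (subgrp G K) W (M\<lparr>carrier := U\<rparr>)}"
      then obtain U' h where U': "u \<in> U'" "subrep (subgrp G K) M U'"
        and h: "h \<in> rep_homs (subgrp G K) W (M\<lparr>carrier := U'\<rparr>)" "bij_betw h (carrier W) U'"
        unfolding isomorphic_reps_def by auto
      have "U' \<subseteq> carrier M" using U'(2) unfolding subrep_def M.submodule_iff by blast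
      moreover have "h \<in> lin_maps W (M\<lparr>carrier := U'\<rparr>)" using h(1) by (simp add: rep_homs_def)
      ultimately have hl: "h \<in> lin_maps W M" using lin_maps_restrict_target[of U' M h W] by blast
      have "h \<in> K_homs" by (rule K_homsI[OF hl]) (use h(1) in \<open>simp add: rep_homs_def\<close>)
      moreover have "u \<in> h ` carrier W" using h(2) U'(1) by (simp add: bij_betw_def)
      ultimately show "u \<in> U" using U by blast
    qed
  qed
  then show "U = carrier M" using gen U unfolding generated_by_def by blast
qed

text \<open>The kernel of a \<open>K\<close>-homomorphism is a subrepresentation of
  \<open>W\<close>, so by irreducibility the map is zero or injective, and its image is zero or a
  copy of \<open>W\<close>.\<close>

lemma generated_by_isotypic_component:
  assumes irr: "\<And>U. subrep (subgrp G K) W U \<Longrightarrow> U = {\<zero>\<^bsub>W\<^esub>} \<or> U = carrier W"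
    and S: "S \<subseteq> K_homs" and gen: "generated_by G M (\<Union>\<phi>\<in>S. \<phi> ` carrier W)"
  shows "generated_by G M (isotypic_component G K W M)"
proof -
  let ?I = "{U. subrep (subgrp G K) M U \<and> isomorphic_reps (subgrp G K) W (M\<lparr>carrier := U\<rparr>)}"
  have sub: "\<Union> ?I \<subseteq> carrier M" unfolding subrep_def M.submodule_iff by blast
  note span = M.lin_span_submodule[OF sub, unfolded M.submodule_iff]
  have im: "\<phi> w \<in> lin_span M (\<Union> ?I)" if \<phi>: "\<phi> \<in> K_homs" and w: "w \<in> carrier W" for \<phi> w
  proof -
    let ?N = "{w \<in> carrier W. \<phi> w = \<zero>\<^bsub>M\<^esub>}"
    have "subrep (subgrp G K) W ?N"
      unfolding subrep_def W.submodule_iff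
      using act_M_zero[OF K_carrier]
      by (auto simp: K_homs_zero[OF \<phi>] K_homs_add[OF \<phi>] K_homs_smult[OF \<phi>] K_homs_equivariant[OF \<phi>] act_W_mem)
    from irr[OF this] show ?thesis
    proof
      assume "?N = carrier W"
      then have "\<phi> w = \<zero>\<^bsub>M\<^esub>" using w by blast
      then show ?thesis using span by simp
    next
      assume N: "?N = {\<zero>\<^bsub>W\<^esub>}"
      have inj: "inj_on \<phi> (carrier W)"
      proof (rule inj_onI)
        fix u v assume u: "u \<in> carrier W" and v: "v \<in> carrier W" and e: "\<phi> u = \<phi> v"
        have "\<phi> (u \<oplus>\<^bsub>W\<^esub> (- 1) \<odot>\<^bsub>W\<^esub> v) = \<zero>\<^bsub>M\<^esub>"
          using M.eq_iff_diff[of "\<phi> u" "\<phi> v"] e K_homs_mem[OF \<phi> u] K_homs_mem[OF \<phi> v] u v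
          by (simp add: K_homs_add[OF \<phi>] K_homs_smult[OF \<phi>])
        then have "u \<oplus>\<^bsub>W\<^esub> (- 1) \<odot>\<^bsub>W\<^esub> v \<in> ?N" using u v by simp
        then have "u \<oplus>\<^bsub>W\<^esub> (- 1) \<odot>\<^bsub>W\<^esub> v = \<zero>\<^bsub>W\<^esub>" unfolding N by blast
        then show "u = v" using W.eq_iff_diff[OF u v] by blast
      qed
      let ?V = "\<phi> ` carrier W"
      have V: "?V \<subseteq> carrier M" using K_homs_mem[OF \<phi>] by blast
      have "subrep (subgrp G K) M ?V"
        unfolding subrep_def M.submodule_iff
      proof (intro conjI ballI allI V)
        show "\<zero>\<^bsub>M\<^esub> \<in> ?V" using K_homs_zero[OF \<phi>] W.zero_mem by (metis imageI)
        show "x \<oplus>\<^bsub>M\<^esub> y \<in> ?V" if "x \<in> ?V" "y \<in> ?V" for x y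
          using that K_homs_add[OF \<phi>] W.add_mem by (metis (no_types, lifting) imageE imageI)
        show "c \<odot>\<^bsub>M\<^esub> x \<in> ?V" if "x \<in> ?V" for c x
          using that K_homs_smult[OF \<phi>] W.smult_mem by (metis (no_types, lifting) imageE imageI)
        show "act M g u \<in> ?V" if "g \<in> carrier (subgrp G K)" "u \<in> ?V" for g u
          using that K_homs_equivariant[OF \<phi>] act_W_mem by (auto simp: image_iff) metis
      qed
      moreover have "isomorphic_reps (subgrp G K) W (M\<lparr>carrier := ?V\<rparr>)"
        unfolding isomorphic_reps_def
      proof (rule bexI[of _ \<phi>])
        show "bij_betw \<phi> (carrier W) (carrier (M\<lparr>carrier := ?V\<rparr>))" using inj by (simp add: bij_betw_def)
        have "\<phi> \<in> lin_maps W (M\<lparr>carrier := ?V\<rparr>)"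
          using lin_maps_restrict_target[OF V, of \<phi> W] K_homs_lin[OF \<phi>] by blast
        then show "\<phi> \<in> rep_homs (subgrp G K) W (M\<lparr>carrier := ?V\<rparr>)"
          using K_homs_equivariant[OF \<phi>] by (simp add: rep_homs_def)
      qed
      ultimately have "?V \<subseteq> \<Union> ?I" by blast
      then show ?thesis using M.lin_span_superset[of "\<Union> ?I"] w by blast
    qed
  qed
  show ?thesis
    unfolding generated_by_def isotypic_component_def
  proof (intro conjI allI impI)
    show "lin_span M (\<Union> ?I) \<subseteq> carrier M" using span by blast
    fix U assume U: "subrep G M U \<and> lin_span M (\<Union> ?I) \<subseteq> U"
    have "(\<Union>\<phi>\<in>S. \<phi> ` carrier W) \<subseteq> U" using im S U by blast
    then show "U = carrier M" using gen U unfolding generated_by_def by blast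
  qed
qed

end

section \<open>Intertwiners from Hecke-linear maps\<close>

locale hecke_rep_pair = M: hecke_rep G T \<mu> K W M + M': hecke_rep G T \<mu> K W M'
  for G :: "'g monoid" (structure) and T :: "'g topology" and \<mu> :: "'g measure"
    and K :: "'g set" and W :: "('g, 'w) rep" and M :: "('g, 'm) rep" and M' :: "('g, 'n) rep" +
  assumes gen: "generated_by G M M.K_image"
begin

text \<open>The equaliser of \<open>h\<close> and \<open>h'\<close> is a subrepresentation
  containing the generators of \<open>M\<close>.\<close>

lemma rep_hom_eqI:
  assumes h: "h \<in> rep_homs G M M'" "h' \<in> rep_homs G M M'"
    and e: "\<And>\<phi>. \<phi> \<in> M.K_homs \<Longrightarrow> compose (carrier W) h \<phi> = compose (carrier W) h' \<phi>"
  shows "h = h'"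
proof (rule lin_maps_eqI[OF rep_homs_lin[OF h(1)] rep_homs_lin[OF h(2)]])
  let ?U = "{m \<in> carrier M. h m = h' m}"
  note hl = rep_homs_lin[OF h(1)] rep_homs_lin[OF h(2)]
  note ms = M.M.complex_space_axioms M'.M.complex_space_axioms
  have "subrep G M ?U"
    unfolding subrep_def M.M.submodule_iff
    using lin_maps_add[OF hl(1)] lin_maps_add[OF hl(2)] lin_maps_smult[OF hl(1)] lin_maps_smult[OF hl(2)]
      lin_maps_zero[OF hl(1) ms] lin_maps_zero[OF hl(2) ms] M.act_M_mem
      rep_homs_act[OF h(1)] rep_homs_act[OF h(2)]
    by simp
  moreover have "M.K_image \<subseteq> ?U"
  proof
    fix m assume "m \<in> M.K_image"
    then obtain \<phi> w where \<phi>: "\<phi> \<in> M.K_homs" "w \<in> carrier W" "m = \<phi> w" by blast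
    then show "m \<in> ?U" using fun_cong[OF e[OF \<phi>(1)], of w] M.K_homs_mem by (simp add: compose_def)
  qed
  ultimately have "?U = carrier M" using gen unfolding generated_by_def by blast
  then show "h m = h' m" if "m \<in> carrier M" for m using that by blast
qed

text \<open>The relation \<open>R\<close> is the graph of \<open>h\<close>: \<open>m'\<close>
  belongs to \<open>m\<close> when \<open>\<alpha>\<close> carries every average of a translate of
  \<open>m\<close> to the corresponding average of \<open>m'\<close>. Uniqueness holds because a
  vector of \<open>M'\<close> with vanishing averages is zero; existence holds on generators and
  passes to the subrepresentation they generate.\<close>

lemma rep_hom_extension:
  assumes gen': "generated_by G M' M'.K_image" and \<alpha>: "\<alpha> \<in> left_module_homs M.\<H> M.F_M M'.F_M"
  obtains h where "h \<in> rep_homs G M M'" "\<forall>\<phi>\<in>M.K_homs. compose (carrier W) h \<phi> = \<alpha> \<phi>"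
proof -
  have \<alpha>m: "\<alpha> \<phi> \<in> M'.K_homs" if "\<phi> \<in> M.K_homs" for \<phi>
    using \<alpha> that by (auto simp: left_module_homs_def M.F_M_simps(1) M'.F_M_simps(1))
  have \<alpha>a: "\<alpha> (\<phi> \<oplus>\<^bsub>M.F_M\<^esub> \<psi>) = \<alpha> \<phi> \<oplus>\<^bsub>M'.F_M\<^esub> \<alpha> \<psi>" if "\<phi> \<in> M.K_homs" "\<psi> \<in> M.K_homs" for \<phi> \<psi>
    using \<alpha> that unfolding left_module_homs_def M.F_M_simps(1) M'.F_M_simps(1) by blast
  have \<alpha>s: "\<alpha> (f \<odot>\<^bsub>M.F_M\<^esub> \<phi>) = f \<odot>\<^bsub>M'.F_M\<^esub> \<alpha> \<phi>" if "\<phi> \<in> M.K_homs" "f \<in> hecke_fun G T K W" for f \<phi>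
    using \<alpha> that unfolding left_module_homs_def M.F_M_simps(1) M'.F_M_simps(1) M.hecke_algebra_simps(1) by blast
  define R where "R m m' \<longleftrightarrow> m \<in> carrier M \<and> m' \<in> carrier M' \<and>
    (\<forall>l\<in>M.W_dual. \<forall>x\<in>carrier G. M'.avg l (act M' x m') = \<alpha> (M.avg l (act M x m)))" for m m'
  note mem = M.act_M_mem M'.act_M_mem
  have R_uniq: "m1 = m2" if R1: "R m m1" and R2: "R m m2" for m m1 m2
  proof -
    have m: "m1 \<in> carrier M'" "m2 \<in> carrier M'" using that by (auto simp: R_def)
    let ?d = "m1 \<oplus>\<^bsub>M'\<^esub> (- 1) \<odot>\<^bsub>M'\<^esub> m2"
    have "?d = \<zero>\<^bsub>M'\<^esub>"
    proof (rule M'.eq_zero_if_avg_zero[OF gen'])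
      fix l x assume l: "l \<in> M.W_dual" and x: "x \<in> carrier G"
      have e: "M'.avg l (act M' x m1) = M'.avg l (act M' x m2)" using R1 R2 l x by (simp add: R_def)
      note a = M'.avg_K_homs[OF l mem(2)[OF x m(2)]]
      have "M'.avg l (act M' x ?d) = M'.avg l (act M' x m2) \<oplus>\<^bsub>M'.F_M\<^esub>
          ((- 1) \<odot>\<^bsub>M.hecke_space\<^esub> \<one>\<^bsub>M.\<H>\<^esub>) \<odot>\<^bsub>M'.F_M\<^esub> M'.avg l (act M' x m2)"
        using m l x mem(2)[OF x] e by (simp add: M'.act_M_add M'.act_M_smult M'.avg_add M'.avg_smult)
      also have "\<dots> = \<zero>\<^bsub>M'.F_M\<^esub>"
        unfolding M'.action_scalar[OF M.hecke_one_mem a] M'.action_one[OF a] M'.F_M_simps(2,3)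
      proof (rule restrict_ext)
        fix w assume w: "w \<in> carrier W"
        show "M'.avg l (act M' x m2) w \<oplus>\<^bsub>M'\<^esub> (\<lambda>w\<in>carrier W. (- 1) \<odot>\<^bsub>M'\<^esub> M'.avg l (act M' x m2) w) w = \<zero>\<^bsub>M'\<^esub>"
          using M'.M.eq_iff_diff[OF M'.K_homs_mem[OF a w] M'.K_homs_mem[OF a w]] w by simp
      qed
      finally show "M'.avg l (act M' x ?d) = \<zero>\<^bsub>M'.F_M\<^esub>" .
    qed (use m in simp)
    then show ?thesis using M'.M.eq_iff_diff[OF m] by blast
  qed
  have R_add: "R (m1 \<oplus>\<^bsub>M\<^esub> m2) (m1' \<oplus>\<^bsub>M'\<^esub> m2')" if "R m1 m1'" "R m2 m2'" for m1 m2 m1' m2'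
    using that unfolding R_def
    by (simp add: M.act_M_add M'.act_M_add M.avg_add M'.avg_add mem \<alpha>a M.avg_K_homs)
  have R_smult: "R (c \<odot>\<^bsub>M\<^esub> m) (c \<odot>\<^bsub>M'\<^esub> m')" if "R m m'" for c m m'
    using that unfolding R_def
    by (simp add: M.act_M_smult M'.act_M_smult M.avg_smult M'.avg_smult mem \<alpha>s M.avg_K_homs
        M.hecke_smult_mem M.hecke_one_mem)
  have R_act: "R (act M g m) (act M' g m')" if "R m m'" "g \<in> carrier G" for g m m'
    using that unfolding R_def by (simp add: mem M.M.act_mult[symmetric] M'.M.act_mult[symmetric])
  \<comment> \<open>By \<open>avg_translate\<close> both averages are given by the same element
    \<open>hecke_elt l x w\<close>, and \<open>\<alpha>\<close> commutes with its action.\<close>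
  have R_hom: "R (\<phi> w) (\<alpha> \<phi> w)" if \<phi>: "\<phi> \<in> M.K_homs" and w: "w \<in> carrier W" for \<phi> w
    unfolding R_def
    using M.K_homs_mem[OF \<phi> w] M'.K_homs_mem[OF \<alpha>m[OF \<phi>] w] \<phi> w \<alpha>m[OF \<phi>]
    by (simp add: M.avg_translate M'.avg_translate \<alpha>s M.hecke_elt_mem)
  have R_ex: "\<exists>m'. R m m'" if m: "m \<in> carrier M" for m
  proof -
    let ?U = "{m \<in> carrier M. \<exists>m'. R m m'}"
    have "subrep G M ?U"
      unfolding subrep_def M.M.submodule_iff
    proof (intro conjI ballI allI)
      have "\<zero>\<^bsub>M'.F_M\<^esub> \<in> M'.K_homs" "\<zero>\<^bsub>M.F_M\<^esub> \<in> M.K_homs"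
        using abelian_groupE(2)[OF M.abelian_group_F_M] abelian_groupE(2)[OF M'.abelian_group_F_M]
        by (simp_all only: M.F_M_simps(1) M'.F_M_simps(1))
      then have "R (\<zero>\<^bsub>M.F_M\<^esub> \<zero>\<^bsub>W\<^esub>) (\<alpha> \<zero>\<^bsub>M.F_M\<^esub> \<zero>\<^bsub>W\<^esub>)" by (intro R_hom) auto
      then show "\<zero>\<^bsub>M\<^esub> \<in> ?U" by (auto simp: M.F_M_simps(2))
    next
      fix x y assume "x \<in> ?U" "y \<in> ?U" then show "x \<oplus>\<^bsub>M\<^esub> y \<in> ?U" using R_add by blast
    next
      fix c x assume "x \<in> ?U" then show "c \<odot>\<^bsub>M\<^esub> x \<in> ?U" using R_smult by blast
    next
      fix g u assume "g \<in> carrier G" "u \<in> ?U" then show "act M g u \<in> ?U" using R_act mem by blast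
    qed blast
    moreover have "M.K_image \<subseteq> ?U" using R_hom M.K_homs_mem by blast
    ultimately have "?U = carrier M" using gen unfolding generated_by_def by blast
    then show ?thesis using m by blast
  qed
  define h where "h = (\<lambda>m\<in>carrier M. THE m'. R m m')"
  have h_eq: "h m = m'" if "R m m'" for m m'
    using that R_uniq by (auto simp: h_def R_def intro!: the_equality)
  have hR: "R m (h m)" if "m \<in> carrier M" for m
    using R_ex[OF that] h_eq by blast
  have hm: "h m \<in> carrier M'" if "m \<in> carrier M" for m using hR[OF that] by (simp add: R_def)
  have "h \<in> lin_maps M M'"
  proof (rule lin_mapsI)
    show "h \<in> extensional (carrier M)" by (simp add: h_def)
  qed (auto intro: hm h_eq R_add R_smult hR)
  moreover have "h (act M g v) = act M' g (h v)" if "g \<in> carrier G" "v \<in> carrier M" for g v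
    using that by (intro h_eq R_act hR)
  ultimately have "h \<in> rep_homs G M M'" by (simp add: rep_homs_def)
  moreover have "compose (carrier W) h \<phi> = \<alpha> \<phi>" if \<phi>: "\<phi> \<in> M.K_homs" for \<phi>
  proof (rule extensionalityI[of _ "carrier W"])
    show "\<alpha> \<phi> \<in> extensional (carrier W)" by (rule lin_maps_ext[OF M'.K_homs_lin[OF \<alpha>m[OF \<phi>]]])
    show "compose (carrier W) h \<phi> w = \<alpha> \<phi> w" if "w \<in> carrier W" for w
      using that h_eq[OF R_hom[OF \<phi> that]] by (simp add: compose_def)
  qed simp
  ultimately show thesis using that by blast
qed

end

context hecke_setup begin

lemma rho_inv_fully_faithful:
  fixes M M' :: "('g, 'v) rep"
  assumes M: "smooth_rep G T M" "generated_by G M (isotypic_component G K W M)"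
    and M': "smooth_rep G T M'" "generated_by G M' (isotypic_component G K W M')"
  shows "bij_betw (rho_inv_mor G K W M M') (rep_homs G M M')
    (left_module_homs \<H> (rho_inv_obj G \<mu> K W M) (rho_inv_obj G \<mu> K W M'))"
proof -
  interpret M: hecke_rep G T \<mu> K W M by (rule hecke_rep[OF M(1)])
  interpret M': hecke_rep G T \<mu> K W M' by (rule hecke_rep[OF M'(1)])
  interpret hecke_rep_pair G T \<mu> K W M M'
    by unfold_locales (rule M.generated_by_K_image[OF M(2)])
  show ?thesis
    unfolding bij_betw_def
  proof (intro conjI equalityI subsetI)
    show "inj_on (rho_inv_mor G K W M M') (rep_homs G M M')"
    proof (rule inj_onI)
      fix h h' assume h: "h \<in> rep_homs G M M'" "h' \<in> rep_homs G M M'"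
        and e: "rho_inv_mor G K W M M' h = rho_inv_mor G K W M M' h'"
      show "h = h'"
      proof (rule rep_hom_eqI[OF h])
        fix \<phi> assume "\<phi> \<in> M.K_homs"
        then show "compose (carrier W) h \<phi> = compose (carrier W) h' \<phi>"
          using fun_cong[OF e, of \<phi>] by (simp add: rho_inv_mor_def)
      qed
    qed
    show "\<alpha> \<in> left_module_homs \<H> M.F_M M'.F_M" if "\<alpha> \<in> rho_inv_mor G K W M M' ` rep_homs G M M'" for \<alpha>
      using that rho_inv_mor_hom[OF M(1) M'(1)] by blast
    fix \<alpha> assume \<alpha>: "\<alpha> \<in> left_module_homs \<H> M.F_M M'.F_M"
    obtain h where h: "h \<in> rep_homs G M M'" "\<forall>\<phi>\<in>M.K_homs. compose (carrier W) h \<phi> = \<alpha> \<phi>"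
      by (rule rep_hom_extension[OF M'.generated_by_K_image[OF M'(2)] \<alpha>])
    have "\<alpha> \<in> extensional M.K_homs" using \<alpha> by (simp add: left_module_homs_def M.F_M_simps(1) PiE_iff)
    then have "rho_inv_mor G K W M M' h = \<alpha>"
      using h(2) by (intro extensionalityI[of _ M.K_homs]) (auto simp: rho_inv_mor_def)
    then show "\<alpha> \<in> rho_inv_mor G K W M M' ` rep_homs G M M'" using h(1) by blast
  qed
qed

end

section \<open>Essential surjectivity\<close>

context hecke_setup begin

lemma hecke_smult_mult:
  assumes f: "f \<in> hecke_fun G T K W" "f' \<in> hecke_fun G T K W"
  shows "(c \<odot>\<^bsub>hecke_space\<^esub> f) \<otimes>\<^bsub>\<H>\<^esub> f' = c \<odot>\<^bsub>hecke_space\<^esub> (f \<otimes>\<^bsub>\<H>\<^esub> f')"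
proof (rule hecke_fun_eqI)
  fix x l w assume x: "x \<in> carrier G" and l: "l \<in> W_dual" and w: "w \<in> carrier W"
  have "((c \<odot>\<^bsub>hecke_space\<^esub> f) \<otimes>\<^bsub>\<H>\<^esub> f') x l w = (\<integral>g. (c \<odot>\<^bsub>hecke_space\<^esub> f) g (f' (inv g \<otimes> x) l) w \<partial>\<mu>)"
    by (rule hecke_mult_apply[OF hecke_smult_mem[OF f(1)] f(2) x l w])
  also have "\<dots> = (\<integral>g. c * f g (f' (inv g \<otimes> x) l) w \<partial>\<mu>)"
    using x l w by (intro integral_cong_carrier) (simp add: hecke_smult_apply hecke_fun_dual[OF f(2)])
  finally show "((c \<odot>\<^bsub>hecke_space\<^esub> f) \<otimes>\<^bsub>\<H>\<^esub> f') x l w = (c \<odot>\<^bsub>hecke_space\<^esub> (f \<otimes>\<^bsub>\<H>\<^esub> f')) x l w"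
    using hecke_mult_apply[OF f x l w] x l w by (simp add: hecke_smult_apply)
qed (intro hecke_mult_mem hecke_smult_mem f)+

lemma hecke_smult_one_mult:
  "f \<in> hecke_fun G T K W \<Longrightarrow> (c \<odot>\<^bsub>hecke_space\<^esub> \<one>\<^bsub>\<H>\<^esub>) \<otimes>\<^bsub>\<H>\<^esub> f = c \<odot>\<^bsub>hecke_space\<^esub> f"
  by (simp add: hecke_smult_mult hecke_one_mem hecke_l_one)

lemma hecke_elt_fixer:
  assumes "x \<in> carrier G" "j \<in> fixer" "v \<in> carrier W"
  shows "hecke_elt l (x \<otimes> j) v = hecke_elt l x v"
  using hecke_elt_act[OF assms(1) fixer_K[OF assms(2)] assms(3)] fixer_act[OF assms(2,3)] by simp

lemma hecke_eval_functional:
  assumes "x \<in> carrier G" "l \<in> W_dual" "w \<in> carrier W"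
  shows "(\<lambda>f\<in>carrier hecke_space. f x l w) \<in> lin_maps hecke_space scalars"
  by (rule lin_mapsI)
    (use assms in \<open>auto simp: hecke_space_simps(1,3) hecke_add_mem hecke_smult_mem hecke_add_apply hecke_smult_apply\<close>)

text \<open>The integrals in \<open>hecke_elt_mult_apply\<close> and
  \<open>integral_hecke_elt\<close> agree at every point, which becomes an identity in the algebra
  by evaluating there. Its left side has the shape of the action of \<open>f\<close> on a
  \<open>K\<close>-homomorphism, so it is the source of Hecke-linearity of
  \<open>unit_hom\<close>.\<close>

lemma hecke_elt_integral:
  assumes l: "l \<in> W_dual" and y: "y \<in> carrier G" and w: "w \<in> carrier W" and f: "f \<in> hecke_fun G T K W"
  defines "F \<equiv> \<lambda>g. hecke_elt l (y \<otimes> g) (transposed W (f g) w)"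
  shows "compactly_supported \<zero>\<^bsub>hecke_space\<^esub> F" "\<And>g. g \<in> carrier G \<Longrightarrow> F g \<in> carrier hecke_space"
    and "lc_integral \<mu> hecke_space F = hecke_elt l y w \<otimes>\<^bsub>\<H>\<^esub> f"
proof -
  have t: "transposed W (f g) w \<in> carrier W" if "g \<in> carrier G" for g
    using transposed_mem[OF hecke_fun_end[OF f that] w] .
  show m: "F g \<in> carrier hecke_space" if "g \<in> carrier G" for g
    using hecke_elt_mem[OF l _ t[OF that], of "y \<otimes> g"] that y by (simp add: F_def hecke_space_simps(1))
  obtain L where L: "cpt_open L" "K \<subseteq> L" "\<forall>x\<in>carrier G - L. f x = \<zero>\<^bsub>dual_end W\<^esub>"
    by (rule hecke_fun_support[OF f])
  show cs: "compactly_supported \<zero>\<^bsub>hecke_space\<^esub> F"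
  proof (rule compactly_supportedI[OF _ L(1)])
    show "locally_constant T F"
    proof (rule locally_constant_right_invariant[OF openin_fixer fixer_one])
      fix g j assume g: "g \<in> carrier G" and j: "j \<in> fixer"
      show "F (g \<otimes> j) = F g"
        using hecke_elt_fixer[OF _ j t[OF g], of "y \<otimes> g" l] g y K_carrier[OF fixer_K[OF j]]
        by (simp add: F_def hecke_fixer_right[OF f g j] m_assoc)
    qed
    fix g assume g: "g \<in> carrier G" "g \<notin> L"
    then have "f g = \<zero>\<^bsub>dual_end W\<^esub>" using L(3) by blast
    then have "transposed W (f g) w = \<zero>\<^bsub>W\<^esub>"
      using w end_zero_mem by (simp only:, intro transposed_eqI) (simp_all add: W.functional_zero)
    moreover have "hecke_elt l (y \<otimes> g) (0 \<odot>\<^bsub>W\<^esub> \<zero>\<^bsub>W\<^esub>) = 0 \<odot>\<^bsub>hecke_space\<^esub> hecke_elt l (y \<otimes> g) \<zero>\<^bsub>W\<^esub>"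
      using g y by (intro hecke_elt_smult[OF l]) auto
    moreover have "0 \<odot>\<^bsub>hecke_space\<^esub> hecke_elt l (y \<otimes> g) \<zero>\<^bsub>W\<^esub> = \<zero>\<^bsub>hecke_space\<^esub>"
      using g y by (intro complex_space.smult_zero_left[OF complex_space_hecke]) (simp add: hecke_space_simps(1) hecke_elt_mem l)
    ultimately show "F g = \<zero>\<^bsub>hecke_space\<^esub>" by (simp add: F_def)
  qed
  have I: "lc_integral \<mu> hecke_space F \<in> carrier hecke_space"
    by (rule lc_integral_mem[OF complex_space_hecke cs m])
  show "lc_integral \<mu> hecke_space F = hecke_elt l y w \<otimes>\<^bsub>\<H>\<^esub> f"
  proof (rule hecke_fun_eqI)
    show "lc_integral \<mu> hecke_space F \<in> hecke_fun G T K W" using I by (simp only: hecke_space_simps(1))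
    show "hecke_elt l y w \<otimes>\<^bsub>\<H>\<^esub> f \<in> hecke_fun G T K W" by (intro hecke_mult_mem hecke_elt_mem l y w f)
    fix x l' w' assume x: "x \<in> carrier G" and l': "l' \<in> W_dual" and w': "w' \<in> carrier W"
    have "lc_integral \<mu> hecke_space F x l' w' = (\<lambda>f\<in>carrier hecke_space. f x l' w') (lc_integral \<mu> hecke_space F)"
      using I by simp
    also have "\<dots> = (\<integral>g. (\<lambda>f\<in>carrier hecke_space. f x l' w') (F g) \<partial>\<mu>)"
      by (rule functional_lc_integral[OF complex_space_hecke cs m hecke_eval_functional[OF x l' w']])
    also have "\<dots> = (\<integral>g. hecke_elt l (y \<otimes> g) (transposed W (f g) w) x l' w' \<partial>\<mu>)"
      using m by (intro integral_cong_carrier) (simp add: F_def)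
    also have "\<dots> = (hecke_elt l y w \<otimes>\<^bsub>\<H>\<^esub> f) x l' w'"
      unfolding integral_hecke_elt[OF l y w f x l' w'] hecke_elt_mult_apply[OF l y w f x l' w'] ..
    finally show "lc_integral \<mu> hecke_space F x l' w' = (hecke_elt l y w \<otimes>\<^bsub>\<H>\<^esub> f) x l' w'" .
  qed
qed

end

text \<open>The representation \<open>c-Ind(\<rho>) \<otimes> N\<close>, realised on functions: for a representation \<open>M\<close> generated by
  \<open>N = Hom\<^sub>K(\<rho>, M)\<close>, a vector \<open>m\<close> is determined by the averages of its translates,
  \<open>(y, l) \<mapsto> avg l (y m)\<close>, and \<open>m = g \<phi>(w)\<close> gives \<open>(y, l) \<mapsto> hecke_elt l (y g) w \<cdot> \<phi>\<close>.\<close>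

locale hecke_module = hecke_setup G T \<mu> K W + N: left_module "hecke_algebra G T \<mu> K W" N
  for G :: "'g monoid" (structure) and T :: "'g topology" and \<mu> :: "'g measure"
    and K :: "'g set" and W :: "('g, 'w) rep" and N :: "('g \<Rightarrow> ('w \<Rightarrow> complex) \<Rightarrow> 'w \<Rightarrow> complex, 'n) module"
begin

lemma N_smult_mem: "f \<in> hecke_fun G T K W \<Longrightarrow> n \<in> carrier N \<Longrightarrow> f \<odot>\<^bsub>N\<^esub> n \<in> carrier N"
  using N.smult_closed by (simp add: hecke_algebra_simps(1))

lemma N_add_left: "f \<in> hecke_fun G T K W \<Longrightarrow> f' \<in> hecke_fun G T K W \<Longrightarrow> n \<in> carrier N \<Longrightarrow>
    (f \<oplus>\<^bsub>\<H>\<^esub> f') \<odot>\<^bsub>N\<^esub> n = f \<odot>\<^bsub>N\<^esub> n \<oplus>\<^bsub>N\<^esub> f' \<odot>\<^bsub>N\<^esub> n"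
  using N.smult_l_distr by (simp add: hecke_algebra_simps(1))

lemma N_add_right: "f \<in> hecke_fun G T K W \<Longrightarrow> n \<in> carrier N \<Longrightarrow> n' \<in> carrier N \<Longrightarrow>
    f \<odot>\<^bsub>N\<^esub> (n \<oplus>\<^bsub>N\<^esub> n') = f \<odot>\<^bsub>N\<^esub> n \<oplus>\<^bsub>N\<^esub> f \<odot>\<^bsub>N\<^esub> n'"
  using N.smult_r_distr by (simp add: hecke_algebra_simps(1))

lemma N_assoc: "f \<in> hecke_fun G T K W \<Longrightarrow> f' \<in> hecke_fun G T K W \<Longrightarrow> n \<in> carrier N \<Longrightarrow>
    (f \<otimes>\<^bsub>\<H>\<^esub> f') \<odot>\<^bsub>N\<^esub> n = f \<odot>\<^bsub>N\<^esub> (f' \<odot>\<^bsub>N\<^esub> n)"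
  using N.smult_assoc by (simp add: hecke_algebra_simps(1))

text \<open>A module over the ring \<open>\<H>\<close> gets its complex scalars through multiples of
  the unit. With them functionals on \<open>N\<close> are available for testing integrals.\<close>

definition N_space :: "(complex, 'n) module" where
  "N_space = \<lparr>carrier = carrier N, monoid.mult = undefined, one = undefined, zero = \<zero>\<^bsub>N\<^esub>, add = add N,
     smult = (\<lambda>c n. (c \<odot>\<^bsub>hecke_space\<^esub> \<one>\<^bsub>\<H>\<^esub>) \<odot>\<^bsub>N\<^esub> n)\<rparr>"

lemma N_space_simps:
  "carrier N_space = carrier N" "\<zero>\<^bsub>N_space\<^esub> = \<zero>\<^bsub>N\<^esub>" "n \<oplus>\<^bsub>N_space\<^esub> n' = n \<oplus>\<^bsub>N\<^esub> n'"
  "c \<odot>\<^bsub>N_space\<^esub> n = (c \<odot>\<^bsub>hecke_space\<^esub> \<one>\<^bsub>\<H>\<^esub>) \<odot>\<^bsub>N\<^esub> n"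
  by (simp_all add: N_space_def)

lemma hecke_zero_smult: "n \<in> carrier N \<Longrightarrow> \<zero>\<^bsub>\<H>\<^esub> \<odot>\<^bsub>N\<^esub> n = \<zero>\<^bsub>N\<^esub>"
proof -
  assume n: "n \<in> carrier N"
  interpret H: complex_space hecke_space by (rule complex_space_hecke)
  have "\<zero>\<^bsub>\<H>\<^esub> \<oplus>\<^bsub>\<H>\<^esub> \<zero>\<^bsub>\<H>\<^esub> = \<zero>\<^bsub>\<H>\<^esub>"
    using H.M.l_zero[OF H.zero_mem] by (simp only: hecke_space_simps)
  then have "\<zero>\<^bsub>\<H>\<^esub> \<odot>\<^bsub>N\<^esub> n \<oplus>\<^bsub>N\<^esub> \<zero>\<^bsub>\<H>\<^esub> \<odot>\<^bsub>N\<^esub> n = \<zero>\<^bsub>\<H>\<^esub> \<odot>\<^bsub>N\<^esub> n"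
    using N_add_left[OF hecke_zero_mem hecke_zero_mem n] by simp
  then show ?thesis using N_smult_mem[OF hecke_zero_mem n] by (simp add: N.M.add.l_cancel_one)
qed

lemma complex_space_N: "complex_space N_space"
proof (rule complex_spaceI; unfold N_space_simps)
  interpret H: complex_space hecke_space by (rule complex_space_hecke)
  note one = hecke_one_mem and sm = hecke_smult_mem[OF hecke_one_mem]
  have onec: "\<one>\<^bsub>\<H>\<^esub> \<in> carrier hecke_space" by (simp only: hecke_space_simps one)
  fix x assume x: "x \<in> carrier N"
  show "\<zero>\<^bsub>N\<^esub> \<oplus>\<^bsub>N\<^esub> x = x" using x by simp
  show "(c \<odot>\<^bsub>hecke_space\<^esub> \<one>\<^bsub>\<H>\<^esub>) \<odot>\<^bsub>N\<^esub> x \<in> carrier N" for c by (rule N_smult_mem[OF sm x])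
  show "((a + b) \<odot>\<^bsub>hecke_space\<^esub> \<one>\<^bsub>\<H>\<^esub>) \<odot>\<^bsub>N\<^esub> x =
    (a \<odot>\<^bsub>hecke_space\<^esub> \<one>\<^bsub>\<H>\<^esub>) \<odot>\<^bsub>N\<^esub> x \<oplus>\<^bsub>N\<^esub> (b \<odot>\<^bsub>hecke_space\<^esub> \<one>\<^bsub>\<H>\<^esub>) \<odot>\<^bsub>N\<^esub> x" for a b
    using N_add_left[OF sm sm x, of a b] H.smult_add_left[OF onec, of a b] by (simp only: hecke_space_simps(3))
  show "((a * b) \<odot>\<^bsub>hecke_space\<^esub> \<one>\<^bsub>\<H>\<^esub>) \<odot>\<^bsub>N\<^esub> x =
    (a \<odot>\<^bsub>hecke_space\<^esub> \<one>\<^bsub>\<H>\<^esub>) \<odot>\<^bsub>N\<^esub> ((b \<odot>\<^bsub>hecke_space\<^esub> \<one>\<^bsub>\<H>\<^esub>) \<odot>\<^bsub>N\<^esub> x)" for a b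
    using N_assoc[OF sm sm x, of a b] hecke_smult_one_mult[OF sm, of a b] H.smult_smult[OF onec, of a b] by simp
  show "(1 \<odot>\<^bsub>hecke_space\<^esub> \<one>\<^bsub>\<H>\<^esub>) \<odot>\<^bsub>N\<^esub> x = x" using H.smult_one_left[OF onec] N.smult_one[OF x] by simp
  show "(0 \<odot>\<^bsub>hecke_space\<^esub> \<one>\<^bsub>\<H>\<^esub>) \<odot>\<^bsub>N\<^esub> x = \<zero>\<^bsub>N\<^esub>"
    using H.smult_zero_left[OF onec] hecke_zero_smult[OF x] by (simp only: hecke_space_simps(2))
  fix y assume y: "y \<in> carrier N"
  show "x \<oplus>\<^bsub>N\<^esub> y \<in> carrier N" "x \<oplus>\<^bsub>N\<^esub> y = y \<oplus>\<^bsub>N\<^esub> x" using x y by (simp_all add: N.M.a_comm)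
  show "(a \<odot>\<^bsub>hecke_space\<^esub> \<one>\<^bsub>\<H>\<^esub>) \<odot>\<^bsub>N\<^esub> (x \<oplus>\<^bsub>N\<^esub> y) =
    (a \<odot>\<^bsub>hecke_space\<^esub> \<one>\<^bsub>\<H>\<^esub>) \<odot>\<^bsub>N\<^esub> x \<oplus>\<^bsub>N\<^esub> (a \<odot>\<^bsub>hecke_space\<^esub> \<one>\<^bsub>\<H>\<^esub>) \<odot>\<^bsub>N\<^esub> y" for a
    by (rule N_add_right[OF sm x y])
  show "x \<oplus>\<^bsub>N\<^esub> y \<oplus>\<^bsub>N\<^esub> z = x \<oplus>\<^bsub>N\<^esub> (y \<oplus>\<^bsub>N\<^esub> z)" if "z \<in> carrier N" for z
    using x y that by (simp add: N.M.a_assoc)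
qed simp

sublocale NS: complex_space N_space by (rule complex_space_N)

text \<open>Letting the algebra act on \<open>n\<close> and applying \<open>\<xi>\<close> is a
  functional on the algebra; it carries the integral identity of \<open>hecke_elt_integral\<close>
  over to \<open>N\<close>.\<close>

lemma N_functional:
  assumes \<xi>: "\<xi> \<in> lin_maps N_space scalars" and n: "n \<in> carrier N"
  shows "(\<lambda>f\<in>carrier hecke_space. \<xi> (f \<odot>\<^bsub>N\<^esub> n)) \<in> lin_maps hecke_space scalars"
proof (rule lin_mapsI)
  fix f assume "f \<in> carrier hecke_space"
  then have f: "f \<in> hecke_fun G T K W" by (simp only: hecke_space_simps)
  {
    fix f' assume "f' \<in> carrier hecke_space"
    then have f': "f' \<in> hecke_fun G T K W" by (simp only: hecke_space_simps)
    show "(\<lambda>f\<in>carrier hecke_space. \<xi> (f \<odot>\<^bsub>N\<^esub> n)) (f \<oplus>\<^bsub>hecke_space\<^esub> f') =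
      (\<lambda>f\<in>carrier hecke_space. \<xi> (f \<odot>\<^bsub>N\<^esub> n)) f \<oplus>\<^bsub>scalars\<^esub> (\<lambda>f\<in>carrier hecke_space. \<xi> (f \<odot>\<^bsub>N\<^esub> n)) f'"
      using NS.functional_add[OF \<xi>] f f' n
      by (simp add: hecke_space_simps(1,3) hecke_add_mem N_add_left N_space_simps N_smult_mem)
  next
    fix c
    show "(\<lambda>f\<in>carrier hecke_space. \<xi> (f \<odot>\<^bsub>N\<^esub> n)) (c \<odot>\<^bsub>hecke_space\<^esub> f) =
      c \<odot>\<^bsub>scalars\<^esub> (\<lambda>f\<in>carrier hecke_space. \<xi> (f \<odot>\<^bsub>N\<^esub> n)) f"
      using NS.functional_smult[OF \<xi>, of "f \<odot>\<^bsub>N\<^esub> n" c] f n N_assoc[OF hecke_smult_mem[OF hecke_one_mem] f n, of c]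
      by (simp add: hecke_space_simps(1) hecke_smult_mem hecke_one_mem hecke_smult_one_mult N_space_simps N_smult_mem)
  }
qed simp_all

section \<open>The induced representation as a space of functions\<close>

definition pts :: "('g \<times> ('w \<Rightarrow> complex)) set" where
  "pts = carrier G \<times> W_dual"

text \<open>The ambient space, in which identities are checked pointwise. Right translation in the
  group variable matches the passage from \<open>m\<close> to \<open>g m\<close> in the averages of
  translates of \<open>m\<close>.\<close>

definition fun_rep :: "('g, 'g \<times> ('w \<Rightarrow> complex) \<Rightarrow> 'n) rep" where
  "fun_rep = \<lparr>carrier = pts \<rightarrow>\<^sub>E carrier N, monoid.mult = undefined, one = undefined,
     zero = (\<lambda>p\<in>pts. \<zero>\<^bsub>N\<^esub>), add = (\<lambda>F F'. \<lambda>p\<in>pts. F p \<oplus>\<^bsub>N\<^esub> F' p),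
     smult = (\<lambda>c F. \<lambda>p\<in>pts. c \<odot>\<^bsub>N_space\<^esub> F p),
     act = (\<lambda>g F. \<lambda>p\<in>pts. F (fst p \<otimes> g, snd p))\<rparr>"

lemma fun_rep_simps:
  "carrier fun_rep = pts \<rightarrow>\<^sub>E carrier N" "\<zero>\<^bsub>fun_rep\<^esub> = (\<lambda>p\<in>pts. \<zero>\<^bsub>N\<^esub>)"
  "F \<oplus>\<^bsub>fun_rep\<^esub> F' = (\<lambda>p\<in>pts. F p \<oplus>\<^bsub>N\<^esub> F' p)"
  "c \<odot>\<^bsub>fun_rep\<^esub> F = (\<lambda>p\<in>pts. c \<odot>\<^bsub>N_space\<^esub> F p)"
  "act fun_rep g F = (\<lambda>p\<in>pts. F (fst p \<otimes> g, snd p))"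
  by (simp_all add: fun_rep_def)

lemma pts_translate: "p \<in> pts \<Longrightarrow> g \<in> carrier G \<Longrightarrow> (fst p \<otimes> g, snd p) \<in> pts"
  by (auto simp: pts_def)

lemma fun_rep_mem: "F \<in> carrier fun_rep \<Longrightarrow> p \<in> pts \<Longrightarrow> F p \<in> carrier N"
  by (auto simp: fun_rep_simps)

lemma fun_rep_eqI:
  "F \<in> carrier fun_rep \<Longrightarrow> F' \<in> carrier fun_rep \<Longrightarrow> (\<And>p. p \<in> pts \<Longrightarrow> F p = F' p) \<Longrightarrow> F = F'"
  by (rule PiE_ext[of F pts "\<lambda>_. carrier N"]) (simp_all add: fun_rep_simps)

lemma complex_space_fun_rep: "complex_space fun_rep"
proof (rule complex_spaceI)
  note NS = NS.smult_mem[unfolded N_space_simps(1)]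
  show "\<zero>\<^bsub>fun_rep\<^esub> \<in> carrier fun_rep" by (simp add: fun_rep_simps)
  fix F assume F: "F \<in> carrier fun_rep"
  note Fm = fun_rep_mem[OF F]
  have mem: "c \<odot>\<^bsub>fun_rep\<^esub> F \<in> carrier fun_rep" for c using Fm NS by (simp add: fun_rep_simps)
  then show "c \<odot>\<^bsub>fun_rep\<^esub> F \<in> carrier fun_rep" for c .
  show "\<zero>\<^bsub>fun_rep\<^esub> \<oplus>\<^bsub>fun_rep\<^esub> F = F"
    by (rule fun_rep_eqI[OF _ F]) (use Fm in \<open>simp_all add: fun_rep_simps\<close>)
  show "1 \<odot>\<^bsub>fun_rep\<^esub> F = F"
    by (rule fun_rep_eqI[OF mem F]) (use Fm NS.smult_one_left in \<open>simp add: fun_rep_simps N_space_simps(1)\<close>)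
  show "0 \<odot>\<^bsub>fun_rep\<^esub> F = \<zero>\<^bsub>fun_rep\<^esub>"
    using Fm NS.smult_zero_left by (auto simp: fun_rep_simps N_space_simps(1,2) intro!: restrict_ext)
  show "(a + b) \<odot>\<^bsub>fun_rep\<^esub> F = a \<odot>\<^bsub>fun_rep\<^esub> F \<oplus>\<^bsub>fun_rep\<^esub> b \<odot>\<^bsub>fun_rep\<^esub> F" for a b
    using Fm NS.smult_add_left by (auto simp: fun_rep_simps N_space_simps(1,3) intro!: restrict_ext)
  show "(a * b) \<odot>\<^bsub>fun_rep\<^esub> F = a \<odot>\<^bsub>fun_rep\<^esub> (b \<odot>\<^bsub>fun_rep\<^esub> F)" for a b
    using Fm NS.smult_smult by (auto simp: fun_rep_simps N_space_simps(1,3) intro!: restrict_ext)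
  fix F' assume F': "F' \<in> carrier fun_rep"
  note Fm' = fun_rep_mem[OF F']
  show "F \<oplus>\<^bsub>fun_rep\<^esub> F' \<in> carrier fun_rep" using Fm Fm' by (simp add: fun_rep_simps)
  show "F \<oplus>\<^bsub>fun_rep\<^esub> F' = F' \<oplus>\<^bsub>fun_rep\<^esub> F"
    using Fm Fm' N.M.a_comm by (auto simp: fun_rep_simps intro!: restrict_ext)
  show "a \<odot>\<^bsub>fun_rep\<^esub> (F \<oplus>\<^bsub>fun_rep\<^esub> F') = a \<odot>\<^bsub>fun_rep\<^esub> F \<oplus>\<^bsub>fun_rep\<^esub> a \<odot>\<^bsub>fun_rep\<^esub> F'" for a
    using Fm Fm' NS.smult_add_right by (auto simp: fun_rep_simps N_space_simps(1,3) intro!: restrict_ext)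
  show "F \<oplus>\<^bsub>fun_rep\<^esub> F' \<oplus>\<^bsub>fun_rep\<^esub> F'' = F \<oplus>\<^bsub>fun_rep\<^esub> (F' \<oplus>\<^bsub>fun_rep\<^esub> F'')"
    if F'': "F'' \<in> carrier fun_rep" for F''
    using Fm Fm' fun_rep_mem[OF F''] N.M.a_assoc by (auto simp: fun_rep_simps intro!: restrict_ext)
qed

sublocale D: complex_space fun_rep by (rule complex_space_fun_rep)

text \<open>Plays the part of the elementary tensor of \<open>g w\<close> with
  \<open>n\<close>.\<close>

definition gen_elt :: "'g \<Rightarrow> 'w \<Rightarrow> 'n \<Rightarrow> 'g \<times> ('w \<Rightarrow> complex) \<Rightarrow> 'n" where
  "gen_elt g w n = (\<lambda>p\<in>pts. hecke_elt (snd p) (fst p \<otimes> g) w \<odot>\<^bsub>N\<^esub> n)"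

text \<open>Finite sums are indexed by lists and carry no coefficients, as a scalar can be absorbed
  into \<open>w\<close>. Every vector is thus named by a list of triples, which bounds the size of
  the representation.\<close>

fun list_elt :: "('g \<times> 'w \<times> 'n) list \<Rightarrow> 'g \<times> ('w \<Rightarrow> complex) \<Rightarrow> 'n" where
  "list_elt [] = \<zero>\<^bsub>fun_rep\<^esub>"
| "list_elt ((g, w, n) # xs) = gen_elt g w n \<oplus>\<^bsub>fun_rep\<^esub> list_elt xs"

abbreviation "triples \<equiv> lists (carrier G \<times> carrier W \<times> carrier N)"

definition ind_carrier :: "('g \<times> ('w \<Rightarrow> complex) \<Rightarrow> 'n) set" where
  "ind_carrier = list_elt ` triples"

definition ind_rep :: "('g, 'g \<times> ('w \<Rightarrow> complex) \<Rightarrow> 'n) rep" where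
  "ind_rep = fun_rep\<lparr>carrier := ind_carrier\<rparr>"

lemma ind_rep_simps:
  "carrier ind_rep = ind_carrier" "\<zero>\<^bsub>ind_rep\<^esub> = \<zero>\<^bsub>fun_rep\<^esub>" "F \<oplus>\<^bsub>ind_rep\<^esub> F' = F \<oplus>\<^bsub>fun_rep\<^esub> F'"
  "c \<odot>\<^bsub>ind_rep\<^esub> F = c \<odot>\<^bsub>fun_rep\<^esub> F" "act ind_rep = act fun_rep"
  by (simp_all add: ind_rep_def)

lemma hecke_elt_pts:
  "p \<in> pts \<Longrightarrow> g \<in> carrier G \<Longrightarrow> w \<in> carrier W \<Longrightarrow> hecke_elt (snd p) (fst p \<otimes> g) w \<in> hecke_fun G T K W"
  by (intro hecke_elt_mem) (auto simp: pts_def)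

lemma gen_elt_mem: "g \<in> carrier G \<Longrightarrow> w \<in> carrier W \<Longrightarrow> n \<in> carrier N \<Longrightarrow> gen_elt g w n \<in> carrier fun_rep"
  by (simp add: gen_elt_def fun_rep_simps N_smult_mem hecke_elt_pts)

lemma gen_elt_act:
  "g \<in> carrier G \<Longrightarrow> g' \<in> carrier G \<Longrightarrow> act fun_rep g' (gen_elt g w n) = gen_elt (g' \<otimes> g) w n"
  by (auto simp: gen_elt_def fun_rep_simps pts_translate pts_def m_assoc intro!: restrict_ext)

lemma gen_elt_smult:
  assumes "g \<in> carrier G" "w \<in> carrier W" "n \<in> carrier N"
  shows "gen_elt g (c \<odot>\<^bsub>W\<^esub> w) n = c \<odot>\<^bsub>fun_rep\<^esub> gen_elt g w n"
  unfolding gen_elt_def fun_rep_simps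
proof (rule restrict_ext)
  fix p assume p: "p \<in> pts"
  note h = hecke_elt_pts[OF p assms(1,2)]
  have "hecke_elt (snd p) (fst p \<otimes> g) (c \<odot>\<^bsub>W\<^esub> w) = c \<odot>\<^bsub>hecke_space\<^esub> hecke_elt (snd p) (fst p \<otimes> g) w"
    using p assms by (intro hecke_elt_smult) (auto simp: pts_def)
  then show "hecke_elt (snd p) (fst p \<otimes> g) (c \<odot>\<^bsub>W\<^esub> w) \<odot>\<^bsub>N\<^esub> n =
    c \<odot>\<^bsub>N_space\<^esub> (\<lambda>p\<in>pts. hecke_elt (snd p) (fst p \<otimes> g) w \<odot>\<^bsub>N\<^esub> n) p"
    using p N_assoc[OF hecke_smult_mem[OF hecke_one_mem] h assms(3), of c]
    by (simp add: N_space_simps hecke_smult_one_mult h)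
qed

lemma gen_elt_add:
  assumes "g \<in> carrier G" "w \<in> carrier W" "w' \<in> carrier W" "n \<in> carrier N"
  shows "gen_elt g (w \<oplus>\<^bsub>W\<^esub> w') n = gen_elt g w n \<oplus>\<^bsub>fun_rep\<^esub> gen_elt g w' n"
  unfolding gen_elt_def fun_rep_simps
proof (rule restrict_ext)
  fix p assume p: "p \<in> pts"
  have "hecke_elt (snd p) (fst p \<otimes> g) (w \<oplus>\<^bsub>W\<^esub> w') = hecke_elt (snd p) (fst p \<otimes> g) w \<oplus>\<^bsub>\<H>\<^esub> hecke_elt (snd p) (fst p \<otimes> g) w'"
    using p assms by (intro hecke_elt_add) (auto simp: pts_def)
  then show "hecke_elt (snd p) (fst p \<otimes> g) (w \<oplus>\<^bsub>W\<^esub> w') \<odot>\<^bsub>N\<^esub> n =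
    (\<lambda>p\<in>pts. hecke_elt (snd p) (fst p \<otimes> g) w \<odot>\<^bsub>N\<^esub> n) p \<oplus>\<^bsub>N\<^esub> (\<lambda>p\<in>pts. hecke_elt (snd p) (fst p \<otimes> g) w' \<odot>\<^bsub>N\<^esub> n) p"
    using p assms by (simp add: N_add_left hecke_elt_pts)
qed

lemma list_elt_mem: "xs \<in> triples \<Longrightarrow> list_elt xs \<in> carrier fun_rep"
  by (induction xs rule: list_elt.induct) (auto simp: gen_elt_mem)

lemma list_elt_append:
  "xs \<in> triples \<Longrightarrow> ys \<in> triples \<Longrightarrow> list_elt (xs @ ys) = list_elt xs \<oplus>\<^bsub>fun_rep\<^esub> list_elt ys"
proof (induction xs rule: list_elt.induct)
  case 1 then show ?case using D.M.l_zero[OF list_elt_mem] by simp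
next
  case (2 g w n xs)
  then have "gen_elt g w n \<in> carrier fun_rep" "xs \<in> triples" by (auto simp: gen_elt_mem)
  then show ?case using 2 D.M.a_assoc[of "gen_elt g w n" "list_elt xs" "list_elt ys"] by (simp add: list_elt_mem)
qed

lemma list_elt_smult:
  "xs \<in> triples \<Longrightarrow> c \<odot>\<^bsub>fun_rep\<^esub> list_elt xs = list_elt (map (\<lambda>(g, w, n). (g, c \<odot>\<^bsub>W\<^esub> w, n)) xs)"
proof (induction xs rule: list_elt.induct)
  case 1 then show ?case using D.smult_zero_right by simp
next
  case (2 g w n xs)
  then have m: "g \<in> carrier G" "w \<in> carrier W" "n \<in> carrier N" "xs \<in> triples" by auto
  have "c \<odot>\<^bsub>fun_rep\<^esub> list_elt ((g, w, n) # xs) = c \<odot>\<^bsub>fun_rep\<^esub> gen_elt g w n \<oplus>\<^bsub>fun_rep\<^esub> c \<odot>\<^bsub>fun_rep\<^esub> list_elt xs"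
    using D.smult_add_right[OF gen_elt_mem[OF m(1-3)] list_elt_mem[OF m(4)]] by simp
  then show ?case using 2(1)[OF m(4)] gen_elt_smult[OF m(1-3), of c] by simp
qed

lemma fun_rep_act_add:
  "g \<in> carrier G \<Longrightarrow> act fun_rep g (F \<oplus>\<^bsub>fun_rep\<^esub> F') = act fun_rep g F \<oplus>\<^bsub>fun_rep\<^esub> act fun_rep g F'"
  unfolding fun_rep_simps by (intro restrict_ext) (simp add: pts_translate)

lemma fun_rep_act_smult:
  "g \<in> carrier G \<Longrightarrow> act fun_rep g (c \<odot>\<^bsub>fun_rep\<^esub> F) = c \<odot>\<^bsub>fun_rep\<^esub> act fun_rep g F"
  unfolding fun_rep_simps by (intro restrict_ext) (simp add: pts_translate)

lemma fun_rep_act_zero: "g \<in> carrier G \<Longrightarrow> act fun_rep g \<zero>\<^bsub>fun_rep\<^esub> = \<zero>\<^bsub>fun_rep\<^esub>"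
  unfolding fun_rep_simps by (intro restrict_ext) (simp add: pts_translate)

lemma list_elt_act:
  "xs \<in> triples \<Longrightarrow> h \<in> carrier G \<Longrightarrow>
    act fun_rep h (list_elt xs) = list_elt (map (\<lambda>(g, w, n). (h \<otimes> g, w, n)) xs)"
proof (induction xs rule: list_elt.induct)
  case 1 then show ?case by (simp add: fun_rep_act_zero)
next
  case (2 g w n xs)
  then show ?case by (simp add: fun_rep_act_add gen_elt_act)
qed

lemma ind_carrier_submodule: "submodule ind_carrier complex_ring fun_rep"
  unfolding D.submodule_iff
proof (intro conjI ballI allI)
  show "ind_carrier \<subseteq> carrier fun_rep" using list_elt_mem by (auto simp: ind_carrier_def)
  show "\<zero>\<^bsub>fun_rep\<^esub> \<in> ind_carrier" unfolding ind_carrier_def by (rule image_eqI[of _ _ "[]"]) auto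
  fix F assume "F \<in> ind_carrier"
  then obtain xs where xs: "xs \<in> triples" "F = list_elt xs" by (auto simp: ind_carrier_def)
  {
    fix F' assume "F' \<in> ind_carrier"
    then obtain ys where ys: "ys \<in> triples" "F' = list_elt ys" by (auto simp: ind_carrier_def)
    show "F \<oplus>\<^bsub>fun_rep\<^esub> F' \<in> ind_carrier"
      unfolding ind_carrier_def using xs ys by (intro image_eqI[of _ _ "xs @ ys"]) (auto simp: list_elt_append)
  next
    fix c
    have "map (\<lambda>(g, w, n). (g, c \<odot>\<^bsub>W\<^esub> w, n)) xs \<in> triples" using xs(1) by (auto simp: in_lists_conv_set)
    then show "c \<odot>\<^bsub>fun_rep\<^esub> F \<in> ind_carrier"
      unfolding ind_carrier_def xs(2) list_elt_smult[OF xs(1)] by (rule imageI)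
  }
qed

lemma ind_carrier_act:
  assumes g: "g \<in> carrier G" and F: "F \<in> ind_carrier" shows "act fun_rep g F \<in> ind_carrier"
proof -
  obtain xs where xs: "xs \<in> triples" "F = list_elt xs" using F by (auto simp: ind_carrier_def)
  have "map (\<lambda>(g', w, n). (g \<otimes> g', w, n)) xs \<in> triples" using xs(1) g by (auto simp: in_lists_conv_set)
  then show ?thesis unfolding ind_carrier_def xs(2) list_elt_act[OF xs(1) g] by (rule imageI)
qed

lemma ind_carrier_mem: "F \<in> ind_carrier \<Longrightarrow> F \<in> carrier fun_rep"
  using ind_carrier_submodule unfolding D.submodule_iff by blast

lemma gen_elt_ind: "g \<in> carrier G \<Longrightarrow> w \<in> carrier W \<Longrightarrow> n \<in> carrier N \<Longrightarrow> gen_elt g w n \<in> ind_carrier"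
  unfolding ind_carrier_def
  by (rule image_eqI[of _ _ "[(g, w, n)]"]) (use D.M.r_zero[OF gen_elt_mem] in auto)

lemma gen_elt_locally_constant:
  assumes w: "w \<in> carrier W" and g: "g \<in> carrier G"
  shows "locally_constant T (\<lambda>x. gen_elt (x \<otimes> g) w n)"
proof (rule locally_constant_continuous[of "\<lambda>x. gen_elt x w n"])
  show "locally_constant T (\<lambda>x. gen_elt x w n)"
  proof (rule locally_constant_right_invariant[OF openin_fixer fixer_one])
    fix x j assume x: "x \<in> carrier G" and j: "j \<in> fixer"
    show "gen_elt (x \<otimes> j) w n = gen_elt x w n"
      unfolding gen_elt_def
    proof (rule restrict_ext)
      fix p assume p: "p \<in> pts"
      then have "fst p \<in> carrier G" by (auto simp: pts_def)
      then show "hecke_elt (snd p) (fst p \<otimes> (x \<otimes> j)) w \<odot>\<^bsub>N\<^esub> n = hecke_elt (snd p) (fst p \<otimes> x) w \<odot>\<^bsub>N\<^esub> n"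
        using hecke_elt_fixer[OF _ j w, of "fst p \<otimes> x" "snd p"] x K_carrier[OF fixer_K[OF j]] by (simp add: m_assoc)
    qed
  qed
qed (intro continuous_rules g)

text \<open>A finite sum of locally constant orbit maps. This gives smoothness, since the stabiliser
  of a vector is a fibre of its orbit map.\<close>

lemma list_elt_locally_constant: "xs \<in> triples \<Longrightarrow> locally_constant T (\<lambda>x. act fun_rep x (list_elt xs))"
proof (induction xs rule: list_elt.induct)
  case 1
  show ?case
    by (rule locally_constant_cong[OF locally_constant_const[of "\<zero>\<^bsub>fun_rep\<^esub>"]])
      (simp add: fun_rep_act_zero)
next
  case (2 g w n xs)
  then have m: "g \<in> carrier G" "w \<in> carrier W" "xs \<in> triples" by auto
  show ?case
    by (rule locally_constant_cong[OF locally_constant_comp2[OF gen_elt_locally_constant[OF m(2,1), of n] 2(1)[OF m(3)],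
          of "add fun_rep"]]) (simp add: fun_rep_act_add gen_elt_act m)
qed

lemma smooth_rep_ind: "smooth_rep G T ind_rep"
proof (intro smooth_rep.intro group_rep.intro smooth_rep_axioms.intro group_rep_axioms.intro)
  show "group G" by (rule is_group)
  show mod: "Module.module complex_ring ind_rep"
    unfolding ind_rep_def
    by (rule submodule.submodule_is_module[OF ind_carrier_submodule complex_space_fun_rep[unfolded complex_space_def]])
  fix g assume g: "g \<in> carrier G"
  show "restrict (act ind_rep g) (carrier ind_rep) \<in> lin_maps ind_rep ind_rep"
  proof (rule lin_mapsI)
    interpret I: complex_space ind_rep unfolding complex_space_def by (rule mod)
    fix x assume x: "x \<in> carrier ind_rep"
    then show "restrict (act ind_rep g) (carrier ind_rep) x \<in> carrier ind_rep"
      using ind_carrier_act[OF g] by (simp add: ind_rep_simps)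
    {
      fix y assume y: "y \<in> carrier ind_rep"
      show "restrict (act ind_rep g) (carrier ind_rep) (x \<oplus>\<^bsub>ind_rep\<^esub> y) =
        restrict (act ind_rep g) (carrier ind_rep) x \<oplus>\<^bsub>ind_rep\<^esub> restrict (act ind_rep g) (carrier ind_rep) y"
        using I.add_mem[OF x y] x y fun_rep_act_add[OF g, of x y] by (simp add: ind_rep_simps)
    next
      fix c
      show "restrict (act ind_rep g) (carrier ind_rep) (c \<odot>\<^bsub>ind_rep\<^esub> x) =
        c \<odot>\<^bsub>ind_rep\<^esub> restrict (act ind_rep g) (carrier ind_rep) x"
        using I.smult_mem[OF x, of c] x fun_rep_act_smult[OF g, of c x] by (simp add: ind_rep_simps)
    }
  qed simp
next
  fix F assume "F \<in> carrier ind_rep"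
  then have F: "F \<in> ind_carrier" by (simp add: ind_rep_simps)
  note Fc = ind_carrier_mem[OF F]
  show "act ind_rep \<one> F = F"
    unfolding ind_rep_simps
  proof (rule fun_rep_eqI[OF _ Fc])
    show "act fun_rep \<one> F \<in> carrier fun_rep" using ind_carrier_mem[OF ind_carrier_act[OF one_closed F]] .
  qed (auto simp: fun_rep_simps pts_def)
  show "act ind_rep (g \<otimes> h) F = act ind_rep g (act ind_rep h F)" if "g \<in> carrier G" "h \<in> carrier G" for g h
    using that by (auto simp: ind_rep_simps fun_rep_simps pts_translate pts_def m_assoc intro!: restrict_ext)
  obtain xs where xs: "xs \<in> triples" "F = list_elt xs" using F by (auto simp: ind_carrier_def)
  show "openin T {g \<in> carrier G. act ind_rep g F = F}"
    using openin_fiber[OF list_elt_locally_constant[OF xs(1)], of "\<lambda>F'. F' = F"] unfolding ind_rep_simps xs(2) .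
qed

section \<open>The unit of the adjunction\<close>

sublocale I: hecke_rep G T \<mu> K W ind_rep by (rule hecke_rep[OF smooth_rep_ind])

definition unit_hom :: "'n \<Rightarrow> 'w \<Rightarrow> 'g \<times> ('w \<Rightarrow> complex) \<Rightarrow> 'n" where
  "unit_hom n = (\<lambda>w\<in>carrier W. gen_elt \<one> w n)"

text \<open>Equivariance is the balancing relation \<open>hecke_elt_act\<close>.\<close>

lemma unit_hom_K_homs:
  assumes n: "n \<in> carrier N" shows "unit_hom n \<in> I.K_homs"
proof (rule I.K_homsI)
  show "unit_hom n \<in> lin_maps W ind_rep"
    by (rule lin_mapsI) (auto simp: unit_hom_def ind_rep_simps gen_elt_ind gen_elt_add gen_elt_smult n)
  fix k w assume k: "k \<in> K" and w: "w \<in> carrier W"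
  have "gen_elt \<one> (act W k w) n = gen_elt (k \<otimes> \<one>) w n"
    unfolding gen_elt_def
  proof (rule restrict_ext)
    fix p assume "p \<in> pts"
    then have "fst p \<in> carrier G" by (auto simp: pts_def)
    then show "hecke_elt (snd p) (fst p \<otimes> \<one>) (act W k w) \<odot>\<^bsub>N\<^esub> n = hecke_elt (snd p) (fst p \<otimes> (k \<otimes> \<one>)) w \<odot>\<^bsub>N\<^esub> n"
      using hecke_elt_act[OF _ k w, of "fst p" "snd p"] K_carrier[OF k] by simp
  qed
  then show "unit_hom n (act W k w) = act ind_rep k (unit_hom n w)"
    using w act_W_mem[OF k w] gen_elt_act[OF one_closed K_carrier[OF k], of w n]
    by (simp add: unit_hom_def ind_rep_simps)
qed

lemma unit_hom_add:
  assumes n: "n \<in> carrier N" "n' \<in> carrier N"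
  shows "unit_hom (n \<oplus>\<^bsub>N\<^esub> n') = unit_hom n \<oplus>\<^bsub>I.F_M\<^esub> unit_hom n'"
  unfolding I.F_M_simps(3) unit_hom_def
proof (rule restrict_ext)
  fix w assume w: "w \<in> carrier W"
  have "gen_elt \<one> w (n \<oplus>\<^bsub>N\<^esub> n') = gen_elt \<one> w n \<oplus>\<^bsub>fun_rep\<^esub> gen_elt \<one> w n'"
    unfolding gen_elt_def fun_rep_simps
    using n w hecke_elt_pts[OF _ one_closed w] by (intro restrict_ext) (simp add: N_add_right)
  then show "gen_elt \<one> w (n \<oplus>\<^bsub>N\<^esub> n') =
    (\<lambda>w\<in>carrier W. gen_elt \<one> w n) w \<oplus>\<^bsub>ind_rep\<^esub> (\<lambda>w\<in>carrier W. gen_elt \<one> w n') w"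
    using w by (simp add: ind_rep_simps)
qed

lemma ind_functional:
  assumes \<xi>: "\<xi> \<in> lin_maps N_space scalars" and p: "p \<in> pts"
  shows "(\<lambda>F\<in>carrier ind_rep. \<xi> (F p)) \<in> lin_maps ind_rep scalars"
proof (rule lin_mapsI)
  fix x assume x: "x \<in> carrier ind_rep"
  note xm = fun_rep_mem[OF ind_carrier_mem p]
  {
    fix y assume y: "y \<in> carrier ind_rep"
    show "(\<lambda>F\<in>carrier ind_rep. \<xi> (F p)) (x \<oplus>\<^bsub>ind_rep\<^esub> y) =
      (\<lambda>F\<in>carrier ind_rep. \<xi> (F p)) x \<oplus>\<^bsub>scalars\<^esub> (\<lambda>F\<in>carrier ind_rep. \<xi> (F p)) y"
      using I.M.add_mem[OF x y] x y NS.functional_add[OF \<xi>, of "x p" "y p"] xm p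
      by (simp add: ind_rep_simps fun_rep_simps(3) N_space_simps(1,3))
  next
    fix c
    show "(\<lambda>F\<in>carrier ind_rep. \<xi> (F p)) (c \<odot>\<^bsub>ind_rep\<^esub> x) =
      c \<odot>\<^bsub>scalars\<^esub> (\<lambda>F\<in>carrier ind_rep. \<xi> (F p)) x"
      using I.M.smult_mem[OF x, of c] x NS.functional_smult[OF \<xi>, of "x p" c] xm p
      by (simp add: ind_rep_simps fun_rep_simps(4) N_space_simps(1))
  }
qed simp_all

text \<open>At the point \<open>(y, l)\<close> the left side is the product of
  \<open>hecke_elt l y w\<close> and \<open>f\<close> applied to \<open>n\<close>, by associativity
  in \<open>N\<close>; the right side integrates \<open>hecke_elt l (y \<otimes> g)\<close> at the
  transposes of \<open>f g\<close>, applied to \<open>n\<close>. These agree by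
  \<open>hecke_elt_integral\<close>.\<close>

lemma unit_hom_smult:
  assumes f: "f \<in> hecke_fun G T K W" and n: "n \<in> carrier N"
  shows "unit_hom (f \<odot>\<^bsub>N\<^esub> n) = f \<odot>\<^bsub>I.F_M\<^esub> unit_hom n"
proof (rule I.K_homs_eqI)
  note fn = N_smult_mem[OF f n] and u = unit_hom_K_homs[OF n]
  show "unit_hom (f \<odot>\<^bsub>N\<^esub> n) \<in> I.K_homs" by (rule unit_hom_K_homs[OF fn])
  show fu: "f \<odot>\<^bsub>I.F_M\<^esub> unit_hom n \<in> I.K_homs" by (rule I.action_K_homs[OF f u])
  fix w assume w: "w \<in> carrier W"
  have m: "unit_hom (f \<odot>\<^bsub>N\<^esub> n) w \<in> ind_carrier" "(f \<odot>\<^bsub>I.F_M\<^esub> unit_hom n) w \<in> ind_carrier"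
    using I.K_homs_mem[OF unit_hom_K_homs[OF fn] w] I.K_homs_mem[OF fu w] by (simp_all only: ind_rep_simps)
  show "unit_hom (f \<odot>\<^bsub>N\<^esub> n) w = (f \<odot>\<^bsub>I.F_M\<^esub> unit_hom n) w"
  proof (rule fun_rep_eqI[OF ind_carrier_mem[OF m(1)] ind_carrier_mem[OF m(2)]])
    fix p assume p: "p \<in> pts"
    then obtain y l where yl: "p = (y, l)" "y \<in> carrier G" "l \<in> W_dual" by (auto simp: pts_def)
    show "unit_hom (f \<odot>\<^bsub>N\<^esub> n) w p = (f \<odot>\<^bsub>I.F_M\<^esub> unit_hom n) w p"
    proof (rule NS.functionals_eqI)
      show "unit_hom (f \<odot>\<^bsub>N\<^esub> n) w p \<in> carrier N_space" "(f \<odot>\<^bsub>I.F_M\<^esub> unit_hom n) w p \<in> carrier N_space"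
        using fun_rep_mem[OF ind_carrier_mem[OF m(1)] p] fun_rep_mem[OF ind_carrier_mem[OF m(2)] p]
        by (simp_all only: N_space_simps)
      fix \<xi> assume \<xi>: "\<xi> \<in> lin_maps N_space scalars"
      let ?\<eta> = "\<lambda>f\<in>carrier hecke_space. \<xi> (f \<odot>\<^bsub>N\<^esub> n)" and ?\<xi> = "\<lambda>F\<in>carrier ind_rep. \<xi> (F p)"
      let ?F = "\<lambda>g. hecke_elt l (y \<otimes> g) (transposed W (f g) w)"
      note int = hecke_elt_integral[OF yl(3,2) w f]
      have "\<xi> ((f \<odot>\<^bsub>I.F_M\<^esub> unit_hom n) w p) = ?\<xi> ((f \<odot>\<^bsub>I.F_M\<^esub> unit_hom n) w)"
        using m(2) by (simp add: ind_rep_simps)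
      also have "\<dots> = (\<integral>g. ?\<xi> (act ind_rep g (unit_hom n (transposed W (f g) w))) \<partial>\<mu>)"
        by (rule I.functional_action[OF f u w ind_functional[OF \<xi> p]])
      also have "\<dots> = (\<integral>g. ?\<eta> (?F g) \<partial>\<mu>)"
      proof (rule integral_cong_carrier)
        fix g assume g: "g \<in> carrier G"
        note t = I.hecke_transposed_mem[OF f g w]
        have "act ind_rep g (unit_hom n (transposed W (f g) w)) = gen_elt g (transposed W (f g) w) n"
          using t gen_elt_act[OF one_closed g] g by (simp add: unit_hom_def ind_rep_simps)
        moreover have "gen_elt g (transposed W (f g) w) n \<in> carrier ind_rep"
          using gen_elt_ind[OF g t n] by (simp add: ind_rep_simps)
        ultimately show "?\<xi> (act ind_rep g (unit_hom n (transposed W (f g) w))) = ?\<eta> (?F g)"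
          using int(2)[OF g] p yl by (simp add: gen_elt_def)
      qed
      also have "\<dots> = ?\<eta> (lc_integral \<mu> hecke_space ?F)"
        by (rule functional_lc_integral[OF complex_space_hecke int(1,2) N_functional[OF \<xi> n], symmetric])
      also have "\<dots> = \<xi> ((hecke_elt l y w \<otimes>\<^bsub>\<H>\<^esub> f) \<odot>\<^bsub>N\<^esub> n)"
        unfolding int(3) using hecke_mult_mem[OF hecke_elt_mem[OF yl(3,2) w] f] by (simp add: hecke_space_simps(1))
      also have "\<dots> = \<xi> (unit_hom (f \<odot>\<^bsub>N\<^esub> n) w p)"
        using N_assoc[OF hecke_elt_mem[OF yl(3,2) w] f n] w p yl by (simp add: unit_hom_def gen_elt_def)
      finally show "\<xi> (unit_hom (f \<odot>\<^bsub>N\<^esub> n) w p) = \<xi> ((f \<odot>\<^bsub>I.F_M\<^esub> unit_hom n) w p)" by simp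
    qed
  qed
qed

text \<open>By \<open>sum_hecke_elt_frame\<close> the values of \<open>unit_hom n b\<close> at
  \<open>(\<one>, E b)\<close> add up to the volume of \<open>K\<close> times \<open>n\<close>, so
  \<open>n\<close> can be recovered from \<open>unit_hom n\<close>.\<close>

lemma unit_hom_inj: "inj_on unit_hom (carrier N)"
proof (rule inj_onI)
  fix n n' assume n: "n \<in> carrier N" "n' \<in> carrier N" and e: "unit_hom n = unit_hom n'"
  interpret H: complex_space hecke_space by (rule complex_space_hecke)
  obtain B E where B: "finite B" "B \<subseteq> carrier W" "\<forall>b\<in>B. E b \<in> W_dual"
    "\<forall>l\<in>W_dual. \<forall>w\<in>carrier W. l w = (\<Sum>b\<in>B. E b w * l b)"
    by (rule dual_frame)
  let ?h = "\<lambda>b. hecke_elt (E b) \<one> b"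
  have h: "?h b \<in> carrier hecke_space" if "b \<in> B" for b
    using that B hecke_elt_mem[OF _ one_closed] by (auto simp: hecke_space_simps(1))
  have sum_mem: "finsum hecke_space ?h B \<in> carrier hecke_space" using h by (intro H.M.finsum_closed) auto
  have s: "finsum hecke_space ?h B = complex_of_real (measure \<mu> K) \<odot>\<^bsub>hecke_space\<^esub> \<one>\<^bsub>\<H>\<^esub>"
  proof (rule hecke_fun_eqI)
    show "finsum hecke_space ?h B \<in> hecke_fun G T K W" using sum_mem by (simp only: hecke_space_simps)
    show "complex_of_real (measure \<mu> K) \<odot>\<^bsub>hecke_space\<^esub> \<one>\<^bsub>\<H>\<^esub> \<in> hecke_fun G T K W"
      by (rule hecke_smult_mem[OF hecke_one_mem])
    fix x l w assume x: "x \<in> carrier G" and l: "l \<in> W_dual" and w: "w \<in> carrier W"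
    have "finsum hecke_space ?h B x l w = (\<lambda>f\<in>carrier hecke_space. f x l w) (finsum hecke_space ?h B)"
      using sum_mem by simp
    also have "\<dots> = (\<Sum>b\<in>B. (\<lambda>f\<in>carrier hecke_space. f x l w) (?h b))"
      by (rule H.functional_finsum[OF hecke_eval_functional[OF x l w] B(1) h])
    also have "\<dots> = (\<Sum>b\<in>B. ?h b x l w)" using h by (intro sum.cong) auto
    also have "\<dots> = measure \<mu> K * \<one>\<^bsub>\<H>\<^esub> x l w" by (rule sum_hecke_elt_frame[OF B x l w])
    finally show "finsum hecke_space ?h B x l w = (complex_of_real (measure \<mu> K) \<odot>\<^bsub>hecke_space\<^esub> \<one>\<^bsub>\<H>\<^esub>) x l w"
      using hecke_smult_apply[OF x l w] by simp
  qed
  have key: "complex_of_real (measure \<mu> K) * \<xi> n = (\<Sum>b\<in>B. \<xi> (unit_hom n b (\<one>, E b)))"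
    if \<xi>: "\<xi> \<in> lin_maps N_space scalars" and n: "n \<in> carrier N" for \<xi> n
  proof -
    let ?\<eta> = "\<lambda>f\<in>carrier hecke_space. \<xi> (f \<odot>\<^bsub>N\<^esub> n)"
    have "(\<Sum>b\<in>B. \<xi> (unit_hom n b (\<one>, E b))) = (\<Sum>b\<in>B. ?\<eta> (?h b))"
    proof (rule sum.cong)
      fix b assume b: "b \<in> B"
      then have "b \<in> carrier W" "(\<one>, E b) \<in> pts" using B by (auto simp: pts_def)
      then show "\<xi> (unit_hom n b (\<one>, E b)) = ?\<eta> (?h b)" using h[OF b] by (simp add: unit_hom_def gen_elt_def)
    qed simp
    also have "\<dots> = ?\<eta> (finsum hecke_space ?h B)"
      by (rule H.functional_finsum[OF N_functional[OF \<xi> n] B(1) h, symmetric])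
    also have "\<dots> = \<xi> (complex_of_real (measure \<mu> K) \<odot>\<^bsub>N_space\<^esub> n)"
      using sum_mem by (simp add: s N_space_simps)
    also have "\<dots> = complex_of_real (measure \<mu> K) * \<xi> n"
      using NS.functional_smult[OF \<xi>] n by (simp add: N_space_simps(1))
    finally show ?thesis by simp
  qed
  show "n = n'"
  proof (rule NS.functionals_eqI)
    fix \<xi> assume \<xi>: "\<xi> \<in> lin_maps N_space scalars"
    have "complex_of_real (measure \<mu> K) * \<xi> n = complex_of_real (measure \<mu> K) * \<xi> n'"
      unfolding key[OF \<xi> n(1)] key[OF \<xi> n(2)] e ..
    then show "\<xi> n = \<xi> n'" unfolding mult_left_cancel[OF measure_K_nonzero] .
  qed (use n in \<open>simp_all add: N_space_simps(1)\<close>)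
qed

text \<open>The translate of \<open>unit_hom n w\<close> by \<open>g\<close> is
  \<open>gen_elt g w n\<close>, and the vectors are finite sums of these.\<close>

lemma ind_rep_generated: "generated_by G ind_rep (\<Union>\<phi>\<in>unit_hom ` carrier N. \<phi> ` carrier W)"
  unfolding generated_by_def
proof (intro conjI allI impI)
  show "(\<Union>\<phi>\<in>unit_hom ` carrier N. \<phi> ` carrier W) \<subseteq> carrier ind_rep"
    using I.K_homs_mem[OF unit_hom_K_homs] by blast
  fix U assume U: "subrep G ind_rep U \<and> (\<Union>\<phi>\<in>unit_hom ` carrier N. \<phi> ` carrier W) \<subseteq> U"
  then have sub: "U \<subseteq> ind_carrier" "\<zero>\<^bsub>fun_rep\<^esub> \<in> U" "\<And>F F'. F \<in> U \<Longrightarrow> F' \<in> U \<Longrightarrow> F \<oplus>\<^bsub>fun_rep\<^esub> F' \<in> U"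
    "\<And>g F. g \<in> carrier G \<Longrightarrow> F \<in> U \<Longrightarrow> act fun_rep g F \<in> U"
    unfolding subrep_def I.M.submodule_iff ind_rep_simps by auto
  have gen: "gen_elt g w n \<in> U" if "g \<in> carrier G" "w \<in> carrier W" "n \<in> carrier N" for g w n
  proof -
    have "unit_hom n w \<in> U" using U that by blast
    then have "gen_elt \<one> w n \<in> U" using that(2) by (simp add: unit_hom_def)
    then have "act fun_rep g (gen_elt \<one> w n) \<in> U" by (rule sub(4)[OF that(1)])
    then show ?thesis using gen_elt_act[OF one_closed that(1)] that(1) by simp
  qed
  have "list_elt xs \<in> U" if "xs \<in> triples" for xs
    using that by (induction xs rule: list_elt.induct) (auto simp: sub gen)
  then show "U = carrier ind_rep" using sub(1) by (auto simp: ind_rep_simps ind_carrier_def)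
qed

text \<open>The image of \<open>N\<close> is closed under sums and the Hecke action, and its values
  generate \<open>ind_rep\<close>, so \<open>K_homs_subset_if_generated\<close> applies.\<close>

lemma unit_hom_surj: "unit_hom ` carrier N = I.K_homs"
proof
  show "unit_hom ` carrier N \<subseteq> I.K_homs" using unit_hom_K_homs by blast
  show "I.K_homs \<subseteq> unit_hom ` carrier N"
  proof (rule I.K_homs_subset_if_generated[OF _ _ _ _ ind_rep_generated])
    show "unit_hom ` carrier N \<subseteq> I.K_homs" using unit_hom_K_homs by blast
    have "unit_hom \<zero>\<^bsub>N\<^esub> = \<zero>\<^bsub>I.F_M\<^esub>"
      unfolding unit_hom_def I.F_M_simps(2) ind_rep_simps fun_rep_simps gen_elt_def
    proof (intro restrict_ext)
      fix w p assume "w \<in> carrier W" "p \<in> pts"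
      then have h: "hecke_elt (snd p) (fst p \<otimes> \<one>) w \<in> hecke_fun G T K W" using hecke_elt_pts[OF _ one_closed] by blast
      show "hecke_elt (snd p) (fst p \<otimes> \<one>) w \<odot>\<^bsub>N\<^esub> \<zero>\<^bsub>N\<^esub> = \<zero>\<^bsub>N\<^esub>"
        using N_add_right[OF h N.M.zero_closed N.M.zero_closed] N_smult_mem[OF h N.M.zero_closed]
        by (simp add: N.M.add.l_cancel_one)
    qed
    then show "\<zero>\<^bsub>I.F_M\<^esub> \<in> unit_hom ` carrier N" by (metis N.M.zero_closed imageI)
    show "\<phi> \<oplus>\<^bsub>I.F_M\<^esub> \<psi> \<in> unit_hom ` carrier N" if "\<phi> \<in> unit_hom ` carrier N" "\<psi> \<in> unit_hom ` carrier N" for \<phi> \<psi>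
    proof -
      obtain n n' where n: "n \<in> carrier N" "n' \<in> carrier N" and e: "\<phi> = unit_hom n" "\<psi> = unit_hom n'"
        using \<open>\<phi> \<in> _\<close> \<open>\<psi> \<in> _\<close> by blast
      show ?thesis unfolding e unit_hom_add[OF n, symmetric] by (intro imageI N.M.a_closed n)
    qed
    show "f \<odot>\<^bsub>I.F_M\<^esub> \<phi> \<in> unit_hom ` carrier N" if "f \<in> hecke_fun G T K W" "\<phi> \<in> unit_hom ` carrier N" for f \<phi>
    proof -
      obtain n where n: "n \<in> carrier N" and e: "\<phi> = unit_hom n" using \<open>\<phi> \<in> _\<close> by blast
      show ?thesis unfolding e unit_hom_smult[OF \<open>f \<in> _\<close> n, symmetric] by (intro imageI N_smult_mem n \<open>f \<in> _\<close>)
    qed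
  qed
qed

end

section \<open>Full subcategories and transport of representations\<close>

lemma is_functor_full_subcat:
  assumes F: "is_functor C D Fo Fm" shows "is_functor (full_subcat C S) D Fo Fm"
proof -
  have [simp]: "Obj (full_subcat C S) = Obj C \<inter> S" "Hom (full_subcat C S) = Hom C"
    "Idt (full_subcat C S) = Idt C" "Cmp (full_subcat C S) = Cmp C"
    by (simp_all add: full_subcat_def)
  have "is_category C" using F unfolding is_functor_def by blast
  then have "is_category (full_subcat C S)" unfolding is_category_def by simp
  then show ?thesis using F unfolding is_functor_def by simp
qed

lemma left_module_iso_if_bij:
  assumes N: "left_module R N" and F: "left_module R F" and \<kappa>: "\<kappa> \<in> left_module_homs R N F"
    and bij: "bij_betw \<kappa> (carrier N) (carrier F)"
  shows "\<exists>e. is_iso (left_module_cat R) F N e"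
proof -
  interpret N: left_module R N by fact
  let ?e = "\<lambda>x\<in>carrier F. inv_into (carrier N) \<kappa> x"
  have inj: "inj_on \<kappa> (carrier N)" and im: "\<kappa> ` carrier N = carrier F" using bij by (auto simp: bij_betw_def)
  have e\<kappa>: "?e (\<kappa> n) = n" if "n \<in> carrier N" for n using that inj im by (auto simp: inv_into_f_f)
  have \<kappa>m: "\<kappa> n \<in> carrier F" if "n \<in> carrier N" for n using that im by blast
  have ex: "\<exists>n\<in>carrier N. x = \<kappa> n" if "x \<in> carrier F" for x using that im by blast
  have \<kappa>a: "\<kappa> (n \<oplus>\<^bsub>N\<^esub> n') = \<kappa> n \<oplus>\<^bsub>F\<^esub> \<kappa> n'" if "n \<in> carrier N" "n' \<in> carrier N" for n n'
    using \<kappa> that unfolding left_module_homs_def by blast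
  have \<kappa>s: "\<kappa> (r \<odot>\<^bsub>N\<^esub> n) = r \<odot>\<^bsub>F\<^esub> \<kappa> n" if "r \<in> carrier R" "n \<in> carrier N" for r n
    using \<kappa> that unfolding left_module_homs_def by blast
  have "?e \<in> left_module_homs R F N"
    unfolding left_module_homs_def
  proof (intro CollectI conjI ballI)
    show "?e \<in> carrier F \<rightarrow>\<^sub>E carrier N" using im by (auto intro: inv_into_into)
    fix x assume "x \<in> carrier F"
    then obtain n where n: "n \<in> carrier N" "x = \<kappa> n" using ex by blast
    {
      fix y assume "y \<in> carrier F"
      then obtain n' where n': "n' \<in> carrier N" "y = \<kappa> n'" using ex by blast
      show "?e (x \<oplus>\<^bsub>F\<^esub> y) = ?e x \<oplus>\<^bsub>N\<^esub> ?e y"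
        unfolding n(2) n'(2) \<kappa>a[OF n(1) n'(1), symmetric] e\<kappa>[OF n(1)] e\<kappa>[OF n'(1)]
        by (rule e\<kappa>[OF N.M.a_closed[OF n(1) n'(1)]])
    next
      fix r assume r: "r \<in> carrier R"
      show "?e (r \<odot>\<^bsub>F\<^esub> x) = r \<odot>\<^bsub>N\<^esub> ?e x"
        unfolding n(2) \<kappa>s[OF r n(1), symmetric] e\<kappa>[OF n(1)] by (rule e\<kappa>[OF N.smult_closed[OF r n(1)]])
    }
  qed
  moreover have "compose (carrier F) \<kappa> ?e = (\<lambda>x\<in>carrier F. x)"
    unfolding compose_def using im by (intro restrict_ext) (simp add: f_inv_into_f)
  moreover have "compose (carrier N) ?e \<kappa> = (\<lambda>x\<in>carrier N. x)"
    unfolding compose_def by (intro restrict_ext e\<kappa>)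
  ultimately have "is_iso (left_module_cat R) F N ?e"
    unfolding is_iso_def left_module_cat_def using \<kappa> by auto
  then show ?thesis by blast
qed

text \<open>The induced representation lives on functions with values in the module, while the
  objects of the category live on \<open>'v\<close>; an injection on the carrier moves it
  there.\<close>

definition transport_rep :: "('b \<Rightarrow> 'c) \<Rightarrow> ('g, 'b) rep \<Rightarrow> ('g, 'c) rep" where
  "transport_rep i V = (let d = inv_into (carrier V) i in
     \<lparr>carrier = i ` carrier V, monoid.mult = undefined, one = undefined, zero = i \<zero>\<^bsub>V\<^esub>,
      add = (\<lambda>x y. i (d x \<oplus>\<^bsub>V\<^esub> d y)), smult = (\<lambda>c x. i (c \<odot>\<^bsub>V\<^esub> d x)),
      act = (\<lambda>g x. i (act V g (d x)))\<rparr>)"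

context
  fixes G :: "'g monoid" and T :: "'g topology" and V :: "('g, 'b) rep" and i :: "'b \<Rightarrow> 'c"
  assumes V: "smooth_rep G T V" and inj: "inj_on i (carrier V)"
begin

interpretation V: smooth_rep G T V by (rule V)
interpretation V: complex_space V by (rule smooth_rep_complex_space[OF V])

lemma transport_rep_simps:
  "carrier (transport_rep i V) = i ` carrier V" "\<zero>\<^bsub>transport_rep i V\<^esub> = i \<zero>\<^bsub>V\<^esub>"
  "x \<in> carrier V \<Longrightarrow> y \<in> carrier V \<Longrightarrow> i x \<oplus>\<^bsub>transport_rep i V\<^esub> i y = i (x \<oplus>\<^bsub>V\<^esub> y)"
  "x \<in> carrier V \<Longrightarrow> c \<odot>\<^bsub>transport_rep i V\<^esub> i x = i (c \<odot>\<^bsub>V\<^esub> x)"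
  "x \<in> carrier V \<Longrightarrow> act (transport_rep i V) g (i x) = i (act V g x)"
  using inj by (simp_all add: transport_rep_def Let_def)

lemma transport_act_mem: "g \<in> carrier G \<Longrightarrow> x \<in> carrier V \<Longrightarrow> act V g x \<in> carrier V"
  using lin_maps_mem[OF V.act_linear] by fastforce

lemma complex_space_transport: "complex_space (transport_rep i V)"
proof (rule complex_spaceI; unfold transport_rep_simps(1,2); (elim imageE)?)
  show "i \<zero>\<^bsub>V\<^esub> \<in> i ` carrier V" by simp
  fix x x' assume x: "x' \<in> carrier V" "x = i x'"
  show "c \<odot>\<^bsub>transport_rep i V\<^esub> x \<in> i ` carrier V" for c using x by (simp add: transport_rep_simps)
  show "i \<zero>\<^bsub>V\<^esub> \<oplus>\<^bsub>transport_rep i V\<^esub> x = x" "1 \<odot>\<^bsub>transport_rep i V\<^esub> x = x" "0 \<odot>\<^bsub>transport_rep i V\<^esub> x = i \<zero>\<^bsub>V\<^esub>"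
    "(a + b) \<odot>\<^bsub>transport_rep i V\<^esub> x = a \<odot>\<^bsub>transport_rep i V\<^esub> x \<oplus>\<^bsub>transport_rep i V\<^esub> b \<odot>\<^bsub>transport_rep i V\<^esub> x"
    "(a * b) \<odot>\<^bsub>transport_rep i V\<^esub> x = a \<odot>\<^bsub>transport_rep i V\<^esub> (b \<odot>\<^bsub>transport_rep i V\<^esub> x)" for a b
    using x by (simp_all add: transport_rep_simps V.smult_add_left V.smult_smult)
  fix y y' assume y: "y' \<in> carrier V" "y = i y'"
  show "x \<oplus>\<^bsub>transport_rep i V\<^esub> y \<in> i ` carrier V" using x y by (simp add: transport_rep_simps)
  show "x \<oplus>\<^bsub>transport_rep i V\<^esub> y = y \<oplus>\<^bsub>transport_rep i V\<^esub> x"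
    using x y by (simp add: transport_rep_simps V.V.M.a_comm)
  show "a \<odot>\<^bsub>transport_rep i V\<^esub> (x \<oplus>\<^bsub>transport_rep i V\<^esub> y) =
    a \<odot>\<^bsub>transport_rep i V\<^esub> x \<oplus>\<^bsub>transport_rep i V\<^esub> a \<odot>\<^bsub>transport_rep i V\<^esub> y" for a
    using x y by (simp add: transport_rep_simps V.smult_add_right)
  show "x \<oplus>\<^bsub>transport_rep i V\<^esub> y \<oplus>\<^bsub>transport_rep i V\<^esub> z = x \<oplus>\<^bsub>transport_rep i V\<^esub> (y \<oplus>\<^bsub>transport_rep i V\<^esub> z)"
    if "z = i z'" "z' \<in> carrier V" for z z'
    using x y that by (simp add: transport_rep_simps V.V.M.a_assoc)
qed

lemma smooth_rep_transport: "smooth_rep G T (transport_rep i V)"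
proof (intro smooth_rep.intro group_rep.intro smooth_rep_axioms.intro group_rep_axioms.intro)
  interpret V': complex_space "transport_rep i V" by (rule complex_space_transport)
  show "group G" using V unfolding smooth_rep_def group_rep_def by blast
  show "Module.module complex_ring (transport_rep i V)"
    using complex_space_transport unfolding complex_space_def .
  fix g assume g: "g \<in> carrier G"
  show "restrict (act (transport_rep i V) g) (carrier (transport_rep i V)) \<in> lin_maps (transport_rep i V) (transport_rep i V)"
  proof (rule lin_mapsI)
    note L = lin_mapsD[OF V.act_linear[OF g]]
    fix x assume xc: "x \<in> carrier (transport_rep i V)"
    then obtain x' where x: "x' \<in> carrier V" "x = i x'" by (auto simp: transport_rep_simps(1))
    show "restrict (act (transport_rep i V) g) (carrier (transport_rep i V)) x \<in> carrier (transport_rep i V)"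
      using x transport_act_mem[OF g] by (simp add: transport_rep_simps)
    {
      fix y assume yc: "y \<in> carrier (transport_rep i V)"
      then obtain y' where y: "y' \<in> carrier V" "y = i y'" by (auto simp: transport_rep_simps(1))
      show "restrict (act (transport_rep i V) g) (carrier (transport_rep i V)) (x \<oplus>\<^bsub>transport_rep i V\<^esub> y) =
        restrict (act (transport_rep i V) g) (carrier (transport_rep i V)) x \<oplus>\<^bsub>transport_rep i V\<^esub>
        restrict (act (transport_rep i V) g) (carrier (transport_rep i V)) y"
        using x y L(2)[OF x(1) y(1)] transport_act_mem[OF g] by (simp add: transport_rep_simps)
    next
      fix c
      show "restrict (act (transport_rep i V) g) (carrier (transport_rep i V)) (c \<odot>\<^bsub>transport_rep i V\<^esub> x) =
        c \<odot>\<^bsub>transport_rep i V\<^esub> restrict (act (transport_rep i V) g) (carrier (transport_rep i V)) x"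
        using x L(3)[OF x(1)] transport_act_mem[OF g] by (simp add: transport_rep_simps)
    }
  qed simp
next
  fix x assume "x \<in> carrier (transport_rep i V)"
  then obtain x' where x: "x' \<in> carrier V" "x = i x'" by (auto simp: transport_rep_simps(1))
  show "act (transport_rep i V) \<one>\<^bsub>G\<^esub> x = x" using x V.act_one by (simp add: transport_rep_simps)
  show "act (transport_rep i V) (g \<otimes>\<^bsub>G\<^esub> h) x = act (transport_rep i V) g (act (transport_rep i V) h x)"
    if "g \<in> carrier G" "h \<in> carrier G" for g h
    using x V.act_mult that transport_act_mem by (simp add: transport_rep_simps)
  have "act (transport_rep i V) g x = x \<longleftrightarrow> act V g x' = x'" if "g \<in> carrier G" for g
    using x transport_act_mem[OF that x(1)] inj by (simp add: transport_rep_simps inj_on_eq_iff)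
  then have "{g \<in> carrier G. act (transport_rep i V) g x = x} = {g \<in> carrier G. act V g x' = x'}" by blast
  then show "openin T {g \<in> carrier G. act (transport_rep i V) g x = x}" using V.smooth[OF x(1)] by simp
qed

lemma transport_hom: "restrict i (carrier V) \<in> rep_homs G V (transport_rep i V)"
  unfolding rep_homs_def
proof (intro CollectI conjI ballI)
  show "restrict i (carrier V) \<in> lin_maps V (transport_rep i V)"
    by (rule lin_mapsI) (simp_all add: transport_rep_simps)
qed (simp add: transport_rep_simps transport_act_mem)

lemma transport_inverse_hom: "restrict (inv_into (carrier V) i) (i ` carrier V) \<in> rep_homs G (transport_rep i V) V"
proof -
  let ?d = "restrict (inv_into (carrier V) i) (i ` carrier V)"
  have d: "?d (i x) = x" if "x \<in> carrier V" for x using that inv_into_f_f[OF inj] by simp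
  have "?d \<in> lin_maps (transport_rep i V) V"
  proof (rule lin_mapsI)
    show "?d \<in> extensional (carrier (transport_rep i V))" by (simp add: transport_rep_simps)
    fix x assume "x \<in> carrier (transport_rep i V)"
    then obtain x' where x: "x' \<in> carrier V" "x = i x'" by (auto simp: transport_rep_simps(1))
    show "?d x \<in> carrier V" unfolding x(2) d[OF x(1)] by (rule x(1))
    {
      fix y assume "y \<in> carrier (transport_rep i V)"
      then obtain y' where y: "y' \<in> carrier V" "y = i y'" by (auto simp: transport_rep_simps(1))
      show "?d (x \<oplus>\<^bsub>transport_rep i V\<^esub> y) = ?d x \<oplus>\<^bsub>V\<^esub> ?d y"
        unfolding x(2) y(2) d[OF x(1)] d[OF y(1)] transport_rep_simps(3)[OF x(1) y(1)]
        by (rule d[OF V.add_mem[OF x(1) y(1)]])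
    next
      fix c
      show "?d (c \<odot>\<^bsub>transport_rep i V\<^esub> x) = c \<odot>\<^bsub>V\<^esub> ?d x"
        unfolding x(2) d[OF x(1)] transport_rep_simps(4)[OF x(1)] by (rule d[OF V.smult_mem[OF x(1)]])
    }
  qed
  moreover have "?d (act (transport_rep i V) g x) = act V g (?d x)"
    if g: "g \<in> carrier G" and x: "x \<in> carrier (transport_rep i V)" for g x
  proof -
    obtain x' where x: "x' \<in> carrier V" "x = i x'" using x by (auto simp: transport_rep_simps(1))
    show ?thesis
      unfolding x(2) d[OF x(1)] transport_rep_simps(5)[OF x(1)] by (rule d[OF transport_act_mem[OF g x(1)]])
  qed
  ultimately show ?thesis unfolding rep_homs_def by blast
qed

end

context hecke_setup begin

lemma transport_K_homs_bij:
  assumes V: "smooth_rep G T V" and inj: "inj_on i (carrier V)"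
  shows "bij_betw (compose (carrier W) (restrict i (carrier V))) (rep_homs (subgrp G K) W V)
    (rep_homs (subgrp G K) W (transport_rep i V))"
proof -
  note V' = smooth_rep_transport[OF V inj] and h = transport_hom[OF V inj] and h' = transport_inverse_hom[OF V inj]
  interpret V: hecke_rep G T \<mu> K W V by (rule hecke_rep[OF V])
  interpret V': hecke_rep G T \<mu> K W "transport_rep i V" by (rule hecke_rep[OF V'])
  show ?thesis
  proof (rule bij_betwI)
    show "compose (carrier W) (restrict i (carrier V)) \<in> V.K_homs \<rightarrow> V'.K_homs"
      using compose_K_hom[OF V V' h] by blast
    show "compose (carrier W) (restrict (inv_into (carrier V) i) (i ` carrier V)) \<in> V'.K_homs \<rightarrow> V.K_homs"
      using compose_K_hom[OF V' V h'] by blast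
    show "compose (carrier W) (restrict (inv_into (carrier V) i) (i ` carrier V))
        (compose (carrier W) (restrict i (carrier V)) \<phi>) = \<phi>" if \<phi>: "\<phi> \<in> V.K_homs" for \<phi>
      by (rule V.K_homs_eqI[OF compose_K_hom[OF V' V h' compose_K_hom[OF V V' h \<phi>]] \<phi>])
        (simp add: compose_def V.K_homs_mem[OF \<phi>] inv_into_f_f[OF inj])
    show "compose (carrier W) (restrict i (carrier V))
        (compose (carrier W) (restrict (inv_into (carrier V) i) (i ` carrier V)) \<psi>) = \<psi>" if \<psi>: "\<psi> \<in> V'.K_homs" for \<psi>
      by (rule V'.K_homs_eqI[OF compose_K_hom[OF V V' h compose_K_hom[OF V' V h' \<psi>]] \<psi>])
        (use V'.K_homs_mem[OF \<psi>] in \<open>auto simp: compose_def transport_rep_simps(1)[OF V inj] inv_into_into f_inv_into_f\<close>)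
  qed
qed

text \<open>The preimage under \<open>i\<close> of a subrepresentation is a subrepresentation, and
  composing with \<open>i\<close> turns \<open>K\<close>-homomorphisms into
  \<open>K\<close>-homomorphisms.\<close>

lemma transport_generated:
  assumes V: "smooth_rep G T V" and inj: "inj_on i (carrier V)"
    and gen: "generated_by G V (\<Union>\<phi>\<in>rep_homs (subgrp G K) W V. \<phi> ` carrier W)"
  shows "generated_by G (transport_rep i V) (\<Union>\<phi>\<in>rep_homs (subgrp G K) W (transport_rep i V). \<phi> ` carrier W)"
proof -
  note V' = smooth_rep_transport[OF V inj] and h = transport_hom[OF V inj]
  note simps = transport_rep_simps[OF V inj]
  interpret V: hecke_rep G T \<mu> K W V by (rule hecke_rep[OF V])
  interpret V': hecke_rep G T \<mu> K W "transport_rep i V" by (rule hecke_rep[OF V'])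
  show ?thesis
    unfolding generated_by_def
  proof (intro conjI allI impI)
    show "V'.K_image \<subseteq> carrier (transport_rep i V)" using V'.K_homs_mem by blast
    fix U assume U: "subrep G (transport_rep i V) U \<and> V'.K_image \<subseteq> U"
    let ?U = "{v \<in> carrier V. i v \<in> U}"
    have Us: "U \<subseteq> i ` carrier V" "i \<zero>\<^bsub>V\<^esub> \<in> U"
      "\<And>x y. x \<in> U \<Longrightarrow> y \<in> U \<Longrightarrow> x \<oplus>\<^bsub>transport_rep i V\<^esub> y \<in> U"
      "\<And>c x. x \<in> U \<Longrightarrow> c \<odot>\<^bsub>transport_rep i V\<^esub> x \<in> U"
      "\<And>g x. g \<in> carrier G \<Longrightarrow> x \<in> U \<Longrightarrow> act (transport_rep i V) g x \<in> U"
      using U unfolding subrep_def V'.M.submodule_iff simps(1,2) by auto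
    have "subrep G V ?U"
      unfolding subrep_def V.M.submodule_iff
    proof (intro conjI ballI allI)
      fix x assume x: "x \<in> ?U"
      show "x \<oplus>\<^bsub>V\<^esub> y \<in> ?U" if "y \<in> ?U" for y using Us(3)[of "i x" "i y"] x that simps(3)[of x y] by simp
      show "c \<odot>\<^bsub>V\<^esub> x \<in> ?U" for c using Us(4)[of "i x" c] x simps(4)[of x c] by simp
    next
      fix g u assume "g \<in> carrier G" "u \<in> ?U"
      then show "act V g u \<in> ?U" using Us(5)[of g "i u"] simps(5)[of u g] V.act_M_mem by simp
    qed (use Us(2) in auto)
    moreover have "V.K_image \<subseteq> ?U"
    proof
      fix v assume "v \<in> V.K_image"
      then obtain \<phi> w where \<phi>: "\<phi> \<in> V.K_homs" and w: "w \<in> carrier W" and v: "v = \<phi> w" by blast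
      have "compose (carrier W) (restrict i (carrier V)) \<phi> w \<in> U"
        using U compose_K_hom[OF V V' h \<phi>] w by blast
      then show "v \<in> ?U" using v w V.K_homs_mem[OF \<phi> w] by (simp add: compose_def)
    qed
    ultimately have "?U = carrier V" using gen unfolding generated_by_def by blast
    then show "U = carrier (transport_rep i V)" unfolding simps(1) using Us(1) by blast
  qed
qed

end

context hecke_module begin

text \<open>\<open>\<kappa>\<close> is the unit followed by transport along \<open>i\<close>.
  Irreducibility of \<open>W\<close> turns generation by images of \<open>K\<close>-homomorphisms
  into generation by the isotypic component.\<close>

lemma exists_rep_with_invariants:
  fixes i :: "('g \<times> ('w \<Rightarrow> complex) \<Rightarrow> 'n) \<Rightarrow> 'v"
  assumes inj: "inj_on i ind_carrier"
    and irr: "\<And>U. subrep (subgrp G K) W U \<Longrightarrow> U = {\<zero>\<^bsub>W\<^esub>} \<or> U = carrier W"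
  obtains M :: "('g, 'v) rep" and \<kappa>
    where "smooth_rep G T M" "generated_by G M (isotypic_component G K W M)"
      "\<kappa> \<in> left_module_homs \<H> N (rho_inv_obj G \<mu> K W M)"
      "bij_betw \<kappa> (carrier N) (carrier (rho_inv_obj G \<mu> K W M))"
proof -
  let ?M = "transport_rep i ind_rep"
  have inj': "inj_on i (carrier ind_rep)" using inj by (simp add: ind_rep_simps)
  note V = smooth_rep_ind and V' = smooth_rep_transport[OF smooth_rep_ind inj']
  interpret M: hecke_rep G T \<mu> K W ?M by (rule hecke_rep[OF V'])
  let ?h = "restrict i (carrier ind_rep)"
  let ?\<kappa> = "\<lambda>n\<in>carrier N. compose (carrier W) ?h (unit_hom n)"
  note h = transport_hom[OF V inj']
  have gen: "generated_by G ?M M.K_image"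
    by (rule transport_generated[OF V inj']) (use ind_rep_generated in \<open>simp only: unit_hom_surj\<close>)
  have "bij_betw (compose (carrier W) ?h \<circ> unit_hom) (carrier N) M.K_homs"
    by (rule bij_betw_trans[OF _ transport_K_homs_bij[OF V inj']])
      (simp add: bij_betw_def unit_hom_inj unit_hom_surj)
  then have bij: "bij_betw ?\<kappa> (carrier N) (carrier M.F_M)"
    by (subst bij_betw_cong[of _ _ "compose (carrier W) ?h \<circ> unit_hom"]) (simp_all add: M.F_M_simps(1))
  have "?\<kappa> \<in> left_module_homs \<H> N M.F_M"
    unfolding left_module_homs_def
  proof (intro CollectI conjI ballI)
    show "?\<kappa> \<in> carrier N \<rightarrow>\<^sub>E carrier M.F_M"
      using compose_K_hom[OF V V' h unit_hom_K_homs] by (simp add: M.F_M_simps(1))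
    fix n assume n: "n \<in> carrier N"
    note u = I.K_homs_mem[OF unit_hom_K_homs]
    {
      fix n' assume n': "n' \<in> carrier N"
      have "compose (carrier W) ?h (unit_hom n \<oplus>\<^bsub>I.F_M\<^esub> unit_hom n') =
        compose (carrier W) ?h (unit_hom n) \<oplus>\<^bsub>M.F_M\<^esub> compose (carrier W) ?h (unit_hom n')"
        unfolding I.F_M_simps(3) M.F_M_simps(3) compose_def
      proof (rule restrict_ext)
        fix w assume w: "w \<in> carrier W"
        show "?h ((\<lambda>w\<in>carrier W. unit_hom n w \<oplus>\<^bsub>ind_rep\<^esub> unit_hom n' w) w) =
          (\<lambda>w\<in>carrier W. ?h (unit_hom n w)) w \<oplus>\<^bsub>?M\<^esub> (\<lambda>w\<in>carrier W. ?h (unit_hom n' w)) w"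
          using lin_maps_add[OF rep_homs_lin[OF h] u[OF n w] u[OF n' w]] w by simp
      qed
      then show "?\<kappa> (n \<oplus>\<^bsub>N\<^esub> n') = ?\<kappa> n \<oplus>\<^bsub>M.F_M\<^esub> ?\<kappa> n'" using n n' by (simp add: unit_hom_add)
    next
      fix f assume "f \<in> carrier \<H>"
      then have f: "f \<in> hecke_fun G T K W" by (simp only: hecke_algebra_simps)
      show "?\<kappa> (f \<odot>\<^bsub>N\<^esub> n) = f \<odot>\<^bsub>M.F_M\<^esub> ?\<kappa> n"
        using compose_action[OF V V' h unit_hom_K_homs[OF n] f] N_smult_mem[OF f n] unit_hom_smult[OF f n] n by simp
    }
  qed
  moreover have "generated_by G ?M (isotypic_component G K W ?M)"
    by (rule M.generated_by_isotypic_component[OF irr subset_refl gen])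
  ultimately show thesis using that V' bij by blast
qed

end

text \<open>The universe is closed under functions from \<open>'w\<close>, hence under sequences, hence under lists.\<close>

lemma list_code_exists:
  fixes ig :: "'g \<Rightarrow> 'v" and iu :: "('w \<Rightarrow> 'v) \<Rightarrow> 'v" and j :: "nat \<Rightarrow> 'w" and p q :: 'v
  assumes ig: "inj ig" and iu: "inj iu" and j: "inj j" and pq: "p \<noteq> q"
  obtains c :: "('g \<times> 'w \<times> ('w \<Rightarrow> 'v)) list \<Rightarrow> 'v" where "inj c"
proof -
  \<comment> \<open>A point of \<open>'w\<close> is coded by its characteristic function, with
    \<open>p\<close> and \<open>q\<close> as the two truth values.\<close>
  define iw where "iw w = iu (\<lambda>x. if x = w then p else q)" for w
  have iw: "w = w'" if "iw w = iw w'" for w w'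
  proof -
    have "(\<lambda>x. if x = w then p else q) = (\<lambda>x. if x = w' then p else q)"
      using that iu unfolding iw_def by (simp only: inj_eq)
    from fun_cong[OF this, of w] show ?thesis using pq by (auto split: if_splits)
  qed
  \<comment> \<open>As \<open>j\<close> embeds the natural numbers into \<open>'w\<close>, a
    sequence in \<open>'v\<close> can be read as a function on \<open>'w\<close> and coded by
    \<open>iu\<close>.\<close>
  define emb where "emb f = iu (\<lambda>w. f (inv_into UNIV j w))" for f
  have emb: "f k = f' k" if "emb f = emb f'" for f f' k
  proof -
    have "(\<lambda>w. f (inv_into UNIV j w)) = (\<lambda>w. f' (inv_into UNIV j w))" using that iu unfolding emb_def by (simp only: inj_eq)
    from fun_cong[OF this, of "j k"] show ?thesis using j by simp
  qed
  define tc where "tc t = (case t of (g, w, n) \<Rightarrow> emb (\<lambda>k. if k = 0 then ig g else if k = 1 then iw w else iu n))" for t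
  have tc: "t = t'" if "tc t = tc t'" for t t'
  proof -
    obtain g w n g' w' n' where t: "t = (g, w, n)" "t' = (g', w', n')" by (metis prod_cases3)
    note e = emb[OF that[unfolded tc_def t prod.case]]
    show ?thesis using e[of 0] e[of 1] e[of 2] injD[OF ig] injD[OF iu] iw unfolding t by auto
  qed
  \<comment> \<open>Entry 0 holds the length and the list starts at entry 1. Lists of different
    lengths already differ at 0, so the unspecified entries beyond the end are never
    compared.\<close>
  define c where "c xs = emb (\<lambda>k. if k = 0 then iw (j (length xs)) else tc (xs ! (k - 1)))" for xs
  have "inj c"
  proof (rule injI)
    fix xs ys assume "c xs = c ys"
    note e = emb[OF this[unfolded c_def]]
    have "length xs = length ys" using e[of 0] iw injD[OF j] by auto
    then show "xs = ys" using e[of "Suc k" for k] tc by (intro nth_equalityI) auto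
  qed
  then show thesis by (rule that)
qed

text \<open>A functional with value 1 at \<open>v\<close> reads off the factor. The point is that a
  nonzero complex space is infinite, so that the natural numbers embed into \<open>'w\<close>, as
  the coding of lists requires.\<close>

lemma (in complex_space) inj_nat_multiples:
  assumes "v \<in> carrier V" "v \<noteq> \<zero>" shows "inj (\<lambda>k::nat. of_nat k \<odot> v)"
proof -
  have "submodule {\<zero>} complex_ring V" by (simp add: submodule_iff)
  then obtain l where l: "l \<in> functionals" "l v = 1"
    using functional_separates_submodule[of "{\<zero>}" v] assms by (metis singletonD)
  show ?thesis
  proof (rule injI)
    fix a b :: nat assume "of_nat a \<odot> v = of_nat b \<odot> v"
    then have "l (of_nat a \<odot> v) = l (of_nat b \<odot> v)" by simp
    then show "a = b" using l assms by (simp add: functional_smult)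
  qed
qed

text \<open>Each vector is coded by one chosen list of triples representing it. The coding asks for
  two distinct elements of \<open>'v\<close>, which a nonzero element of \<open>N\<close> supplies;
  if \<open>N\<close> is zero there is at most one vector and any map is injective.\<close>

lemma (in hecke_setup) ind_carrier_embeds:
  fixes N :: "('g \<Rightarrow> ('w \<Rightarrow> complex) \<Rightarrow> 'w \<Rightarrow> complex, 'w \<Rightarrow> 'v) module"
  assumes N: "left_module \<H> N" and W0: "carrier W \<noteq> {\<zero>\<^bsub>W\<^esub>}"
    and univ: "universe_for TYPE('g) TYPE('w) TYPE('v)"
  obtains i :: "_ \<Rightarrow> 'v" where "inj_on i (hecke_module.ind_carrier G T \<mu> K W N)"
proof -
  interpret hecke_module G T \<mu> K W N by (intro hecke_module.intro hecke_setup_axioms N)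
  show thesis
  proof (cases "\<exists>n\<in>carrier N. n \<noteq> \<zero>\<^bsub>N\<^esub>")
    case True
    then obtain n where "n \<noteq> \<zero>\<^bsub>N\<^esub>" by blast
    \<comment> \<open>Elements of \<open>N\<close> are functions into \<open>'v\<close>, so two
      different ones differ at some \<open>u\<close>; their values there serve as truth
      values.\<close>
    then obtain u where pq: "n u \<noteq> \<zero>\<^bsub>N\<^esub> u" by (metis ext)
    obtain ig :: "'g \<Rightarrow> 'v" where ig: "inj ig" using univ unfolding universe_for_def lepoll_def by blast
    obtain iu :: "('w \<Rightarrow> 'v) \<Rightarrow> 'v" where iu: "inj iu" using univ unfolding universe_for_def lepoll_def by blast
    obtain v where v: "v \<in> carrier W" "v \<noteq> \<zero>\<^bsub>W\<^esub>" using W0 W.zero_mem by blast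
    obtain c :: "('g \<times> 'w \<times> ('w \<Rightarrow> 'v)) list \<Rightarrow> 'v" where c: "inj c"
      by (rule list_code_exists[OF ig iu W.inj_nat_multiples[OF v] pq])
    have "inj_on (c \<circ> inv_into triples list_elt) ind_carrier"
      unfolding ind_carrier_def by (intro comp_inj_on inj_on_inv_into subset_refl) (rule inj_on_subset[OF c subset_UNIV])
    then show ?thesis by (rule that)
  next
    case False
    have "inj_on (\<lambda>_. undefined) ind_carrier"
    proof (rule inj_onI)
      fix F F' assume F: "F \<in> ind_carrier" "F' \<in> ind_carrier"
      show "F = F'"
      proof (rule fun_rep_eqI[OF ind_carrier_mem[OF F(1)] ind_carrier_mem[OF F(2)]])
        fix p assume p: "p \<in> pts"
        show "F p = F' p"
          using False fun_rep_mem[OF ind_carrier_mem[OF F(1)] p] fun_rep_mem[OF ind_carrier_mem[OF F(2)] p] by metis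
      qed
    qed
    then show ?thesis by (rule that)
  qed
qed

text \<open>A nonzero vector has an open stabiliser in the compact group \<open>K\<close>, so its
  orbit is finite; the span of the orbit is stable and nonzero, hence all of
  \<open>W\<close>.\<close>

lemma (in haar_group) irreducible_smooth_rep_fin_dim:
  assumes K: "cpt_open K" and W: "irreducible_smooth_rep (subgrp G K) (subtopology T K) W"
  shows "fin_dim_subspace W (carrier W)"
proof -
  have sm: "smooth_rep (subgrp G K) (subtopology T K) W" and W0: "carrier W \<noteq> {\<zero>\<^bsub>W\<^esub>}"
    and irr: "\<And>U. subrep (subgrp G K) W U \<Longrightarrow> U = {\<zero>\<^bsub>W\<^esub>} \<or> U = carrier W"
    using W unfolding irreducible_smooth_rep_def by blast+
  interpret W: smooth_rep "subgrp G K" "subtopology T K" W by (rule sm)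
  interpret W: complex_space W by (rule smooth_rep_complex_space[OF sm])
  obtain w where w: "w \<in> carrier W" "w \<noteq> \<zero>\<^bsub>W\<^esub>" using W0 W.zero_mem by blast
  note Kc = cpt_open_carrier[OF K]
  have mem: "act W k v \<in> carrier W" if "k \<in> K" "v \<in> carrier W" for k v
    using lin_maps_mem[OF W.act_linear[of k], of v] that by simp
  have one: "act W \<one> v = v" if "v \<in> carrier W" for v using W.act_one[OF that] by simp
  have mult: "act W (k \<otimes> k') v = act W k (act W k' v)" if "k \<in> K" "k' \<in> K" "v \<in> carrier W" for k k' v
    using W.act_mult that by simp
  let ?J = "{k \<in> K. act W k w = w}"
  \<comment> \<open>The orbit map is extended by zero outside \<open>K\<close> so that finiteness of
    its image follows from \<open>compactly_supported_finite_image\<close>.\<close>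
  let ?f = "\<lambda>k. if k \<in> K then act W k w else \<zero>\<^bsub>W\<^esub>"
  have J: "openin T ?J" using openin_trans_full[OF _ cpt_open_openin[OF K], of ?J] W.smooth[OF w(1)] by simp
  have "compactly_supported \<zero>\<^bsub>W\<^esub> ?f"
  proof (rule compactly_supportedI[OF _ K])
    show "locally_constant T ?f"
    proof (rule locally_constant_right_invariant[OF J])
      show "\<one> \<in> ?J" using cpt_open_one[OF K] one[OF w(1)] by simp
      fix x j assume x: "x \<in> carrier G" and j: "j \<in> ?J"
      then have jK: "j \<in> K" and jw: "act W j w = w" by auto
      show "?f (x \<otimes> j) = ?f x"
        using cpt_open_mult_cancel_right[OF K jK x] mult[OF _ jK w(1), of x] jw by simp
    qed
  qed simp
  then have fin: "finite (?f ` carrier G)" by (rule compactly_supported_finite_image)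
  let ?B = "(\<lambda>k. act W k w) ` K"
  have "?B \<subseteq> ?f ` carrier G" using Kc by (auto simp: image_iff)
  then have finB: "finite ?B" using fin by (rule finite_subset)
  have B: "?B \<subseteq> carrier W" using mem w(1) by blast
  have wB: "w \<in> ?B" using one[OF w(1)] cpt_open_one[OF K] by (metis imageI)
  note span = W.lin_span_submodule[OF B]
  have sub: "lin_span W ?B \<subseteq> carrier W" using span unfolding W.submodule_iff by blast
  have stable: "act W k u \<in> lin_span W ?B" if k: "k \<in> K" and u: "u \<in> lin_span W ?B" for k u
  proof -
    let ?U = "{u \<in> carrier W. act W k u \<in> lin_span W ?B}"
    note L = lin_mapsD[OF W.act_linear[of k]]
    have zero: "act W k \<zero>\<^bsub>W\<^esub> = \<zero>\<^bsub>W\<^esub>" using L(3)[of "\<zero>\<^bsub>W\<^esub>" 0] k mem[OF k W.zero_mem] by simp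
    have "submodule ?U complex_ring W"
      unfolding W.submodule_iff
    proof (intro conjI ballI allI)
      note sp = span[unfolded W.submodule_iff]
      show "\<zero>\<^bsub>W\<^esub> \<in> ?U" using zero sp by simp
      fix x assume x: "x \<in> ?U"
      show "x \<oplus>\<^bsub>W\<^esub> y \<in> ?U" if y: "y \<in> ?U" for y
      proof -
        have "act W k (x \<oplus>\<^bsub>W\<^esub> y) = act W k x \<oplus>\<^bsub>W\<^esub> act W k y" using L(2)[of x y] x y k by simp
        then show ?thesis using x y sp by simp
      qed
      show "c \<odot>\<^bsub>W\<^esub> x \<in> ?U" for c
      proof -
        have "act W k (c \<odot>\<^bsub>W\<^esub> x) = c \<odot>\<^bsub>W\<^esub> act W k x" using L(3)[of x c] x k by simp
        then show ?thesis using x sp by simp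
      qed
    qed blast
    moreover have "?B \<subseteq> ?U"
    proof
      fix b assume "b \<in> ?B"
      then obtain k' where k': "k' \<in> K" "b = act W k' w" by blast
      have "act W k b = act W (k \<otimes> k') w" using mult[OF k k'(1) w(1)] k'(2) by simp
      then have "act W k b \<in> ?B" using cpt_open_mult[OF K k k'(1)] by blast
      then show "b \<in> ?U" using W.lin_span_superset[of ?B] mem[OF k'(1) w(1)] k'(2) by blast
    qed
    ultimately show ?thesis using W.lin_span_least u by blast
  qed
  have "subrep (subgrp G K) W (lin_span W ?B)" unfolding subrep_def using span stable by simp
  moreover have "lin_span W ?B \<noteq> {\<zero>\<^bsub>W\<^esub>}" using subsetD[OF W.lin_span_superset wB] w(2) by (metis singletonD)
  ultimately have "carrier W = lin_span W ?B" using irr by metis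
  then show ?thesis unfolding fin_dim_subspace_def using finB B by blast
qed

theorem theorem1p9:
  fixes G :: "'g monoid" and T :: "'g topology" and \<mu> :: "'g measure"
    and K :: "'g set" and W :: "('g, 'w) rep"
  assumes "ell_c_group G T"
    and "tame G T"
    and "haar_measure G T \<mu>"
    and "compact_open_subgroup G T K"
    and "irreducible_smooth_rep (subgrp G K) (subtopology T K) W"
    and "universe_for TYPE('g) TYPE('w) TYPE('v)"
  shows "is_functor
           (smooth_rep_cat G T :: (('g, 'v) rep, 'v \<Rightarrow> 'v) cat)
           (left_module_cat (hecke_algebra G T \<mu> K W))
           (rho_inv_obj G \<mu> K W) (rho_inv_mor G K W) \<and>
         is_equivalence
           (rho_generated_cat G T K W :: (('g, 'v) rep, 'v \<Rightarrow> 'v) cat)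
           (left_module_cat (hecke_algebra G T \<mu> K W))
           (rho_inv_obj G \<mu> K W) (rho_inv_mor G K W)"
proof -
  interpret haar_group G T \<mu>
    by (intro haar_group.intro haar_group_axioms.intro assms)
  have irr: "smooth_rep (subgrp G K) (subtopology T K) W" "carrier W \<noteq> {\<zero>\<^bsub>W\<^esub>}"
    "\<And>U. subrep (subgrp G K) W U \<Longrightarrow> U = {\<zero>\<^bsub>W\<^esub>} \<or> U = carrier W"
    using assms(5) unfolding irreducible_smooth_rep_def by blast+
  interpret hecke_setup G T \<mu> K W
    by (intro hecke_setup.intro hecke_setup_axioms.intro haar_group_axioms irr(1) assms(4)
        irreducible_smooth_rep_fin_dim[OF assms(4,5)])
  let ?C = "rho_generated_cat G T K W :: (('g, 'v) rep, 'v \<Rightarrow> 'v) cat"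
  have Obj: "M \<in> Obj ?C \<longleftrightarrow> smooth_rep G T M \<and> generated_by G M (isotypic_component G K W M)"
    and Hom: "Hom ?C = rep_homs G" for M
    by (simp_all add: rho_generated_cat_def full_subcat_def smooth_rep_cat_def)
  have "is_equivalence ?C (left_module_cat \<H>) (rho_inv_obj G \<mu> K W) (rho_inv_mor G K W)"
  proof (rule is_equivalence_if_fully_faithful_ess_surj)
    show "is_functor ?C (left_module_cat \<H>) (rho_inv_obj G \<mu> K W) (rho_inv_mor G K W)"
      unfolding rho_generated_cat_def by (rule is_functor_full_subcat[OF is_functor_rho_inv])
    fix M M' assume "M \<in> Obj ?C" "M' \<in> Obj ?C"
    then show "bij_betw (rho_inv_mor G K W M M') (Hom ?C M M')
      (Hom (left_module_cat \<H>) (rho_inv_obj G \<mu> K W M) (rho_inv_obj G \<mu> K W M'))"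
      using rho_inv_fully_faithful[of M M'] unfolding Obj Hom by (simp add: left_module_cat_def)
  next
    fix N :: "('g \<Rightarrow> ('w \<Rightarrow> complex) \<Rightarrow> 'w \<Rightarrow> complex, 'w \<Rightarrow> 'v) module"
    assume "N \<in> Obj (left_module_cat \<H>)"
    then have N: "left_module \<H> N" by (simp add: left_module_cat_def)
    interpret N: hecke_module G T \<mu> K W N by (intro hecke_module.intro hecke_setup_axioms N)
    obtain i :: "_ \<Rightarrow> 'v" where i: "inj_on i N.ind_carrier" by (rule ind_carrier_embeds[OF N irr(2) assms(6)])
    obtain M :: "('g, 'v) rep" and \<kappa> where M: "smooth_rep G T M" "generated_by G M (isotypic_component G K W M)"
      and \<kappa>: "\<kappa> \<in> left_module_homs \<H> N (rho_inv_obj G \<mu> K W M)" "bij_betw \<kappa> (carrier N) (carrier (rho_inv_obj G \<mu> K W M))"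
      by (rule N.exists_rep_with_invariants[OF i irr(3)])
    interpret M: hecke_rep G T \<mu> K W M by (rule hecke_rep[OF M(1)])
    \<comment> \<open>\<open>\<kappa>\<close> runs from \<open>N\<close> to the invariants of
      \<open>M\<close>; the isomorphism asked for is its inverse.\<close>
    show "\<exists>M\<in>Obj ?C. \<exists>e. is_iso (left_module_cat \<H>) (rho_inv_obj G \<mu> K W M) N e"
      using left_module_iso_if_bij[OF N M.left_module_F_M \<kappa>] M Obj by blast
  qed
  then show ?thesis using is_functor_rho_inv by blast
qed

end
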